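(* There is a function $\Phi:\mathbb{N}\to\mathbb{N}$ such that the following holds. Let $(q_n)_{n\ge 0}$ be any sequence of integers $q_n\ge 2$ with $q_n\ge \Phi(h_n)$ for all $n$, where $h_0=1$ and $h_{n+1}=q_nh_n$ (that is, $q_n\gg h_n$ grows sufficiently fast). Let $\alpha_{n,y}$ ($n\ge 0$, $0\le y\le q_n-1$) be independent random variables, $\alpha_{n,y}$ being uniformly distributed on $\{0,1,\dots,h_n-1\}$, and let $T$ be the iceberg transformation of $(X,\mu)$ defined by $(q_n)$ and the rotations $(\alpha_{n,y})$. Then almost surely: (i) $T$ has $1/4$-local rank; (ii) the Koopman operator $\hat T$ has simple spectrum; (iii) $\sigma*\sigma\ll\lambda$, where $\sigma$ is the spectral type of $\hat T$ (on functions with zero mean) and $\lambda$ is the Lebesgue measure on the circle $S^1$; (iv) for a dense set of functions $f\in L^2(X,\mu)$ with zero mean, for every $\varepsilon>0$, $\langle \hat T^t f,f\rangle = O(t^{-1/2+\varepsilon})$ as $t\to\infty$.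
   Context: Iceberg transformation (without spacers): let $q_n\ge 2$ be integers, $h_0=1$, $h_{n+1}=q_nh_n$, and let $\alpha_{n,y}\in\{0,\dots,h_n-1\}$ for $n\ge0$, $0\le y\le q_n-1$. Let $X_n=\{0,1,\dots,h_n-1\}$ (identified with $\mathbb{Z}/h_n\mathbb{Z}$) with uniform probability measure $\mu_n$. Define $\phi_n:X_{n+1}\to X_n$ by $\phi_n(yh_n+t)=t-\alpha_{n,y} \pmod{h_n}$ for $0\le t<h_n$, $0\le y\le q_n-1$. Let $X=\{x=(x_0,x_1,\dots): x_n\in X_n,\ \phi_n(x_{n+1})=x_n \text{ for all } n\}$ be the inverse limit, with the Borel probability measure $\mu$ satisfying $\mu(\{x: x_n=t\})=h_n^{-1}$ for all $n$ and $t\in X_n$. A point $x$ is regular if there is $n_0$ such that $\phi_n(x_{n+1}+1)=x_n+1$ for all $n\ge n_0$ (where $x_n+1$ is taken modulo $h_n$); $\mu$-almost every point is regular. For regular $x$, $Tx$ is the point of $X$ with $(Tx)_n=x_n+1 \pmod{h_n}$ for all $n\ge n_0$, the coordinates with $n<n_0$ being determined by $(Tx)_n=\phi_n((Tx)_{n+1})$. Koopman operator: $\hat T f(x)=f(Tx)$ on $L^2(X,\mu)$. It has simple spectrum if there is $e_0\in L^2(X,\mu)$ (a cyclic vector) such that the closed linear span of $\{\hat T^k e_0: k\in\mathbb{Z}\}$ is all of $L^2(X,\mu)$. The spectral type $\sigma$ is the (equivalence class of the) maximal spectral type measure of $\hat T$ restricted to $\{f:\int f\,d\mu=0\}$; $\langle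 f,g\rangle=\int f\bar g\,d\mu$. Local rank: a Rokhlin tower of height $h$ is a sequence of disjoint measurable sets $\mathcal{T}=\{C,TC,\dots,T^{h-1}C\}$, called its levels; $\cup\mathcal{T}$ denotes their union. The local rank $\beta(T)$ is the maximal $\beta$ for which there is a sequence of Rokhlin towers $\mathcal{T}_n$ with $\mu(\cup\mathcal{T}_n)\to\beta$ such that for every measurable set $A$ there exist measurable sets $A_n$ with $\mu(A_n\triangle A)\to0$, where each $A_n$ is measurable with respect to the partition of $X$ into the levels of $\mathcal{T}_n$ and the single points outside $\cup\mathcal{T}_n$ (that is, $A_n\cap(\cup\mathcal{T}_n)$ is a union of levels of $\mathcal{T}_n$). "$T$ has $1/4$-local rank" means $\beta(T)\ge 1/4$. *)

theory Defs
  imports "HOL-Probability.Probability" "HOL-Library.Landau_Symbols"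
begin

section \<open>Iceberg transformations\<close>

primrec iceberg_height :: "(nat \<Rightarrow> nat) \<Rightarrow> nat \<Rightarrow> nat" where
  "iceberg_height q 0 = 1"
| "iceberg_height q (Suc n) = q n * iceberg_height q n"

text \<open>
  The rotation numbers are a family \<open>\<alpha>\<close> indexed by the pairs \<open>(n, y)\<close> with \<open>y < q n\<close>.
  The base spaces are represented as \<open>{..<iceberg_height q n}\<close>. The subtraction is carried
  out in \<open>int\<close>, where \<open>mod\<close> yields the representative in \<open>{0..<h}\<close> also for negative arguments.
\<close>

definition iceberg_proj :: "(nat \<Rightarrow> nat) \<Rightarrow> (nat \<times> nat \<Rightarrow> nat) \<Rightarrow> nat \<Rightarrow> nat \<Rightarrow> nat" where
  "iceberg_proj q \<alpha> n u =
     (let h = iceberg_height q n; y = u div h; t = u mod h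
      in nat ((int t - int (\<alpha> (n, y))) mod int h))"

definition iceberg_space :: "(nat \<Rightarrow> nat) \<Rightarrow> (nat \<times> nat \<Rightarrow> nat) \<Rightarrow> (nat \<Rightarrow> nat) set" where
  "iceberg_space q \<alpha> =
     {x. \<forall>n. x n < iceberg_height q n \<and> iceberg_proj q \<alpha> n (x (Suc n)) = x n}"

text \<open>
  The cylinders \<open>{x. x n = t}\<close> form (together with the empty set) an intersection-stable
  generator of the Borel sigma-algebra of the inverse limit, so the measure is determined
  by its values on them.
\<close>

definition iceberg_measure :: "(nat \<Rightarrow> nat) \<Rightarrow> (nat \<times> nat \<Rightarrow> nat) \<Rightarrow> (nat \<Rightarrow> nat) measure" where
  "iceberg_measure q \<alpha> =
     extend_measure (iceberg_space q \<alpha>)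
       (SIGMA n:UNIV. {..<iceberg_height q n})
       (\<lambda>(n, t). {x \<in> iceberg_space q \<alpha>. x n = t})
       (\<lambda>(n, t). ennreal (1 / real (iceberg_height q n)))"

definition iceberg_regular :: "(nat \<Rightarrow> nat) \<Rightarrow> (nat \<times> nat \<Rightarrow> nat) \<Rightarrow> (nat \<Rightarrow> nat) set" where
  "iceberg_regular q \<alpha> =
     {x \<in> iceberg_space q \<alpha>. \<exists>n\<^sub>0. \<forall>n\<ge>n\<^sub>0.
        iceberg_proj q \<alpha> n ((x (Suc n) + 1) mod iceberg_height q (Suc n)) =
        (x n + 1) mod iceberg_height q n}"

text \<open>
  A point of the inverse limit is determined by any tail of its coordinates, so the
  description below is unique. On the null set of non-regular points the map is (arbitrarily)
  the identity.
\<close>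

definition iceberg_map ::
  "(nat \<Rightarrow> nat) \<Rightarrow> (nat \<times> nat \<Rightarrow> nat) \<Rightarrow> (nat \<Rightarrow> nat) \<Rightarrow> (nat \<Rightarrow> nat)" where
  "iceberg_map q \<alpha> x =
     (if x \<in> iceberg_regular q \<alpha>
      then THE x'. x' \<in> iceberg_space q \<alpha> \<and>
             (\<exists>n\<^sub>0. \<forall>n\<ge>n\<^sub>0. x' n = (x n + 1) mod iceberg_height q n)
      else x)"

text \<open>
  The map is injective on the regular points, and the image of the regular points has full
  measure; off this image the inverse is again (arbitrarily) the identity.
\<close>

definition iceberg_inv ::
  "(nat \<Rightarrow> nat) \<Rightarrow> (nat \<times> nat \<Rightarrow> nat) \<Rightarrow> (nat \<Rightarrow> nat) \<Rightarrow> (nat \<Rightarrow> nat)" where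
  "iceberg_inv q \<alpha> x =
     (if x \<in> iceberg_map q \<alpha> ` iceberg_regular q \<alpha>
      then inv_into (iceberg_regular q \<alpha>) (iceberg_map q \<alpha>) x
      else x)"

definition iceberg_pow ::
  "(nat \<Rightarrow> nat) \<Rightarrow> (nat \<times> nat \<Rightarrow> nat) \<Rightarrow> int \<Rightarrow> (nat \<Rightarrow> nat) \<Rightarrow> (nat \<Rightarrow> nat)" where
  "iceberg_pow q \<alpha> k =
     (if 0 \<le> k then iceberg_map q \<alpha> ^^ nat k else iceberg_inv q \<alpha> ^^ nat (- k))"


section \<open>Random rotations\<close>

definition rotation_index :: "(nat \<Rightarrow> nat) \<Rightarrow> (nat \<times> nat) set" where
  "rotation_index q = (SIGMA n:UNIV. {..<q n})"

definition rotation_distr :: "(nat \<Rightarrow> nat) \<Rightarrow> nat \<times> nat \<Rightarrow> nat measure" where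
  "rotation_distr q = (\<lambda>(n, y). uniform_count_measure {..<iceberg_height q n})"

definition rotation_measure :: "(nat \<Rightarrow> nat) \<Rightarrow> (nat \<times> nat \<Rightarrow> nat) measure" where
  "rotation_measure q = PiM (rotation_index q) (rotation_distr q)"

text \<open>
  The product measure is the joint law of independent uniformly distributed random
  variables: what holds almost everywhere for it holds almost surely for any
  such family, on any probability space.
\<close>

lemma AE_random_rotations:
  fixes W :: "'w measure" and A :: "nat \<times> nat \<Rightarrow> 'w \<Rightarrow> nat"
  assumes W: "prob_space W" and q: "\<And>n. 2 \<le> q n"
    and indep: "prob_space.indep_vars W (rotation_distr q) A (rotation_index q)"
    and unif: "\<And>i. i \<in> rotation_index q \<Longrightarrow>
                 distr W (rotation_distr q i) (A i) = rotation_distr q i"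
    and AE: "AE \<alpha> in rotation_measure q. P \<alpha>"
  shows "AE w in W. P (\<lambda>i\<in>rotation_index q. A i w)"
proof -
  interpret prob_space W by (rule W)
  have rv: "random_variable (rotation_distr q i) (A i)" if "i \<in> rotation_index q" for i
    using indep that by (auto simp: indep_vars_def)
  have "(0, 0) \<in> rotation_index q"
    using q[of 0] by (simp add: rotation_index_def)
  then have ne: "rotation_index q \<noteq> {}" by blast
  have "distr W (PiM (rotation_index q) (rotation_distr q)) (\<lambda>w. \<lambda>i\<in>rotation_index q. A i w)
        = PiM (rotation_index q) (\<lambda>i. distr W (rotation_distr q i) (A i))"
    using indep_vars_iff_distr_eq_PiM'[where I = "rotation_index q" and M' = "rotation_distr q" and X = A] ne rv indep
    by blast
  also have "\<dots> = rotation_measure q"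
    unfolding rotation_measure_def by (rule PiM_cong) (simp_all add: unif)
  finally have d: "distr W (PiM (rotation_index q) (rotation_distr q))
                     (\<lambda>w. \<lambda>i\<in>rotation_index q. A i w) = rotation_measure q" .
  have "(\<lambda>w. \<lambda>i\<in>rotation_index q. A i w) \<in> measurable W (PiM (rotation_index q) (rotation_distr q))"
    by (rule measurable_restrict) (rule rv)
  then show ?thesis
    using AE unfolding d[symmetric] by (rule AE_distrD)
qed


section \<open>Square-integrable functions and the Koopman operator\<close>

text \<open>
  Elements of \<open>L\<^sup>2\<close> are represented by square-integrable functions, without passing
  to the quotient modulo almost everywhere equality.
\<close>

definition L2_space :: "'a measure \<Rightarrow> ('a \<Rightarrow> complex) set" where
  "L2_space M = {f \<in> borel_measurable M. integrable M (\<lambda>x. (norm (f x))\<^sup>2)}"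

definition L2_zero_mean :: "'a measure \<Rightarrow> ('a \<Rightarrow> complex) set" where
  "L2_zero_mean M = {f \<in> L2_space M. integral\<^sup>L M f = 0}"

definition L2_inner :: "'a measure \<Rightarrow> ('a \<Rightarrow> complex) \<Rightarrow> ('a \<Rightarrow> complex) \<Rightarrow> complex" where
  "L2_inner M f g = (\<integral>x. f x * cnj (g x) \<partial>M)"

definition L2_dist :: "'a measure \<Rightarrow> ('a \<Rightarrow> complex) \<Rightarrow> ('a \<Rightarrow> complex) \<Rightarrow> real" where
  "L2_dist M f g = sqrt (\<integral>x. (norm (f x - g x))\<^sup>2 \<partial>M)"

definition L2_closure :: "'a measure \<Rightarrow> ('a \<Rightarrow> complex) set \<Rightarrow> ('a \<Rightarrow> complex) set" where
  "L2_closure M D = {f \<in> L2_space M. \<forall>\<epsilon>>0. \<exists>g\<in>D. L2_dist M f g < \<epsilon>}"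

definition complex_span :: "('a \<Rightarrow> complex) set \<Rightarrow> ('a \<Rightarrow> complex) set" where
  "complex_span B = {(\<lambda>x. \<Sum>b\<in>F. c b * b x) | F c. finite F \<and> F \<subseteq> B}"

definition koopman :: "('a \<Rightarrow> 'a) \<Rightarrow> ('a \<Rightarrow> complex) \<Rightarrow> ('a \<Rightarrow> complex)" where
  "koopman T f = (\<lambda>x. f (T x))"

text \<open>
  Below, \<open>S k\<close> is the \<open>k\<close>-th power (\<open>k\<close> an integer) of an invertible
  measure-preserving transformation, so \<open>koopman (S k)\<close> is the \<open>k\<close>-th power of its
  Koopman operator.
\<close>

definition simple_spectrum :: "'a measure \<Rightarrow> (int \<Rightarrow> 'a \<Rightarrow> 'a) \<Rightarrow> bool" where
  "simple_spectrum M S \<longleftrightarrow>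
     (\<exists>e\<in>L2_space M. L2_closure M (complex_span (range (\<lambda>k. koopman (S k) e))) = L2_space M)"


section \<open>Spectral type\<close>

definition circle_borel :: "complex measure" where
  "circle_borel = restrict_space borel (sphere 0 1)"

definition circle_lebesgue :: "complex measure" where
  "circle_lebesgue = distr (restrict_space lborel {0..<2 * pi}) circle_borel cis"

definition circle_convolution :: "complex measure \<Rightarrow> complex measure \<Rightarrow> complex measure" where
  "circle_convolution \<mu> \<nu> = distr (\<mu> \<Otimes>\<^sub>M \<nu>) circle_borel (\<lambda>(z, w). z * w)"

definition spectral_measure ::
  "'a measure \<Rightarrow> (int \<Rightarrow> 'a \<Rightarrow> 'a) \<Rightarrow> ('a \<Rightarrow> complex) \<Rightarrow> complex measure \<Rightarrow> bool" where
  "spectral_measure M S f \<nu> \<longleftrightarrow>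
     sets \<nu> = sets circle_borel \<and> finite_measure \<nu> \<and>
     (\<forall>k::int. (\<integral>z. z powi k \<partial>\<nu>) = L2_inner M (koopman (S k) f) f)"

text \<open>
  The measures in the maximal spectral type on the zero-mean functions: all spectral
  measures are absolutely continuous with respect to \<open>\<sigma>\<close>, and \<open>\<sigma>\<close> is equivalent to one of
  them. Recall that \<open>absolutely_continuous \<mu> \<nu>\<close> means that \<open>\<nu>\<close> is absolutely continuous
  with respect to \<open>\<mu>\<close>.
\<close>

definition maximal_spectral_type ::
  "'a measure \<Rightarrow> (int \<Rightarrow> 'a \<Rightarrow> 'a) \<Rightarrow> complex measure \<Rightarrow> bool" where
  "maximal_spectral_type M S \<sigma> \<longleftrightarrow>
     sets \<sigma> = sets circle_borel \<and> finite_measure \<sigma> \<and>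
     (\<forall>f\<in>L2_zero_mean M. \<exists>\<nu>. spectral_measure M S f \<nu> \<and> absolutely_continuous \<sigma> \<nu>) \<and>
     (\<exists>f\<in>L2_zero_mean M. \<exists>\<nu>. spectral_measure M S f \<nu> \<and> absolutely_continuous \<nu> \<sigma>)"


section \<open>Local rank\<close>

definition tower_level :: "('a \<Rightarrow> 'a) \<Rightarrow> 'a set \<Rightarrow> nat \<Rightarrow> 'a set" where
  "tower_level T C i = (T ^^ i) ` C"

definition tower_union :: "('a \<Rightarrow> 'a) \<Rightarrow> 'a set \<Rightarrow> nat \<Rightarrow> 'a set" where
  "tower_union T C h = (\<Union>i<h. tower_level T C i)"

definition rokhlin_tower :: "'a measure \<Rightarrow> ('a \<Rightarrow> 'a) \<Rightarrow> 'a set \<Rightarrow> nat \<Rightarrow> bool" where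
  "rokhlin_tower M T C h \<longleftrightarrow>
     1 \<le> h \<and> (\<forall>i<h. tower_level T C i \<in> sets M) \<and>
     disjoint_family_on (tower_level T C) {..<h}"

definition approximating_towers ::
  "'a measure \<Rightarrow> ('a \<Rightarrow> 'a) \<Rightarrow> (nat \<Rightarrow> 'a set) \<Rightarrow> (nat \<Rightarrow> nat) \<Rightarrow> bool" where
  "approximating_towers M T C h \<longleftrightarrow>
     (\<forall>n. rokhlin_tower M T (C n) (h n)) \<and>
     (\<forall>A\<in>sets M. \<exists>B.
        (\<forall>n. B n \<in> sets M \<and>
             (\<exists>J\<subseteq>{..<h n}. B n \<inter> tower_union T (C n) (h n) = (\<Union>j\<in>J. tower_level T (C n) j))) \<and>
        (\<lambda>n. measure M (sym_diff (B n) A)) \<longlonglongrightarrow> 0)"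

text \<open>
  For a probability measure on a countably generated sigma-algebra the set below is nonempty
  (take empty towers), bounded by 1 and, by a diagonal argument, contains its supremum, so
  this is the maximum.
\<close>

definition local_rank :: "'a measure \<Rightarrow> ('a \<Rightarrow> 'a) \<Rightarrow> real" where
  "local_rank M T =
     Sup {\<beta>. \<exists>C h. approximating_towers M T C h \<and>
                  (\<lambda>n. measure M (tower_union T (C n) (h n))) \<longlonglongrightarrow> \<beta>}"

end

theory Submission
  imports Defs
begin

text \<open>At scale \<open>h\<^sub>n\<close> the map \<open>T\<close> adds 1 to \<open>x\<^sub>n\<close>, except at the ends of the blocks of length \<open>h\<^sub>n\<close>.
  Hoeffding's inequality and the Borel-Cantelli lemma show that, almost surely, for all large \<open>n\<close>
  and all \<open>t < (q\<^sub>n - 1) h\<^sub>n\<close>, the pair of \<open>x\<^sub>n\<close> and \<open>(T\<^sup>t x)\<^sub>n\<close> is distributed, up to about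
  \<open>q\<^sub>n\<close> to the power \<open>-1/2\<close>, as if \<open>x\<^sub>n\<close> moved to \<open>x\<^sub>n + t\<close> with probability \<open>max 0 (1 - t / h\<^sub>n)\<close> and
  were resampled otherwise. Used at the levels \<open>n + 1\<close> and \<open>n\<close>, this bounds the correlations of cylinder
  functions, hence mixing, and their products are square summable, hence the convolution is absolutely
  continuous. For the simple spectrum, average \<open>T\<^sup>s\<close> against a character of the integers modulo
  \<open>h\<^sub>n\<close> over \<open>L h\<^sub>n\<close> steps: a cylinder function then acts like its Fourier coefficient times the
  character. If \<open>f\<close> is orthogonal to the cyclic space of \<open>g\<close>, letting \<open>n\<close> and then \<open>L\<close> grow shows
  that \<open>f\<close> lies in the cyclic space of \<open>f + g\<close>, so a cyclic vector can be assembled from a total sequence.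
  The tower for the local rank stands on a set \<open>{x. x n = a}\<close> and has height about \<open>h\<^sub>n / 2\<close>.\<close>

section \<open>Square-integrable functions\<close>

text \<open>Two losses shape the estimates. Reading the power t of \<open>T\<close> as a translation
  of the coordinate at level m costs about t / h_m, so one level cannot serve times close to the
  next height. For \<open>h n \<le> t < h (Suc n)\<close> the power is therefore read at level
  \<open>Suc n\<close>, where that cost is tiny, and the counts of level \<open>n\<close> are
  applied to the exact cyclic translation, where nothing is lost at block ends. In the spectral part
  the averages of any two cylinder functions are nearly multiples of the same vector, and for
  parallel vectors Cauchy-Schwarz is an equality. Norm products are then controlled by inner
  products, which vanish for orthogonal cyclic spaces. The squared norms of the averages sum to
  about 1 / L, the squared errors of parallelism to about 1 / L^2, so mixed terms have order
  L^(-3/2), still small after multiplication by L. In the growth condition the power of 3 gives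
  \<open>h n \<le> ln (q n)\<close>, so polynomial losses in the height cost only logarithms of
  \<open>q n\<close>.\<close>

definition L2_norm :: "'a measure \<Rightarrow> ('a \<Rightarrow> complex) \<Rightarrow> real" where
  "L2_norm M f = sqrt (\<integral>x. (norm (f x))\<^sup>2 \<partial>M)"

lemma norm_add_sq_le: "(norm (a + b :: complex))\<^sup>2 \<le> 2 * (norm a)\<^sup>2 + 2 * (norm b)\<^sup>2"
proof -
  have "(norm (a + b))\<^sup>2 \<le> (norm a + norm b)\<^sup>2" by (intro power_mono norm_triangle_ineq) auto
  also have "\<dots> \<le> 2 * (norm a)\<^sup>2 + 2 * (norm b)\<^sup>2"
    using sum_squares_bound[of "norm a" "norm b"] by (simp add: power2_sum)
  finally show ?thesis .
qed

lemma borel_measurable_cnj [measurable (raw)]: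
  "f \<in> borel_measurable M \<Longrightarrow> (\<lambda>x. cnj (f x)) \<in> borel_measurable M"
  by (rule borel_measurable_continuous_on[of cnj]) (auto intro: continuous_intros)

lemma L2_measurable [measurable_dest]: "f \<in> L2_space M \<Longrightarrow> f \<in> borel_measurable M"
  by (simp add: L2_space_def)

lemma L2_integrable_sq: "f \<in> L2_space M \<Longrightarrow> integrable M (\<lambda>x. (norm (f x))\<^sup>2)"
  by (simp add: L2_space_def)

lemma L2_add [intro]:
  assumes "f \<in> L2_space M" "g \<in> L2_space M" shows "(\<lambda>x. f x + g x) \<in> L2_space M"
proof -
  have [measurable]: "f \<in> borel_measurable M" "g \<in> borel_measurable M"
    using assms by (auto simp: L2_space_def)
  have "integrable M (\<lambda>x. (norm (f x + g x))\<^sup>2)"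
    by (rule Bochner_Integration.integrable_bound[of M "\<lambda>x. 2 * (norm (f x))\<^sup>2 + 2 * (norm (g x))\<^sup>2"])
       (use assms norm_add_sq_le in \<open>auto simp: L2_space_def\<close>)
  then show ?thesis by (simp add: L2_space_def)
qed

lemma L2_scale [intro]: "f \<in> L2_space M \<Longrightarrow> (\<lambda>x. c * f x) \<in> L2_space M"
  by (auto simp: L2_space_def norm_mult power_mult_distrib)

lemma L2_zero [intro, simp]: "(\<lambda>x. 0) \<in> L2_space M" by (simp add: L2_space_def)

lemma L2_uminus [intro]: "f \<in> L2_space M \<Longrightarrow> (\<lambda>x. - f x) \<in> L2_space M"
  using L2_scale[of f M "-1"] by simp

lemma L2_diff [intro]:
  "f \<in> L2_space M \<Longrightarrow> g \<in> L2_space M \<Longrightarrow> (\<lambda>x. f x - g x) \<in> L2_space M"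
  using L2_add[OF _ L2_uminus] by simp

lemma L2_sum [intro]:
  assumes "\<And>i. i \<in> I \<Longrightarrow> f i \<in> L2_space M" shows "(\<lambda>x. \<Sum>i\<in>I. f i x) \<in> L2_space M"
  using assms by (induction I rule: infinite_finite_induct) auto

lemma L2_bounded:
  assumes "finite_measure M" "f \<in> borel_measurable M" "\<And>x. x \<in> space M \<Longrightarrow> norm (f x) \<le> C"
  shows "f \<in> L2_space M"
proof -
  interpret finite_measure M by fact
  have [measurable]: "f \<in> borel_measurable M" by fact
  have "integrable M (\<lambda>x. (norm (f x))\<^sup>2)"
    using assms(3) by (intro integrable_const_bound[where B="C\<^sup>2"] AE_I2) (auto intro!: power_mono)
  then show ?thesis using assms by (simp add: L2_space_def)
qed

lemma L2_integrable_mult: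
  assumes "f \<in> L2_space M" "g \<in> L2_space M" shows "integrable M (\<lambda>x. f x * cnj (g x))"
proof -
  have [measurable]: "f \<in> borel_measurable M" "g \<in> borel_measurable M"
    using assms by (auto simp: L2_space_def)
  have m: "(\<lambda>x. f x * cnj (g x)) \<in> borel_measurable M" by measurable
  have b: "norm (f x * cnj (g x)) \<le> norm ((norm (f x))\<^sup>2 + (norm (g x))\<^sup>2)" for x
  proof -
    have "0 \<le> norm (f x) * norm (g x)" by simp
    then have "norm (f x) * norm (g x) \<le> (norm (f x))\<^sup>2 + (norm (g x))\<^sup>2"
      using sum_squares_bound[of "norm (f x)" "norm (g x)"] by linarith
    then show ?thesis by (simp add: norm_mult)
  qed
  show ?thesis
    by (rule Bochner_Integration.integrable_bound[of M "\<lambda>x. (norm (f x))\<^sup>2 + (norm (g x))\<^sup>2"])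
       (use assms b m in \<open>auto simp: L2_space_def\<close>)
qed

lemma inner_add_left: "f \<in> L2_space M \<Longrightarrow> g \<in> L2_space M \<Longrightarrow> h \<in> L2_space M \<Longrightarrow>
    L2_inner M (\<lambda>x. f x + g x) h = L2_inner M f h + L2_inner M g h"
  unfolding L2_inner_def by (simp add: distrib_right L2_integrable_mult)

lemma inner_scale_left: "L2_inner M (\<lambda>x. c * f x) h = c * L2_inner M f h"
  unfolding L2_inner_def by (simp add: mult.assoc)

lemma inner_cnj: "L2_inner M g f = cnj (L2_inner M f g)"
  unfolding L2_inner_def using Bochner_Integration.integral_cnj[of M "\<lambda>x. f x * cnj (g x)"] by (simp add: mult.commute)

lemma inner_add_right: "f \<in> L2_space M \<Longrightarrow> g \<in> L2_space M \<Longrightarrow> h \<in> L2_space M \<Longrightarrow>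
    L2_inner M h (\<lambda>x. f x + g x) = L2_inner M h f + L2_inner M h g"
  using inner_add_left[of f M g h] by (metis complex_cnj_add inner_cnj)

lemma inner_scale_right: "L2_inner M h (\<lambda>x. c * f x) = cnj c * L2_inner M h f"
  using inner_scale_left[of M c f h] by (metis complex_cnj_mult inner_cnj)

lemma inner_diff_left: "f \<in> L2_space M \<Longrightarrow> g \<in> L2_space M \<Longrightarrow> h \<in> L2_space M \<Longrightarrow>
    L2_inner M (\<lambda>x. f x - g x) h = L2_inner M f h - L2_inner M g h"
  unfolding L2_inner_def by (simp add: left_diff_distrib L2_integrable_mult)

lemma inner_diff_right: "f \<in> L2_space M \<Longrightarrow> g \<in> L2_space M \<Longrightarrow> h \<in> L2_space M \<Longrightarrow>
    L2_inner M h (\<lambda>x. f x - g x) = L2_inner M h f - L2_inner M h g"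
  using inner_diff_left[of f M g h] by (metis complex_cnj_diff inner_cnj)

lemma inner_zero [simp]: "L2_inner M (\<lambda>x. 0) h = 0" "L2_inner M h (\<lambda>x. 0) = 0"
  by (simp_all add: L2_inner_def)

lemma inner_sum_left:
  assumes "\<And>i. i \<in> I \<Longrightarrow> f i \<in> L2_space M" "h \<in> L2_space M"
  shows "L2_inner M (\<lambda>x. \<Sum>i\<in>I. f i x) h = (\<Sum>i\<in>I. L2_inner M (f i) h)" using assms
  by (induction I rule: infinite_finite_induct) (auto simp: inner_add_left L2_sum)

lemma inner_sum_right:
  assumes "\<And>i. i \<in> I \<Longrightarrow> f i \<in> L2_space M" "h \<in> L2_space M"
  shows "L2_inner M h (\<lambda>x. \<Sum>i\<in>I. f i x) = (\<Sum>i\<in>I. L2_inner M h (f i))"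
proof -
  have "L2_inner M h (\<lambda>x. \<Sum>i\<in>I. f i x) = cnj (\<Sum>i\<in>I. L2_inner M (f i) h)"
    by (subst inner_cnj) (simp only: inner_sum_left[OF assms])
  also have "\<dots> = (\<Sum>i\<in>I. L2_inner M h (f i))"
    unfolding cnj_sum by (rule sum.cong[OF refl]) (rule inner_cnj[symmetric])
  finally show ?thesis .
qed

lemma L2_norm_nonneg [simp]: "0 \<le> L2_norm M f" by (simp add: L2_norm_def)

lemma L2_norm_sq: "(L2_norm M f)\<^sup>2 = (\<integral>x. (norm (f x))\<^sup>2 \<partial>M)"
  by (simp add: L2_norm_def)

lemma inner_self: "L2_inner M f f = of_real ((L2_norm M f)\<^sup>2)"
  unfolding L2_inner_def L2_norm_sq complex_norm_square[symmetric] of_real_power[symmetric]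
  by (simp only: integral_complex_of_real)

lemma Re_inner_self: "Re (L2_inner M f f) = (L2_norm M f)\<^sup>2" by (simp add: inner_self)

lemma L2_norm_zero [simp]: "L2_norm M (\<lambda>x. 0) = 0" by (simp add: L2_norm_def)

lemma L2_dist_norm: "L2_dist M f g = L2_norm M (\<lambda>x. f x - g x)" by (simp add: L2_dist_def L2_norm_def)

lemma L2_norm_scale: "L2_norm M (\<lambda>x. c * f x) = norm c * L2_norm M f"
  by (simp add: L2_norm_def norm_mult power_mult_distrib real_sqrt_mult)

lemma L2_norm_minus: "L2_norm M (\<lambda>x. f x - g x) = L2_norm M (\<lambda>x. g x - f x)"
  by (simp add: L2_norm_def norm_minus_commute)

lemma L2_norm_add_sq:
  assumes "f \<in> L2_space M" "g \<in> L2_space M" shows "(L2_norm M (\<lambda>x. f x + g x))\<^sup>2 =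
           (L2_norm M f)\<^sup>2 + 2 * Re (L2_inner M f g) + (L2_norm M g)\<^sup>2"
proof -
  have "of_real ((L2_norm M (\<lambda>x. f x + g x))\<^sup>2) =
        L2_inner M f f + L2_inner M f g + L2_inner M g f + L2_inner M g g"
    unfolding inner_self[symmetric] using assms by (simp add: inner_add_left inner_add_right L2_add)
  then have "Re (of_real ((L2_norm M (\<lambda>x. f x + g x))\<^sup>2)) =
        Re (L2_inner M f f + L2_inner M f g + L2_inner M g f + L2_inner M g g)" by simp
  moreover have "Re (L2_inner M g f) = Re (L2_inner M f g)" by (subst inner_cnj) simp
  ultimately show ?thesis by (simp add: Re_inner_self)
qed

lemma L2_norm_diff_sq:
  assumes "f \<in> L2_space M" "g \<in> L2_space M" shows "(L2_norm M (\<lambda>x. f x - g x))\<^sup>2 =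
           (L2_norm M f)\<^sup>2 - 2 * Re (L2_inner M f g) + (L2_norm M g)\<^sup>2"
  using L2_norm_add_sq[OF assms(1) L2_uminus[OF assms(2)]]
    inner_scale_right[of M f "-1" g] L2_norm_scale[of M "-1" g] by simp

text \<open>Functions are not identified modulo null sets, so \<open>L2_norm M g = 0\<close> does
  not make \<open>g\<close> the zero function. Both cases come from one quadratic inequality in a
  real \<open>s\<close>: the squared norm of \<open>f - s a g\<close> is nonnegative, with
  \<open>a\<close> the inner product. If the norm of \<open>g\<close> is 0, a large \<open>s\<close>
  contradicts it.\<close>

lemma L2_cauchy_schwarz:
  assumes "f \<in> L2_space M" "g \<in> L2_space M"
  shows "norm (L2_inner M f g) \<le> L2_norm M f * L2_norm M g"
proof -
  define a where "a = L2_inner M f g"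
  have key: "2 * s * (norm a)\<^sup>2 \<le> (L2_norm M f)\<^sup>2 + s\<^sup>2 * (norm a)\<^sup>2 * (L2_norm M g)\<^sup>2" for s :: real
  proof -
    have "0 \<le> (L2_norm M (\<lambda>x. f x - (of_real s * a) * g x))\<^sup>2" by simp
    also have "\<dots> = (L2_norm M f)\<^sup>2 - 2 * Re (cnj (of_real s * a) * a) + (norm (of_real s * a) * L2_norm M g)\<^sup>2"
      using assms by (subst L2_norm_diff_sq) (auto simp: inner_scale_right L2_norm_scale a_def)
    also have "cnj (of_real s * a) * a = of_real (s * (norm a)\<^sup>2)"
      using complex_norm_square[of a] by (simp add: mult_ac)
    finally show ?thesis by (simp add: norm_mult power_mult_distrib mult_ac)
  qed
  show ?thesis
  proof (cases "L2_norm M g = 0")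
    case True
    have "a = 0"
    proof (rule ccontr)
      assume "a \<noteq> 0"
      then have p: "(norm a)\<^sup>2 > 0" by simp
      have "2 * (((L2_norm M f)\<^sup>2 + 1) / (norm a)\<^sup>2) * (norm a)\<^sup>2 \<le> (L2_norm M f)\<^sup>2"
        using key[of "((L2_norm M f)\<^sup>2 + 1) / (norm a)\<^sup>2"] True by simp
      then show False using p by (simp add: add_increasing)
         (smt (verit) zero_le_power2)
    qed
    then show ?thesis by (simp add: a_def)
  next
    case False
    then have p: "(L2_norm M g)\<^sup>2 > 0" by simp
    have "2 * (norm a)\<^sup>2 / (L2_norm M g)\<^sup>2 \<le> (L2_norm M f)\<^sup>2 + (norm a)\<^sup>2 / (L2_norm M g)\<^sup>2"
      using key[of "1 / (L2_norm M g)\<^sup>2"] False by (simp add: field_simps power2_eq_square)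
    then have "(norm a)\<^sup>2 \<le> (L2_norm M f)\<^sup>2 * (L2_norm M g)\<^sup>2"
      using p by (simp add: field_simps)
    then have "(norm a)\<^sup>2 \<le> (L2_norm M f * L2_norm M g)\<^sup>2" by (simp add: power_mult_distrib)
    then show ?thesis unfolding a_def by (rule power2_le_imp_le) simp
  qed
qed

lemma L2_triangle:
  assumes "f \<in> L2_space M" "g \<in> L2_space M"
  shows "L2_norm M (\<lambda>x. f x + g x) \<le> L2_norm M f + L2_norm M g"
proof (rule power2_le_imp_le)
  have "Re (L2_inner M f g) \<le> L2_norm M f * L2_norm M g"
    using L2_cauchy_schwarz[OF assms] complex_Re_le_cmod order_trans by blast
  then show "(L2_norm M (\<lambda>x. f x + g x))\<^sup>2 \<le> (L2_norm M f + L2_norm M g)\<^sup>2"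
    by (simp add: L2_norm_add_sq[OF assms] power2_sum)
qed simp

lemma L2_triangle3:
  assumes "f \<in> L2_space M" "g \<in> L2_space M" "h \<in> L2_space M"
  shows "L2_norm M (\<lambda>x. f x - h x) \<le> L2_norm M (\<lambda>x. f x - g x) + L2_norm M (\<lambda>x. g x - h x)"
  using L2_triangle[OF L2_diff[OF assms(1,2)] L2_diff[OF assms(2,3)]] by simp

lemma L2_norm_le_add_diff:
  assumes "f \<in> L2_space M" "g \<in> L2_space M"
  shows "L2_norm M f \<le> L2_norm M g + L2_norm M (\<lambda>x. f x - g x)"
  using L2_triangle[OF assms(2) L2_diff[OF assms]] by simp

lemma L2_norm_sum_le:
  assumes "\<And>i. i \<in> I \<Longrightarrow> f i \<in> L2_space M"
  shows "L2_norm M (\<lambda>x. \<Sum>i\<in>I. f i x) \<le> (\<Sum>i\<in>I. L2_norm M (f i))" using assms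
proof (induction I rule: infinite_finite_induct)
  case (insert i I)
  then show ?case using L2_triangle[of "f i" M "\<lambda>x. \<Sum>i\<in>I. f i x"] by (force intro!: L2_sum)
qed auto

lemma L2_norm_cong_AE:
  assumes "f \<in> borel_measurable M" "g \<in> borel_measurable M" "AE x in M. f x = g x"
  shows "L2_norm M f = L2_norm M g"
proof -
  have [measurable]: "f \<in> borel_measurable M" "g \<in> borel_measurable M" by fact+
  have "(\<integral>x. (norm (f x))\<^sup>2 \<partial>M) = (\<integral>x. (norm (g x))\<^sup>2 \<partial>M)"
    by (rule integral_cong_AE) (use assms in auto)
  then show ?thesis by (simp add: L2_norm_def)
qed

lemma inner_cong_AE:
  assumes "f \<in> borel_measurable M" "g \<in> borel_measurable M" "AE x in M. f x = g x"
    "f' \<in> borel_measurable M" "g' \<in> borel_measurable M" "AE x in M. f' x = g' x"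
  shows "L2_inner M f f' = L2_inner M g g'"
proof -
  have m [measurable]: "f \<in> borel_measurable M" "g \<in> borel_measurable M" "f' \<in> borel_measurable M" "g' \<in> borel_measurable M" by fact+
  have "(\<lambda>x. f x * cnj (f' x)) \<in> borel_measurable M" "(\<lambda>x. g x * cnj (g' x)) \<in> borel_measurable M"
    using m by (auto intro!: borel_measurable_times)
  moreover have "AE x in M. f x * cnj (f' x) = g x * cnj (g' x)" using assms(3,6) by eventually_elim simp
  ultimately show ?thesis unfolding L2_inner_def by (intro integral_cong_AE)
qed

lemma inner_perturb:
  assumes "f \<in> L2_space M" "g \<in> L2_space M" "f' \<in> L2_space M" "g' \<in> L2_space M"
  shows "norm (L2_inner M f g - L2_inner M f' g') \<le>
    L2_norm M (\<lambda>x. f x - f' x) * L2_norm M g + L2_norm M f' * L2_norm M (\<lambda>x. g x - g' x)"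
proof -
  have "L2_inner M f g - L2_inner M f' g' =
     L2_inner M (\<lambda>x. f x - f' x) g + L2_inner M f' (\<lambda>x. g x - g' x)"
    using assms by (simp add: inner_diff_left inner_diff_right)
  also have "norm \<dots> \<le> norm (L2_inner M (\<lambda>x. f x - f' x) g) + norm (L2_inner M f' (\<lambda>x. g x - g' x))"
    by (rule norm_triangle_ineq)
  also have "\<dots> \<le> L2_norm M (\<lambda>x. f x - f' x) * L2_norm M g + L2_norm M f' * L2_norm M (\<lambda>x. g x - g' x)"
    using assms by (intro add_mono L2_cauchy_schwarz) auto
  finally show ?thesis .
qed

text \<open>The Riesz-Fischer argument: monotone convergence makes the sum of the absolute values
  finite almost everywhere, and its square is an integrable majorant for the squared tails.
  Projections and the assembly of a cyclic vector rest on this form of completeness.\<close>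

lemma L2_series_complete:
  assumes f: "\<And>i. f i \<in> L2_space M" and s: "summable (\<lambda>i. L2_norm M (f i))"
  shows "\<exists>e\<in>L2_space M. (\<lambda>n. L2_norm M (\<lambda>x. e x - (\<Sum>i<n. f i x))) \<longlonglongrightarrow> 0"
proof -
  have [measurable]: "\<And>i. f i \<in> borel_measurable M" using f by (auto simp: L2_space_def)
  define C where "C = (\<Sum>i. L2_norm M (f i))"
  define G where "G n x = (\<Sum>i<n. norm (f i x))" for n x
  have [measurable]: "\<And>n. G n \<in> borel_measurable M" unfolding G_def by measurable
  have G0: "0 \<le> G n x" for n x by (simp add: G_def sum_nonneg)
  have nf: "(\<lambda>x. of_real (norm (f i x))) \<in> L2_space M" for i
    using f[of i] by (auto simp: L2_space_def)
  have GL: "(\<lambda>x. complex_of_real (G n x)) \<in> L2_space M" for n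
    unfolding G_def of_real_sum by (rule L2_sum) (rule nf)
  have Gn: "L2_norm M (\<lambda>x. complex_of_real (G n x)) \<le> C" for n
  proof -
    have "L2_norm M (\<lambda>x. complex_of_real (G n x)) \<le> (\<Sum>i<n. L2_norm M (\<lambda>x. complex_of_real (norm (f i x))))"
      unfolding G_def of_real_sum by (rule L2_norm_sum_le) (rule nf)
    also have "\<dots> = (\<Sum>i<n. L2_norm M (f i))" by (simp add: L2_norm_def)
    also have "\<dots> \<le> C" unfolding C_def by (rule sum_le_suminf[OF s]) auto
    finally show ?thesis .
  qed
  have iG: "integrable M (\<lambda>x. (G n x)\<^sup>2)" for n using L2_integrable_sq[OF GL[of n]] by simp
  have G2: "(\<integral>x. (G n x)\<^sup>2 \<partial>M) \<le> C\<^sup>2" for n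
  proof -
    have "(\<integral>x. (G n x)\<^sup>2 \<partial>M) = (L2_norm M (\<lambda>x. complex_of_real (G n x)))\<^sup>2"
      by (simp add: L2_norm_sq)
    also have "\<dots> \<le> C\<^sup>2" using Gn by (intro power_mono) auto
    finally show ?thesis .
  qed
  have mono: "G n x \<le> G m x" if "n \<le> m" for n m x unfolding G_def using that by (intro sum_mono2) auto
  have "AE x in M. summable (\<lambda>i. norm (f i x))"
  proof -
    have "(\<integral>\<^sup>+x. (SUP n. ennreal ((G n x)\<^sup>2)) \<partial>M) = (SUP n. \<integral>\<^sup>+x. ennreal ((G n x)\<^sup>2) \<partial>M)"
      by (intro nn_integral_monotone_convergence_SUP)
         (auto simp: incseq_def le_fun_def intro!: ennreal_leI power_mono mono G0)
    also have "\<dots> = (SUP n. ennreal (\<integral>x. (G n x)\<^sup>2 \<partial>M))"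
      by (subst nn_integral_eq_integral) (auto simp: iG)
    also have "\<dots> \<le> ennreal (C\<^sup>2)" by (intro SUP_least ennreal_leI G2)
    finally have "(\<integral>\<^sup>+x. (SUP n. ennreal ((G n x)\<^sup>2)) \<partial>M) < \<infinity>"
      by (simp add: le_less_trans)
    then have "AE x in M. (SUP n. ennreal ((G n x)\<^sup>2)) \<noteq> \<infinity>"
      by (intro nn_integral_noteq_infinite) auto
    then show ?thesis
    proof eventually_elim
      case (elim x)
      define B where "B = enn2real (SUP n. ennreal ((G n x)\<^sup>2))"
      have "ennreal ((G n x)\<^sup>2) \<le> ennreal B" for n
        using elim unfolding B_def by (subst ennreal_enn2real) (auto simp: less_top[symmetric] intro: SUP_upper)
      then have b: "(G n x)\<^sup>2 \<le> B" for n by (metis B_def enn2real_nonneg ennreal_le_iff)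
      show ?case
      proof (rule summableI_nonneg_bounded[where x="sqrt B"])
        show "(\<Sum>i<n. norm (f i x)) \<le> sqrt B" for n
          using b[of n] unfolding G_def by (rule real_le_rsqrt)
      qed simp
    qed
  qed
  note AEs = this
  define e where "e x = (\<Sum>i. f i x)" for x
  define H where "H x = (\<Sum>i. norm (f i x))" for x
  have [measurable]: "e \<in> borel_measurable M" "H \<in> borel_measurable M"
    unfolding e_def H_def by measurable
  have iH: "integrable M (\<lambda>x. (H x)\<^sup>2)"
  proof (rule integrable_monotone_convergence[where f="\<lambda>n x. (G n x)\<^sup>2" and x="lim (\<lambda>n. \<integral>x. (G n x)\<^sup>2 \<partial>M)"])
    show "AE x in M. mono (\<lambda>n. (G n x)\<^sup>2)"
      by (rule AE_I2) (auto simp: incseq_def intro!: power_mono mono G0)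
    show "AE x in M. (\<lambda>n. (G n x)\<^sup>2) \<longlonglongrightarrow> (H x)\<^sup>2"
      using AEs by eventually_elim (auto intro!: tendsto_power summable_LIMSEQ simp: G_def H_def)
    have "convergent (\<lambda>n. \<integral>x. (G n x)\<^sup>2 \<partial>M)"
    proof (rule Bseq_monoseq_convergent)
      show "Bseq (\<lambda>n. \<integral>x. (G n x)\<^sup>2 \<partial>M)"
        by (rule BseqI'[of _ "C\<^sup>2"]) (use G2 in auto)
      show "monoseq (\<lambda>n. \<integral>x. (G n x)\<^sup>2 \<partial>M)"
        by (rule monoI1) (auto intro!: integral_mono iG power_mono mono G0)
    qed
    then show "(\<lambda>n. \<integral>x. (G n x)\<^sup>2 \<partial>M) \<longlonglongrightarrow> lim (\<lambda>n. \<integral>x. (G n x)\<^sup>2 \<partial>M)"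
      by (rule convergent_LIMSEQ_iff[THEN iffD1])
  qed (use iG in auto)
  have bnd: "AE x in M. norm ((norm (e x - (\<Sum>i<n. f i x)))\<^sup>2) \<le> (H x)\<^sup>2" for n using AEs
  proof eventually_elim
    case (elim x)
    have sf: "summable (\<lambda>i. f i x)" using elim by (rule summable_norm_cancel)
    have "e x - (\<Sum>i<n. f i x) = (\<Sum>i. f (i + n) x)"
      unfolding e_def using suminf_minus_initial_segment[OF sf, of n] by simp
    also have "norm \<dots> \<le> (\<Sum>i. norm (f (i + n) x))"
      by (rule summable_norm) (use elim in \<open>simp add: summable_iff_shift[of "\<lambda>i. norm (f i x)"]\<close>)
    also have "\<dots> = H x - G n x" unfolding H_def G_def by (rule suminf_minus_initial_segment[OF elim])
    also have "\<dots> \<le> H x" using G0 by simp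
    finally show ?case by (auto intro!: power_mono)
  qed
  have "integrable M (\<lambda>x. (norm (e x))\<^sup>2)"
    by (rule Bochner_Integration.integrable_bound[OF iH]) (use bnd[of 0] in auto)
  then have eL: "e \<in> L2_space M" by (simp add: L2_space_def)
  have "(\<lambda>n. \<integral>x. (norm (e x - (\<Sum>i<n. f i x)))\<^sup>2 \<partial>M) \<longlonglongrightarrow> (\<integral>x. 0 \<partial>M)"
  proof (rule integral_dominated_convergence[where w="\<lambda>x. (H x)\<^sup>2"])
    show "AE x in M. (\<lambda>n. (norm (e x - (\<Sum>i<n. f i x)))\<^sup>2) \<longlonglongrightarrow> 0"
      using AEs proof eventually_elim
      case (elim x)
      have "(\<lambda>n. \<Sum>i<n. f i x) \<longlonglongrightarrow> e x"
        unfolding e_def by (intro summable_LIMSEQ summable_norm_cancel[OF elim])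
      then have "(\<lambda>n. (norm (e x - (\<Sum>i<n. f i x)))\<^sup>2) \<longlonglongrightarrow> (norm (e x - e x))\<^sup>2"
        by (intro tendsto_intros)
      then show ?case by simp
    qed
  qed (use iH bnd in auto)
  then have "(\<lambda>n. sqrt (\<integral>x. (norm (e x - (\<Sum>i<n. f i x)))\<^sup>2 \<partial>M)) \<longlonglongrightarrow> sqrt 0"
    by (intro tendsto_real_sqrt) simp
  then show ?thesis using eL by (auto simp: L2_norm_def)
qed

section \<open>Subspaces, closures and orthogonal projections\<close>

definition L2_subspace :: "'a measure \<Rightarrow> ('a \<Rightarrow> complex) set \<Rightarrow> bool" where
  "L2_subspace M W \<longleftrightarrow> W \<subseteq> L2_space M \<and> W \<noteq> {} \<and>
     (\<forall>f\<in>W. \<forall>g\<in>W. (\<lambda>x. f x + g x) \<in> W) \<and> (\<forall>f\<in>W. \<forall>c. (\<lambda>x. c * f x) \<in> W)"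

lemma L2_subspace_add: "L2_subspace M W \<Longrightarrow> f \<in> W \<Longrightarrow> g \<in> W \<Longrightarrow> (\<lambda>x. f x + g x) \<in> W"
  and L2_subspace_scale: "L2_subspace M W \<Longrightarrow> f \<in> W \<Longrightarrow> (\<lambda>x. c * f x) \<in> W"
  and L2_subspace_sub: "L2_subspace M W \<Longrightarrow> W \<subseteq> L2_space M"
  unfolding L2_subspace_def by auto

lemma L2_closure_iff:
  "f \<in> L2_closure M D \<longleftrightarrow> f \<in> L2_space M \<and> (\<forall>\<epsilon>>0. \<exists>g\<in>D. L2_norm M (\<lambda>x. f x - g x) < \<epsilon>)"
  by (simp add: L2_closure_def L2_dist_norm)

lemma L2_closure_superset: "D \<subseteq> L2_space M \<Longrightarrow> D \<subseteq> L2_closure M D"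
  by (force simp: L2_closure_iff)

lemma L2_closure_closed:
  assumes "D \<subseteq> L2_space M" shows "L2_closure M (L2_closure M D) = L2_closure M D"
proof
  show "L2_closure M (L2_closure M D) \<subseteq> L2_closure M D"
  proof
    fix f assume f: "f \<in> L2_closure M (L2_closure M D)"
    then have fL: "f \<in> L2_space M" by (simp add: L2_closure_iff)
    show "f \<in> L2_closure M D" unfolding L2_closure_iff
    proof (intro conjI allI impI fL)
      fix \<epsilon> :: real assume "\<epsilon> > 0"
      then have "\<epsilon> / 2 > 0" by simp
      with f obtain g where g: "g \<in> L2_closure M D" "L2_norm M (\<lambda>x. f x - g x) < \<epsilon> / 2"
        unfolding L2_closure_iff[of f] by blast
      with \<open>\<epsilon> / 2 > 0\<close> obtain h where h: "h \<in> D" "L2_norm M (\<lambda>x. g x - h x) < \<epsilon> / 2"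
        unfolding L2_closure_iff[of g] by blast
      have "L2_norm M (\<lambda>x. f x - h x) \<le> L2_norm M (\<lambda>x. f x - g x) + L2_norm M (\<lambda>x. g x - h x)"
        using fL g h assms by (intro L2_triangle3) (auto simp: L2_closure_iff)
      with g h show "\<exists>g\<in>D. L2_norm M (\<lambda>x. f x - g x) < \<epsilon>" by force
    qed
  qed
  show "L2_closure M D \<subseteq> L2_closure M (L2_closure M D)"
    by (rule L2_closure_superset) (auto simp: L2_closure_iff)
qed

lemma L2_closure_mono: "D \<subseteq> D' \<Longrightarrow> L2_closure M D \<subseteq> L2_closure M D'"
  by (force simp: L2_closure_iff)

lemma L2_closure_subset: "L2_closure M D \<subseteq> L2_space M" by (auto simp: L2_closure_iff)

lemma L2_closure_minimal:
  assumes "D \<subseteq> L2_closure M E" "E \<subseteq> L2_space M" shows "L2_closure M D \<subseteq> L2_closure M E"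
  using L2_closure_mono[OF assms(1)] L2_closure_closed[OF assms(2)] by blast

lemma L2_subspace_closure:
  assumes W: "L2_subspace M W" shows "L2_subspace M (L2_closure M W)" unfolding L2_subspace_def
proof (intro conjI ballI allI)
  have WL: "W \<subseteq> L2_space M" using W by (simp add: L2_subspace_def)
  show "L2_closure M W \<subseteq> L2_space M" by (rule L2_closure_subset)
  show "L2_closure M W \<noteq> {}" using L2_closure_superset[OF WL] W by (auto simp: L2_subspace_def)
  fix f assume f: "f \<in> L2_closure M W"
  then have fL: "f \<in> L2_space M" using L2_closure_subset by blast
  show "(\<lambda>x. f x + g x) \<in> L2_closure M W" if g: "g \<in> L2_closure M W" for g
    unfolding L2_closure_iff proof (intro conjI allI impI)
    have gL: "g \<in> L2_space M" using g L2_closure_subset by blast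
    show "(\<lambda>x. f x + g x) \<in> L2_space M" using fL gL by blast
    fix \<epsilon> :: real assume "\<epsilon> > 0"
    then have e: "\<epsilon> / 2 > 0" by simp
    obtain f' where f': "f' \<in> W" "L2_norm M (\<lambda>x. f x - f' x) < \<epsilon> / 2" using f e unfolding L2_closure_iff by blast
    obtain g' where g': "g' \<in> W" "L2_norm M (\<lambda>x. g x - g' x) < \<epsilon> / 2" using g e unfolding L2_closure_iff by blast
    have "L2_norm M (\<lambda>x. (f x - f' x) + (g x - g' x)) \<le> L2_norm M (\<lambda>x. f x - f' x) + L2_norm M (\<lambda>x. g x - g' x)"
      using fL gL f' g' WL by (intro L2_triangle) auto
    then have "L2_norm M (\<lambda>x. f x + g x - (f' x + g' x)) < \<epsilon>"
      using f' g' by (simp add: algebra_simps)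
    moreover have "(\<lambda>x. f' x + g' x) \<in> W" using W f' g' by (auto simp: L2_subspace_def)
    ultimately show "\<exists>h\<in>W. L2_norm M (\<lambda>x. f x + g x - h x) < \<epsilon>" by (intro bexI)
  qed
  show "(\<lambda>x. c * f x) \<in> L2_closure M W" for c unfolding L2_closure_iff
  proof (intro conjI allI impI)
    show "(\<lambda>x. c * f x) \<in> L2_space M" using fL by blast
    fix \<epsilon> :: real assume "\<epsilon> > 0"
    then have e: "\<epsilon> / (norm c + 1) > 0" by (simp add: add_nonneg_pos)
    obtain f' where f': "f' \<in> W" "L2_norm M (\<lambda>x. f x - f' x) < \<epsilon> / (norm c + 1)"
      using f e unfolding L2_closure_iff by blast
    have "L2_norm M (\<lambda>x. c * f x - c * f' x) = norm c * L2_norm M (\<lambda>x. f x - f' x)"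
      using L2_norm_scale[of M c "\<lambda>x. f x - f' x"] by (simp add: right_diff_distrib)
    also have "\<dots> \<le> (norm c + 1) * L2_norm M (\<lambda>x. f x - f' x)" by (intro mult_right_mono) auto
    also have "\<dots> < \<epsilon>" using f'(2) by (simp add: pos_less_divide_eq add_nonneg_pos mult.commute)
    finally show "\<exists>h\<in>W. L2_norm M (\<lambda>x. c * f x - h x) < \<epsilon>"
      using f' W by (intro bexI[of _ "\<lambda>x. c * f' x"]) (auto simp: L2_subspace_def)
  qed
qed

text \<open>\<open>W\<close> itself is not closed, so a minimizing sequence is taken from
  \<open>W\<close>: the parallelogram law turns near minimality into small steps, and the limit lies
  in the closure. Orthogonality comes from perturbing the near minimizers by multiples of
  \<open>g\<close>.\<close>

lemma L2_projection:
  assumes W: "L2_subspace M W" and f: "f \<in> L2_space M"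
  obtains w where "w \<in> L2_closure M W" "\<And>g. g \<in> L2_closure M W \<Longrightarrow> L2_inner M (\<lambda>x. f x - w x) g = 0"
proof -
  have WL: "W \<subseteq> L2_space M" and Wne: "W \<noteq> {}" using W by (auto simp: L2_subspace_def)
  define d where "d = (INF g\<in>W. (L2_norm M (\<lambda>x. f x - g x))\<^sup>2)"
  have bdd: "bdd_below ((\<lambda>g. (L2_norm M (\<lambda>x. f x - g x))\<^sup>2) ` W)"
    by (rule bdd_belowI[of _ 0]) auto
  have d_le: "d \<le> (L2_norm M (\<lambda>x. f x - g x))\<^sup>2" if "g \<in> W" for g
    unfolding d_def by (rule cINF_lower[OF bdd that])
  \<comment> \<open>The tolerance \<open>(1/4)^n\<close> on squared distances makes consecutive
    members at most \<open>2 * (1/2)^n\<close> apart, which is summable.\<close>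
  have "\<exists>g\<in>W. (L2_norm M (\<lambda>x. f x - g x))\<^sup>2 < d + (1/4)^n" for n :: nat
    using cINF_less_iff[OF Wne bdd, of "d + (1/4)^n"] unfolding d_def by simp
  then obtain u where u: "\<And>n. u n \<in> W" "\<And>n. (L2_norm M (\<lambda>x. f x - u n x))\<^sup>2 < d + (1/4)^n"
    by metis
  have uL: "u n \<in> L2_space M" for n using u WL by blast
  have step: "L2_norm M (\<lambda>x. u (Suc n) x - u n x) \<le> 2 * (1/2)^n" for n
  proof (rule power2_le_imp_le)
    let ?a = "\<lambda>x. f x - u n x" and ?b = "\<lambda>x. f x - u (Suc n) x"
    have aL: "?a \<in> L2_space M" and bL: "?b \<in> L2_space M" using f uL by auto
    have "(L2_norm M (\<lambda>x. ?a x - ?b x))\<^sup>2 + (L2_norm M (\<lambda>x. ?a x + ?b x))\<^sup>2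
          = 2 * (L2_norm M ?a)\<^sup>2 + 2 * (L2_norm M ?b)\<^sup>2"
      unfolding L2_norm_add_sq[OF aL bL] L2_norm_diff_sq[OF aL bL] by simp
    moreover have "4 * d \<le> (L2_norm M (\<lambda>x. ?a x + ?b x))\<^sup>2"
    proof -
      have "(\<lambda>x. u n x + u (Suc n) x) \<in> W" using W u by (auto simp: L2_subspace_def)
      then have "(\<lambda>x. (1/2) * (u n x + u (Suc n) x)) \<in> W" by (rule L2_subspace_scale[OF W])
      from d_le[OF this] have "4 * d \<le> 4 * (L2_norm M (\<lambda>x. f x - (1/2) * (u n x + u (Suc n) x)))\<^sup>2" by simp
      also have "\<dots> = (L2_norm M (\<lambda>x. 2 * (f x - (1/2) * (u n x + u (Suc n) x))))\<^sup>2"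
        unfolding L2_norm_scale power_mult_distrib by simp
      also have "(\<lambda>x. 2 * (f x - (1/2) * (u n x + u (Suc n) x))) = (\<lambda>x. ?a x + ?b x)"
        by (auto simp: algebra_simps)
      finally show ?thesis .
    qed
    ultimately have "(L2_norm M (\<lambda>x. ?a x - ?b x))\<^sup>2 \<le> 2 * (1/4)^n + 2 * (1/4)^Suc n"
      using u(2)[of n] u(2)[of "Suc n"] by linarith
    also have "\<dots> \<le> 4 * (1/4)^n" by simp
    also have "(1/4::real)^n = ((1/2)^n)\<^sup>2" by (simp add: power2_eq_square flip: power_mult_distrib)
    also have "4 * ((1/2::real)^n)\<^sup>2 = (2 * (1/2)^n)\<^sup>2" by (simp add: power2_eq_square)
    finally show "(L2_norm M (\<lambda>x. u (Suc n) x - u n x))\<^sup>2 \<le> (2 * (1/2)^n)\<^sup>2" by simp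
  qed simp
  have "summable (\<lambda>n. L2_norm M (\<lambda>x. u (Suc n) x - u n x))"
    by (rule summable_comparison_test'[of "\<lambda>n. 2 * (1/2)^n"]) (use step in \<open>auto intro: summable_mult summable_geometric\<close>)
  from L2_series_complete[OF _ this] uL obtain e where
    e: "e \<in> L2_space M" "(\<lambda>n. L2_norm M (\<lambda>x. e x - (\<Sum>i<n. u (Suc i) x - u i x))) \<longlonglongrightarrow> 0"
    by blast
  define w where "w x = u 0 x + e x" for x
  have wL: "w \<in> L2_space M" unfolding w_def using e uL by blast
  have "w x - u n x = e x - (\<Sum>i<n. u (Suc i) x - u i x)" for n x
    using sum_lessThan_telescope[of "\<lambda>i. u i x" n] by (simp add: w_def)
  then have lim: "(\<lambda>n. L2_norm M (\<lambda>x. w x - u n x)) \<longlonglongrightarrow> 0"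
    using e(2) by simp
  have wW: "w \<in> L2_closure M W" unfolding L2_closure_iff
  proof (intro conjI allI impI wL)
    fix \<epsilon> :: real assume "\<epsilon> > 0"
    with lim have "\<forall>\<^sub>F n in sequentially. L2_norm M (\<lambda>x. w x - u n x) < \<epsilon>" by (rule order_tendstoD)
    then show "\<exists>g\<in>W. L2_norm M (\<lambda>x. w x - g x) < \<epsilon>"
      using u(1) by (auto simp: eventually_sequentially)
  qed
  have small: "norm (L2_inner M (\<lambda>x. f x - u n x) g) \<le> sqrt ((1/4)^n) * L2_norm M g" if g: "g \<in> W" for g n
  proof -
    have gL: "g \<in> L2_space M" using g WL by blast
    define a where "a = L2_inner M (\<lambda>x. f x - u n x) g"
    have key: "2 * s * (norm a)\<^sup>2 \<le> (1/4)^n + s\<^sup>2 * (norm a)\<^sup>2 * (L2_norm M g)\<^sup>2" for s :: real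
    proof -
      have "(\<lambda>x. u n x + (of_real s * a) * g x) \<in> W"
        by (rule L2_subspace_add[OF W u(1) L2_subspace_scale[OF W g]])
      from d_le[OF this] have "d \<le> (L2_norm M (\<lambda>x. (f x - u n x) - (of_real s * a) * g x))\<^sup>2"
        by (simp add: algebra_simps)
      also have "\<dots> = (L2_norm M (\<lambda>x. f x - u n x))\<^sup>2 - 2 * Re (cnj (of_real s * a) * a) + (norm (of_real s * a) * L2_norm M g)\<^sup>2"
        using f uL gL by (subst L2_norm_diff_sq) (auto simp: inner_scale_right L2_norm_scale a_def)
      also have "cnj (of_real s * a) * a = of_real (s * (norm a)\<^sup>2)"
        using complex_norm_square[of a] by (simp add: mult_ac)
      finally show ?thesis using u(2)[of n] by (simp add: norm_mult power_mult_distrib mult_ac)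
    qed
    show ?thesis
    proof (cases "L2_norm M g = 0")
      case True
      have "norm a \<le> L2_norm M (\<lambda>x. f x - u n x) * L2_norm M g"
        unfolding a_def using f uL gL by (intro L2_cauchy_schwarz) auto
      then show ?thesis using True by (simp add: a_def)
    next
      case False
      then have p: "(L2_norm M g)\<^sup>2 > 0" by simp
      have "2 * (norm a)\<^sup>2 / (L2_norm M g)\<^sup>2 \<le> (1/4)^n + (norm a)\<^sup>2 / (L2_norm M g)\<^sup>2"
        using key[of "1 / (L2_norm M g)\<^sup>2"] False by (simp add: field_simps power2_eq_square)
      then have "(norm a)\<^sup>2 \<le> (1/4)^n * (L2_norm M g)\<^sup>2" using p by (simp add: field_simps)
      then have "(norm a)\<^sup>2 \<le> (sqrt ((1/4)^n) * L2_norm M g)\<^sup>2" by (simp add: power_mult_distrib)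
      then show ?thesis unfolding a_def by (rule power2_le_imp_le) simp
    qed
  qed
  have orth: "L2_inner M (\<lambda>x. f x - w x) g = 0" if g: "g \<in> W" for g
  proof -
    have gL: "g \<in> L2_space M" using g WL by blast
    have b: "norm (L2_inner M (\<lambda>x. f x - w x) g) \<le> (sqrt ((1/4)^n) + L2_norm M (\<lambda>x. w x - u n x)) * L2_norm M g" for n
    proof -
      have "L2_inner M (\<lambda>x. f x - w x) g = L2_inner M (\<lambda>x. f x - u n x) g - L2_inner M (\<lambda>x. w x - u n x) g"
        using f uL gL wL by (simp add: inner_diff_left)
      also have "norm \<dots> \<le> norm (L2_inner M (\<lambda>x. f x - u n x) g) + norm (L2_inner M (\<lambda>x. w x - u n x) g)"
        by (rule norm_triangle_ineq4)
      also have "\<dots> \<le> sqrt ((1/4)^n) * L2_norm M g + L2_norm M (\<lambda>x. w x - u n x) * L2_norm M g"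
        using uL gL wL by (intro add_mono small g L2_cauchy_schwarz) auto
      finally show ?thesis by (simp add: algebra_simps)
    qed
    have "(\<lambda>n. (sqrt ((1/4)^n) + L2_norm M (\<lambda>x. w x - u n x)) * L2_norm M g) \<longlonglongrightarrow> (sqrt 0 + 0) * L2_norm M g"
      by (intro tendsto_intros lim LIMSEQ_power_zero) auto
    then have "norm (L2_inner M (\<lambda>x. f x - w x) g) \<le> 0"
      by (intro LIMSEQ_le_const[of _ 0]) (use b in auto)
    then show ?thesis by simp
  qed
  have "L2_inner M (\<lambda>x. f x - w x) g = 0" if g: "g \<in> L2_closure M W" for g
  proof -
    have gL: "g \<in> L2_space M" using g by (simp add: L2_closure_iff)
    have fw: "(\<lambda>x. f x - w x) \<in> L2_space M" using f wL by auto
    have "norm (L2_inner M (\<lambda>x. f x - w x) g) \<le> 0 + \<epsilon>" if \<epsilon>: "\<epsilon> > 0" for \<epsilon>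
    proof -
      define K where "K = L2_norm M (\<lambda>x. f x - w x) + 1"
      have K: "K > 0" by (simp add: K_def add_nonneg_pos)
      obtain g' where g': "g' \<in> W" "L2_norm M (\<lambda>x. g x - g' x) < \<epsilon> / K"
        using g divide_pos_pos[OF \<epsilon> K] unfolding L2_closure_iff by blast
      have g'L: "g' \<in> L2_space M" using g' WL by blast
      have "L2_inner M (\<lambda>x. f x - w x) g = L2_inner M (\<lambda>x. f x - w x) (\<lambda>x. g x - g' x)"
        using orth[OF g'(1)] fw gL g'L by (simp add: inner_diff_right)
      also have "norm \<dots> \<le> L2_norm M (\<lambda>x. f x - w x) * L2_norm M (\<lambda>x. g x - g' x)"
        using fw gL g'L by (intro L2_cauchy_schwarz) auto
      also have "\<dots> \<le> K * (\<epsilon> / K)" using g' K by (intro mult_mono) (auto simp: K_def)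
      finally show ?thesis using K by simp
    qed
    then have "norm (L2_inner M (\<lambda>x. f x - w x) g) \<le> 0" by (rule field_le_epsilon)
    then show ?thesis by simp
  qed
  with wW that show ?thesis by blast
qed

lemma complex_span_superset: "b \<in> B \<Longrightarrow> b \<in> complex_span B" unfolding complex_span_def
  by (rule CollectI, rule exI[of _ "{b}"], rule exI[of _ "\<lambda>_. 1"]) auto

lemma complex_span_zero: "(\<lambda>x. 0) \<in> complex_span B"
  unfolding complex_span_def by (rule CollectI, rule exI[of _ "{}"]) auto

lemma complex_span_scale:
  assumes "f \<in> complex_span B" shows "(\<lambda>x. c * f x) \<in> complex_span B"
proof -
  obtain F a where F: "finite F" "F \<subseteq> B" "f = (\<lambda>x. \<Sum>b\<in>F. a b * b x)"
    using assms by (auto simp: complex_span_def)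
  then show ?thesis unfolding complex_span_def
    by (intro CollectI exI[of _ F] exI[of _ "\<lambda>b. c * a b"]) (auto simp: sum_distrib_left mult.assoc)
qed

lemma complex_span_add:
  assumes "f \<in> complex_span B" "g \<in> complex_span B" shows "(\<lambda>x. f x + g x) \<in> complex_span B"
proof -
  obtain F a where F: "finite F" "F \<subseteq> B" "f = (\<lambda>x. \<Sum>b\<in>F. a b * b x)"
    using assms by (auto simp: complex_span_def)
  obtain G c where G: "finite G" "G \<subseteq> B" "g = (\<lambda>x. \<Sum>b\<in>G. c b * b x)"
    using assms by (auto simp: complex_span_def)
  have "f x = (\<Sum>b\<in>F \<union> G. (if b \<in> F then a b else 0) * b x)" for x
    using F G by (simp add: if_distrib[of "\<lambda>t. t * _"] sum.If_cases Int_absorb1 cong: if_cong)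
  moreover have "g x = (\<Sum>b\<in>F \<union> G. (if b \<in> G then c b else 0) * b x)" for x
    using F G by (simp add: if_distrib[of "\<lambda>t. t * _"] sum.If_cases Int_absorb1 cong: if_cong)
  ultimately have "(\<lambda>x. f x + g x) = (\<lambda>x. \<Sum>b\<in>F \<union> G.
      ((if b \<in> F then a b else 0) + (if b \<in> G then c b else 0)) * b x)"
    by (auto simp: sum.distrib distrib_right)
  with F G show ?thesis unfolding complex_span_def
    by (intro CollectI exI[of _ "F \<union> G"] exI[of _ "\<lambda>b. (if b \<in> F then a b else 0) + (if b \<in> G then c b else 0)"]) auto
qed

lemma complex_span_sum:
  assumes "\<And>i. i \<in> I \<Longrightarrow> f i \<in> complex_span B" shows "(\<lambda>x. \<Sum>i\<in>I. f i x) \<in> complex_span B"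
  using assms by (induction I rule: infinite_finite_induct) (auto simp: complex_span_zero complex_span_add)

lemma complex_span_subspace:
  assumes "B \<subseteq> L2_space M" shows "L2_subspace M (complex_span B)" unfolding L2_subspace_def
proof (intro conjI)
  show "complex_span B \<subseteq> L2_space M"
  proof
    fix f assume "f \<in> complex_span B"
    then obtain F a where F: "finite F" "F \<subseteq> B" "f = (\<lambda>x. \<Sum>b\<in>F. a b * b x)"
      by (auto simp: complex_span_def)
    show "f \<in> L2_space M" unfolding F(3) using F(2) assms by (intro L2_sum L2_scale) auto
  qed
  show "complex_span B \<noteq> {}" using complex_span_zero by blast
qed (auto simp: complex_span_add complex_span_scale)

lemma L2_subspace_zero: "L2_subspace M W \<Longrightarrow> (\<lambda>x. 0) \<in> W"
  using L2_subspace_scale[of M W _ 0] by (auto simp: L2_subspace_def)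

lemma L2_subspace_sum:
  assumes "L2_subspace M W" "\<And>i. i \<in> I \<Longrightarrow> f i \<in> W" shows "(\<lambda>x. \<Sum>i\<in>I. f i x) \<in> W"
  using assms(2) by (induction I rule: infinite_finite_induct)
     (auto simp: L2_subspace_zero[OF assms(1)] intro!: L2_subspace_add[OF assms(1)])

lemma L2_subspace_diff:
  assumes "L2_subspace M W" "f \<in> W" "g \<in> W" shows "(\<lambda>x. f x - g x) \<in> W"
  using L2_subspace_add[OF assms(1,2) L2_subspace_scale[OF assms(1,3), of "-1"]] by simp

lemma complex_span_minimal:
  assumes "L2_subspace M W" "B \<subseteq> W" shows "complex_span B \<subseteq> W"
proof
  fix f assume "f \<in> complex_span B"
  then obtain F a where F: "finite F" "F \<subseteq> B" "f = (\<lambda>x. \<Sum>b\<in>F. a b * b x)"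
    by (auto simp: complex_span_def)
  show "f \<in> W" unfolding F(3) using F(2) assms
    by (intro L2_subspace_sum[OF assms(1)] L2_subspace_scale[OF assms(1)]) auto
qed

text \<open>Koopman operators compose only almost everywhere, so cyclic spaces have to be stable
  under changes on null sets.\<close>

lemma L2_closure_AE:
  assumes "D \<subseteq> L2_space M" "g \<in> L2_closure M D" "f \<in> borel_measurable M" "AE x in M. f x = g x"
  shows "f \<in> L2_closure M D"
proof -
  have gL: "g \<in> L2_space M" using assms(2) L2_closure_subset by blast
  have [measurable]: "g \<in> borel_measurable M" "f \<in> borel_measurable M" using gL assms by auto
  have "integrable M (\<lambda>x. (norm (f x))\<^sup>2) \<longleftrightarrow> integrable M (\<lambda>x. (norm (g x))\<^sup>2)"
    by (rule integrable_cong_AE) (use assms(4) in auto)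
  then have fL: "f \<in> L2_space M" using gL assms(3) by (simp add: L2_space_def)
  have "L2_norm M (\<lambda>x. f x - h x) = L2_norm M (\<lambda>x. g x - h x)" if "h \<in> D" for h
  proof (rule L2_norm_cong_AE)
    have [measurable]: "h \<in> borel_measurable M" using that assms(1) by auto
    show "(\<lambda>x. f x - h x) \<in> borel_measurable M" "(\<lambda>x. g x - h x) \<in> borel_measurable M" by measurable
    show "AE x in M. f x - h x = g x - h x" using assms(4) by eventually_elim simp
  qed
  with assms(2) fL show ?thesis unfolding L2_closure_iff by metis
qed

lemma sum_mult_le_sqrt:
  fixes a b :: "'i \<Rightarrow> real"
  assumes "(\<Sum>i\<in>I. (a i)\<^sup>2) \<le> A\<^sup>2" "(\<Sum>i\<in>I. (b i)\<^sup>2) \<le> B\<^sup>2" "0 \<le> A" "0 \<le> B"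
  shows "(\<Sum>i\<in>I. a i * b i) \<le> A * B"
proof -
  have "(\<Sum>i\<in>I. a i * b i)\<^sup>2 \<le> (\<Sum>i\<in>I. (a i)\<^sup>2) * (\<Sum>i\<in>I. (b i)\<^sup>2)"
    by (rule Cauchy_Schwarz_ineq_sum)
  also have "\<dots> \<le> A\<^sup>2 * B\<^sup>2" using assms by (intro mult_mono) (auto simp: sum_nonneg)
  finally have "(\<Sum>i\<in>I. a i * b i)\<^sup>2 \<le> (A * B)\<^sup>2" by (simp add: power_mult_distrib)
  then show ?thesis by (rule power2_le_imp_le) (use assms(3,4) in simp)
qed

section \<open>Unitary actions and cyclic spaces\<close>

text \<open>The group law is required almost everywhere only, as for \<open>iceberg_pow\<close>: it
  iterates a map and an inverse that are both set to the identity at exceptional points.\<close>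

locale unitary_action = prob_space M for M :: "'a measure" +
  fixes S :: "int \<Rightarrow> 'a \<Rightarrow> 'a"
  assumes S_meas: "\<And>k. S k \<in> measurable M M"
    and S_pres: "\<And>k. distr M M (S k) = M"
    and S_comp: "\<And>j k. AE x in M. S j (S k x) = S (j + k) x"
    and S_zero: "AE x in M. S 0 x = x"
begin

abbreviation "inn \<equiv> L2_inner M"
abbreviation "nrm \<equiv> L2_norm M"
abbreviation "L2 \<equiv> L2_space M"
abbreviation "L2_0 \<equiv> L2_zero_mean M"
abbreviation "clo \<equiv> L2_closure M"
abbreviation "U k \<equiv> koopman (S k)"
abbreviation corr where "corr k f g \<equiv> L2_inner M (koopman (S k) f) g"

lemma finM: "finite_measure M" by (rule finite_measure_axioms)

lemma koopman_meas: "f \<in> borel_measurable M \<Longrightarrow> U k f \<in> borel_measurable M"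
  unfolding koopman_def using S_meas by (rule measurable_compose)

lemma koopman_L2 [intro]: "f \<in> L2 \<Longrightarrow> U k f \<in> L2"
proof -
  assume f: "f \<in> L2"
  have "integrable M (\<lambda>x. (norm (f (S k x)))\<^sup>2)"
  proof (rule integrable_distr[OF S_meas])
    show "integrable (distr M M (S k)) (\<lambda>x. (norm (f x))\<^sup>2)"
      unfolding S_pres using f by (rule L2_integrable_sq)
  qed
  then show ?thesis using koopman_meas[of f k] f by (simp add: L2_space_def koopman_def)
qed

lemma inner_koopman:
  assumes "f \<in> L2" "g \<in> L2" shows "corr k f (U k g) = inn f g"
proof -
  have [measurable]: "f \<in> borel_measurable M" "g \<in> borel_measurable M" using assms by auto
  have "inn f g = (\<integral>x. f x * cnj (g x) \<partial>distr M M (S k))" unfolding S_pres L2_inner_def ..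
  also have "\<dots> = (\<integral>x. f (S k x) * cnj (g (S k x)) \<partial>M)"
    by (rule integral_distr[OF S_meas]) measurable
  finally show ?thesis by (simp add: L2_inner_def koopman_def)
qed

lemma norm_koopman: "f \<in> L2 \<Longrightarrow> nrm (U k f) = nrm f"
  using inner_koopman[of f f k] by (simp add: inner_self flip: of_real_power)

lemma koopman_koopman_AE: "AE x in M. U j (U k f) x = U (j + k) f x"
  using S_comp[of k j] by eventually_elim (simp add: koopman_def add.commute)

lemma koopman_zero_AE: "AE x in M. U 0 f x = f x"
  using S_zero by eventually_elim (simp add: koopman_def)

lemma inner_koopman2:
  assumes f: "f \<in> L2" and g: "g \<in> L2" shows "corr j f (U k g) = corr (j - k) f g"
proof -
  have "corr j f (U k g) =
      corr (-k) (U j f) (U (-k) (U k g))" using f g by (subst inner_koopman) auto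
  also have "\<dots> = corr (j - k) f g"
  proof (rule inner_cong_AE)
    show "AE x in M. U (-k) (U j f) x = U (j - k) f x"
      using koopman_koopman_AE[of "-k" j f] by simp
    show "AE x in M. U (-k) (U k g) x = g x"
      using koopman_koopman_AE[of "-k" k g] koopman_zero_AE[of g] by eventually_elim simp
  qed (use f g in \<open>auto intro!: koopman_meas\<close>)
  finally show ?thesis .
qed

lemma corr_minus:
  assumes "f \<in> L2" "g \<in> L2" shows "corr (- k) f g = cnj (corr k g f)"
proof -
  have "corr (- k) f g = corr 0 f (U k g)" using inner_koopman2[OF assms, of 0 k] by simp
  also have "\<dots> = inn f (U k g)"
    using assms by (intro inner_cong_AE koopman_zero_AE) (auto intro!: koopman_meas)
  finally show ?thesis by (simp add: inner_cnj[of M f])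
qed

lemma corr_zero: "f \<in> L2 \<Longrightarrow> g \<in> L2 \<Longrightarrow> corr 0 f g = inn f g"
  by (intro inner_cong_AE koopman_zero_AE) (auto intro!: koopman_meas)

lemma corr_bound:
  "f \<in> L2 \<Longrightarrow> g \<in> L2 \<Longrightarrow> norm (corr k f g) \<le> nrm f * nrm g"
  using L2_cauchy_schwarz[of "U k f" M g] by (simp add: norm_koopman koopman_L2)

lemma integral_koopman: "f \<in> L2 \<Longrightarrow> integral\<^sup>L M (U k f) = integral\<^sup>L M f"
proof -
  assume "f \<in> L2"
  then have [measurable]: "f \<in> borel_measurable M" by auto
  have "integral\<^sup>L M f = integral\<^sup>L (distr M M (S k)) f" by (simp add: S_pres)
  also have "\<dots> = (\<integral>x. f (S k x) \<partial>M)" by (rule integral_distr[OF S_meas]) measurable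
  finally show ?thesis by (simp add: koopman_def)
qed

definition cyc :: "('a \<Rightarrow> complex) \<Rightarrow> ('a \<Rightarrow> complex) set" where
  "cyc f = complex_span (range (\<lambda>k. U k f))"

definition cycZ :: "('a \<Rightarrow> complex) \<Rightarrow> ('a \<Rightarrow> complex) set" where
  "cycZ f = clo (cyc f)"

definition tp :: "int set \<Rightarrow> (int \<Rightarrow> complex) \<Rightarrow> ('a \<Rightarrow> complex) \<Rightarrow> 'a \<Rightarrow> complex" where
  "tp K c f x = (\<Sum>k\<in>K. c k * U k f x)"

lemma tp_L2 [intro]: "f \<in> L2 \<Longrightarrow> tp K c f \<in> L2"
  unfolding tp_def by (intro L2_sum L2_scale koopman_L2)

lemma cyc_subspace: "f \<in> L2 \<Longrightarrow> L2_subspace M (cyc f)"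
  unfolding cyc_def by (rule complex_span_subspace) auto

lemma cyc_L2: "f \<in> L2 \<Longrightarrow> cyc f \<subseteq> L2" using cyc_subspace L2_subspace_sub by blast

lemma cycZ_subspace: "f \<in> L2 \<Longrightarrow> L2_subspace M (cycZ f)"
  unfolding cycZ_def by (intro L2_subspace_closure cyc_subspace)

lemma cycZ_L2: "cycZ f \<subseteq> L2" unfolding cycZ_def by (rule L2_closure_subset)

lemma cyc_cycZ: "f \<in> L2 \<Longrightarrow> cyc f \<subseteq> cycZ f"
  unfolding cycZ_def by (rule L2_closure_superset[OF cyc_L2])

lemma koopman_cyc: "U k f \<in> cyc f" unfolding cyc_def by (rule complex_span_superset) auto

text \<open>Distinct exponents may give the same function, so exponents are first chosen
  injectively; only then can a combination of functions be reindexed by integers.\<close>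

lemma cyc_tp:
  assumes "g \<in> cyc f" obtains K c where "finite K" "g = tp K c f"
proof -
  obtain F a where F: "finite F" "F \<subseteq> range (\<lambda>k. U k f)" "g = (\<lambda>x. \<Sum>b\<in>F. a b * b x)"
    using assms by (auto simp: complex_span_def cyc_def)
  obtain K where K: "inj_on (\<lambda>k. U k f) K" "F = (\<lambda>k. U k f) ` K"
    using F(2)[unfolded subset_image_inj] by blast
  have fin: "finite K" using F(1) K finite_imageD by blast
  have "g = tp K (\<lambda>k. a (U k f)) f"
    unfolding F(3) K(2) tp_def by (subst sum.reindex[OF K(1)]) simp
  with fin that show ?thesis by blast
qed

lemma cycZ_AE:
  assumes "f \<in> L2" "g \<in> cycZ f" "h \<in> borel_measurable M" "AE x in M. h x = g x"
  shows "h \<in> cycZ f"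
  using L2_closure_AE[OF cyc_L2[OF assms(1)] _ assms(3,4)] assms(2) unfolding cycZ_def by blast

lemma cycZ_self: "f \<in> L2 \<Longrightarrow> f \<in> cycZ f"
proof -
  assume f: "f \<in> L2"
  have "U 0 f \<in> cycZ f" using koopman_cyc cyc_cycZ[OF f] by blast
  moreover have "AE x in M. f x = U 0 f x" using koopman_zero_AE[of f] by eventually_elim simp
  ultimately show ?thesis by (rule cycZ_AE[OF f _ L2_measurable[OF f]])
qed

lemma koopman_cycZ:
  assumes f: "f \<in> L2" and g: "g \<in> cycZ f" shows "U k g \<in> cycZ f"
proof -
  have gL: "g \<in> L2" using g cycZ_L2 by blast
  have 1: "U k h \<in> cycZ f" if h: "h \<in> cyc f" for h
  proof -
    obtain K c where K: "finite K" "h = tp K c f" by (rule cyc_tp[OF h])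
    have "tp K (\<lambda>j. c j) (U k f) \<in> cycZ f" (is "?g \<in> _") if K: "finite K"
    proof -
      have "(\<lambda>x. \<Sum>j\<in>K. c j * U (k + j) f x) \<in> cycZ f"
        using koopman_cyc cyc_cycZ[OF f]
        by (intro L2_subspace_sum[OF cycZ_subspace[OF f]] L2_subspace_scale[OF cycZ_subspace[OF f]]) auto
      moreover have "AE x in M. \<forall>j\<in>K. U j (U k f) x = U (k + j) f x"
        using koopman_koopman_AE[of _ k f] K by (intro AE_finite_allI) (auto simp: add.commute)
      then have "AE x in M. ?g x = (\<Sum>j\<in>K. c j * U (k + j) f x)"
        by eventually_elim (auto simp: tp_def)
      ultimately show ?thesis by (rule cycZ_AE[OF f _ L2_measurable[OF tp_L2[OF koopman_L2[OF f]]]])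
    qed
    moreover have "AE x in M. \<forall>j\<in>K. U k (U j f) x = U j (U k f) x"
    proof (intro AE_finite_allI K(1))
      fix j show "AE x in M. U k (U j f) x = U j (U k f) x"
        using koopman_koopman_AE[of k j f] koopman_koopman_AE[of j k f]
        by eventually_elim (simp add: add.commute)
    qed
    then have "AE x in M. U k h x = tp K c (U k f) x"
      by eventually_elim (auto simp: K(2) tp_def koopman_def)
    moreover have "U k h \<in> borel_measurable M" using h cyc_L2[OF f] by (auto intro!: koopman_meas)
    ultimately show ?thesis using cycZ_AE[OF f] K(1) by blast
  qed
  have "U k g \<in> clo (cycZ f)" unfolding L2_closure_iff
  proof (intro conjI allI impI)
    show "U k g \<in> L2" using gL by blast
    fix \<epsilon> :: real assume "\<epsilon> > 0"
    then obtain h where h: "h \<in> cyc f" "nrm (\<lambda>x. g x - h x) < \<epsilon>"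
      using g unfolding cycZ_def L2_closure_iff by blast
    have hL: "h \<in> L2" using h cyc_L2[OF f] by blast
    have "nrm (\<lambda>x. U k g x - U k h x) = nrm (U k (\<lambda>x. g x - h x))"
      by (simp add: koopman_def)
    also have "\<dots> < \<epsilon>" using gL hL h(2) by (subst norm_koopman) auto
    finally show "\<exists>h\<in>cycZ f. nrm (\<lambda>x. U k g x - h x) < \<epsilon>" using 1[OF h(1)] by blast
  qed
  then show ?thesis unfolding cycZ_def by (simp add: L2_closure_closed[OF cyc_L2[OF f]])
qed

lemma cycZ_minimal:
  assumes "f \<in> L2" "g \<in> cycZ f" shows "cycZ g \<subseteq> cycZ f"
proof -
  have "cyc g \<subseteq> cycZ f" unfolding cyc_def
    using koopman_cycZ[OF assms] by (intro complex_span_minimal[OF cycZ_subspace[OF assms(1)]]) auto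
  then show ?thesis using L2_closure_minimal[OF _ cyc_L2[OF assms(1)]] unfolding cycZ_def by blast
qed

lemma orth_cycZ:
  assumes f: "f \<in> L2" and g: "g \<in> L2"
    and o: "\<And>k. inn f (U k g) = 0" and h: "h \<in> cycZ g" shows "inn f h = 0"
proof -
  have hL: "h \<in> L2" using h cycZ_L2 by blast
  have c: "inn f h' = 0" if h': "h' \<in> cyc g" for h'
  proof -
    obtain K c where K: "finite K" "h' = tp K c g" by (rule cyc_tp[OF h'])
    have "inn f h' = (\<Sum>k\<in>K. inn f (\<lambda>x. c k * U k g x))"
      unfolding K(2) tp_def using f g by (intro inner_sum_right) auto
    also have "\<dots> = 0" by (simp add: inner_scale_right o)
    finally show ?thesis .
  qed
  have "norm (inn f h) \<le> 0 + \<epsilon>" if e: "\<epsilon> > 0" for \<epsilon>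
  proof -
    have K: "nrm f + 1 > 0" by (simp add: add_nonneg_pos)
    obtain h' where h': "h' \<in> cyc g" "nrm (\<lambda>x. h x - h' x) < \<epsilon> / (nrm f + 1)"
      using h divide_pos_pos[OF e K] unfolding cycZ_def L2_closure_iff by blast
    have h'L: "h' \<in> L2" using h' cyc_L2[OF g] by blast
    have "inn f h = inn f (\<lambda>x. h x - h' x)" using c[OF h'(1)] f hL h'L by (simp add: inner_diff_right)
    also have "norm \<dots> \<le> nrm f * nrm (\<lambda>x. h x - h' x)"
      using f hL h'L by (intro L2_cauchy_schwarz) auto
    also have "\<dots> \<le> (nrm f + 1) * (\<epsilon> / (nrm f + 1))" using h' by (intro mult_mono) auto
    finally show ?thesis using K by simp
  qed
  then have "norm (inn f h) \<le> 0" by (rule field_le_epsilon)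
  then show ?thesis by simp
qed

end

section \<open>Twisted averages summed over roots of unity\<close>

lemma sum_roots_unity:
  assumes N: "0 < N"
  shows "(\<Sum>k<N. cis (2 * pi * real k * of_int m / real N)) = (if int N dvd m then of_nat N else 0)"
proof -
  define z where "z = cis (2 * pi * of_int m / real N)"
  have p: "cis (2 * pi * real k * of_int m / real N) = z ^ k" for k
    unfolding z_def Complex.DeMoivre by (rule arg_cong[of _ _ cis]) (simp add: algebra_simps)
  have zN: "z ^ N = 1"
  proof -
    have "z ^ N = cis (2 * pi * of_int m)" unfolding z_def Complex.DeMoivre using N by simp
    then show ?thesis by (simp add: cis_multiple_2pi)
  qed
  show ?thesis
  proof (cases "int N dvd m")
    case True
    then obtain r where "m = int N * r" by blast
    then have "2 * pi * of_int m / real N = 2 * pi * of_int r" using N by simp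
    then have "z = 1" unfolding z_def by (simp only: cis_multiple_2pi Ints_of_int)
    with True show ?thesis unfolding p by simp
  next
    case False
    have "z \<noteq> 1"
    proof
      assume "z = 1"
      then have "cos (2 * pi * of_int m / real N) = 1" unfolding z_def by (simp add: complex_eq_iff)
      then obtain r :: int where "2 * pi * of_int m / real N = of_int r * 2 * pi"
        unfolding cos_one_2pi_int by blast
      then have "real_of_int m = of_int (r * int N)" using N by (simp add: field_simps)
      then have "m = r * int N" unfolding of_int_eq_iff .
      with False show False by simp
    qed
    then show ?thesis unfolding p using False zN by (simp add: geometric_sum)
  qed
qed

text \<open>A congruent pair amounts to a common residue modulo \<open>N\<close> and two quotients
  below \<open>L\<close>.\<close>

lemma card_cong_pairs:
  assumes "0 < N"
  shows "card {(s, s'). s < L * N \<and> s' < L * N \<and> int N dvd int s - int s'} = L * L * N"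
proof -
  have "bij_betw (\<lambda>(r, i, j). (i * N + r, j * N + r)) ({..<N} \<times> {..<L} \<times> {..<L})
      {(s, s'). s < L * N \<and> s' < L * N \<and> int N dvd int s - int s'}"
  proof (rule bij_betw_byWitness[where f'="\<lambda>(s, s'). (s mod N, s div N, s' div N)"])
    show "\<forall>a\<in>{..<N} \<times> {..<L} \<times> {..<L}.
       (\<lambda>(s, s'). (s mod N, s div N, s' div N)) ((\<lambda>(r, i, j). (i * N + r, j * N + r)) a) = a"
      using assms by auto
    show "\<forall>a'\<in>{(s, s'). s < L * N \<and> s' < L * N \<and> int N dvd int s - int s'}.
       (\<lambda>(r, i, j). (i * N + r, j * N + r)) ((\<lambda>(s, s'). (s mod N, s div N, s' div N)) a') = a'"
    proof clarsimp
      fix s s' assume "int N dvd int s - int s'"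
      then have "int s mod int N = int s' mod int N" by (simp add: mod_eq_dvd_iff)
      then have "s mod N = s' mod N" by (metis zmod_int of_nat_eq_iff)
      then show "s' div N * N + s mod N = s'" by simp
    qed
    have "i * N + r < L * N" if "r < N" "i < L" for r i
    proof -
      have "i * N + r < (i + 1) * N" using that by simp
      also have "\<dots> \<le> L * N" using that by (intro mult_right_mono) auto
      finally show ?thesis .
    qed
    then show "(\<lambda>(r, i, j). (i * N + r, j * N + r)) ` ({..<N} \<times> {..<L} \<times> {..<L})
       \<subseteq> {(s, s'). s < L * N \<and> s' < L * N \<and> int N dvd int s - int s'}"
      by (auto simp: algebra_simps simp flip: right_diff_distrib)
    show "(\<lambda>(s, s'). (s mod N, s div N, s' div N)) ` {(s, s'). s < L * N \<and> s' < L * N \<and> int N dvd int s - int s'}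
       \<subseteq> {..<N} \<times> {..<L} \<times> {..<L}" using assms by (auto simp: less_mult_imp_div_less)
  qed
  then have "card {(s, s'). s < L * N \<and> s' < L * N \<and> int N dvd int s - int s'} = card ({..<N} \<times> {..<L} \<times> {..<L})"
    by (simp add: bij_betw_same_card)
  then show ?thesis by simp
qed

context unitary_action begin

text \<open>The ergodic average of length \<open>Q\<close> twisted by \<open>z\<close>. For
  \<open>z\<close> on the unit circle it emphasizes the part of \<open>f\<close> with spectrum near
  \<open>z\<close>.\<close>

definition bop :: "nat \<Rightarrow> complex \<Rightarrow> ('a \<Rightarrow> complex) \<Rightarrow> 'a \<Rightarrow> complex" where
  "bop Q z f x = (\<Sum>s<Q. (cnj z ^ s / of_nat Q) * U (int s) f x)"

abbreviation rt :: "nat \<Rightarrow> nat \<Rightarrow> complex" where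
  "rt N k \<equiv> cis (2 * pi * real k / real N)"

abbreviation bform where "bform Q z f g \<equiv> inn (bop Q z f) (bop Q z g)"
abbreviation bnorm where "bnorm Q z f \<equiv> nrm (bop Q z f)"

lemma bop_L2 [intro]: "f \<in> L2 \<Longrightarrow> bop Q z f \<in> L2"
  unfolding bop_def by (intro L2_sum L2_scale koopman_L2)

lemma bop_add: "bop Q z (\<lambda>x. f x + g x) = (\<lambda>x. bop Q z f x + bop Q z g x)"
  by (simp add: bop_def koopman_def sum.distrib algebra_simps fun_eq_iff)

lemma bop_diff: "bop Q z (\<lambda>x. f x - g x) = (\<lambda>x. bop Q z f x - bop Q z g x)"
  by (simp add: bop_def koopman_def sum_subtractf algebra_simps fun_eq_iff)

lemma bop_scale: "bop Q z (\<lambda>x. c * f x) = (\<lambda>x. c * bop Q z f x)"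
  by (simp add: bop_def koopman_def sum_distrib_left algebra_simps fun_eq_iff)

lemma bform_eq:
  assumes f: "f \<in> L2" and g: "g \<in> L2"
  shows "bform Q z f g = (\<Sum>s<Q. \<Sum>s'<Q. cnj z ^ s * z ^ s' / (of_nat Q)\<^sup>2 *
           corr (int s - int s') f g)"
proof -
  have "bform Q z f g = (\<Sum>s<Q. inn (\<lambda>x. (cnj z ^ s / of_nat Q) * U (int s) f x) (bop Q z g))"
    unfolding bop_def[of _ _ f] by (intro inner_sum_left L2_scale koopman_L2 bop_L2 f g)
  also have "\<dots> = (\<Sum>s<Q. \<Sum>s'<Q. inn (\<lambda>x. (cnj z ^ s / of_nat Q) * U (int s) f x)
       (\<lambda>x. (cnj z ^ s' / of_nat Q) * U (int s') g x))"
    unfolding bop_def[of _ _ g] by (intro sum.cong refl inner_sum_right L2_scale koopman_L2 f g)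
  also have "\<dots> = (\<Sum>s<Q. \<Sum>s'<Q. cnj z ^ s * z ^ s' / (of_nat Q)\<^sup>2 *
           corr (int s - int s') f g)" unfolding inner_scale_left inner_scale_right inner_koopman2[OF f g]
    by (intro sum.cong refl) (simp add: power2_eq_square)
  finally show ?thesis .
qed

lemma bform_commute_orth:
  assumes f: "f \<in> L2" and g: "g \<in> L2"
    and o: "\<And>k. corr k f g = 0" shows "bform Q z f g = 0" unfolding bform_eq[OF f g] o by simp

text \<open>Orthogonality of the roots of unity removes every pair \<open>s\<close>,
  \<open>s'\<close> that is not congruent modulo \<open>N\<close>.\<close>

lemma sum_bform:
  assumes f: "f \<in> L2" and g: "g \<in> L2" and N: "0 < N" shows "(\<Sum>k<N. bform Q (rt N k) f g) =
    (\<Sum>(s, s')\<in>{(s, s'). s < Q \<and> s' < Q \<and> int N dvd int s - int s'}.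
        of_nat N / (of_nat Q)\<^sup>2 * corr (int s - int s') f g)"
proof -
  let ?c = "\<lambda>s s'. corr (int s - int s') f g"
  have ph: "cnj (rt N k) ^ s * rt N k ^ s' = cis (2 * pi * real k * of_int (int s' - int s) / real N)" for k s s'
  proof -
    have "cnj (rt N k) = cis (- (2 * pi * real k / real N))" by (simp add: cis_cnj)
    then have "cnj (rt N k) ^ s * rt N k ^ s' = cis (real s * (- (2 * pi * real k / real N)) + real s' * (2 * pi * real k / real N))"
      by (simp only: Complex.DeMoivre cis_mult)
    also have "real s * (- (2 * pi * real k / real N)) + real s' * (2 * pi * real k / real N)
        = 2 * pi * real k * of_int (int s' - int s) / real N" by (simp add: diff_divide_distrib algebra_simps)
    finally show ?thesis .
  qed
  have "(\<Sum>k<N. bform Q (rt N k) f g) = (\<Sum>s<Q. \<Sum>s'<Q. (\<Sum>k<N. cnj (rt N k) ^ s * rt N k ^ s') / (of_nat Q)\<^sup>2 * ?c s s')"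
    unfolding bform_eq[OF f g] sum_divide_distrib sum_distrib_right
    by (subst sum.swap, rule sum.cong[OF refl], rule sum.swap)
  also have "\<dots> = (\<Sum>s<Q. \<Sum>s'<Q. (if int N dvd int s - int s' then of_nat N else 0) / (of_nat Q)\<^sup>2 * ?c s s')"
    unfolding ph sum_roots_unity[OF N] by (simp add: dvd_diff_commute)
  also have "\<dots> = (\<Sum>(s, s')\<in>{..<Q} \<times> {..<Q}. (if int N dvd int s - int s' then of_nat N / (of_nat Q)\<^sup>2 * ?c s s' else 0))"
    unfolding sum.cartesian_product by (intro sum.cong refl) auto
  also have "\<dots> = (\<Sum>(s, s')\<in>{(s, s'). s < Q \<and> s' < Q \<and> int N dvd int s - int s'}. of_nat N / (of_nat Q)\<^sup>2 * ?c s s')"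
    by (rule sum.mono_neutral_cong_right) (auto split: if_splits)
  finally show ?thesis .
qed

text \<open>The diagonal consists of \<open>L * N\<close> terms of weight
  \<open>N / (L * N)^2\<close>, in total \<open>1 / L\<close>. Every other congruent pair differs by
  a nonzero multiple of \<open>N\<close>, and the weights of all congruent pairs sum to 1.\<close>

lemma sum_bform_close:
  assumes f: "f \<in> L2" and g: "g \<in> L2" and N: "0 < N" and L: "0 < L"
    and \<delta>: "0 \<le> \<delta>"
    and d: "\<And>r. r \<noteq> 0 \<Longrightarrow> \<bar>r\<bar> < int L \<Longrightarrow> norm (corr (r * int N) f g) \<le> \<delta>"
  shows "norm ((\<Sum>k<N. bform (L * N) (rt N k) f g) - inn f g / of_nat L) \<le> \<delta>"
proof -
  let ?P = "{(s, s'). s < L * N \<and> s' < L * N \<and> int N dvd int s - int s'}"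
  let ?D = "(\<lambda>s. (s, s)) ` {..<L * N}"
  let ?C = "of_nat N / (of_nat (L * N))\<^sup>2 :: complex"
  let ?c = "\<lambda>(s, s'). corr (int s - int s') f g"
  have fin: "finite ?P" by (rule finite_subset[of _ "{..<L*N} \<times> {..<L*N}"]) auto
  have sub: "?D \<subseteq> ?P" by auto
  have "(\<Sum>p\<in>?D. ?C * ?c p) = of_nat (L * N) * (?C * inn f g)"
    by (subst sum.reindex) (auto simp: inj_on_def corr_zero[OF f g])
  also have "\<dots> = inn f g / of_nat L" using N L by (simp add: power2_eq_square field_simps)
  finally have D: "(\<Sum>p\<in>?D. ?C * ?c p) = inn f g / of_nat L" .
  have eq: "(\<Sum>k<N. bform (L * N) (rt N k) f g) = (\<Sum>p\<in>?P. ?C * ?c p)"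
    unfolding sum_bform[OF f g N] by (intro sum.cong) auto
  have "norm ((\<Sum>k<N. bform (L * N) (rt N k) f g) - inn f g / of_nat L) = norm (\<Sum>p\<in>?P - ?D. ?C * ?c p)"
    unfolding eq D[symmetric] sum_diff[OF fin sub] ..
  also have "\<dots> \<le> (\<Sum>p\<in>?P - ?D. norm ?C * \<delta>)"
  proof (rule sum_norm_le)
    fix p assume p: "p \<in> ?P - ?D"
    obtain s s' where ss: "p = (s, s')" by (cases p)
    from p ss have a: "s < L * N" "s' < L * N" "int N dvd int s - int s'" "s \<noteq> s'" by auto
    then obtain r where r: "int s - int s' = int N * r" by blast
    have "r \<noteq> 0" using r a by auto
    moreover have "\<bar>r\<bar> < int L"
    proof -
      have "int N * \<bar>r\<bar> = \<bar>int s - int s'\<bar>" using r by (simp add: abs_mult)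
      also have "\<dots> < int (L * N)" using a by linarith
      finally show ?thesis using N by (simp add: mult.commute)
    qed
    ultimately have "norm (?c p) \<le> \<delta>" using d[of r] ss r by (simp add: mult.commute)
    then show "norm (?C * ?c p) \<le> norm ?C * \<delta>" by (simp only: norm_mult mult_left_mono norm_ge_zero)
  qed
  also have "\<dots> = of_nat (card (?P - ?D)) * (norm ?C * \<delta>)" by (rule sum_constant)
  also have "\<dots> \<le> of_nat (card ?P) * (norm ?C * \<delta>)"
    by (intro mult_right_mono of_nat_mono card_mono[OF fin Diff_subset] mult_nonneg_nonneg norm_ge_zero \<delta>)
  also have "\<dots> = \<delta>" unfolding card_cong_pairs[OF N] using N L
    by (simp add: norm_divide norm_power norm_mult power2_eq_square field_simps)
  finally show ?thesis .
qed

text \<open>A Bessel inequality, uniform in \<open>L\<close> and \<open>N\<close>: the weights of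
  the congruent pairs sum to 1. It permits replacing functions by approximations inside the sums
  over roots of unity.\<close>

lemma sum_bnorm_sq:
  assumes f: "f \<in> L2" and N: "0 < N" and L: "0 < L"
  shows "(\<Sum>k<N. (bnorm (L * N) (rt N k) f)\<^sup>2) \<le> (nrm f)\<^sup>2"
proof -
  let ?P = "{(s, s'). s < L * N \<and> s' < L * N \<and> int N dvd int s - int s'}"
  let ?C = "of_nat N / (of_nat (L * N))\<^sup>2 :: complex"
  let ?s = "\<Sum>k<N. (bnorm (L * N) (rt N k) f)\<^sup>2"
  have eq: "complex_of_real ?s = (\<Sum>k<N. bform (L * N) (rt N k) f f)" unfolding inner_self by simp
  have "?s = norm (complex_of_real ?s)"
    unfolding norm_of_real by (rule abs_of_nonneg[symmetric]) (simp add: sum_nonneg)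
  also have "\<dots> = norm (\<Sum>k<N. bform (L * N) (rt N k) f f)" unfolding eq ..
  also have "\<dots> \<le> (\<Sum>p\<in>?P. norm ?C * (nrm f)\<^sup>2)" unfolding sum_bform[OF f f N]
  proof (rule sum_norm_le)
    fix p :: "nat \<times> nat" obtain s s' where p: "p = (s, s')" by (cases p)
    have "norm (corr (int s - int s') f f) \<le> (nrm f)\<^sup>2"
      using corr_bound[OF f f] by (simp add: power2_eq_square)
    then show "norm (case p of (s, s') \<Rightarrow> ?C * corr (int s - int s') f f) \<le> norm ?C * (nrm f)\<^sup>2"
      unfolding p by (simp only: norm_mult mult_left_mono norm_ge_zero split_conv)
  qed
  also have "\<dots> = of_nat (card ?P) * (norm ?C * (nrm f)\<^sup>2)" by (rule sum_constant)
  also have "\<dots> = (nrm f)\<^sup>2" unfolding card_cong_pairs[OF N] using N L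
    by (simp add: norm_divide norm_power norm_mult power2_eq_square field_simps)
  finally show ?thesis .
qed

text \<open>Write B for the average and w' for \<open>f + g - w\<close>. Since \<open>f - w\<close>
  is orthogonal to the cyclic space of \<open>f + g\<close>, and this survives B, the form of
  \<open>w\<close> and \<open>g\<close> equals both |Bf|^2 - |Bw|^2 and |Bg|^2 - |Bw'|^2. It is thus
  a nonnegative number below |Bf|^2 and below |Bg|^2, hence below their geometric mean.\<close>

lemma orth_projection_bform:
  assumes f: "f \<in> L2" and g: "g \<in> L2"
    and o: "\<And>k. corr k f g = 0"
    and w: "w \<in> cycZ (\<lambda>x. f x + g x)"
    and p: "\<And>h. h \<in> cycZ (\<lambda>x. f x + g x) \<Longrightarrow> inn (\<lambda>x. f x - w x) h = 0"
  shows "norm (bform Q z w g) \<le> bnorm Q z f * bnorm Q z g"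
proof -
  have fg: "(\<lambda>x. f x + g x) \<in> L2" using f g by auto
  have wL: "w \<in> L2" using w cycZ_L2 by blast
  \<comment> \<open>The cyclic space is invariant, so orthogonality to it makes all correlations
    vanish, and the form is a combination of correlations.\<close>
  have of_bop: "bform Q z a h = 0" if a: "a \<in> L2" and oa: "\<And>h. h \<in> cycZ (\<lambda>x. f x + g x) \<Longrightarrow> inn a h = 0"
    and h: "h \<in> cycZ (\<lambda>x. f x + g x)" for a h
  proof (rule bform_commute_orth[OF a])
    show "h \<in> L2" using h cycZ_L2 by blast
    then have "corr k a h = inn a (U (- k) h)" for k
      using corr_minus[of h a k] a by (simp add: inner_cnj[of M a])
    then show "corr k a h = 0" for k using oa[OF koopman_cycZ[OF fg h]] by simp
  qed
  define bf bg bw where "bf = bop Q z f" and "bg = bop Q z g" and "bw = bop Q z w"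
  have L: "bf \<in> L2" "bg \<in> L2" "bw \<in> L2" unfolding bf_def bg_def bw_def using f g wL by auto
  have aL: "(\<lambda>x. f x - w x) \<in> L2" using f wL by auto
  have fgo: "inn bf bg = 0" unfolding bf_def bg_def by (rule bform_commute_orth[OF f g o])
  have gfo: "inn bg bf = 0" using fgo by (subst inner_cnj) simp
  have 1: "inn bf bf = inn bw bf + inn bw bg"
  proof -
    have "inn (\<lambda>x. bf x - bw x) (\<lambda>x. bf x + bg x) = 0"
      using of_bop[OF aL p cycZ_self[OF fg]] by (simp add: bop_add bop_diff bf_def bg_def bw_def)
    then show ?thesis using L fgo by (simp add: inner_diff_left inner_add_right L2_add algebra_simps)
  qed
  have 2: "inn bf bw = inn bw bw"
  proof -
    have "inn (\<lambda>x. bf x - bw x) bw = 0" using of_bop[OF aL p w] by (simp add: bop_diff bf_def bw_def)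
    then show ?thesis using L by (simp add: inner_diff_left)
  qed
  have tw2: "inn bw bf = inn bw bw" using 2 by (subst inner_cnj) (simp add: inner_self)
  have t1: "inn bw bg = of_real ((nrm bf)\<^sup>2 - (nrm bw)\<^sup>2)" using 1 tw2 by (simp add: inner_self)
  define w' where "w' = (\<lambda>x. (f x + g x) - w x)"
  define bw' where "bw' = bop Q z w'"
  have bw': "bw' = (\<lambda>x. bf x + bg x - bw x)" unfolding bw'_def w'_def bf_def bg_def bw_def
    by (simp add: bop_add bop_diff)
  have w'L: "w' \<in> cycZ (\<lambda>x. f x + g x)" unfolding w'_def
    by (intro L2_subspace_diff[OF cycZ_subspace[OF fg]] cycZ_self fg w)
  have "inn (\<lambda>x. bf x - bw x) bw' = 0"
    using of_bop[OF aL p w'L] by (simp add: bop_diff bf_def bw_def bw'_def)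
  moreover have "(\<lambda>x. bf x - bw x) = (\<lambda>x. bw' x - bg x)" unfolding bw' by auto
  moreover have bw'L: "bw' \<in> L2" unfolding bw' using L by auto
  ultimately have 3: "inn bw' bw' = inn bg bw'" using L by (simp add: inner_diff_left)
  have 4: "inn bg bw = inn bg bg - inn bg bw'"
    using L gfo unfolding bw' by (simp add: inner_diff_right inner_add_right L2_add)
  then have t2: "inn bg bw = of_real ((nrm bg)\<^sup>2 - (nrm bw')\<^sup>2)"
    using 3 by (simp add: inner_self flip: 3)
  define \<tau> where "\<tau> = (nrm bf)\<^sup>2 - (nrm bw)\<^sup>2"
  have \<tau>2: "\<tau> = (nrm bg)\<^sup>2 - (nrm bw')\<^sup>2"
  proof -
    have "inn bg bw = cnj (inn bw bg)" by (rule inner_cnj)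
    then have "complex_of_real \<tau> = of_real ((nrm bg)\<^sup>2 - (nrm bw')\<^sup>2)"
      unfolding t1 t2 \<tau>_def by simp
    then show ?thesis unfolding of_real_eq_iff .
  qed
  have \<tau>0: "0 \<le> \<tau>"
  proof -
    have "(nrm bw)\<^sup>2 = norm (inn bf bw)" unfolding 2 inner_self by (simp add: norm_power)
    also have "\<dots> \<le> nrm bf * nrm bw" using L by (intro L2_cauchy_schwarz)
    finally have "nrm bw * nrm bw \<le> nrm bf * nrm bw" by (simp add: power2_eq_square)
    then have "nrm bw \<le> nrm bf" using mult_right_le_imp_le[of "nrm bw" "nrm bw" "nrm bf"]
      by (cases "nrm bw = 0") (auto simp: less_le)
    then show ?thesis unfolding \<tau>_def by (simp add: power_mono)
  qed
  have "\<tau> \<le> (nrm bf)\<^sup>2" unfolding \<tau>_def by simp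
  moreover have "\<tau> \<le> (nrm bg)\<^sup>2" unfolding \<tau>2 by simp
  ultimately have "\<tau> * \<tau> \<le> (nrm bf)\<^sup>2 * (nrm bg)\<^sup>2" using \<tau>0 by (intro mult_mono) auto
  then have "\<tau>\<^sup>2 \<le> (nrm bf * nrm bg)\<^sup>2" by (simp add: power2_eq_square mult_ac)
  then have "\<tau> \<le> nrm bf * nrm bg" by (rule power2_le_imp_le) simp
  moreover have "bform Q z w g = of_real \<tau>" using t1 unfolding \<tau>_def bw_def bg_def .
  then have "norm (bform Q z w g) = \<tau>" using \<tau>0 by (simp only: norm_of_real abs_of_nonneg)
  ultimately show ?thesis unfolding bf_def bg_def by simp
qed

end

section \<open>Averages that are nearly multiples of a common vector\<close>

context unitary_action begin

lemma bform_scale_left: "bform Q z (\<lambda>x. c * f x) g = c * bform Q z f g"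
  by (simp add: bop_scale inner_scale_left)

lemma bform_scale_right: "bform Q z f (\<lambda>x. c * g x) = cnj c * bform Q z f g"
  by (simp add: bop_scale inner_scale_right)

lemma bform_cs:
  assumes "f \<in> L2" "g \<in> L2" shows "norm (bform Q z f g) \<le> bnorm Q z f * bnorm Q z g"
  using assms by (intro L2_cauchy_schwarz bop_L2)

text \<open>When the square is expanded, the three terms sum to about 1 / L, -2w and w times the
  squared norm of \<open>F\<close>. What remains is 1 / L - w, at most 2 / L^2, while the averages
  of \<open>F\<close> themselves have total about 1 / L: the approximation by multiples of the
  averages of \<open>X k\<close> is of smaller order than what is approximated.\<close>

lemma level_estimate_one:
  assumes F: "F \<in> L2" and X: "\<And>k. k < N \<Longrightarrow> X k \<in> L2"
    and L: "0 < L" and R: "nrm F \<le> R"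
    and w: "(1 - 2 / real L) / real L \<le> w" "w \<le> 1 / real L"
    and c: "(\<Sum>k<N. (norm (c k))\<^sup>2) = (nrm F)\<^sup>2"
    and h1: "(\<Sum>k<N. norm (c k) * norm (bform Q (rt N k) F (X k) - c k * of_real w)) \<le> \<eta>"
    and h2: "(\<Sum>k<N. (norm (c k))\<^sup>2 * \<bar>(bnorm Q (rt N k) (X k))\<^sup>2 - w\<bar>) \<le> \<eta>"
    and h4: "(\<Sum>k<N. (bnorm Q (rt N k) F)\<^sup>2) \<le> (nrm F)\<^sup>2 / real L + \<eta>"
  shows "(\<Sum>k<N. (bnorm Q (rt N k) (\<lambda>x. F x - c k * X k x))\<^sup>2) \<le> 2 * R\<^sup>2 / (real L)\<^sup>2 + 4 * \<eta>"
    and "(\<Sum>k<N. (norm (c k) * bnorm Q (rt N k) (X k))\<^sup>2) \<le> R\<^sup>2 / real L + \<eta>"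
proof -
  have R2: "(nrm F)\<^sup>2 \<le> R\<^sup>2" using R by (intro power_mono) auto
  let ?b = "\<lambda>k. bnorm Q (rt N k) (X k)"
  have a: "(norm (c k) * ?b k)\<^sup>2 \<le> (norm (c k))\<^sup>2 * w + (norm (c k))\<^sup>2 * \<bar>(?b k)\<^sup>2 - w\<bar>" for k
  proof -
    have "(norm (c k))\<^sup>2 * (?b k)\<^sup>2 \<le> (norm (c k))\<^sup>2 * (w + \<bar>(?b k)\<^sup>2 - w\<bar>)"
      by (intro mult_left_mono) auto
    then show ?thesis by (simp add: power_mult_distrib distrib_left)
  qed
  have A: "(\<Sum>k<N. (norm (c k) * ?b k)\<^sup>2) \<le> w * (nrm F)\<^sup>2 + \<eta>"
  proof -
    have "(\<Sum>k<N. (norm (c k) * ?b k)\<^sup>2) \<le> (\<Sum>k<N. (norm (c k))\<^sup>2 * w + (norm (c k))\<^sup>2 * \<bar>(?b k)\<^sup>2 - w\<bar>)"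
      by (intro sum_mono a)
    also have "\<dots> = w * (nrm F)\<^sup>2 + (\<Sum>k<N. (norm (c k))\<^sup>2 * \<bar>(?b k)\<^sup>2 - w\<bar>)"
      unfolding sum.distrib sum_distrib_right[symmetric] c by (simp add: mult.commute)
    also have "\<dots> \<le> w * (nrm F)\<^sup>2 + \<eta>" using h2 by simp
    finally show ?thesis .
  qed
  also have "w * (nrm F)\<^sup>2 + \<eta> \<le> (1 / real L) * R\<^sup>2 + \<eta>"
  proof -
    have "w * (nrm F)\<^sup>2 \<le> (1 / real L) * (nrm F)\<^sup>2" using w(2) by (intro mult_right_mono) auto
    also have "\<dots> \<le> (1 / real L) * R\<^sup>2" using R2 by (intro mult_left_mono) auto
    finally show ?thesis by simp
  qed
  finally show "(\<Sum>k<N. (norm (c k) * bnorm Q (rt N k) (X k))\<^sup>2) \<le> R\<^sup>2 / real L + \<eta>" by simp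
  have e: "(bnorm Q (rt N k) (\<lambda>x. F x - c k * X k x))\<^sup>2 \<le> (bnorm Q (rt N k) F)\<^sup>2
     - 2 * ((norm (c k))\<^sup>2 * w) + 2 * (norm (c k) * norm (bform Q (rt N k) F (X k) - c k * of_real w))
     + (norm (c k) * ?b k)\<^sup>2" if k: "k < N" for k
  proof -
    have "(bnorm Q (rt N k) (\<lambda>x. F x - c k * X k x))\<^sup>2 = (bnorm Q (rt N k) F)\<^sup>2
       - 2 * Re (bform Q (rt N k) F (\<lambda>x. c k * X k x)) + (bnorm Q (rt N k) (\<lambda>x. c k * X k x))\<^sup>2"
      unfolding bop_diff using F X[OF k] by (intro L2_norm_diff_sq) auto
    also have "bnorm Q (rt N k) (\<lambda>x. c k * X k x) = norm (c k) * ?b k"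
      unfolding bop_scale by (rule L2_norm_scale)
    also have "bform Q (rt N k) F (\<lambda>x. c k * X k x) = cnj (c k) * bform Q (rt N k) F (X k)"
      by (rule bform_scale_right)
    also have "cnj (c k) * bform Q (rt N k) F (X k) =
        of_real ((norm (c k))\<^sup>2 * w) + cnj (c k) * (bform Q (rt N k) F (X k) - c k * of_real w)"
      using complex_norm_square[of "c k"] by (simp add: algebra_simps)
    finally have 1: "(bnorm Q (rt N k) (\<lambda>x. F x - c k * X k x))\<^sup>2 = (bnorm Q (rt N k) F)\<^sup>2
       - 2 * Re (of_real ((norm (c k))\<^sup>2 * w) + cnj (c k) * (bform Q (rt N k) F (X k) - c k * of_real w))
       + (norm (c k) * ?b k)\<^sup>2" .
    have 2: "- 2 * Re (of_real ((norm (c k))\<^sup>2 * w) + cnj (c k) * (bform Q (rt N k) F (X k) - c k * of_real w))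
       \<le> - 2 * ((norm (c k))\<^sup>2 * w) + 2 * (norm (c k) * norm (bform Q (rt N k) F (X k) - c k * of_real w))"
    proof -
      have "\<bar>Re (cnj (c k) * (bform Q (rt N k) F (X k) - c k * of_real w))\<bar>
          \<le> norm (cnj (c k) * (bform Q (rt N k) F (X k) - c k * of_real w))" by (rule abs_Re_le_cmod)
      also have "\<dots> = norm (c k) * norm (bform Q (rt N k) F (X k) - c k * of_real w)"
        unfolding norm_mult by simp
      finally show ?thesis unfolding plus_complex.sel Re_complex_of_real distrib_left by linarith
    qed
    show ?thesis using 1 2 by linarith
  qed
  have "(\<Sum>k<N. (bnorm Q (rt N k) (\<lambda>x. F x - c k * X k x))\<^sup>2) \<le> (\<Sum>k<N. (bnorm Q (rt N k) F)\<^sup>2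
     - 2 * ((norm (c k))\<^sup>2 * w) + 2 * (norm (c k) * norm (bform Q (rt N k) F (X k) - c k * of_real w))
     + (norm (c k) * ?b k)\<^sup>2)" by (intro sum_mono e) auto
  also have "\<dots> = (\<Sum>k<N. (bnorm Q (rt N k) F)\<^sup>2) - 2 * w * (\<Sum>k<N. (norm (c k))\<^sup>2)
     + 2 * (\<Sum>k<N. norm (c k) * norm (bform Q (rt N k) F (X k) - c k * of_real w))
     + (\<Sum>k<N. (norm (c k) * ?b k)\<^sup>2)"
    by (simp add: sum.distrib sum_subtractf sum_distrib_left mult_ac)
  also have "\<dots> \<le> (nrm F)\<^sup>2 / real L + \<eta> - 2 * w * (nrm F)\<^sup>2 + 2 * \<eta> + (w * (nrm F)\<^sup>2 + \<eta>)"
    using h4 h1 A unfolding c by linarith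
  also have "\<dots> = (1 / real L - w) * (nrm F)\<^sup>2 + 4 * \<eta>" by (simp add: algebra_simps)
  also have "\<dots> \<le> (2 / (real L)\<^sup>2) * R\<^sup>2 + 4 * \<eta>"
  proof -
    have "1 / real L - w \<le> 2 / (real L)\<^sup>2"
      using w(1) L by (simp add: power2_eq_square diff_divide_distrib)
    then show ?thesis using R2 w(2) by (intro add_right_mono mult_mono) auto
  qed
  finally show "(\<Sum>k<N. (bnorm Q (rt N k) (\<lambda>x. F x - c k * X k x))\<^sup>2) \<le> 2 * R\<^sup>2 / (real L)\<^sup>2 + 4 * \<eta>"
    by simp
qed

text \<open>For multiples of one vector the product of the norms is the modulus of the inner
  product. The averages of \<open>F\<close> and \<open>G\<close> are close to multiples of the
  average of \<open>X k\<close>, so their norm products are bounded by the moduli of their forms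
  plus mixed errors, which the Cauchy-Schwarz inequality for sums bounds by \<open>A * E\<close> and
  \<open>E * E\<close>.\<close>

lemma level_estimate:
  assumes F: "F \<in> L2" and G: "G \<in> L2" and X: "\<And>k. k < N \<Longrightarrow> X k \<in> L2"
    and A: "(\<Sum>k<N. (norm (c k) * bnorm Q (rt N k) (X k))\<^sup>2) \<le> A\<^sup>2"
      "(\<Sum>k<N. (norm (d k) * bnorm Q (rt N k) (X k))\<^sup>2) \<le> A\<^sup>2" "0 \<le> A"
    and E: "(\<Sum>k<N. (bnorm Q (rt N k) (\<lambda>x. F x - c k * X k x))\<^sup>2) \<le> E\<^sup>2"
      "(\<Sum>k<N. (bnorm Q (rt N k) (\<lambda>x. G x - d k * X k x))\<^sup>2) \<le> E\<^sup>2" "0 \<le> E"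
    and \<kappa>: "(\<Sum>k<N. norm (bform Q (rt N k) F G)) \<le> \<kappa>"
  shows "(\<Sum>k<N. bnorm Q (rt N k) F * bnorm Q (rt N k) G) \<le> \<kappa> + 4 * (A * E) + 2 * E\<^sup>2"
proof -
  define a where "a k = norm (c k) * bnorm Q (rt N k) (X k)" for k
  define a' where "a' k = norm (d k) * bnorm Q (rt N k) (X k)" for k
  define e where "e k = bnorm Q (rt N k) (\<lambda>x. F x - c k * X k x)" for k
  define e' where "e' k = bnorm Q (rt N k) (\<lambda>x. G x - d k * X k x)" for k
  have pos: "0 \<le> a k" "0 \<le> a' k" "0 \<le> e k" "0 \<le> e' k" for k
    by (auto simp: a_def a'_def e_def e'_def)
  have bF: "bnorm Q (rt N k) F \<le> a k + e k" if k: "k < N" for k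
    using L2_norm_le_add_diff[of "bop Q (rt N k) F" M "bop Q (rt N k) (\<lambda>x. c k * X k x)"] F X[OF k]
    by (simp add: bop_diff bop_scale L2_norm_scale a_def e_def bop_L2 L2_scale)
  have bG: "bnorm Q (rt N k) G \<le> a' k + e' k" if k: "k < N" for k
    using L2_norm_le_add_diff[of "bop Q (rt N k) G" M "bop Q (rt N k) (\<lambda>x. d k * X k x)"] G X[OF k]
    by (simp add: bop_diff bop_scale L2_norm_scale a'_def e'_def bop_L2 L2_scale)
  have prod: "a k * a' k \<le> norm (bform Q (rt N k) F G) + (a k * e' k + e k * a' k + e k * e' k)" if k: "k < N" for k
  proof -
    let ?z = "rt N k"
    have "a k * a' k = norm (bform Q ?z (\<lambda>x. c k * X k x) (\<lambda>x. d k * X k x))"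
      unfolding bform_scale_left bform_scale_right inner_self
      by (simp add: a_def a'_def norm_mult power2_eq_square)
    also have "bform Q ?z (\<lambda>x. c k * X k x) (\<lambda>x. d k * X k x) = bform Q ?z F G -
       (bform Q ?z (\<lambda>x. c k * X k x) (\<lambda>x. G x - d k * X k x) +
        bform Q ?z (\<lambda>x. F x - c k * X k x) (\<lambda>x. d k * X k x) +
        bform Q ?z (\<lambda>x. F x - c k * X k x) (\<lambda>x. G x - d k * X k x))"
    proof -
      have L: "bop Q ?z F \<in> L2" "bop Q ?z G \<in> L2"
         "bop Q ?z (\<lambda>x. c k * X k x) \<in> L2" "bop Q ?z (\<lambda>x. d k * X k x) \<in> L2"
        using F G X[OF k] by auto
      show ?thesis using L by (simp add: bop_diff inner_diff_left inner_diff_right L2_diff)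
    qed
    also have "norm \<dots> \<le> norm (bform Q ?z F G) +
       (norm (bform Q ?z (\<lambda>x. c k * X k x) (\<lambda>x. G x - d k * X k x)) +
        norm (bform Q ?z (\<lambda>x. F x - c k * X k x) (\<lambda>x. d k * X k x)) +
        norm (bform Q ?z (\<lambda>x. F x - c k * X k x) (\<lambda>x. G x - d k * X k x)))"
      by (rule order_trans[OF norm_triangle_ineq4 add_left_mono], rule order_trans[OF norm_triangle_ineq add_right_mono], rule norm_triangle_ineq)
    also have "\<dots> \<le> norm (bform Q ?z F G) + (a k * e' k + e k * a' k + e k * e' k)"
    proof -
      have n: "bnorm Q ?z (\<lambda>x. c k * X k x) = a k" "bnorm Q ?z (\<lambda>x. d k * X k x) = a' k"
        by (simp_all add: bop_scale L2_norm_scale a_def a'_def)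
      have "norm (bform Q ?z (\<lambda>x. c k * X k x) (\<lambda>x. G x - d k * X k x)) \<le> a k * e' k"
        "norm (bform Q ?z (\<lambda>x. F x - c k * X k x) (\<lambda>x. d k * X k x)) \<le> e k * a' k"
        "norm (bform Q ?z (\<lambda>x. F x - c k * X k x) (\<lambda>x. G x - d k * X k x)) \<le> e k * e' k"
        unfolding e_def e'_def n[symmetric] using F G X[OF k] by (auto intro!: bform_cs L2_diff L2_scale)
      then show ?thesis by linarith
    qed
    finally show ?thesis .
  qed
  have s: "(\<Sum>k<N. a k * e' k) \<le> A * E" "(\<Sum>k<N. e k * a' k) \<le> E * A" "(\<Sum>k<N. e k * e' k) \<le> E * E"
    using A E by (intro sum_mult_le_sqrt; simp add: a_def a'_def e_def e'_def)+
  have "(\<Sum>k<N. bnorm Q (rt N k) F * bnorm Q (rt N k) G) \<le> (\<Sum>k<N. (a k + e k) * (a' k + e' k))"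
    using bF bG pos by (intro sum_mono mult_mono) (auto simp: add_nonneg_nonneg)
  also have "\<dots> \<le> (\<Sum>k<N. norm (bform Q (rt N k) F G) + 2 * (a k * e' k) + 2 * (e k * a' k) + 2 * (e k * e' k))"
  proof (rule sum_mono)
    fix k assume "k \<in> {..<N}"
    then have "a k * a' k \<le> norm (bform Q (rt N k) F G) + (a k * e' k + e k * a' k + e k * e' k)"
      by (intro prod) simp
    moreover have "(a k + e k) * (a' k + e' k) = a k * a' k + a k * e' k + e k * a' k + e k * e' k"
      by (simp add: algebra_simps)
    ultimately show "(a k + e k) * (a' k + e' k) \<le> norm (bform Q (rt N k) F G) + 2 * (a k * e' k) + 2 * (e k * a' k) + 2 * (e k * e' k)"
      by linarith
  qed
  also have "\<dots> = (\<Sum>k<N. norm (bform Q (rt N k) F G)) + 2 * (\<Sum>k<N. a k * e' k) + 2 * (\<Sum>k<N. e k * a' k) + 2 * (\<Sum>k<N. e k * e' k)"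
    by (simp add: sum.distrib sum_distrib_left)
  also have "\<dots> \<le> \<kappa> + 2 * (A * E) + 2 * (E * A) + 2 * (E * E)" using s \<kappa> by linarith
  finally show ?thesis by (simp add: power2_eq_square algebra_simps)
qed

lemma L2_zero_mean_L2: "f \<in> L2_0 \<Longrightarrow> f \<in> L2" by (simp add: L2_zero_mean_def)

lemma one_L2 [simp]: "(\<lambda>x. 1) \<in> L2" by (rule L2_bounded[OF finM, where C=1]) auto

lemma L2_zero_mean_iff: "f \<in> L2_0 \<longleftrightarrow> f \<in> L2 \<and> inn f (\<lambda>x. 1) = 0"
  by (simp add: L2_zero_mean_def L2_inner_def)

lemma zero_mean_subspace: "L2_subspace M (L2_0)" unfolding L2_subspace_def
proof (intro conjI ballI allI)
  show "L2_0 \<noteq> {}" using L2_zero_mean_iff[of "\<lambda>x. 0"] by auto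
qed (auto simp: L2_zero_mean_iff inner_add_left inner_scale_left)

lemma koopman_zero_mean: "f \<in> L2_0 \<Longrightarrow> U k f \<in> L2_0"
  by (auto simp: L2_zero_mean_def integral_koopman)

lemma cycZ_zero_mean:
  assumes "f \<in> L2_0" shows "cycZ f \<subseteq> L2_0"
proof
  fix h assume h: "h \<in> cycZ f"
  have "inn (\<lambda>x. 1) (U k f) = 0" for k
    using koopman_zero_mean[OF assms, of k] unfolding L2_zero_mean_iff by (subst inner_cnj) simp
  then have "inn (\<lambda>x. 1) h = 0" by (rule orth_cycZ[OF one_L2 L2_zero_mean_L2[OF assms] _ h])
  then show "h \<in> L2_0" using h cycZ_L2 unfolding L2_zero_mean_iff by (subst inner_cnj) auto
qed

end

section \<open>Levels of rank one and cyclic vectors\<close>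

text \<open>\<open>X n k\<close> are the characters of the cyclic group of order \<open>N n\<close>, \<open>c\<close> the Fourier coefficients, and \<open>w n L\<close>
  is the average of \<open>max 0 (1 - \<bar>s - s'\<bar> / N n)\<close> over \<open>s, s' < L * N n\<close>.\<close>

locale rank_one_levels = unitary_action M S for M :: "'a measure" and S +
  fixes D :: "('a \<Rightarrow> complex) set" and N :: "nat \<Rightarrow> nat"
    and X :: "nat \<Rightarrow> nat \<Rightarrow> 'a \<Rightarrow> complex" and c :: "('a \<Rightarrow> complex) \<Rightarrow> nat \<Rightarrow> nat \<Rightarrow> complex"
    and w :: "nat \<Rightarrow> nat \<Rightarrow> real"
  assumes D_zero_mean: "D \<subseteq> L2_0"
    and D_dense: "L2_0 \<subseteq> clo D"
    and D_mixing: "\<And>F G. F \<in> D \<Longrightarrow> G \<in> D \<Longrightarrow> (\<lambda>t::nat. corr (int t) F G) \<longlonglongrightarrow> 0"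
    and N_lim: "filterlim N at_top sequentially"
    and X_L2: "\<And>n k. X n k \<in> L2"
    and c_sq: "\<And>F. F \<in> D \<Longrightarrow> eventually (\<lambda>n. (\<Sum>k<N n. (norm (c F n k))\<^sup>2) = (nrm F)\<^sup>2) sequentially"
    and w_bd: "\<And>L. 0 < L \<Longrightarrow> eventually (\<lambda>n. (1 - 2 / real L) / real L \<le> w n L \<and> w n L \<le> 1 / real L) sequentially"
    and lim1: "\<And>F L. F \<in> D \<Longrightarrow> 0 < L \<Longrightarrow>
       (\<lambda>n. \<Sum>k<N n. norm (c F n k) * norm (bform (L * N n) (rt (N n) k) F (X n k) - c F n k * of_real (w n L))) \<longlonglongrightarrow> 0"
    and lim2: "\<And>F L. F \<in> D \<Longrightarrow> 0 < L \<Longrightarrow>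
       (\<lambda>n. \<Sum>k<N n. (norm (c F n k))\<^sup>2 * \<bar>(bnorm (L * N n) (rt (N n) k) (X n k))\<^sup>2 - w n L\<bar>) \<longlonglongrightarrow> 0"
begin

lemma D_L2: "F \<in> D \<Longrightarrow> F \<in> L2" using D_zero_mean L2_zero_mean_L2 by blast

lemma approx_D:
  assumes "f \<in> L2_0" "0 < \<epsilon>" obtains F where "F \<in> D" "nrm (\<lambda>x. f x - F x) < \<epsilon>"
proof -
  have "f \<in> clo D" using assms(1) D_dense by blast
  then show ?thesis using assms(2) that unfolding L2_closure_iff by blast
qed

lemma mixing:
  assumes f: "f \<in> L2_0" and g: "g \<in> L2_0"
  shows "(\<lambda>t::nat. corr (int t) f g) \<longlonglongrightarrow> 0"
proof (rule tendstoI)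
  fix \<epsilon> :: real assume e: "0 < \<epsilon>"
  have fL: "f \<in> L2" and gL: "g \<in> L2" using f g L2_zero_mean_L2 by auto
  define R where "R = nrm f + nrm g + 1"
  have R: "R > 0" "nrm g \<le> R" by (auto simp: R_def add_nonneg_pos)
  define \<delta> where "\<delta> = min 1 (\<epsilon> / (4 * R))"
  have \<delta>: "0 < \<delta>" "\<delta> \<le> 1" "\<delta> * R \<le> \<epsilon> / 4"
  proof -
    show "0 < \<delta>" "\<delta> \<le> 1" using e R by (auto simp: \<delta>_def)
    have "\<delta> * R \<le> \<epsilon> / (4 * R) * R" using R by (intro mult_right_mono) (auto simp: \<delta>_def)
    then show "\<delta> * R \<le> \<epsilon> / 4" using R by simp
  qed
  obtain F where F: "F \<in> D" "nrm (\<lambda>x. f x - F x) < \<delta>" by (rule approx_D[OF f \<delta>(1)])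
  obtain G where G: "G \<in> D" "nrm (\<lambda>x. g x - G x) < \<delta>" by (rule approx_D[OF g \<delta>(1)])
  have FL: "F \<in> L2" and GL: "G \<in> L2" using F G D_L2 by auto
  have FR: "nrm F \<le> R"
    using L2_norm_le_add_diff[OF FL fL] F(2) L2_norm_minus[of M F f] \<delta>(2) L2_norm_nonneg[of M g]
    unfolding R_def by linarith
  have "\<forall>\<^sub>F t in sequentially. norm (corr (int t) F G) < \<epsilon> / 2"
    using tendstoD[OF D_mixing[OF F(1) G(1)], of "\<epsilon> / 2"] e by simp
  then show "\<forall>\<^sub>F t in sequentially. dist (corr (int t) f g) 0 < \<epsilon>"
  proof eventually_elim
    case (elim t)
    have "norm (corr (int t) f g - corr (int t) F G) \<le>
       nrm (\<lambda>x. U (int t) f x - U (int t) F x) * nrm g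
       + nrm (U (int t) F) * nrm (\<lambda>x. g x - G x)"
      using fL gL FL GL by (intro inner_perturb) auto
    also have "(\<lambda>x. U (int t) f x - U (int t) F x) = U (int t) (\<lambda>x. f x - F x)"
      by (simp add: koopman_def)
    also have "nrm (U (int t) (\<lambda>x. f x - F x)) = nrm (\<lambda>x. f x - F x)"
      using fL FL by (intro norm_koopman) auto
    also have "nrm (U (int t) F) = nrm F" by (rule norm_koopman[OF FL])
    also have "nrm (\<lambda>x. f x - F x) * nrm g + nrm F * nrm (\<lambda>x. g x - G x) \<le> \<delta> * R + R * \<delta>"
      using F G R FR \<delta> by (intro add_mono mult_mono) auto
    also have "\<dots> \<le> \<epsilon> / 2" using \<delta>(3) by (simp add: mult.commute)
    finally show ?case using elim norm_triangle_sub[of "corr (int t) f g" "corr (int t) F G"] by simp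
  qed
qed

lemma mixing_multiples:
  assumes f: "f \<in> L2_0" and g: "g \<in> L2_0" and e: "0 < \<epsilon>"
  shows "\<forall>\<^sub>F n in sequentially. \<forall>r. r \<noteq> 0 \<longrightarrow> \<bar>r\<bar> < int L \<longrightarrow>
           norm (corr ((r * int (N n))) f g) \<le> \<epsilon>"
proof -
  have fL: "f \<in> L2" and gL: "g \<in> L2" using f g L2_zero_mean_L2 by auto
  have "\<forall>\<^sub>F t in sequentially. norm (corr (int t) f g) < \<epsilon>"
    "\<forall>\<^sub>F t in sequentially. norm (corr (int t) g f) < \<epsilon>"
    using tendstoD[OF mixing[OF f g] e] tendstoD[OF mixing[OF g f] e] by auto
  then obtain T1 T2 where T12: "\<And>t. t \<ge> T1 \<Longrightarrow> norm (corr (int t) f g) < \<epsilon>"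
     "\<And>t. t \<ge> T2 \<Longrightarrow> norm (corr (int t) g f) < \<epsilon>"
    unfolding eventually_sequentially by blast
  define T where "T = max T1 T2"
  have T: "\<And>t. t \<ge> T \<Longrightarrow> norm (corr (int t) f g) < \<epsilon>"
     "\<And>t. t \<ge> T \<Longrightarrow> norm (corr (int t) g f) < \<epsilon>" using T12 by (auto simp: T_def)
  have "\<forall>\<^sub>F n in sequentially. N n \<ge> T" using N_lim unfolding filterlim_at_top by blast
  then show ?thesis
  proof eventually_elim
    case (elim n)
    show ?case
    proof (intro allI impI)
      fix r :: int assume r: "r \<noteq> 0" "\<bar>r\<bar> < int L"
      have "1 * N n \<le> nat \<bar>r\<bar> * N n" using r by (intro mult_right_mono) auto
      with elim have m: "T \<le> nat \<bar>r\<bar> * N n" by linarith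
      show "norm (corr ((r * int (N n))) f g) \<le> \<epsilon>"
      proof (cases "0 \<le> r")
        case True
        then have eq: "r * int (N n) = int (nat \<bar>r\<bar> * N n)" by simp
        show ?thesis using T(1)[OF m] unfolding eq by (rule less_imp_le)
      next
        case False
        then have eq: "r * int (N n) = - int (nat \<bar>r\<bar> * N n)" by simp
        show ?thesis using T(2)[OF m] unfolding eq corr_minus[OF fL gL] complex_mod_cnj by (rule less_imp_le)
      qed
    qed
  qed
qed

end

context rank_one_levels begin

text \<open>Up to mixing errors \<open>inn v g / L\<close> is the sum of the forms of
  \<open>v\<close> and \<open>g\<close> over the roots of unity.
  \<open>orth_projection_bform\<close> bounds it by the norm products of \<open>f\<close> and
  \<open>g\<close>; after passing to approximations from \<open>D\<close>,
  \<open>level_estimate\<close> controls these, because the forms of \<open>f\<close> and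
  \<open>g\<close> vanish. \<open>\<epsilon>\<close> serves as the tolerance of every approximation
  made at a fixed \<open>L\<close>.\<close>

lemma projection_bound:
  assumes f: "f \<in> L2_0" and g: "g \<in> L2_0"
    and o: "\<And>k. corr k f g = 0"
    and v: "v \<in> cycZ (\<lambda>x. f x + g x)"
    and p: "\<And>h. h \<in> cycZ (\<lambda>x. f x + g x) \<Longrightarrow> inn (\<lambda>x. f x - v x) h = 0"
    and L: "0 < L" and R: "R = nrm f + nrm g + 1" and e: "0 < \<epsilon>" "\<epsilon> \<le> 1"
  shows "norm (inn v g) / real L \<le> 5 * R * \<epsilon> + \<epsilon> +
     (4 * (sqrt (R\<^sup>2 / real L + \<epsilon>) * sqrt (2 * R\<^sup>2 / (real L)\<^sup>2 + 4 * \<epsilon>)) + 2 * (2 * R\<^sup>2 / (real L)\<^sup>2 + 4 * \<epsilon>))"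
proof -
  have fL: "f \<in> L2" and gL: "g \<in> L2" using f g L2_zero_mean_L2 by auto
  have fg: "(\<lambda>x. f x + g x) \<in> L2_0" by (rule L2_subspace_add[OF zero_mean_subspace f g])
  have v0: "v \<in> L2_0" using cycZ_zero_mean[OF fg] v by blast
  have vL: "v \<in> L2" using v0 L2_zero_mean_L2 by auto
  have R0: "0 < R" "nrm f \<le> R" "nrm g \<le> R" by (auto simp: R add_nonneg_pos)
  obtain F where F: "F \<in> D" "nrm (\<lambda>x. f x - F x) < \<epsilon>" by (rule approx_D[OF f e(1)])
  obtain G where G: "G \<in> D" "nrm (\<lambda>x. g x - G x) < \<epsilon>" by (rule approx_D[OF g e(1)])
  have FL: "F \<in> L2" and GL: "G \<in> L2" using F G D_L2 by auto
  have F0: "F \<in> L2_0" and G0: "G \<in> L2_0" using F G D_zero_mean by auto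
  have FR: "nrm F \<le> R"
    using L2_norm_le_add_diff[OF FL fL] F(2) L2_norm_minus[of M F f] e L2_norm_nonneg[of M g]
    unfolding R by linarith
  have GR: "nrm G \<le> R"
    using L2_norm_le_add_diff[OF GL gL] G(2) L2_norm_minus[of M G g] e L2_norm_nonneg[of M f]
    unfolding R by linarith
  have ev1: "\<forall>\<^sub>F n in sequentially. (\<Sum>k<N n. norm (c H n k) * norm (bform (L * N n) (rt (N n) k) H (X n k) - c H n k * of_real (w n L))) < \<epsilon>"
    if H: "H \<in> D" for H using order_tendstoD(2)[OF lim1[OF H L] e(1)] .
  have ev2: "\<forall>\<^sub>F n in sequentially. (\<Sum>k<N n. (norm (c H n k))\<^sup>2 * \<bar>(bnorm (L * N n) (rt (N n) k) (X n k))\<^sup>2 - w n L\<bar>) < \<epsilon>"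
    if H: "H \<in> D" for H using order_tendstoD(2)[OF lim2[OF H L] e(1)] .
  have "\<forall>\<^sub>F n in sequentially. N n \<ge> 1" using N_lim unfolding filterlim_at_top by blast
  then have "\<forall>\<^sub>F n in sequentially. norm (inn v g) / real L \<le> 5 * R * \<epsilon> + \<epsilon> +
     (4 * (sqrt (R\<^sup>2 / real L + \<epsilon>) * sqrt (2 * R\<^sup>2 / (real L)\<^sup>2 + 4 * \<epsilon>)) + 2 * (2 * R\<^sup>2 / (real L)\<^sup>2 + 4 * \<epsilon>))"
    using ev1[OF F(1)] ev1[OF G(1)] ev2[OF F(1)] ev2[OF G(1)] c_sq[OF F(1)] c_sq[OF G(1)] w_bd[OF L]
      mixing_multiples[OF F0 F0 e(1), of L] mixing_multiples[OF G0 G0 e(1), of L] mixing_multiples[OF v0 g e(1), of L]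
  \<comment> \<open>The bound to be shown does not mention \<open>n\<close>, so a single index that
    meets all tolerances at once is enough.\<close>
  proof eventually_elim
    case (elim n)
    define Q where "Q = L * N n"
    have N: "0 < N n" using elim(1) by simp
    note close = sum_bform_close[OF _ _ N L less_imp_le[OF e(1)], folded Q_def]
    have sq: "(\<Sum>k<N n. (bnorm Q (rt (N n) k) H)\<^sup>2) \<le> (nrm H)\<^sup>2 / real L + \<epsilon>"
      if HL: "H \<in> L2" and m: "\<forall>r. r \<noteq> 0 \<longrightarrow> \<bar>r\<bar> < int L \<longrightarrow> norm (corr ((r * int (N n))) H H) \<le> \<epsilon>" for H
    proof -
      have "norm ((\<Sum>k<N n. bform Q (rt (N n) k) H H) - inn H H / of_nat L) \<le> \<epsilon>"
        using m by (intro close[OF HL HL]) blast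
      moreover have "(\<Sum>k<N n. bform Q (rt (N n) k) H H) - inn H H / of_nat L =
        of_real ((\<Sum>k<N n. (bnorm Q (rt (N n) k) H)\<^sup>2) - (nrm H)\<^sup>2 / real L)"
        unfolding inner_self by simp
      ultimately have "\<bar>(\<Sum>k<N n. (bnorm Q (rt (N n) k) H)\<^sup>2) - (nrm H)\<^sup>2 / real L\<bar> \<le> \<epsilon>"
        by (simp only: norm_of_real)
      then show ?thesis by linarith
    qed
    have w1: "(1 - 2 / real L) / real L \<le> w n L" and w2: "w n L \<le> 1 / real L" using elim by auto
    have sqF: "(\<Sum>k<N n. (bnorm Q (rt (N n) k) F)\<^sup>2) \<le> (nrm F)\<^sup>2 / real L + \<epsilon>" by (rule sq[OF FL]) (rule elim)
    have sqG: "(\<Sum>k<N n. (bnorm Q (rt (N n) k) G)\<^sup>2) \<le> (nrm G)\<^sup>2 / real L + \<epsilon>" by (rule sq[OF GL]) (rule elim)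
    note oneF = level_estimate_one[where N="N n" and Q=Q and X="X n" and c="c F n" and \<eta>=\<epsilon>,
        OF FL X_L2 L FR w1 w2 elim(6) less_imp_le[OF elim(2), folded Q_def] less_imp_le[OF elim(4), folded Q_def] sqF]
    note oneG = level_estimate_one[where N="N n" and Q=Q and X="X n" and c="c G n" and \<eta>=\<epsilon>,
        OF GL X_L2 L GR w1 w2 elim(7) less_imp_le[OF elim(3), folded Q_def] less_imp_le[OF elim(5), folded Q_def] sqG]
    define E where "E = sqrt (2 * R\<^sup>2 / (real L)\<^sup>2 + 4 * \<epsilon>)"
    define A where "A = sqrt (R\<^sup>2 / real L + \<epsilon>)"
    have E2: "E\<^sup>2 = 2 * R\<^sup>2 / (real L)\<^sup>2 + 4 * \<epsilon>" "0 \<le> E" using e unfolding E_def by (auto simp: add_nonneg_nonneg)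
    have A2: "A\<^sup>2 = R\<^sup>2 / real L + \<epsilon>" "0 \<le> A" using e unfolding A_def by (auto simp: add_nonneg_nonneg)
    have bs: "(\<Sum>k<N n. (bnorm Q (rt (N n) k) H)\<^sup>2) \<le> (nrm H)\<^sup>2" if "H \<in> L2" for H
      unfolding Q_def by (rule sum_bnorm_sq[OF that N L])
    have cs: "(\<Sum>k<N n. bnorm Q (rt (N n) k) H * bnorm Q (rt (N n) k) K) \<le> nrm H * nrm K"
      if "H \<in> L2" "K \<in> L2" for H K by (intro sum_mult_le_sqrt bs that L2_norm_nonneg)
    have fF: "(\<lambda>x. f x - F x) \<in> L2" and gG: "(\<lambda>x. g x - G x) \<in> L2" using fL gL FL GL by auto
    have "(\<Sum>k<N n. norm (bform Q (rt (N n) k) F G)) \<le>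
        (\<Sum>k<N n. bnorm Q (rt (N n) k) (\<lambda>x. f x - F x) * bnorm Q (rt (N n) k) G
           + bnorm Q (rt (N n) k) f * bnorm Q (rt (N n) k) (\<lambda>x. g x - G x))"
    proof (rule sum_mono)
      fix k
      have "bform Q (rt (N n) k) f g = 0" by (rule bform_commute_orth[OF fL gL o])
      then have "norm (bform Q (rt (N n) k) F G) = norm (bform Q (rt (N n) k) F G - bform Q (rt (N n) k) f g)" by simp
      also have "\<dots> \<le> nrm (\<lambda>x. bop Q (rt (N n) k) F x - bop Q (rt (N n) k) f x) * bnorm Q (rt (N n) k) G
         + bnorm Q (rt (N n) k) f * nrm (\<lambda>x. bop Q (rt (N n) k) G x - bop Q (rt (N n) k) g x)"
        using fL gL FL GL by (intro inner_perturb bop_L2)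
      finally show "norm (bform Q (rt (N n) k) F G) \<le> bnorm Q (rt (N n) k) (\<lambda>x. f x - F x) * bnorm Q (rt (N n) k) G
           + bnorm Q (rt (N n) k) f * bnorm Q (rt (N n) k) (\<lambda>x. g x - G x)" unfolding bop_diff
          L2_norm_minus[of M "bop Q (rt (N n) k) F"] L2_norm_minus[of M "bop Q (rt (N n) k) G"] .
    qed
    also have "\<dots> \<le> nrm (\<lambda>x. f x - F x) * nrm G + nrm f * nrm (\<lambda>x. g x - G x)"
      unfolding sum.distrib using fF gG fL GL by (intro add_mono cs)
    also have "\<dots> \<le> \<epsilon> * R + R * \<epsilon>"
      using F G R0 GR e by (intro add_mono mult_mono) auto
    finally have \<kappa>: "(\<Sum>k<N n. norm (bform Q (rt (N n) k) F G)) \<le> 2 * R * \<epsilon>" by simp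
    have FG: "(\<Sum>k<N n. bnorm Q (rt (N n) k) F * bnorm Q (rt (N n) k) G) \<le> 2 * R * \<epsilon> + 4 * (A * E) + 2 * E\<^sup>2"
      using level_estimate[OF FL GL X_L2 oneF(2)[folded A2(1)] oneG(2)[folded A2(1)] A2(2) oneF(1)[folded E2(1)] oneG(1)[folded E2(1)] E2(2) \<kappa>] .
    have "(\<Sum>k<N n. norm (bform Q (rt (N n) k) v g)) \<le> (\<Sum>k<N n. bnorm Q (rt (N n) k) f * bnorm Q (rt (N n) k) g)"
      by (intro sum_mono orth_projection_bform[OF fL gL o v p])
    also have "\<dots> \<le> (\<Sum>k<N n. (bnorm Q (rt (N n) k) F + bnorm Q (rt (N n) k) (\<lambda>x. f x - F x)) *
        (bnorm Q (rt (N n) k) G + bnorm Q (rt (N n) k) (\<lambda>x. g x - G x)))" unfolding bop_diff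
      by (intro sum_mono mult_mono L2_norm_le_add_diff bop_L2 fL FL gL GL add_nonneg_nonneg L2_norm_nonneg)
    also have "\<dots> = (\<Sum>k<N n. bnorm Q (rt (N n) k) F * bnorm Q (rt (N n) k) G)
        + (\<Sum>k<N n. bnorm Q (rt (N n) k) (\<lambda>x. f x - F x) * bnorm Q (rt (N n) k) G)
        + (\<Sum>k<N n. bnorm Q (rt (N n) k) F * bnorm Q (rt (N n) k) (\<lambda>x. g x - G x))
        + (\<Sum>k<N n. bnorm Q (rt (N n) k) (\<lambda>x. f x - F x) * bnorm Q (rt (N n) k) (\<lambda>x. g x - G x))"
      by (simp add: distrib_left distrib_right sum.distrib)
    also have "\<dots> \<le> (2 * R * \<epsilon> + 4 * (A * E) + 2 * E\<^sup>2) + nrm (\<lambda>x. f x - F x) * nrm G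
        + nrm F * nrm (\<lambda>x. g x - G x) + nrm (\<lambda>x. f x - F x) * nrm (\<lambda>x. g x - G x)"
      by (intro add_mono FG cs fF gG FL GL)
    also have "\<dots> \<le> (2 * R * \<epsilon> + 4 * (A * E) + 2 * E\<^sup>2) + \<epsilon> * R + R * \<epsilon> + \<epsilon> * R"
    proof -
      have "nrm (\<lambda>x. g x - G x) \<le> R" using G e R L2_norm_nonneg[of M f] L2_norm_nonneg[of M g] by linarith
      then show ?thesis using F G R0 GR FR e by (intro add_mono mult_mono order_refl) auto
    qed
    finally have S: "(\<Sum>k<N n. norm (bform Q (rt (N n) k) v g)) \<le> 5 * R * \<epsilon> + 4 * (A * E) + 2 * E\<^sup>2"
      by (simp add: algebra_simps)
    have "norm ((\<Sum>k<N n. bform Q (rt (N n) k) v g) - inn v g / of_nat L) \<le> \<epsilon>"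
      using elim by (intro close[OF vL gL]) blast
    then have "norm (inn v g / of_nat L) \<le> norm (\<Sum>k<N n. bform Q (rt (N n) k) v g) + \<epsilon>"
      by (smt (verit) norm_triangle_sub norm_minus_commute)
    also have "\<dots> \<le> (\<Sum>k<N n. norm (bform Q (rt (N n) k) v g)) + \<epsilon>" by (intro add_right_mono norm_sum)
    also have "\<dots> \<le> 5 * R * \<epsilon> + 4 * (A * E) + 2 * E\<^sup>2 + \<epsilon>" using S by simp
    finally show ?case unfolding E2 unfolding E_def A_def norm_divide norm_of_nat by linarith
  qed
  then show ?thesis by (simp add: eventually_const_iff)
qed

text \<open>For vanishing tolerance the bound has order L^(-3/2), against 1 / L on the left;
  multiplying by L and letting L grow gives \<open>inn v g = 0\<close> for the projection
  \<open>v\<close> of \<open>f\<close>, and this forces \<open>v\<close> to agree with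
  \<open>f\<close> in norm. So vectors with orthogonal cyclic spaces behave as if their spectral
  measures were mutually singular, which is the multiplicity one property in the form needed
  below.\<close>

lemma orth_in_cycZ_sum:
  assumes f: "f \<in> L2_0" and g: "g \<in> L2_0"
    and o: "\<And>k. corr k f g = 0" shows "f \<in> cycZ (\<lambda>x. f x + g x)"
proof -
  have fL: "f \<in> L2" and gL: "g \<in> L2" using f g L2_zero_mean_L2 by auto
  have fgL: "(\<lambda>x. f x + g x) \<in> L2" using fL gL by auto
  obtain v where v: "v \<in> cycZ (\<lambda>x. f x + g x)"
    and p: "\<And>h. h \<in> cycZ (\<lambda>x. f x + g x) \<Longrightarrow> inn (\<lambda>x. f x - v x) h = 0"
    using L2_projection[OF cyc_subspace[OF fgL] fL] unfolding cycZ_def by blast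
  have vL: "v \<in> L2" using v cycZ_L2 by blast
  define R where "R = nrm f + nrm g + 1"
  define a where "a = norm (inn v g)"
  have aL: "a / real L \<le> 4 * (sqrt (R\<^sup>2 / real L) * sqrt (2 * R\<^sup>2 / (real L)\<^sup>2)) + 2 * (2 * R\<^sup>2 / (real L)\<^sup>2)" if L: "0 < L" for L
  proof -
    let ?h = "\<lambda>\<epsilon>. 5 * R * \<epsilon> + \<epsilon> +
     (4 * (sqrt (R\<^sup>2 / real L + \<epsilon>) * sqrt (2 * R\<^sup>2 / (real L)\<^sup>2 + 4 * \<epsilon>)) + 2 * (2 * R\<^sup>2 / (real L)\<^sup>2 + 4 * \<epsilon>))"
    have "((\<lambda>\<epsilon>. ?h \<epsilon>) \<longlongrightarrow> ?h 0) (at_right 0)"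
      by (intro tendsto_intros)
    moreover have "\<forall>\<^sub>F \<epsilon> in at_right 0. a / real L \<le> ?h \<epsilon>"
      unfolding eventually_at_right_field a_def
      by (intro exI[of _ 1] conjI allI impI projection_bound[OF f g o v p L R_def]) auto
    ultimately have "a / real L \<le> ?h 0" by (intro tendsto_lowerbound[of ?h "?h 0" "at_right 0"]) auto
    then show ?thesis by simp
  qed
  have "a \<le> 6 * R\<^sup>2 * (1 / sqrt (real L)) + 4 * R\<^sup>2 * (1 / real L)" if L: "0 < L" for L
  proof -
    have s: "sqrt (real L) > 0" "sqrt (real L) * sqrt (real L) = real L" using L by auto
    have R0: "R \<ge> 0" by (simp add: R_def add_nonneg_nonneg)
    have "sqrt 2 \<le> 3 / 2" by (rule real_le_lsqrt) (auto simp: power2_eq_square)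
    have "sqrt (R\<^sup>2 / real L) * sqrt (2 * R\<^sup>2 / (real L)\<^sup>2) = sqrt 2 * (R\<^sup>2 / (sqrt (real L) * real L))"
      using R0 L by (simp add: real_sqrt_divide real_sqrt_mult power2_eq_square)
    also have "\<dots> \<le> (3 / 2) * (R\<^sup>2 / (sqrt (real L) * real L))"
      using \<open>sqrt 2 \<le> 3 / 2\<close> s by (intro mult_right_mono) auto
    finally have "a / real L \<le> 4 * ((3 / 2) * (R\<^sup>2 / (sqrt (real L) * real L))) + 2 * (2 * R\<^sup>2 / (real L)\<^sup>2)"
      using aL[OF L] by linarith
    then have "a / real L * real L \<le> (4 * ((3 / 2) * (R\<^sup>2 / (sqrt (real L) * real L))) + 2 * (2 * R\<^sup>2 / (real L)\<^sup>2)) * real L"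
      by (intro mult_right_mono) auto
    moreover have "a / real L * real L = a" using L by simp
    moreover have "(4 * ((3 / 2) * (R\<^sup>2 / (sqrt (real L) * real L))) + 2 * (2 * R\<^sup>2 / (real L)\<^sup>2)) * real L
        = 6 * R\<^sup>2 * (1 / sqrt (real L)) + 4 * R\<^sup>2 * (1 / real L)"
      using L by (simp add: field_simps power2_eq_square)
    ultimately show ?thesis by simp
  qed
  note bd = this
  have lim: "(\<lambda>L. 6 * R\<^sup>2 * (1 / sqrt (real L)) + 4 * R\<^sup>2 * (1 / real L)) \<longlonglongrightarrow> 6 * R\<^sup>2 * 0 + 4 * R\<^sup>2 * 0"
    by (intro tendsto_intros lim_1_over_n)
       (intro tendsto_divide_0[OF tendsto_const] filterlim_at_top_imp_at_infinity
         filterlim_compose[OF sqrt_at_top filterlim_real_sequentially])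
  have "a \<le> 6 * R\<^sup>2 * 0 + 4 * R\<^sup>2 * 0"
    by (rule LIMSEQ_le_const[OF lim]) (use bd in \<open>auto intro!: exI[of _ 1]\<close>)
  then have vg: "inn v g = 0" unfolding a_def by simp
  have g0: "inn (\<lambda>x. f x - v x) (\<lambda>x. f x + g x) = 0" by (rule p[OF cycZ_self[OF fgL]])
  have v0: "inn (\<lambda>x. f x - v x) v = 0" by (rule p[OF v])
  have fg0: "inn f g = 0" using o[of 0] corr_zero[OF fL gL] by simp
  have "inn f f = inn v f" using g0 vg fg0 fL gL vL by (simp add: inner_diff_left inner_add_right L2_add)
  moreover have "inn f v = inn v v" using v0 fL vL by (simp add: inner_diff_left)
  ultimately have "inn (\<lambda>x. f x - v x) (\<lambda>x. f x - v x) = 0"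
    using fL vL by (simp add: inner_diff_left inner_diff_right L2_diff)
  then have n0: "nrm (\<lambda>x. f x - v x) = 0" by (simp add: inner_self)
  have "f \<in> clo (cycZ (\<lambda>x. f x + g x))" unfolding L2_closure_iff
    using fL v n0 by (auto intro!: bexI[of _ v])
  then show ?thesis unfolding cycZ_def by (simp add: L2_closure_closed[OF cyc_L2[OF fgL]])
qed

text \<open>A Gram-Schmidt process for cyclic spaces: \<open>u j\<close> is a positive multiple of
  the part of \<open>h j\<close> orthogonal to the cyclic space of \<open>g j\<close>, the sum of
  its predecessors. Then \<open>g j\<close> and the tail \<open>e - g j\<close> have orthogonal
  cyclic spaces, so \<open>orth_in_cycZ_sum\<close> places \<open>g j\<close> in the cyclic space of
  \<open>e\<close>, and with it \<open>u j\<close> and \<open>h j\<close>.\<close>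

lemma exists_cyclic_zero_mean:
  fixes h :: "nat \<Rightarrow> 'a \<Rightarrow> complex"
  assumes h: "\<And>j. h j \<in> L2_0" and tot: "L2_0 \<subseteq> clo (complex_span (range h))"
  shows "\<exists>e\<in>L2_0. L2_0 \<subseteq> cycZ e"
proof -
  have hL: "h j \<in> L2" for j using h L2_zero_mean_L2 by blast
  define P where "P g a = (SOME v. v \<in> cycZ g \<and> (\<forall>u\<in>cycZ g. inn (\<lambda>x. a x - v x) u = 0))" for g a
  have P: "P g a \<in> cycZ g" "\<And>u. u \<in> cycZ g \<Longrightarrow> inn (\<lambda>x. a x - P g a x) u = 0"
    if gL: "g \<in> L2" and aL: "a \<in> L2" for g a
  proof -
    have "\<exists>v. v \<in> cycZ g \<and> (\<forall>u\<in>cycZ g. inn (\<lambda>x. a x - v x) u = 0)"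
    proof (rule L2_projection[OF cyc_subspace[OF gL] aL, folded cycZ_def])
      fix v assume v: "v \<in> cycZ g" "\<And>u. u \<in> cycZ g \<Longrightarrow> inn (\<lambda>x. a x - v x) u = 0"
      show ?thesis by (intro exI[of _ v] conjI ballI v)
    qed
    then have A: "P g a \<in> cycZ g \<and> (\<forall>u\<in>cycZ g. inn (\<lambda>x. a x - P g a x) u = 0)"
      unfolding P_def by (rule someI_ex)
    show "P g a \<in> cycZ g" by (rule conjunct1[OF A])
    show "inn (\<lambda>x. a x - P g a x) u = 0" if "u \<in> cycZ g" for u
      by (rule bspec[OF conjunct2[OF A] that])
  qed
  \<comment> \<open>The factor bounds the norm of \<open>u j\<close> by \<open>(1/2)^j\<close>, and
    being positive it can be divided out when \<open>h j\<close> is recovered.\<close>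
  define s where "s g j = (1/2)^j / (1 + nrm (\<lambda>x. h j x - P g (h j) x))" for g j
  define du where "du g j x = of_real (s g j) * (h j x - P g (h j) x)" for g j x
  define g where "g = rec_nat (\<lambda>x. 0) (\<lambda>j gj x. gj x + du gj j x)"
  define u where "u j = du (g j) j" for j
  have g0: "g 0 = (\<lambda>x. 0)" and gS: "g (Suc j) = (\<lambda>x. g j x + u j x)" for j
    by (simp_all add: g_def u_def)
  have s_pos: "s g j > 0" for g j by (simp add: s_def add_pos_nonneg)
  have uz: "u j \<in> L2_0" if gz: "g j \<in> L2_0" for j
  proof -
    have gL: "g j \<in> L2" using gz L2_zero_mean_L2 by blast
    have "P (g j) (h j) \<in> L2_0" using P(1)[OF gL hL] cycZ_zero_mean[OF gz] by blast
    then have "(\<lambda>x. h j x - P (g j) (h j) x) \<in> L2_0"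
      by (rule L2_subspace_diff[OF zero_mean_subspace h])
    then show ?thesis unfolding u_def du_def by (rule L2_subspace_scale[OF zero_mean_subspace])
  qed
  have gz: "g j \<in> L2_0" for j
  proof (induction j)
    case 0 then show ?case unfolding g0 by (rule L2_subspace_zero[OF zero_mean_subspace])
  next
    case (Suc j) then show ?case unfolding gS by (intro L2_subspace_add[OF zero_mean_subspace] uz)
  qed
  have gL: "g j \<in> L2" for j using gz L2_zero_mean_L2 by blast
  have uL: "u j \<in> L2" for j using uz[OF gz] L2_zero_mean_L2 by blast
  have u_orth: "inn (u j) y = 0" if "y \<in> cycZ (g j)" for j y
    unfolding u_def du_def inner_scale_left using P(2)[OF gL hL that] by simp
  have orth_sym: "corr k (g j) t = 0"
    if t: "t \<in> L2" and o: "\<And>y. y \<in> cycZ (g j) \<Longrightarrow> inn t y = 0" for j k t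
  proof -
    have "inn t (U k (g j)) = 0" by (rule o[OF koopman_cycZ[OF gL cycZ_self[OF gL]]])
    then show ?thesis by (subst inner_cnj) simp
  qed
  have g_step: "cycZ (g j) \<subseteq> cycZ (g (Suc j))" for j
  proof (rule cycZ_minimal[OF gL])
    show "g j \<in> cycZ (g (Suc j))" unfolding gS by (intro orth_in_cycZ_sum gz uz orth_sym uL u_orth)
  qed
  have g_mono: "cycZ (g j) \<subseteq> cycZ (g i)" if "j \<le> i" for i j
    using lift_Suc_mono_le[of "\<lambda>j. cycZ (g j)", OF g_step that] .
  have un: "nrm (u j) \<le> (1/2)^j" for j
  proof -
    let ?n = "nrm (\<lambda>x. h j x - P (g j) (h j) x)"
    have "nrm (u j) = s (g j) j * ?n" unfolding u_def du_def L2_norm_scale using s_pos[of "g j" j] by simp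
    also have "\<dots> = (1/2)^j * (?n / (1 + ?n))" by (simp add: s_def)
    also have "\<dots> \<le> (1/2)^j * 1" by (intro mult_left_mono) (auto simp: divide_le_eq add_pos_nonneg)
    finally show ?thesis by simp
  qed
  have "summable (\<lambda>j. nrm (u j))"
    by (rule summable_comparison_test'[of "\<lambda>n. (1/2)^n"]) (use un in \<open>auto intro: summable_geometric\<close>)
  from L2_series_complete[OF uL this] obtain e where
    e: "e \<in> L2" "(\<lambda>n. nrm (\<lambda>x. e x - (\<Sum>i<n. u i x))) \<longlonglongrightarrow> 0" by blast
  have gsum: "g n = (\<lambda>x. \<Sum>i<n. u i x)" for n by (induction n) (simp_all add: g0 gS)
  have lim: "(\<lambda>n. nrm (\<lambda>x. e x - g n x)) \<longlonglongrightarrow> 0" using e(2) unfolding gsum .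
  have inner_lim: "(\<lambda>n. inn (g n) y) \<longlonglongrightarrow> inn e y" if y: "y \<in> L2" for y
  proof (rule Lim_transform[OF tendsto_const])
    have b: "norm (inn (g n) y - inn e y) \<le> nrm (\<lambda>x. e x - g n x) * nrm y" for n
      unfolding norm_minus_commute[of "inn (g n) y"]
      using L2_cauchy_schwarz[OF L2_diff[OF e(1) gL] y] by (simp add: inner_diff_left[OF e(1) gL y])
    have l: "(\<lambda>n. nrm (\<lambda>x. e x - g n x) * nrm y) \<longlonglongrightarrow> 0"
      using tendsto_mult_right[OF lim, of "nrm y"] by simp
    show "(\<lambda>n. inn (g n) y - inn e y) \<longlonglongrightarrow> 0"
      by (rule Lim_null_comparison[OF _ l], rule always_eventually, rule allI, rule b)
  qed
  have ez: "e \<in> L2_0" unfolding L2_zero_mean_iff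
  proof (intro conjI e(1))
    have "(\<lambda>n. inn (g n) (\<lambda>x. 1)) = (\<lambda>n. 0)" using gz unfolding L2_zero_mean_iff by simp
    from inner_lim[OF one_L2, unfolded this] show "inn e (\<lambda>x. 1) = 0" by (simp add: LIMSEQ_const_iff)
  qed
  have tail: "inn (\<lambda>x. e x - g j x) y = 0" if y: "y \<in> cycZ (g j)" for j y
  proof -
    have yL: "y \<in> L2" using y cycZ_L2 by blast
    have "inn (g (j + n)) y = inn (g j) y" for n
    proof (induction n)
      case (Suc n)
      have "y \<in> cycZ (g (j + n))" using g_mono[of j "j + n"] y by auto
      then have "inn (u (j + n)) y = 0" by (rule u_orth)
      then show ?case using Suc by (simp add: gS inner_add_left[OF gL uL yL])
    qed simp
    moreover have "(\<lambda>n. inn (g (n + j)) y) \<longlonglongrightarrow> inn e y"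
      using inner_lim[OF yL] by (rule LIMSEQ_ignore_initial_segment)
    ultimately have "(\<lambda>n::nat. inn (g j) y) \<longlonglongrightarrow> inn e y" by (simp only: add.commute[of _ j])
    then have "inn e y = inn (g j) y" by (simp add: LIMSEQ_const_iff)
    then show ?thesis by (simp add: inner_diff_left[OF e(1) gL yL])
  qed
  have ge: "cycZ (g j) \<subseteq> cycZ e" for j
  proof (rule cycZ_minimal[OF e(1)])
    have "g j \<in> cycZ (\<lambda>x. g j x + (e x - g j x))"
      by (intro orth_in_cycZ_sum gz L2_subspace_diff[OF zero_mean_subspace ez gz] orth_sym L2_diff e(1) gL tail)
    then show "g j \<in> cycZ e" by simp
  qed
  have "h j \<in> cycZ e" for j
  proof -
    have Z: "L2_subspace M (cycZ e)" by (rule cycZ_subspace[OF e(1)])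
    have 1: "P (g j) (h j) \<in> cycZ e" using P(1)[OF gL hL] ge by blast
    have 2: "g (Suc j) \<in> cycZ e" "g j \<in> cycZ e" using cycZ_self[OF gL] ge by blast+
    have "(\<lambda>x. g (Suc j) x - g j x) \<in> cycZ e" by (rule L2_subspace_diff[OF Z 2])
    then have "u j \<in> cycZ e" by (simp add: gS)
    then have "(\<lambda>x. of_real (1 / s (g j) j) * u j x) \<in> cycZ e" by (rule L2_subspace_scale[OF Z])
    from L2_subspace_add[OF Z this 1] have "(\<lambda>x. of_real (1 / s (g j) j) * u j x + P (g j) (h j) x) \<in> cycZ e" .
    moreover have "(\<lambda>x. of_real (1 / s (g j) j) * u j x + P (g j) (h j) x) = h j"
      using s_pos[of "g j" j] by (auto simp: u_def du_def)
    ultimately show ?thesis by simp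
  qed
  then have "complex_span (range h) \<subseteq> cycZ e"
    by (intro complex_span_minimal[OF cycZ_subspace[OF e(1)]]) auto
  then have "clo (complex_span (range h)) \<subseteq> cycZ e"
    unfolding cycZ_def by (rule L2_closure_minimal[OF _ cyc_L2[OF e(1)]])
  then show ?thesis using ez tot by blast
qed

text \<open>The vector \<open>e + 1\<close> is cyclic for the whole space because mixing separates
  constants from zero-mean functions. Let \<open>r\<close> be the part of 1 orthogonal to the cyclic
  space of \<open>e + 1\<close>, with mean \<open>a\<close>. The correlations of \<open>e\<close>
  with \<open>r - a\<close> all equal \<open>- cnj a\<close>, and mixing forces
  \<open>a = 0\<close>; but \<open>a\<close> is also the squared norm of \<open>r\<close>.\<close>

lemma simple_spectrum_of_cyclic:
  assumes e: "e \<in> L2_0" and cyc_e: "L2_0 \<subseteq> cycZ e" shows "simple_spectrum M S"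
proof -
  have eL: "e \<in> L2" using e L2_zero_mean_L2 by blast
  define e1 where "e1 = (\<lambda>x. e x + 1)"
  have e1L: "e1 \<in> L2" unfolding e1_def by (rule L2_add[OF eL one_L2])
  let ?one = "\<lambda>x::'a. 1::complex"
  obtain p where p: "p \<in> cycZ e1" "\<And>h. h \<in> cycZ e1 \<Longrightarrow> inn (\<lambda>x. ?one x - p x) h = 0"
    using L2_projection[OF cyc_subspace[OF e1L] one_L2] unfolding cycZ_def by blast
  have pL: "p \<in> L2" using p cycZ_L2 by blast
  define r where "r = (\<lambda>x. 1 - p x)"
  have rL: "r \<in> L2" unfolding r_def by (rule L2_diff[OF one_L2 pL])
  have r0: "inn r h = 0" if "h \<in> cycZ e1" for h unfolding r_def using p(2)[OF that] by simp
  define a where "a = inn r ?one"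
  define r' where "r' = (\<lambda>x. r x - a)"
  have aL: "(\<lambda>x. a) \<in> L2" using L2_scale[OF one_L2, of a] by simp
  have r'L: "r' \<in> L2" unfolding r'_def by (rule L2_diff[OF rL aL])
  have ia: "inn (\<lambda>x. a) ?one = a" by (simp add: L2_inner_def prob_space)
  have "inn r' ?one = a - a" unfolding r'_def inner_diff_left[OF rL aL one_L2] ia a_def[symmetric] ..
  then have r'z: "r' \<in> L2_0" unfolding L2_zero_mean_iff using r'L by simp
  have k1: "U k e1 = (\<lambda>x. U k e x + 1)" for k by (simp add: koopman_def e1_def)
  have "corr (int k) e r' = - cnj a" for k
  proof -
    have "inn r (U k e1) = 0" by (rule r0) (rule koopman_cycZ[OF e1L cycZ_self[OF e1L]])
    then have "inn r (U k e) = - a"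
      unfolding k1 using rL eL by (simp add: inner_add_right koopman_L2 a_def eq_neg_iff_add_eq_0)
    moreover have "inn (\<lambda>x. a) (U k e) = 0"
    proof -
      have "corr k e ?one = 0" using koopman_zero_mean[OF e, of k] by (simp add: L2_zero_mean_iff)
      then have "inn ?one (U k e) = 0" by (subst inner_cnj) simp
      then show ?thesis using inner_scale_left[of M a ?one] by simp
    qed
    ultimately have "inn r' (U k e) = - a"
      unfolding r'_def using rL aL eL by (simp add: inner_diff_left koopman_L2)
    then show ?thesis by (subst inner_cnj) simp
  qed
  then have "(\<lambda>k::nat. - cnj a) \<longlonglongrightarrow> 0" using mixing[OF e r'z] by simp
  then have a0: "a = 0" by (simp add: LIMSEQ_const_iff)
  have "inn r r = 0" using a0 r0[OF p(1)] inner_diff_right[OF one_L2 pL rL] unfolding a_def r_def by simp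
  then have n0: "nrm (\<lambda>x. 1 - p x) = 0" by (simp add: inner_self r_def)
  have "?one \<in> clo (cycZ e1)" unfolding L2_closure_iff using p n0 by (auto intro!: bexI[of _ p])
  then have one: "?one \<in> cycZ e1" unfolding cycZ_def by (simp add: L2_closure_closed[OF cyc_L2[OF e1L]])
  have Z: "L2_subspace M (cycZ e1)" by (rule cycZ_subspace[OF e1L])
  have "(\<lambda>x. e1 x - 1) \<in> cycZ e1" by (rule L2_subspace_diff[OF Z cycZ_self[OF e1L] one])
  then have "e \<in> cycZ e1" by (simp add: e1_def)
  then have sub: "L2_0 \<subseteq> cycZ e1" using cycZ_minimal[OF e1L] cyc_e by blast
  have "f \<in> cycZ e1" if f: "f \<in> L2" for f
  proof -
    define m where "m = inn f ?one"
    have mL: "(\<lambda>x. m) \<in> L2" using L2_scale[OF one_L2, of m] by simp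
    have im: "inn (\<lambda>x. m) ?one = m" by (simp add: L2_inner_def prob_space)
    have "inn (\<lambda>x. f x - m) ?one = m - m"
      unfolding inner_diff_left[OF f mL one_L2] im m_def[symmetric] ..
    then have "(\<lambda>x. f x - m) \<in> L2_0" unfolding L2_zero_mean_iff using L2_diff[OF f mL] by simp
    then have 1: "(\<lambda>x. f x - m) \<in> cycZ e1" using sub by blast
    have "(\<lambda>x. m * 1) \<in> cycZ e1" by (rule L2_subspace_scale[OF Z one])
    from L2_subspace_add[OF Z 1 this] show ?thesis by simp
  qed
  then have "cycZ e1 = L2" using cycZ_L2 by blast
  then show ?thesis unfolding simple_spectrum_def using e1L by (auto simp: cycZ_def cyc_def)
qed

end

section \<open>Spectral measures on the circle\<close>

definition tv :: "int set \<Rightarrow> (int \<Rightarrow> complex) \<Rightarrow> complex \<Rightarrow> complex" where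
  "tv K c z = (\<Sum>k\<in>K. c k * z powi k)"

abbreviation "tv_sq K c \<nu> \<equiv> (\<integral>z. (norm (tv K c z))\<^sup>2 \<partial>\<nu>)"

text \<open>Equality is imposed on the unit circle only, where conjugation inverts \<open>z\<close>;
  this makes the class closed under conjugation as well as under sums and products.\<close>

definition trigpoly :: "(complex \<Rightarrow> complex) \<Rightarrow> bool" where
  "trigpoly p \<longleftrightarrow> (\<exists>K c. finite K \<and> (\<forall>z\<in>sphere 0 1. p z = tv K c z))"

lemma trigpoly_monom: "trigpoly (\<lambda>z. a * z powi k)"
  unfolding trigpoly_def by (rule exI[of _ "{k}"], rule exI[of _ "\<lambda>_. a"]) (simp add: tv_def)

lemma trigpoly_const: "trigpoly (\<lambda>z. a)" using trigpoly_monom[of a 0] by simp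

lemma trigpoly_add:
  assumes "trigpoly p" "trigpoly q" shows "trigpoly (\<lambda>z. p z + q z)"
proof -
  obtain K c where K: "finite K" "\<forall>z\<in>sphere 0 1. p z = tv K c z" using assms unfolding trigpoly_def by blast
  obtain J d where J: "finite J" "\<forall>z\<in>sphere 0 1. q z = tv J d z" using assms unfolding trigpoly_def by blast
  have 1: "tv K c z = tv (K \<union> J) (\<lambda>k. if k \<in> K then c k else 0) z" for z
    unfolding tv_def by (rule sum.mono_neutral_cong_left) (use K J in auto)
  have 2: "tv J d z = tv (K \<union> J) (\<lambda>k. if k \<in> J then d k else 0) z" for z
    unfolding tv_def by (rule sum.mono_neutral_cong_left) (use K J in auto)
  have "\<forall>z\<in>sphere 0 1. p z + q z = tv (K \<union> J) (\<lambda>k. (if k \<in> K then c k else 0) + (if k \<in> J then d k else 0)) z"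
    using K(2) J(2) unfolding 1 2 by (auto simp: tv_def sum.distrib distrib_right)
  then show ?thesis unfolding trigpoly_def using K(1) J(1) by blast
qed

lemma trigpoly_cong: "trigpoly p \<Longrightarrow> (\<And>z. z \<in> sphere 0 1 \<Longrightarrow> p z = q z) \<Longrightarrow> trigpoly q"
  unfolding trigpoly_def by (metis (no_types, lifting))

lemma trigpoly_sum:
  "(\<And>i. i \<in> I \<Longrightarrow> trigpoly (p i)) \<Longrightarrow> trigpoly (\<lambda>z. \<Sum>i\<in>I. p i z)"
  by (induction I rule: infinite_finite_induct) (auto simp: trigpoly_const trigpoly_add)

lemma trigpoly_tv: "trigpoly (tv K c)" unfolding tv_def[abs_def] by (intro trigpoly_sum trigpoly_monom)

lemma sphere_powi_mult: "z \<in> sphere (0::complex) 1 \<Longrightarrow> z powi j * z powi k = z powi (j + k)"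
proof -
  assume "z \<in> sphere 0 1"
  then have "z \<noteq> 0" by auto
  then show ?thesis by (simp add: power_int_add)
qed

lemma sphere_powi_cnj: "z \<in> sphere (0::complex) 1 \<Longrightarrow> cnj (z powi k) = z powi (- k)"
proof -
  assume z: "z \<in> sphere 0 1"
  then have "z * cnj z = 1" using complex_norm_square[of z] by simp
  then have "cnj z = inverse z" by (rule inverse_unique[symmetric])
  then show ?thesis by (simp add: power_int_minus power_int_inverse)
qed

lemma trigpoly_mult:
  assumes "trigpoly p" "trigpoly q" shows "trigpoly (\<lambda>z. p z * q z)"
proof -
  obtain K c where K: "finite K" "\<forall>z\<in>sphere 0 1. p z = tv K c z" using assms unfolding trigpoly_def by blast
  obtain J d where J: "finite J" "\<forall>z\<in>sphere 0 1. q z = tv J d z" using assms unfolding trigpoly_def by blast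
  have "trigpoly (\<lambda>z. \<Sum>k\<in>K. \<Sum>j\<in>J. (c k * d j) * z powi (k + j))"
    by (intro trigpoly_sum trigpoly_monom)
  then show ?thesis
  proof (rule trigpoly_cong)
    fix z :: complex assume z: "z \<in> sphere 0 1"
    have "p z * q z = (\<Sum>k\<in>K. \<Sum>j\<in>J. (c k * z powi k) * (d j * z powi j))"
      using K J z by (simp add: tv_def sum_product)
    also have "\<dots> = (\<Sum>k\<in>K. \<Sum>j\<in>J. (c k * d j) * z powi (k + j))"
      by (intro sum.cong refl) (simp flip: sphere_powi_mult[OF z])
    finally show "(\<Sum>k\<in>K. \<Sum>j\<in>J. (c k * d j) * z powi (k + j)) = p z * q z" by simp
  qed
qed

lemma trigpoly_cnj:
  assumes "trigpoly p" shows "trigpoly (\<lambda>z. cnj (p z))"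
proof -
  obtain K c where K: "finite K" "\<forall>z\<in>sphere 0 1. p z = tv K c z" using assms unfolding trigpoly_def by blast
  have "trigpoly (\<lambda>z. \<Sum>k\<in>K. cnj (c k) * z powi (- k))" by (intro trigpoly_sum trigpoly_monom)
  then show ?thesis
  proof (rule trigpoly_cong)
    fix z :: complex assume z: "z \<in> sphere 0 1"
    then show "(\<Sum>k\<in>K. cnj (c k) * z powi (- k)) = cnj (p z)"
      using K by (simp add: tv_def flip: sphere_powi_cnj[OF z])
  qed
qed

lemma continuous_on_tv: "continuous_on (sphere 0 1) (tv K c)"
  unfolding tv_def[abs_def] by (intro continuous_intros) auto

lemma trigpoly_continuous: "trigpoly p \<Longrightarrow> continuous_on (sphere 0 1) p"
proof -
  assume "trigpoly p"
  then obtain K c where "\<forall>z\<in>sphere 0 1. p z = tv K c z" unfolding trigpoly_def by blast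
  then show ?thesis using continuous_on_tv[of K c] continuous_on_cong[of "sphere 0 1" "sphere 0 1" p "tv K c"] by simp
qed

text \<open>The real Stone-Weierstrass theorem, applied to the algebra of those real functions that
  are trigonometric polynomials when regarded as complex functions; \<open>Re\<close> and
  \<open>Im\<close> belong to it and separate points.\<close>

lemma trigpoly_approx:
  fixes g :: "complex \<Rightarrow> real"
  assumes g: "continuous_on (sphere 0 1) g" and e: "0 < e"
  obtains K c where "finite K" "\<And>z. z \<in> sphere 0 1 \<Longrightarrow> norm (of_real (g z) - tv K c z) < e"
proof -
  let ?P = "\<lambda>f :: complex \<Rightarrow> real. trigpoly (\<lambda>z. complex_of_real (f z))"
  have "\<exists>f. ?P f \<and> (\<forall>z\<in>sphere 0 1. \<bar>g z - f z\<bar> < e)"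
  proof (rule Stone_Weierstrass_HOL[where P="?P"])
    show "compact (sphere (0::complex) 1)" by simp
    show "?P (\<lambda>x. a)" for a by (rule trigpoly_const)
    show "continuous_on (sphere 0 1) f" if "?P f" for f
      using continuous_on_Re[OF trigpoly_continuous[OF that]] by simp
    show "?P (\<lambda>x. f x + h x)" if "?P f \<and> ?P h" for f h
      using that trigpoly_add[of "\<lambda>z. complex_of_real (f z)" "\<lambda>z. complex_of_real (h z)"] by simp
    show "?P (\<lambda>x. f x * h x)" if "?P f \<and> ?P h" for f h
      using that trigpoly_mult[of "\<lambda>z. complex_of_real (f z)" "\<lambda>z. complex_of_real (h z)"] by simp
    show "\<exists>f. ?P f \<and> f x \<noteq> f y" if "x \<in> sphere 0 1 \<and> y \<in> sphere 0 1 \<and> x \<noteq> y" for x y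
    proof -
      have id: "trigpoly (\<lambda>z. z)" using trigpoly_monom[of 1 1] by simp
      have "?P Re"
      proof (rule trigpoly_cong)
        show "trigpoly (\<lambda>z. (1/2) * (z + cnj z))"
          by (intro trigpoly_mult trigpoly_const trigpoly_add id trigpoly_cnj)
      qed (simp add: complex_add_cnj)
      moreover have "?P Im"
      proof (rule trigpoly_cong)
        show "trigpoly (\<lambda>z. (- \<i> / 2) * (z + (- 1) * cnj z))"
          by (intro trigpoly_mult trigpoly_const trigpoly_add id trigpoly_cnj)
      qed (simp add: complex_eq_iff)
      moreover have "Re x \<noteq> Re y \<or> Im x \<noteq> Im y" using that by (simp add: complex_eq_iff)
      ultimately show ?thesis by blast
    qed
  qed (use g e in auto)
  then obtain f where f: "?P f" "\<forall>z\<in>sphere 0 1. \<bar>g z - f z\<bar> < e" by blast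
  then obtain K c where K: "finite K" "\<forall>z\<in>sphere 0 1. of_real (f z) = tv K c z" unfolding trigpoly_def by blast
  have "norm (of_real (g z) - tv K c z) < e" if "z \<in> sphere 0 1" for z
  proof -
    have "of_real (g z) - tv K c z = of_real (g z - f z)" using K that by simp
    then show ?thesis using f(2) that by (simp only: norm_of_real)
  qed
  with K(1) that show ?thesis by blast
qed

lemma space_circle: "sets \<nu> = sets circle_borel \<Longrightarrow> space \<nu> = sphere 0 1"
  using sets_eq_imp_space_eq[of \<nu> circle_borel] by (simp add: circle_borel_def space_restrict_space)

lemma circle_measurable_continuous:
  fixes f :: "complex \<Rightarrow> 'b::topological_space"
  assumes "sets \<nu> = sets circle_borel" "continuous_on (sphere 0 1) f" shows "f \<in> borel_measurable \<nu>"
proof -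
  have "f \<in> borel_measurable circle_borel"
    unfolding circle_borel_def by (rule borel_measurable_continuous_on_restrict[OF assms(2)])
  then show ?thesis using measurable_cong_sets[OF assms(1) refl] by blast
qed

lemma circle_integrable_continuous:
  fixes f :: "complex \<Rightarrow> 'b::{banach, second_countable_topology}"
  assumes \<nu>: "sets \<nu> = sets circle_borel" "finite_measure \<nu>" and f: "continuous_on (sphere 0 1) f"
  shows "integrable \<nu> f"
proof -
  interpret finite_measure \<nu> by fact
  have "compact (f ` sphere 0 1)" by (intro compact_continuous_image f) simp
  then obtain B where "\<forall>y\<in>f ` sphere 0 1. norm y \<le> B" using compact_imp_bounded bounded_iff by metis
  then show ?thesis
    by (intro integrable_const_bound[where B=B] AE_I2 circle_measurable_continuous[OF \<nu>(1) f])
       (auto simp: space_circle[OF \<nu>(1)])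
qed

lemma continuous_norm_tv_sq: "continuous_on (sphere 0 1) (\<lambda>z. (norm (tv K c z))\<^sup>2)"
  by (intro continuous_intros continuous_on_tv)

text \<open>The hypothesis compares two measures on trigonometric polynomials only; testing it on
  polynomials close to continuous functions that decrease to the indicator of a compact set
  transfers it to null sets, by inner regularity.\<close>

lemma circle_measure_le_of_trig:
  assumes \<nu>: "sets \<nu> = sets circle_borel" "finite_measure \<nu>"
    and \<rho>: "sets \<rho> = sets circle_borel" "finite_measure \<rho>"
    and e: "0 \<le> \<epsilon>" and C: "0 \<le> C"
    and H: "\<And>K c. finite K \<Longrightarrow> (\<And>z. z \<in> sphere 0 1 \<Longrightarrow> norm (tv K c z) \<le> 2) \<Longrightarrow>
       (tv_sq K c \<nu>) \<le> C * sqrt (tv_sq K c \<rho>) + \<epsilon>"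
    and A: "A \<in> null_sets \<rho>" shows "emeasure \<nu> A \<le> ennreal \<epsilon>"
proof -
  interpret N: finite_measure \<nu> by fact
  interpret R: finite_measure \<rho> by fact
  have As: "A \<in> sets circle_borel" using A \<rho> by auto
  then have AS: "A \<subseteq> sphere 0 1" "A \<in> sets borel"
    by (auto simp: circle_borel_def sets_restrict_space)
  have K_le: "measure \<nu> K \<le> \<epsilon>" if K: "compact K" "K \<subseteq> A" for K
  proof (cases "K = {}")
    case True then show ?thesis using e by simp
  next
    case False
    have Kc: "closed K" using K compact_imp_closed by blast
    have Ks: "K \<in> sets circle_borel"
      unfolding circle_borel_def sets_restrict_space using K AS Kc by (auto intro!: image_eqI[of _ _ K])
    have K\<rho>: "measure \<rho> K = 0"
    proof -
      have "K \<in> null_sets \<rho>" using null_sets_subset[OF A _ K(2)] Ks \<rho> by simp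
      then show ?thesis by (simp add: measure_def null_setsD1)
    qed
    define g where "g n z = max 0 (1 - real n * infdist z K)" for n :: nat and z :: complex
    have gc: "continuous_on X (g n)" for n X unfolding g_def by (intro continuous_intros)
    have g01: "0 \<le> g n z" "g n z \<le> 1" for n z by (auto simp: g_def infdist_nonneg)
    have g1: "g n z = 1" if "z \<in> K" for n z using that by (simp add: g_def)
    have lim: "(\<lambda>n. \<integral>z. (g n z)\<^sup>2 \<partial>\<rho>) \<longlonglongrightarrow> (\<integral>z. indicator K z \<partial>\<rho>)"
    proof (rule integral_dominated_convergence[where w="\<lambda>_. 1"])
      show "AE z in \<rho>. (\<lambda>n. (g n z)\<^sup>2) \<longlonglongrightarrow> indicator K z"
      proof (rule AE_I2)
        fix z
        show "(\<lambda>n. (g n z)\<^sup>2) \<longlonglongrightarrow> indicator K z"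
        proof (cases "z \<in> K")
          case True then show ?thesis using g1 by simp
        next
          case False
          then have d: "infdist z K > 0"
            using Kc \<open>K \<noteq> {}\<close> in_closed_iff_infdist_zero infdist_nonneg less_le by metis
          obtain m :: nat where m: "1 / infdist z K < real m" using reals_Archimedean2 by blast
          have "\<forall>\<^sub>F n in sequentially. (g n z)\<^sup>2 = 0"
          proof (rule eventually_sequentiallyI[of m])
            fix n assume "m \<le> n"
            then have "1 / infdist z K < real n" using m by linarith
            then have "1 < real n * infdist z K" using d by (simp add: divide_less_eq)
            then show "(g n z)\<^sup>2 = 0" by (simp add: g_def)
          qed
          then show ?thesis using False tendsto_eventually by fastforce
        qed
      qed
      show "AE z in \<rho>. norm ((g n z)\<^sup>2) \<le> 1" for n
        using g01 by (intro AE_I2) (auto intro: power_le_one)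
      show "(\<lambda>z. (g n z)\<^sup>2) \<in> borel_measurable \<rho>" for n
        by (rule circle_measurable_continuous[OF \<rho>(1)]) (intro continuous_intros gc)
      show "indicat_real K \<in> borel_measurable \<rho>" using Ks \<rho> by (intro borel_measurable_indicator) simp
    qed auto
    have "K \<inter> space \<rho> = K" "K \<inter> space \<nu> = K" using K AS space_circle[OF \<rho>(1)] space_circle[OF \<nu>(1)] by auto
    then have K1: "(\<integral>z. indicat_real K z \<partial>\<rho>) = 0" "measure \<nu> K = (\<integral>z. indicat_real K z \<partial>\<nu>)"
      unfolding Bochner_Integration.integral_indicator using K\<rho> by simp_all
    with lim K1(1) have lim0: "(\<lambda>n. \<integral>z. (g n z)\<^sup>2 \<partial>\<rho>) \<longlonglongrightarrow> 0" by simp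
    \<comment> \<open>An approximation of \<open>g n\<close> within \<open>1 / n\<close> is bounded
      by 2, so \<open>H\<close> applies to it. Its modulus and \<open>g n\<close> add up to at most
      3, so the squares differ by at most \<open>3 / n\<close>.\<close>
    have bd: "measure \<nu> K \<le> C * sqrt ((\<integral>z. (g n z)\<^sup>2 \<partial>\<rho>) + 3 * measure \<rho> (space \<rho>) / real n) + \<epsilon> + 3 * measure \<nu> (space \<nu>) / real n"
      if n: "n \<ge> 1" for n
    proof -
      have n0: "0 < 1 / real n" "1 / real n \<le> 1" using n by auto
      obtain J c where J: "finite J" "\<And>z. z \<in> sphere 0 1 \<Longrightarrow> norm (of_real (g n z) - tv J c z) < 1 / real n"
        by (rule trigpoly_approx[OF gc n0(1)]) blast
      have b2: "norm (tv J c z) \<le> 2" if z: "z \<in> sphere 0 1" for z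
      proof -
        have "norm (tv J c z) \<le> norm (complex_of_real (g n z)) + norm (tv J c z - of_real (g n z))"
          by (rule norm_triangle_sub)
        moreover have "norm (tv J c z - of_real (g n z)) < 1 / real n"
          using J(2)[OF z] by (simp only: norm_minus_commute)
        moreover have "norm (complex_of_real (g n z)) = g n z" using g01 by simp
        ultimately show ?thesis using n0 g01[of n z] by linarith
      qed
      have sqd: "\<bar>(g n z)\<^sup>2 - (norm (tv J c z))\<^sup>2\<bar> \<le> 3 / real n" if z: "z \<in> sphere 0 1" for z
      proof -
        have a: "\<bar>g n z - norm (tv J c z)\<bar> \<le> 1 / real n"
          using norm_triangle_ineq3[of "of_real (g n z)" "tv J c z"] J(2)[OF z] g01[of n z] by simp
        have b: "\<bar>g n z + norm (tv J c z)\<bar> \<le> 3" using b2[OF z] g01[of n z] by simp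
        have c: "(g n z)\<^sup>2 - (norm (tv J c z))\<^sup>2 = (g n z - norm (tv J c z)) * (g n z + norm (tv J c z))"
          by (simp add: power2_eq_square algebra_simps)
        have "\<bar>(g n z)\<^sup>2 - (norm (tv J c z))\<^sup>2\<bar> \<le> (1 / real n) * 3"
          unfolding c abs_mult by (rule mult_mono[OF a b]) simp_all
        then show ?thesis by simp
      qed
      have ig: "integrable \<nu>' (\<lambda>z. (g n z)\<^sup>2)" and it: "integrable \<nu>' (\<lambda>z. (norm (tv J c z))\<^sup>2)"
        if "sets \<nu>' = sets circle_borel" "finite_measure \<nu>'" for \<nu>'
        by (rule circle_integrable_continuous[OF that], intro continuous_intros gc)
           (rule circle_integrable_continuous[OF that continuous_norm_tv_sq])
      have "measure \<nu> K = (\<integral>z. indicator K z \<partial>\<nu>)" by (rule K1(2))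
      also have "\<dots> \<le> (\<integral>z. (g n z)\<^sup>2 \<partial>\<nu>)"
      proof (rule integral_mono)
        show "integrable \<nu> (indicat_real K)"
          using Ks \<nu>(1) by (intro integrable_real_indicator) (simp_all add: N.emeasure_eq_measure)
        show "indicat_real K z \<le> (g n z)\<^sup>2" for z using g1[of z n] by (simp add: indicator_def)
      qed (rule ig[OF \<nu>])
      also have "\<dots> \<le> (\<integral>z. (norm (tv J c z))\<^sup>2 + 3 / real n \<partial>\<nu>)"
      proof (rule integral_mono)
        fix z assume "z \<in> space \<nu>"
        then have "z \<in> sphere 0 1" using space_circle[OF \<nu>(1)] by simp
        from sqd[OF this] show "(g n z)\<^sup>2 \<le> (norm (tv J c z))\<^sup>2 + 3 / real n" by linarith
      qed (use ig[OF \<nu>] it[OF \<nu>] in auto)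
      also have "\<dots> = (\<integral>z. (norm (tv J c z))\<^sup>2 \<partial>\<nu>) + 3 / real n * measure \<nu> (space \<nu>)"
        using it[OF \<nu>] by simp
      also have "(\<integral>z. (norm (tv J c z))\<^sup>2 \<partial>\<nu>) \<le> C * sqrt (\<integral>z. (norm (tv J c z))\<^sup>2 \<partial>\<rho>) + \<epsilon>"
        by (rule H[OF J(1) b2])
      also have "(\<integral>z. (norm (tv J c z))\<^sup>2 \<partial>\<rho>) \<le> (\<integral>z. (g n z)\<^sup>2 + 3 / real n \<partial>\<rho>)"
      proof (rule integral_mono)
        fix z assume "z \<in> space \<rho>"
        then have "z \<in> sphere 0 1" using space_circle[OF \<rho>(1)] by simp
        from sqd[OF this] show "(norm (tv J c z))\<^sup>2 \<le> (g n z)\<^sup>2 + 3 / real n" by linarith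
      qed (use ig[OF \<rho>] it[OF \<rho>] in auto)
      also have "\<dots> = (\<integral>z. (g n z)\<^sup>2 \<partial>\<rho>) + 3 / real n * measure \<rho> (space \<rho>)"
        using ig[OF \<rho>] by simp
      finally show ?thesis using C by (simp add: mult_left_mono)
    qed
    have "(\<lambda>n. C * sqrt ((\<integral>z. (g n z)\<^sup>2 \<partial>\<rho>) + 3 * measure \<rho> (space \<rho>) / real n) + \<epsilon> + 3 * measure \<nu> (space \<nu>) / real n)
       \<longlonglongrightarrow> C * sqrt (0 + 0) + \<epsilon> + 0"
      by (intro tendsto_intros lim0 lim_const_over_n)
    then have "measure \<nu> K \<le> C * sqrt (0 + 0) + \<epsilon> + 0"
      by (rule LIMSEQ_le_const) (use bd in blast)
    then show ?thesis by simp
  qed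
  \<comment> \<open>Inner regularity by compact sets is used for a measure on the Borel sets of the
    plane, so \<open>\<nu>\<close> is transported there.\<close>
  define \<nu>' where "\<nu>' = distr \<nu> borel (\<lambda>z. z)"
  have m: "(\<lambda>z. z) \<in> measurable \<nu> borel"
    by (rule circle_measurable_continuous[OF \<nu>(1)]) (intro continuous_intros)
  have em: "emeasure \<nu>' B = emeasure \<nu> B" if "B \<subseteq> sphere 0 1" "B \<in> sets borel" for B
    using that m unfolding \<nu>'_def by (subst emeasure_distr) (auto simp: space_circle[OF \<nu>(1)] Int_absorb2)
  have "emeasure \<nu>' A = (SUP K \<in> {K. K \<subseteq> A \<and> compact K}. emeasure \<nu>' K)"
  proof (rule inner_regular)
    show "sets \<nu>' = sets borel" by (simp add: \<nu>'_def)
    show "emeasure \<nu>' (space \<nu>') \<noteq> \<infinity>"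
      unfolding \<nu>'_def by (subst emeasure_distr[OF m]) (auto simp: N.emeasure_eq_measure)
    show "A \<in> sets borel" by (rule AS)
  qed
  also have "\<dots> \<le> ennreal \<epsilon>"
  proof (rule SUP_least)
    fix K assume "K \<in> {K. K \<subseteq> A \<and> compact K}"
    then have K: "compact K" "K \<subseteq> A" by auto
    then have "emeasure \<nu>' K = emeasure \<nu> K" using AS by (intro em) (auto simp: compact_imp_closed)
    also have "\<dots> \<le> ennreal \<epsilon>" unfolding N.emeasure_eq_measure using K_le[OF K] by (rule ennreal_leI)
    finally show "emeasure \<nu>' K \<le> ennreal \<epsilon>" .
  qed
  finally show ?thesis using em AS by simp
qed

lemma circle_ac_of_trig:
  assumes \<nu>: "sets \<nu> = sets circle_borel" "finite_measure \<nu>"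
    and \<rho>: "sets \<rho> = sets circle_borel" "finite_measure \<rho>" and C: "0 \<le> C"
    and H: "\<And>K c. finite K \<Longrightarrow> (\<And>z. z \<in> sphere 0 1 \<Longrightarrow> norm (tv K c z) \<le> 2) \<Longrightarrow>
       (tv_sq K c \<nu>) \<le> C * sqrt (tv_sq K c \<rho>)"
  shows "absolutely_continuous \<rho> \<nu>" unfolding absolutely_continuous_def
proof
  fix A assume A: "A \<in> null_sets \<rho>"
  have "emeasure \<nu> A \<le> ennreal 0"
    by (rule circle_measure_le_of_trig[OF \<nu> \<rho> order_refl C _ A]) (use H in simp)
  then show "A \<in> null_sets \<nu>" using A \<nu> \<rho> by (auto simp: null_sets_def)
qed

lemma sets_circle_lebesgue [simp]: "sets circle_lebesgue = sets circle_borel" by (simp add: circle_lebesgue_def)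

lemma cis_measurable_circle: "cis \<in> measurable borel circle_borel" unfolding circle_borel_def
  by (intro measurable_restrict_space2 borel_measurable_continuous_onI continuous_intros) auto

lemma finite_circle_lebesgue: "finite_measure circle_lebesgue"
proof -
  have "cis \<in> measurable (restrict_space lborel {0..<2 * pi}) circle_borel"
    using cis_measurable_circle by (intro measurable_restrict_space1) simp
  moreover have "finite_measure (restrict_space lborel {0..<2 * pi})"
    by (rule finite_measureI) (simp add: emeasure_restrict_space space_restrict_space)
  ultimately show ?thesis unfolding circle_lebesgue_def by (simp add: finite_measure.finite_measure_distr)
qed

lemma cis_powi: "cis \<theta> powi k = cis (of_int k * \<theta>)"
  by (cases k rule: int_cases2) (simp_all add: power_int_minus Complex.DeMoivre cis_inverse)

lemma integral_cis_period:
  "(\<integral>\<theta>. indicator {0..2 * pi} \<theta> *\<^sub>R cis (of_int k * \<theta>) \<partial>lborel) = (if k = 0 then of_real (2 * pi) else 0)"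
proof (cases "k = 0")
  case False
  let ?F = "\<lambda>\<theta>. cis (of_int k * \<theta>) / (\<i> * of_int k)"
  have "(\<integral>\<theta>. indicator {0..2 * pi} \<theta> *\<^sub>R cis (of_int k * \<theta>) \<partial>lborel) = ?F (2 * pi) - ?F 0"
  proof (rule integral_FTC_Icc)
    show "(?F has_vector_derivative cis (of_int k * \<theta>)) (at \<theta> within {0..2 * pi})" for \<theta>
      unfolding cis_conv_exp using False
      by (auto intro!: derivative_eq_intros has_vector_derivative_real_field simp: field_simps)
    show "continuous_on {0..2 * pi} (\<lambda>\<theta>. cis (of_int k * \<theta>))" by (intro continuous_intros)
  qed simp
  also have "cis (of_int k * (2 * pi)) = 1" using cis_multiple_2pi[of "of_int k"] by (simp add: mult.commute)
  finally show ?thesis using False by simp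
qed (simp add: scaleR_conv_of_real)

lemma integral_circle_lebesgue_powi:
  "(\<integral>z. z powi k \<partial>circle_lebesgue) = (if k = 0 then of_real (2 * pi) else 0)"
proof -
  have m: "cis \<in> measurable (restrict_space lborel {0..<2 * pi}) circle_borel"
    using cis_measurable_circle by (intro measurable_restrict_space1) simp
  have "(\<integral>z. z powi k \<partial>circle_lebesgue) = (\<integral>\<theta>. cis \<theta> powi k \<partial>restrict_space lborel {0..<2 * pi})"
    unfolding circle_lebesgue_def
    by (rule integral_distr[OF m]) (rule circle_measurable_continuous[OF refl], intro continuous_intros, auto)
  also have "\<dots> = (\<integral>\<theta>. indicator {0..<2 * pi} \<theta> *\<^sub>R cis (of_int k * \<theta>) \<partial>lborel)"
    unfolding cis_powi by (rule integral_restrict_space) simp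
  also have "\<dots> = (\<integral>\<theta>. indicator {0..2 * pi} \<theta> *\<^sub>R cis (of_int k * \<theta>) \<partial>lborel)"
  proof (rule integral_cong_AE)
    have "AE \<theta> in lborel. \<theta> \<noteq> 2 * pi" by (rule AE_lborel_singleton)
    then show "AE \<theta> in lborel. indicator {0..<2 * pi} \<theta> *\<^sub>R cis (of_int k * \<theta>) = indicator {0..2 * pi} \<theta> *\<^sub>R cis (of_int k * \<theta>)"
      by eventually_elim (auto simp: indicator_def)
    have "(\<lambda>\<theta>. cis (of_int k * \<theta>)) \<in> borel_measurable lborel"
      by (simp, intro borel_measurable_continuous_onI continuous_intros)
    then show "(\<lambda>\<theta>. indicator {0..<2 * pi} \<theta> *\<^sub>R cis (of_int k * \<theta>)) \<in> borel_measurable lborel"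
      "(\<lambda>\<theta>. indicator {0..2 * pi} \<theta> *\<^sub>R cis (of_int k * \<theta>)) \<in> borel_measurable lborel"
      by (auto intro!: borel_measurable_scaleR)
  qed
  finally show ?thesis by (simp only: integral_cis_period)
qed

lemma norm_tv_sq:
  assumes z: "z \<in> sphere 0 1"
  shows "of_real ((norm (tv K c z))\<^sup>2) = (\<Sum>k\<in>K. \<Sum>l\<in>K. c k * cnj (c l) * z powi (k - l))"
proof -
  have "of_real ((norm (tv K c z))\<^sup>2) = tv K c z * cnj (tv K c z)"
    using complex_norm_square[of "tv K c z"] by simp
  also have "\<dots> = (\<Sum>k\<in>K. \<Sum>l\<in>K. (c k * z powi k) * (cnj (c l) * cnj (z powi l)))"
    by (simp add: tv_def sum_product)
  also have "\<dots> = (\<Sum>k\<in>K. \<Sum>l\<in>K. c k * cnj (c l) * z powi (k - l))"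
  proof (intro sum.cong refl)
    fix k l
    have "z powi k * z powi (- l) = z powi (k - l)" using sphere_powi_mult[OF z, of k "- l"] by simp
    then show "(c k * z powi k) * (cnj (c l) * cnj (z powi l)) = c k * cnj (c l) * z powi (k - l)"
      unfolding sphere_powi_cnj[OF z] by (simp add: mult_ac)
  qed
  finally show ?thesis .
qed

lemma continuous_powi_sphere: "continuous_on (sphere 0 1) (\<lambda>z::complex. z powi k)"
  by (intro continuous_intros) auto

lemma integral_norm_tv_sq:
  assumes \<nu>: "sets \<nu> = sets circle_borel" "finite_measure \<nu>"
  shows "of_real (tv_sq K c \<nu>) = (\<Sum>k\<in>K. \<Sum>l\<in>K. c k * cnj (c l) * (\<integral>z. z powi (k - l) \<partial>\<nu>))"
proof -
  have i: "integrable \<nu> (\<lambda>z. z powi j)" for j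
    by (rule circle_integrable_continuous[OF \<nu> continuous_powi_sphere])
  have "of_real (tv_sq K c \<nu>) = (\<integral>z. complex_of_real ((norm (tv K c z))\<^sup>2) \<partial>\<nu>)"
    by (rule integral_complex_of_real[symmetric])
  also have "\<dots> = (\<integral>z. (\<Sum>k\<in>K. \<Sum>l\<in>K. c k * cnj (c l) * z powi (k - l)) \<partial>\<nu>)"
    by (intro Bochner_Integration.integral_cong refl norm_tv_sq) (simp add: space_circle[OF \<nu>(1)])
  also have "\<dots> = (\<Sum>k\<in>K. \<Sum>l\<in>K. c k * cnj (c l) * (\<integral>z. z powi (k - l) \<partial>\<nu>))"
    using i by (simp add: Bochner_Integration.integral_sum Bochner_Integration.integrable_sum)
  finally show ?thesis .
qed

lemma card_diff_pairs:
  fixes k :: int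
  assumes "\<bar>k\<bar> \<le> int n"
  shows "card {(s, s'). s < n \<and> s' < n \<and> int s - int s' = k} = n - nat \<bar>k\<bar>"
proof -
  have "bij_betw (\<lambda>i. (i + nat k, i + nat (- k))) {..<n - nat \<bar>k\<bar>} {(s, s'). s < n \<and> s' < n \<and> int s - int s' = k}"
    by (rule bij_betw_byWitness[where f'="\<lambda>(s, s'). min s s'"]) (use assms in \<open>auto simp: min_def\<close>)
  from bij_betw_same_card[OF this] show ?thesis by (simp only: card_lessThan)
qed

section \<open>Existence and comparison of spectral measures\<close>

context unitary_action begin

text \<open>\<open>P n\<close> is the Fejer mean of the correlation sequence, and it is nonnegative
  as a multiple of a squared norm. The measures with these densities live on one bounded interval,
  hence are tight. A weak limit has the correlations as values of its characteristic function at the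
  integers, and \<open>cis\<close> carries it to the circle.\<close>

lemma herglotz_normalized:
  assumes f: "f \<in> L2" and f1: "nrm f = 1" shows "\<exists>\<nu>. spectral_measure M S f \<nu>"
proof -
  let ?c = "\<lambda>k::int. corr k f f"
  have c0: "?c 0 = 1" using corr_zero[OF f f] f1 by (simp add: inner_self)
  \<comment> \<open>The factor makes the Fourier coefficient of index k equal to 1 - |k| / (n + 1)
    times the correlation, for |k| up to n + 1; at k = 0 this is total mass 1.\<close>
  define P where "P n \<theta> = (real (Suc n) / (2 * pi)) * (bnorm (Suc n) (cis \<theta>) f)\<^sup>2" for n \<theta>
  have P0: "0 \<le> P n \<theta>" for n \<theta> by (simp add: P_def)
  have P_eq: "complex_of_real (P n \<theta>) = (\<Sum>s<Suc n. \<Sum>s'<Suc n. (1 / (2 * pi * Suc n)) * cis (of_int (int s' - int s) * \<theta>) * ?c (int s - int s'))"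
    for n \<theta>
  proof -
    have ph: "cnj (cis \<theta>) ^ s * cis \<theta> ^ s' = cis (of_int (int s' - int s) * \<theta>)" for s s' :: nat
      by (simp add: cis_cnj Complex.DeMoivre cis_mult algebra_simps)
    have "complex_of_real (P n \<theta>) = (real (Suc n) / (2 * pi)) * bform (Suc n) (cis \<theta>) f f"
      unfolding P_def inner_self by simp
    also have "\<dots> = (\<Sum>s<Suc n. \<Sum>s'<Suc n. (real (Suc n) / (2 * pi)) * (cis (of_int (int s' - int s) * \<theta>) / (of_nat (Suc n))\<^sup>2 * ?c (int s - int s')))"
      unfolding bform_eq[OF f f] ph sum_distrib_left ..
    also have "\<dots> = (\<Sum>s<Suc n. \<Sum>s'<Suc n. (1 / (2 * pi * Suc n)) * cis (of_int (int s' - int s) * \<theta>) * ?c (int s - int s'))"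
      by (intro sum.cong refl) (simp add: power2_eq_square field_simps del: of_nat_Suc)
    finally show ?thesis .
  qed
  have Pc: "continuous_on UNIV (P n)" for n
  proof -
    have "continuous_on UNIV (\<lambda>\<theta>. Re (complex_of_real (P n \<theta>)))"
      unfolding P_eq by (intro continuous_intros)
    then show ?thesis by simp
  qed
  define d where "d n \<theta> = indicator {0..2 * pi} \<theta> * P n \<theta>" for n \<theta>
  have [measurable]: "P n \<in> borel_measurable borel" for n by (rule borel_measurable_continuous_onI[OF Pc])
  have [measurable]: "d n \<in> borel_measurable borel" for n unfolding d_def by measurable
  have d0: "0 \<le> d n \<theta>" for n \<theta> using P0 by (simp add: d_def)
  have icis: "integrable lborel (\<lambda>\<theta>. indicator {0..2 * pi} \<theta> *\<^sub>R cis (of_int k * \<theta>))" for k :: int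
    by (rule borel_integrable_atLeastAtMost'[unfolded set_integrable_def]) (intro continuous_intros)
  have dint: "(\<integral>\<theta>. d n \<theta> *\<^sub>R cis (of_int k * \<theta>) \<partial>lborel) =
      (\<Sum>s<Suc n. \<Sum>s'<Suc n. (1 / (2 * pi * Suc n)) * ?c (int s - int s') * (if k = int s - int s' then of_real (2 * pi) else 0))"
    and dintegrable: "integrable lborel (\<lambda>\<theta>. d n \<theta> *\<^sub>R cis (of_int k * \<theta>))" for n k
  proof -
    have eq: "d n \<theta> *\<^sub>R cis (of_int k * \<theta>) = (\<Sum>s<Suc n. \<Sum>s'<Suc n. ((1 / (2 * pi * Suc n)) * ?c (int s - int s')) *
        (indicator {0..2 * pi} \<theta> *\<^sub>R cis (of_int (k + int s' - int s) * \<theta>)))" for \<theta>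
    proof -
      have "d n \<theta> *\<^sub>R cis (of_int k * \<theta>) = indicator {0..2 * pi} \<theta> * (complex_of_real (P n \<theta>) * cis (of_int k * \<theta>))"
        by (simp add: d_def scaleR_conv_of_real indicator_def)
      also have "\<dots> = (\<Sum>s<Suc n. \<Sum>s'<Suc n. ((1 / (2 * pi * Suc n)) * ?c (int s - int s')) *
        (indicator {0..2 * pi} \<theta> *\<^sub>R (cis (of_int (int s' - int s) * \<theta>) * cis (of_int k * \<theta>))))"
        unfolding P_eq sum_distrib_left sum_distrib_right
        by (intro sum.cong refl) (simp add: scaleR_conv_of_real indicator_def)
      finally show ?thesis by (simp add: cis_mult algebra_simps)
    qed
    show "integrable lborel (\<lambda>\<theta>. d n \<theta> *\<^sub>R cis (of_int k * \<theta>))"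
      unfolding eq by (intro Bochner_Integration.integrable_sum integrable_mult_right icis)
    have "(\<integral>\<theta>. d n \<theta> *\<^sub>R cis (of_int k * \<theta>) \<partial>lborel) =
      (\<Sum>s<Suc n. \<Sum>s'<Suc n. ((1 / (2 * pi * Suc n)) * ?c (int s - int s')) *
        (if k + int s' - int s = 0 then of_real (2 * pi) else 0))" unfolding eq
      by (subst Bochner_Integration.integral_sum, intro Bochner_Integration.integrable_sum integrable_mult_right icis,
          rule sum.cong[OF refl], subst Bochner_Integration.integral_sum, intro integrable_mult_right icis,
          rule sum.cong[OF refl]) (simp only: integral_mult_right_zero integral_cis_period)
    also have "\<dots> = (\<Sum>s<Suc n. \<Sum>s'<Suc n. (1 / (2 * pi * Suc n)) * ?c (int s - int s') * (if k = int s - int s' then of_real (2 * pi) else 0))"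
      by (intro sum.cong refl arg_cong2[of _ _ _ _ "(*)"]) auto
    finally show "(\<integral>\<theta>. d n \<theta> *\<^sub>R cis (of_int k * \<theta>) \<partial>lborel) =
      (\<Sum>s<Suc n. \<Sum>s'<Suc n. (1 / (2 * pi * Suc n)) * ?c (int s - int s') * (if k = int s - int s' then of_real (2 * pi) else 0))" .
  qed
  have dval: "(\<integral>\<theta>. d n \<theta> *\<^sub>R cis (of_int k * \<theta>) \<partial>lborel) = (of_nat (Suc n - nat \<bar>k\<bar>) / of_nat (Suc n)) * ?c k"
    if k: "\<bar>k\<bar> \<le> int (Suc n)" for n k
  proof -
    let ?Q = "{(s, s'). s < Suc n \<and> s' < Suc n \<and> int s - int s' = k}"
    have "(\<integral>\<theta>. d n \<theta> *\<^sub>R cis (of_int k * \<theta>) \<partial>lborel) =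
      (\<Sum>(s, s')\<in>{..<Suc n} \<times> {..<Suc n}. if int s - int s' = k then (1 / of_nat (Suc n)) * ?c k else 0)"
      unfolding dint sum.cartesian_product proof (rule sum.cong[OF refl], clarify)
      fix s s'
      show "(1 / (2 * pi * Suc n)) * ?c (int s - int s') * (if k = int s - int s' then of_real (2 * pi) else 0)
         = (if int s - int s' = k then (1 / of_nat (Suc n)) * ?c k else 0)"
        by (cases "k = int s - int s'") (simp_all del: of_nat_Suc)
    qed
    also have "\<dots> = (\<Sum>(s, s')\<in>?Q. (1 / of_nat (Suc n)) * ?c k)"
      by (rule sum.mono_neutral_cong_right) (auto split: if_splits)
    also have "\<dots> = of_nat (card ?Q) * ((1 / of_nat (Suc n)) * ?c k)"
      by (simp only: split_def sum_constant)
    finally show ?thesis unfolding card_diff_pairs[OF k] by simp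
  qed
  define \<mu> where "\<mu> n = density lborel (\<lambda>\<theta>. ennreal (d n \<theta>))" for n
  have idn: "integrable lborel (d n)" and dn1: "(\<integral>\<theta>. d n \<theta> \<partial>lborel) = 1" for n
  proof -
    have "integrable lborel (\<lambda>\<theta>. Re (d n \<theta> *\<^sub>R cis (of_int 0 * \<theta>)))" by (rule integrable_Re[OF dintegrable])
    then show "integrable lborel (d n)" by simp
    have "complex_of_real (\<integral>\<theta>. d n \<theta> \<partial>lborel) = (\<integral>\<theta>. d n \<theta> *\<^sub>R cis (of_int 0 * \<theta>) \<partial>lborel)"
      by (simp add: scaleR_conv_of_real)
    also have "\<dots> = 1" by (subst dval) (simp_all add: c0 del: of_nat_Suc)
    finally show "(\<integral>\<theta>. d n \<theta> \<partial>lborel) = 1" by (simp only: of_real_eq_1_iff)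
  qed
  have em1: "emeasure (\<mu> n) UNIV = 1" for n
  proof -
    have "emeasure (\<mu> n) UNIV = (\<integral>\<^sup>+\<theta>. ennreal (d n \<theta>) \<partial>lborel)" unfolding \<mu>_def by (subst emeasure_density) auto
    also have "\<dots> = ennreal (\<integral>\<theta>. d n \<theta> \<partial>lborel)" by (rule nn_integral_eq_integral[OF idn]) (use d0 in simp)
    finally show ?thesis by (simp add: dn1)
  qed
  have rd: "real_distribution (\<mu> n)" for n
  proof -
    have "prob_space (\<mu> n)" by (rule prob_spaceI) (use em1 in \<open>simp add: \<mu>_def\<close>)
    then show ?thesis by (simp add: real_distribution_def real_distribution_axioms_def \<mu>_def)
  qed
  \<comment> \<open>Tightness is formulated with half-open intervals; this one contains
    \<open>{0..2 * pi}\<close>.\<close>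
  have supp: "measure (\<mu> n) {-1<..7} = 1" for n
  proof -
    have pi4: "2 * pi \<le> 7" using pi_approx by simp
    have "emeasure (\<mu> n) {-1<..7} = (\<integral>\<^sup>+\<theta>. ennreal (d n \<theta>) * indicator {-1<..7} \<theta> \<partial>lborel)"
      unfolding \<mu>_def by (subst emeasure_density) auto
    also have "\<dots> = (\<integral>\<^sup>+\<theta>. ennreal (d n \<theta>) \<partial>lborel)"
      by (intro nn_integral_cong) (use pi4 in \<open>auto simp: d_def indicator_def\<close>)
    also have "\<dots> = ennreal (\<integral>\<theta>. d n \<theta> \<partial>lborel)" by (rule nn_integral_eq_integral[OF idn]) (use d0 in simp)
    finally show ?thesis by (simp add: dn1 measure_def)
  qed
  have "tight \<mu>" unfolding tight_def
  proof (intro conjI allI impI)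
    show "real_distribution (\<mu> n)" for n by (rule rd)
    fix \<epsilon> :: real assume "0 < \<epsilon>"
    then show "\<exists>a b::real. a < b \<and> (\<forall>n. 1 - \<epsilon> < measure (\<mu> n) {a<..b})"
      by (intro exI[of _ "-1"] exI[of _ "7::real"]) (simp add: supp)
  qed
  from tight_imp_convergent_subsubsequence[OF this strict_mono_id]
  obtain r M' where r: "strict_mono (r :: nat \<Rightarrow> nat)" "real_distribution M'" "weak_conv_m (\<mu> \<circ> id \<circ> r) M'" by blast
  interpret M': real_distribution M' by (rule r(2))
  have char_lim: "(\<lambda>n. char (\<mu> (r n)) t) \<longlonglongrightarrow> char M' t" for t
    using levy_continuity1[of "\<mu> \<circ> id \<circ> r" M' t] rd r by (simp add: comp_def)
  have iexp: "iexp x = cis x" for x by (simp add: cis_conv_exp mult.commute)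
  have char_val: "char (\<mu> n) (of_int k) = (\<integral>\<theta>. d n \<theta> *\<^sub>R cis (of_int k * \<theta>) \<partial>lborel)" for n k
  proof -
    have "(\<lambda>\<theta>. cis (of_int k * \<theta>)) \<in> borel_measurable lborel"
      by (simp, intro borel_measurable_continuous_onI continuous_intros)
    then show ?thesis unfolding char_def iexp \<mu>_def by (rule integral_density) (use d0 in auto)
  qed
  have charM: "char M' (of_int k) = ?c k" for k :: int
  proof -
    have "(\<lambda>n. char (\<mu> n) (of_int k)) \<longlonglongrightarrow> 1 * ?c k"
    proof (rule Lim_transform_eventually)
      have "(\<lambda>n. 1 - real (nat \<bar>k\<bar>) / real (Suc n)) \<longlonglongrightarrow> 1 - 0"
        by (intro tendsto_intros LIMSEQ_Suc[OF lim_const_over_n])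
      then have "(\<lambda>n. complex_of_real (1 - real (nat \<bar>k\<bar>) / real (Suc n))) \<longlonglongrightarrow> of_real (1 - 0)"
        by (rule tendsto_of_real)
      then show "(\<lambda>n. complex_of_real (1 - real (nat \<bar>k\<bar>) / real (Suc n)) * ?c k) \<longlonglongrightarrow> 1 * ?c k"
        by (intro tendsto_intros) simp
      show "\<forall>\<^sub>F n in sequentially. complex_of_real (1 - real (nat \<bar>k\<bar>) / real (Suc n)) * ?c k = char (\<mu> n) (of_int k)"
      proof (rule eventually_sequentiallyI[of "nat \<bar>k\<bar>"])
        fix n assume n: "nat \<bar>k\<bar> \<le> n"
        then have k: "\<bar>k\<bar> \<le> int (Suc n)" by linarith
        have "real (Suc n - nat \<bar>k\<bar>) / real (Suc n) = 1 - real (nat \<bar>k\<bar>) / real (Suc n)"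
          using n by (simp add: of_nat_diff diff_divide_distrib del: of_nat_Suc)
        then have "complex_of_real (1 - real (nat \<bar>k\<bar>) / real (Suc n)) = of_nat (Suc n - nat \<bar>k\<bar>) / of_nat (Suc n)"
          by (metis of_real_divide of_real_of_nat_eq)
        then show "complex_of_real (1 - real (nat \<bar>k\<bar>) / real (Suc n)) * ?c k = char (\<mu> n) (of_int k)"
          unfolding char_val dval[OF k] by simp
      qed
    qed
    then have "(\<lambda>n. char (\<mu> (r n)) (of_int k)) \<longlonglongrightarrow> ?c k"
      using LIMSEQ_subseq_LIMSEQ[OF _ r(1)] by (fastforce simp: comp_def)
    with char_lim show ?thesis by (rule LIMSEQ_unique)
  qed
  define \<nu> where "\<nu> = distr M' circle_borel cis"
  have mc: "cis \<in> measurable M' circle_borel" using cis_measurable_circle by simp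
  have "spectral_measure M S f \<nu>" unfolding spectral_measure_def
  proof (intro conjI allI)
    show "sets \<nu> = sets circle_borel" by (simp add: \<nu>_def)
    show "finite_measure \<nu>" unfolding \<nu>_def by (rule M'.finite_measure_distr[OF mc])
    fix k :: int
    have "(\<integral>z. z powi k \<partial>\<nu>) = (\<integral>\<theta>. cis \<theta> powi k \<partial>M')" unfolding \<nu>_def
      by (rule integral_distr[OF mc]) (rule circle_measurable_continuous[OF refl continuous_powi_sphere])
    also have "\<dots> = char M' (of_int k)" unfolding char_def iexp cis_powi ..
    finally show "(\<integral>z. z powi k \<partial>\<nu>) = ?c k" by (simp add: charM)
  qed
  then show ?thesis by blast
qed

lemma herglotz:
  assumes f: "f \<in> L2" shows "\<exists>\<nu>. spectral_measure M S f \<nu>"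
proof (cases "nrm f = 0")
  case True
  have "corr k f f = 0" for k using corr_bound[OF f f, of k] True by simp
  then have "spectral_measure M S f (null_measure circle_borel)"
    by (auto simp: spectral_measure_def intro!: finite_measureI)
  then show ?thesis by blast
next
  case False
  define a where "a = nrm f"
  have a: "a > 0" using False L2_norm_nonneg[of M f] unfolding a_def by linarith
  define f1 where "f1 = (\<lambda>x. of_real (1 / a) * f x)"
  have f1L: "f1 \<in> L2" unfolding f1_def using f by (rule L2_scale)
  have "norm (complex_of_real (1 / a)) = 1 / a" unfolding norm_of_real using a by simp
  then have "nrm f1 = 1" unfolding f1_def L2_norm_scale a_def[symmetric] using a by simp
  from herglotz_normalized[OF f1L this] obtain \<nu> where \<nu>: "spectral_measure M S f1 \<nu>" by blast
  interpret N: finite_measure \<nu> using \<nu> by (simp add: spectral_measure_def)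
  have s: "sets \<nu> = sets circle_borel" using \<nu> by (simp add: spectral_measure_def)
  define \<nu>' where "\<nu>' = density \<nu> (\<lambda>_. ennreal (a\<^sup>2))"
  have "spectral_measure M S f \<nu>'" unfolding spectral_measure_def
  proof (intro conjI allI)
    show "sets \<nu>' = sets circle_borel" by (simp add: \<nu>'_def s)
    show "finite_measure \<nu>'" unfolding \<nu>'_def
      by (rule finite_measureI) (simp add: emeasure_density ennreal_mult_eq_top_iff N.emeasure_eq_measure)
    fix k :: int
    have "(\<integral>z. z powi k \<partial>\<nu>') = (\<integral>z. a\<^sup>2 *\<^sub>R z powi k \<partial>\<nu>)" unfolding \<nu>'_def
      by (rule integral_density) (auto intro!: circle_measurable_continuous[OF s continuous_powi_sphere])
    also have "\<dots> = a\<^sup>2 *\<^sub>R corr k f1 f1" using \<nu> by (simp add: spectral_measure_def)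
    also have "U k f1 = (\<lambda>x. of_real (1 / a) * U k f x)" by (simp add: koopman_def f1_def)
    also have "a\<^sup>2 *\<^sub>R inn (\<lambda>x. of_real (1 / a) * U k f x) f1 = corr k f f"
      unfolding f1_def inner_scale_left inner_scale_right using a
      by (simp add: scaleR_conv_of_real power2_eq_square)
    finally show "(\<integral>z. z powi k \<partial>\<nu>') = corr k f f" .
  qed
  then show ?thesis by blast
qed

text \<open>On trigonometric polynomials this is the isometry between the cyclic space of
  \<open>f\<close> and the square-integrable functions for \<open>\<nu>\<close>.\<close>

lemma norm_tp_sq:
  assumes f: "f \<in> L2" and \<nu>: "spectral_measure M S f \<nu>"
  shows "(nrm (tp K c f))\<^sup>2 = (tv_sq K c \<nu>)"
proof -
  have "inn (tp K c f) (tp K c f) = (\<Sum>k\<in>K. inn (\<lambda>x. c k * U k f x) (tp K c f))"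
    unfolding tp_def[abs_def] by (rule inner_sum_left) (use f in \<open>auto intro!: L2_sum L2_scale\<close>)
  also have "\<dots> = (\<Sum>k\<in>K. \<Sum>l\<in>K. inn (\<lambda>x. c k * U k f x) (\<lambda>x. c l * U l f x))"
    unfolding tp_def[abs_def] by (intro sum.cong refl inner_sum_right) (use f in \<open>auto intro!: L2_sum L2_scale\<close>)
  also have "\<dots> = (\<Sum>k\<in>K. \<Sum>l\<in>K. c k * cnj (c l) * (\<integral>z. z powi (k - l) \<partial>\<nu>))"
    unfolding inner_scale_left inner_scale_right inner_koopman2[OF f f]
    by (intro sum.cong refl) (use \<nu> in \<open>simp add: spectral_measure_def\<close>)
  also have "\<dots> = of_real (tv_sq K c \<nu>)"
    using \<nu> by (intro integral_norm_tv_sq[symmetric]) (auto simp: spectral_measure_def)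
  finally show ?thesis unfolding inner_self of_real_eq_iff .
qed

lemma norm_tp_le_2:
  assumes f: "f \<in> L2" and b: "\<And>z. z \<in> sphere 0 1 \<Longrightarrow> norm (tv K c z) \<le> 2"
  shows "nrm (tp K c f) \<le> 2 * nrm f"
proof -
  obtain \<nu> where \<nu>: "spectral_measure M S f \<nu>" using herglotz[OF f] by blast
  have s: "sets \<nu> = sets circle_borel" "finite_measure \<nu>" using \<nu> by (auto simp: spectral_measure_def)
  interpret N: finite_measure \<nu> by (rule s(2))
  have "complex_of_real (measure \<nu> (space \<nu>)) = (\<integral>z. z powi 0 \<partial>\<nu>)"
    by (simp add: scaleR_conv_of_real)
  also have "\<dots> = inn f f" using \<nu> corr_zero[OF f f] unfolding spectral_measure_def by metis
  finally have m: "measure \<nu> (space \<nu>) = (nrm f)\<^sup>2" unfolding inner_self of_real_eq_iff .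
  have "(nrm (tp K c f))\<^sup>2 = (tv_sq K c \<nu>)" by (rule norm_tp_sq[OF f \<nu>])
  also have "\<dots> \<le> (\<integral>z. 2\<^sup>2 \<partial>\<nu>)"
  proof (rule integral_mono)
    fix z assume "z \<in> space \<nu>"
    then show "(norm (tv K c z))\<^sup>2 \<le> 2\<^sup>2" using b[of z] space_circle[OF s(1)] by (intro power_mono) auto
  qed (auto intro: circle_integrable_continuous[OF s continuous_norm_tv_sq])
  also have "\<dots> = (2 * nrm f)\<^sup>2" by (simp add: m power_mult_distrib mult.commute)
  finally show ?thesis by (rule power2_le_imp_le) simp
qed

lemma tp_diff: "tp K c (\<lambda>x. f x - g x) = (\<lambda>x. tp K c f x - tp K c g x)"
  by (simp add: tp_def koopman_def fun_eq_iff sum_subtractf algebra_simps)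

text \<open>With X and Y the norms of \<open>tp K c f\<close> and \<open>tp K c g\<close>, the
  triangle inequality gives X at most Y plus twice the distance of \<open>f\<close> and
  \<open>g\<close>. Since Y is at most \<open>2 * nrm g\<close>, squaring leaves a bound on X^2 that
  is linear in Y, the shape \<open>circle_measure_le_of_trig\<close> asks for. It serves to pass
  absolute continuity to limits of vectors.\<close>

lemma spectral_null_close:
  assumes f: "f \<in> L2" and g: "g \<in> L2"
    and \<nu>: "spectral_measure M S f \<nu>" and \<rho>: "spectral_measure M S g \<rho>" and A: "A \<in> null_sets \<rho>"
  shows "emeasure \<nu> A \<le> ennreal (4 * (nrm (\<lambda>x. f x - g x))\<^sup>2)"
proof -
  define \<delta> where "\<delta> = nrm (\<lambda>x. f x - g x)"
  have \<delta>: "0 \<le> \<delta>" by (simp add: \<delta>_def)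
  have fg: "(\<lambda>x. f x - g x) \<in> L2" using f g by auto
  show ?thesis unfolding \<delta>_def[symmetric]
  proof (rule circle_measure_le_of_trig[where C="2 * nrm g + 4 * \<delta>"])
    show "sets \<nu> = sets circle_borel" "finite_measure \<nu>" "sets \<rho> = sets circle_borel" "finite_measure \<rho>"
      using \<nu> \<rho> by (auto simp: spectral_measure_def)
    fix K c assume K: "finite K" and b: "\<And>z. z \<in> sphere 0 1 \<Longrightarrow> norm (tv K c z) \<le> 2"
    define X where "X = nrm (tp K c f)"
    define Y where "Y = nrm (tp K c g)"
    have "X \<le> Y + nrm (\<lambda>x. tp K c f x - tp K c g x)"
      unfolding X_def Y_def using f g by (intro L2_norm_le_add_diff) auto
    also have "nrm (\<lambda>x. tp K c f x - tp K c g x) \<le> 2 * \<delta>"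
      unfolding tp_diff[symmetric] \<delta>_def by (rule norm_tp_le_2[OF fg b])
    finally have "X \<le> Y + 2 * \<delta>" by simp
    then have "X\<^sup>2 \<le> (Y + 2 * \<delta>)\<^sup>2" by (intro power_mono) (auto simp: X_def)
    also have "\<dots> = Y * Y + 4 * \<delta> * Y + 4 * \<delta>\<^sup>2" by (simp add: power2_eq_square algebra_simps)
    also have "Y * Y \<le> 2 * nrm g * Y" unfolding Y_def by (intro mult_right_mono norm_tp_le_2[OF g b]) auto
    finally have "X\<^sup>2 \<le> (2 * nrm g + 4 * \<delta>) * Y + 4 * \<delta>\<^sup>2" by (simp add: algebra_simps)
    moreover have "Y = sqrt (tv_sq K c \<rho>)"
      unfolding norm_tp_sq[OF g \<rho>, symmetric] Y_def by simp
    ultimately show "(tv_sq K c \<nu>) \<le> (2 * nrm g + 4 * \<delta>) * sqrt (tv_sq K c \<rho>) + 4 * \<delta>\<^sup>2"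
      unfolding norm_tp_sq[OF f \<nu>, symmetric] X_def by simp
  qed (use \<delta> A in auto)
qed

lemma tp_commute_AE:
  assumes "finite J" "finite K" shows "AE x in M. tp K c (tp J d f) x = tp J d (tp K c f) x"
proof -
  have "AE x in M. \<forall>k\<in>K. \<forall>j\<in>J. U k (U j f) x = U j (U k f) x"
  proof (intro AE_finite_allI assms)
    fix j k show "AE x in M. U k (U j f) x = U j (U k f) x"
      using koopman_koopman_AE[of k j f] koopman_koopman_AE[of j k f] by eventually_elim (simp add: add.commute)
  qed
  then show ?thesis
  proof eventually_elim
    case (elim x)
    have "tp K c (tp J d f) x = (\<Sum>k\<in>K. \<Sum>j\<in>J. c k * (d j * U k (U j f) x))"
      by (simp add: tp_def koopman_def sum_distrib_left)
    also have "\<dots> = (\<Sum>k\<in>K. \<Sum>j\<in>J. d j * (c k * U j (U k f) x))"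
    proof (intro sum.cong refl)
      fix k j assume "k \<in> K" "j \<in> J"
      then have e: "U k (U j f) x = U j (U k f) x" using elim by blast
      show "c k * (d j * U k (U j f) x) = d j * (c k * U j (U k f) x)"
        unfolding e by (rule mult.left_commute)
    qed
    also have "\<dots> = (\<Sum>j\<in>J. \<Sum>k\<in>K. d j * (c k * U j (U k f) x))" by (rule sum.swap)
    also have "\<dots> = tp J d (tp K c f) x" by (simp add: tp_def koopman_def sum_distrib_left)
    finally show ?case .
  qed
qed

lemma norm_tp_le: "f \<in> L2 \<Longrightarrow> nrm (tp J d f) \<le> (\<Sum>j\<in>J. norm (d j)) * nrm f"
proof -
  assume f: "f \<in> L2"
  have "nrm (tp J d f) \<le> (\<Sum>j\<in>J. nrm (\<lambda>x. d j * U j f x))"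
    unfolding tp_def[abs_def] using f by (intro L2_norm_sum_le L2_scale koopman_L2)
  then show ?thesis unfolding L2_norm_scale norm_koopman[OF f] sum_distrib_right .
qed

text \<open>An element of the algebraic span is \<open>tp J d e\<close>. Operators of this kind
  commute almost everywhere, so \<open>tp K c\<close> of it is bounded by a constant times
  \<open>tp K c e\<close>, which gives absolute continuity. \<open>spectral_null_close\<close>
  extends this to the closure.\<close>

lemma spectral_ac_cyclic:
  assumes e: "e \<in> L2" and f: "f \<in> cycZ e"
    and \<nu>: "spectral_measure M S f \<nu>" and \<rho>: "spectral_measure M S e \<rho>"
  shows "absolutely_continuous \<rho> \<nu>" unfolding absolutely_continuous_def
proof
  fix A assume A: "A \<in> null_sets \<rho>"
  have fL: "f \<in> L2" using f cycZ_L2 by blast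
  have le: "emeasure \<nu> A \<le> 0 + ennreal \<epsilon>" if eps: "0 < \<epsilon>" for \<epsilon>
  proof -
    obtain g where g: "g \<in> cyc e" "nrm (\<lambda>x. f x - g x) < sqrt (\<epsilon> / 4)"
    proof -
      have "0 < sqrt (\<epsilon> / 4)" using eps by simp
      then show ?thesis using f that unfolding cycZ_def L2_closure_iff by blast
    qed
    have gL: "g \<in> L2" using g cyc_L2[OF e] by blast
    obtain J d where J: "finite J" "g = tp J d e" by (rule cyc_tp[OF g(1)])
    obtain \<gamma> where \<gamma>: "spectral_measure M S g \<gamma>" using herglotz[OF gL] by blast
    define B where "B = (\<Sum>j\<in>J. norm (d j))"
    have B: "0 \<le> B" by (simp add: B_def sum_nonneg)
    have "absolutely_continuous \<rho> \<gamma>"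
    proof (rule circle_ac_of_trig[where C="B\<^sup>2 * (2 * nrm e)"])
      show "sets \<gamma> = sets circle_borel" "finite_measure \<gamma>" "sets \<rho> = sets circle_borel" "finite_measure \<rho>"
        using \<gamma> \<rho> by (auto simp: spectral_measure_def)
      fix K c assume K: "finite K" and b: "\<And>z. z \<in> sphere 0 1 \<Longrightarrow> norm (tv K c z) \<le> 2"
      define Y where "Y = nrm (tp K c e)"
      have "nrm (tp K c g) = nrm (tp J d (tp K c e))"
        unfolding J(2) using e by (intro L2_norm_cong_AE tp_commute_AE J K L2_measurable tp_L2)
      also have "\<dots> \<le> B * Y" unfolding B_def Y_def using e by (intro norm_tp_le tp_L2)
      finally have "(nrm (tp K c g))\<^sup>2 \<le> (B * Y)\<^sup>2" by (intro power_mono) auto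
      also have "\<dots> = B\<^sup>2 * (Y * Y)" by (simp add: power2_eq_square)
      also have "\<dots> \<le> B\<^sup>2 * (2 * nrm e * Y)"
        unfolding Y_def by (intro mult_left_mono mult_right_mono norm_tp_le_2[OF e b]) auto
      finally have "(nrm (tp K c g))\<^sup>2 \<le> B\<^sup>2 * (2 * nrm e) * Y" by simp
      moreover have "Y = sqrt (tv_sq K c \<rho>)"
        unfolding norm_tp_sq[OF e \<rho>, symmetric] Y_def by simp
      ultimately show "(\<integral>z. (norm (tv K c z))\<^sup>2 \<partial>\<gamma>) \<le> B\<^sup>2 * (2 * nrm e) * sqrt (tv_sq K c \<rho>)"
        unfolding norm_tp_sq[OF gL \<gamma>, symmetric] by simp
    qed (use B in simp)
    then have "A \<in> null_sets \<gamma>" using A unfolding absolutely_continuous_def by blast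
    then have "emeasure \<nu> A \<le> ennreal (4 * (nrm (\<lambda>x. f x - g x))\<^sup>2)"
      by (rule spectral_null_close[OF fL gL \<nu> \<gamma>])
    also have "\<dots> \<le> ennreal \<epsilon>"
    proof (rule ennreal_leI)
      have "(nrm (\<lambda>x. f x - g x))\<^sup>2 \<le> (sqrt (\<epsilon> / 4))\<^sup>2" using g(2) by (intro power_mono) auto
      then show "4 * (nrm (\<lambda>x. f x - g x))\<^sup>2 \<le> \<epsilon>" using eps by simp
    qed
    finally show ?thesis by simp
  qed
  have "emeasure \<nu> A \<le> 0"
  proof (rule ennreal_le_epsilon)
    fix \<epsilon> :: real assume "0 < \<epsilon>"
    then show "emeasure \<nu> A \<le> 0 + ennreal \<epsilon>" by (rule le)
  qed
  then show "A \<in> null_sets \<nu>" using A \<nu> \<rho> by (auto simp: null_sets_def spectral_measure_def)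
qed

lemma maximal_spectral_type_cyclic:
  assumes e: "e \<in> L2_0" and cyc_e: "L2_0 \<subseteq> cycZ e" and \<rho>: "spectral_measure M S e \<rho>"
  shows "maximal_spectral_type M S \<rho>" unfolding maximal_spectral_type_def
proof (intro conjI ballI)
  have eL: "e \<in> L2" using e L2_zero_mean_L2 by blast
  show "sets \<rho> = sets circle_borel" "finite_measure \<rho>" using \<rho> by (auto simp: spectral_measure_def)
  show "\<exists>\<nu>. spectral_measure M S f \<nu> \<and> absolutely_continuous \<rho> \<nu>" if f: "f \<in> L2_0" for f
  proof -
    obtain \<nu> where \<nu>: "spectral_measure M S f \<nu>" using herglotz[OF L2_zero_mean_L2[OF f]] by blast
    have "f \<in> cycZ e" using f cyc_e by blast
    from spectral_ac_cyclic[OF eL this \<nu> \<rho>] \<nu> show ?thesis by blast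
  qed
  show "\<exists>f\<in>L2_0. \<exists>\<nu>. spectral_measure M S f \<nu> \<and> absolutely_continuous \<nu> \<rho>"
    using e \<rho> by (auto simp: absolutely_continuous_def)
qed

end

section \<open>Convolution on the circle and square-summable Fourier coefficients\<close>

lemma circle_mult_measurable:
  assumes "sets \<mu> = sets circle_borel" "sets \<nu> = sets circle_borel"
  shows "(\<lambda>(z, w). z * w) \<in> measurable (\<mu> \<Otimes>\<^sub>M \<nu>) circle_borel"
proof -
  have id: "(\<lambda>z. z) \<in> borel_measurable \<mu>" "(\<lambda>z. z) \<in> borel_measurable \<nu>"
    using assms by (auto intro!: circle_measurable_continuous continuous_intros)
  have "(\<lambda>p. fst p * snd p) \<in> borel_measurable (\<mu> \<Otimes>\<^sub>M \<nu>)"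
    by (intro borel_measurable_times measurable_compose[OF measurable_fst id(1)] measurable_compose[OF measurable_snd id(2)])
  moreover have "fst p * snd p \<in> sphere 0 1" if "p \<in> space (\<mu> \<Otimes>\<^sub>M \<nu>)" for p
    using that by (auto simp: space_pair_measure space_circle[OF assms(1)] space_circle[OF assms(2)] norm_mult)
  ultimately show ?thesis unfolding circle_borel_def split_def by (intro measurable_restrict_space2) auto
qed

lemma sets_circle_convolution [simp]: "sets (circle_convolution \<mu> \<nu>) = sets circle_borel"
  by (simp add: circle_convolution_def)

lemma finite_circle_convolution:
  assumes "sets \<mu> = sets circle_borel" "sets \<nu> = sets circle_borel" "finite_measure \<mu>" "finite_measure \<nu>"
  shows "finite_measure (circle_convolution \<mu> \<nu>)"
proof -
  interpret A: finite_measure \<mu> by fact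
  interpret B: finite_measure \<nu> by fact
  have "finite_measure (\<mu> \<Otimes>\<^sub>M \<nu>)"
    by (intro finite_measureI) (auto simp: space_pair_measure B.emeasure_pair_measure_Times
        A.emeasure_eq_measure B.emeasure_eq_measure ennreal_mult_eq_top_iff)
  then show ?thesis unfolding circle_convolution_def
    by (intro finite_measure.finite_measure_distr circle_mult_measurable assms)
qed

lemma integral_circle_convolution_powi:
  assumes \<mu>: "sets \<mu> = sets circle_borel" "finite_measure \<mu>" and \<nu>: "sets \<nu> = sets circle_borel" "finite_measure \<nu>"
  shows "(\<integral>z. z powi k \<partial>circle_convolution \<mu> \<nu>) = (\<integral>z. z powi k \<partial>\<mu>) * (\<integral>z. z powi k \<partial>\<nu>)"
proof -
  interpret A: finite_measure \<mu> by fact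
  interpret B: finite_measure \<nu> by fact
  interpret P: pair_sigma_finite \<mu> \<nu> ..
  interpret AB: finite_measure "\<mu> \<Otimes>\<^sub>M \<nu>"
    by (intro finite_measureI) (auto simp: space_pair_measure B.emeasure_pair_measure_Times
        A.emeasure_eq_measure B.emeasure_eq_measure ennreal_mult_eq_top_iff)
  have m: "(\<lambda>z. z powi k) \<in> borel_measurable \<mu>" "(\<lambda>z. z powi k) \<in> borel_measurable \<nu>" "(\<lambda>z. z powi k) \<in> borel_measurable circle_borel"
    using \<mu> \<nu> by (auto intro!: circle_measurable_continuous continuous_powi_sphere)
  have "(\<integral>z. z powi k \<partial>circle_convolution \<mu> \<nu>) = (\<integral>p. (case p of (z, w) \<Rightarrow> z * w) powi k \<partial>(\<mu> \<Otimes>\<^sub>M \<nu>))"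
    unfolding circle_convolution_def by (rule integral_distr[OF circle_mult_measurable[OF \<mu>(1) \<nu>(1)] m(3)])
  also have "\<dots> = (\<integral>p. (case p of (z, w) \<Rightarrow> z powi k * w powi k) \<partial>(\<mu> \<Otimes>\<^sub>M \<nu>))"
    by (intro Bochner_Integration.integral_cong refl) (auto simp: power_int_mult_distrib)
  also have "\<dots> = (\<integral>z. (\<integral>w. z powi k * w powi k \<partial>\<nu>) \<partial>\<mu>)"
  proof -
    have "(\<lambda>p. fst p powi k * snd p powi k) \<in> borel_measurable (\<mu> \<Otimes>\<^sub>M \<nu>)"
      by (intro borel_measurable_times measurable_compose[OF measurable_fst m(1)] measurable_compose[OF measurable_snd m(2)])
    then have "integrable (\<mu> \<Otimes>\<^sub>M \<nu>) (\<lambda>(z, w). z powi k * w powi k)"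
      by (intro AB.integrable_const_bound[where B=1] AE_I2)
         (auto simp: split_def space_pair_measure space_circle[OF \<mu>(1)] space_circle[OF \<nu>(1)] norm_mult norm_power_int)
    from P.integral_fst'[OF this] show ?thesis by simp
  qed
  also have "\<dots> = (\<integral>z. z powi k \<partial>\<mu>) * (\<integral>z. z powi k \<partial>\<nu>)" by simp
  finally show ?thesis .
qed

lemma integral_tv:
  assumes \<nu>: "sets \<nu> = sets circle_borel" "finite_measure \<nu>"
  shows "(\<integral>z. tv K c z \<partial>\<nu>) = (\<Sum>k\<in>K. c k * (\<integral>z. z powi k \<partial>\<nu>))"
  unfolding tv_def using circle_integrable_continuous[OF \<nu> continuous_powi_sphere]
  by (simp add: Bochner_Integration.integral_sum)

lemma integral_circle_lebesgue_tv_sq: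
  "(tv_sq K c circle_lebesgue) = 2 * pi * (\<Sum>k\<in>K. (norm (c k))\<^sup>2)"
proof (cases "finite K")
  case True
  have "complex_of_real (tv_sq K c circle_lebesgue) =
      (\<Sum>k\<in>K. \<Sum>l\<in>K. c k * cnj (c l) * (if k - l = 0 then of_real (2 * pi) else 0))"
    unfolding integral_norm_tv_sq[OF sets_circle_lebesgue finite_circle_lebesgue] integral_circle_lebesgue_powi ..
  also have "\<dots> = (\<Sum>k\<in>K. \<Sum>l\<in>K. if l = k then c k * cnj (c k) * of_real (2 * pi) else 0)"
    by (intro sum.cong refl) auto
  also have "\<dots> = (\<Sum>k\<in>K. c k * cnj (c k) * of_real (2 * pi))" using True by simp
  also have "\<dots> = complex_of_real (2 * pi * (\<Sum>k\<in>K. (norm (c k))\<^sup>2))"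
    by (simp add: sum_distrib_left mult.commute flip: complex_norm_square)
  finally show ?thesis unfolding of_real_eq_iff .
qed (simp add: tv_def)

text \<open>If p is a trigonometric polynomial bounded by 2, then |p|^2 is again one, say with
  coefficients \<open>d\<close>. Parseval bounds the square sum of \<open>d\<close> by
  \<open>4 / (2 * pi)\<close> times the Lebesgue integral of |p|^2, and Cauchy-Schwarz against the
  coefficients of \<open>\<nu>\<close> yields the hypothesis of \<open>circle_ac_of_trig\<close>. No
  density is constructed.\<close>

lemma circle_ac_of_square_summable:
  assumes \<nu>: "sets \<nu> = sets circle_borel" "finite_measure \<nu>"
    and B: "\<And>K. finite K \<Longrightarrow> (\<Sum>k\<in>K. (norm (\<integral>z. z powi k \<partial>\<nu>))\<^sup>2) \<le> B"
  shows "absolutely_continuous circle_lebesgue \<nu>"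
proof (rule circle_ac_of_trig[OF \<nu> sets_circle_lebesgue finite_circle_lebesgue, where C="sqrt (4 / (2 * pi)) * sqrt B"])
  have B0: "0 \<le> B" using B[of "{}"] by simp
  then show "0 \<le> sqrt (4 / (2 * pi)) * sqrt B" by simp
  fix K c assume K: "finite K" and b: "\<And>z. z \<in> sphere 0 1 \<Longrightarrow> norm (tv K c z) \<le> 2"
  have "trigpoly (\<lambda>z. tv K c z * cnj (tv K c z))" by (intro trigpoly_mult trigpoly_cnj trigpoly_tv)
  then obtain J d where J: "finite J" "\<forall>z\<in>sphere 0 1. tv K c z * cnj (tv K c z) = tv J d z"
    unfolding trigpoly_def by blast
  have sq: "of_real ((norm (tv K c z))\<^sup>2) = tv J d z" if "z \<in> sphere 0 1" for z
    using J(2) that complex_norm_square[of "tv K c z"] by simp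
  have "complex_of_real (tv_sq K c \<nu>) = (\<integral>z. complex_of_real ((norm (tv K c z))\<^sup>2) \<partial>\<nu>)"
    by (rule integral_complex_of_real[symmetric])
  also have "\<dots> = (\<integral>z. tv J d z \<partial>\<nu>)"
    by (intro Bochner_Integration.integral_cong refl sq) (simp add: space_circle[OF \<nu>(1)])
  also have "\<dots> = (\<Sum>k\<in>J. d k * (\<integral>z. z powi k \<partial>\<nu>))" by (rule integral_tv[OF \<nu>])
  finally have "norm (complex_of_real (tv_sq K c \<nu>)) = norm (\<Sum>k\<in>J. d k * (\<integral>z. z powi k \<partial>\<nu>))" by simp
  then have "(tv_sq K c \<nu>) \<le> norm (\<Sum>k\<in>J. d k * (\<integral>z. z powi k \<partial>\<nu>))"
    unfolding norm_of_real by linarith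
  also have "\<dots> \<le> (\<Sum>k\<in>J. norm (d k) * norm (\<integral>z. z powi k \<partial>\<nu>))"
    by (rule sum_norm_le) (simp add: norm_mult)
  also have "\<dots> \<le> sqrt (\<Sum>k\<in>J. (norm (d k))\<^sup>2) * sqrt B"
    by (rule sum_mult_le_sqrt) (use B[OF J(1)] B0 in \<open>simp_all add: sum_nonneg\<close>)
  also have "(\<Sum>k\<in>J. (norm (d k))\<^sup>2) \<le> 4 / (2 * pi) * (tv_sq K c circle_lebesgue)"
  proof -
    have "2 * pi * (\<Sum>k\<in>J. (norm (d k))\<^sup>2) = (\<integral>z. (norm (tv J d z))\<^sup>2 \<partial>circle_lebesgue)"
      by (rule integral_circle_lebesgue_tv_sq[symmetric])
    also have "\<dots> \<le> (\<integral>z. 4 * (norm (tv K c z))\<^sup>2 \<partial>circle_lebesgue)"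
    proof (rule integral_mono)
      fix z assume "z \<in> space circle_lebesgue"
      then have z: "z \<in> sphere 0 1" by (simp only: space_circle[OF sets_circle_lebesgue])
      have "norm (tv J d z) = (norm (tv K c z))\<^sup>2" unfolding sq[OF z, symmetric] norm_of_real by simp
      then have "(norm (tv J d z))\<^sup>2 = (norm (tv K c z))\<^sup>2 * (norm (tv K c z))\<^sup>2" by (simp add: power2_eq_square)
      also have "\<dots> \<le> 2\<^sup>2 * (norm (tv K c z))\<^sup>2" using b[OF z] by (intro mult_right_mono power_mono) auto
      finally show "(norm (tv J d z))\<^sup>2 \<le> 4 * (norm (tv K c z))\<^sup>2" by simp
    qed (auto intro!: circle_integrable_continuous[OF sets_circle_lebesgue finite_circle_lebesgue] continuous_norm_tv_sq continuous_intros)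
    finally show ?thesis by (simp add: field_simps)
  qed
  finally have "(tv_sq K c \<nu>) \<le> sqrt (4 / (2 * pi) * (tv_sq K c circle_lebesgue)) * sqrt B"
    using B0 by (simp add: mult_right_mono)
  then show "(tv_sq K c \<nu>) \<le> sqrt (4 / (2 * pi)) * sqrt B * sqrt (tv_sq K c circle_lebesgue)"
    unfolding real_sqrt_mult by (simp only: mult_ac)
qed

lemma emeasure_circle_convolution:
  assumes \<mu>: "sets \<mu> = sets circle_borel" and \<nu>: "sets \<nu> = sets circle_borel" "finite_measure \<nu>"
    and A: "A \<in> sets circle_borel"
  shows "emeasure (circle_convolution \<mu> \<nu>) A = (\<integral>\<^sup>+z. emeasure \<nu> {w \<in> sphere 0 1. z * w \<in> A} \<partial>\<mu>)"
    and "(\<lambda>z. emeasure \<nu> {w \<in> sphere 0 1. z * w \<in> A}) \<in> borel_measurable \<mu>"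
    and "z \<in> sphere 0 1 \<Longrightarrow> {w \<in> sphere 0 1. z * w \<in> A} \<in> sets circle_borel"
proof -
  interpret B: finite_measure \<nu> by fact
  let ?E = "(\<lambda>(z, w). z * w) -` A \<inter> space (\<mu> \<Otimes>\<^sub>M \<nu>)"
  have E: "?E \<in> sets (\<mu> \<Otimes>\<^sub>M \<nu>)" by (rule measurable_sets[OF circle_mult_measurable[OF \<mu> \<nu>(1)] A])
  have sec: "Pair z -` ?E = {w \<in> sphere 0 1. z * w \<in> A}" if "z \<in> space \<mu>" for z
    using that by (auto simp: space_pair_measure space_circle[OF \<nu>(1)])
  have "emeasure (circle_convolution \<mu> \<nu>) A = emeasure (\<mu> \<Otimes>\<^sub>M \<nu>) ?E"
    unfolding circle_convolution_def by (rule emeasure_distr[OF circle_mult_measurable[OF \<mu> \<nu>(1)] A])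
  also have "\<dots> = (\<integral>\<^sup>+z. emeasure \<nu> (Pair z -` ?E) \<partial>\<mu>)" by (rule B.emeasure_pair_measure_alt[OF E])
  also have "\<dots> = (\<integral>\<^sup>+z. emeasure \<nu> {w \<in> sphere 0 1. z * w \<in> A} \<partial>\<mu>)"
    by (intro nn_integral_cong) (simp only: sec)
  finally show "emeasure (circle_convolution \<mu> \<nu>) A = (\<integral>\<^sup>+z. emeasure \<nu> {w \<in> sphere 0 1. z * w \<in> A} \<partial>\<mu>)" .
  have "(\<lambda>z. emeasure \<nu> (Pair z -` ?E)) \<in> borel_measurable \<mu>" by (rule B.measurable_emeasure_Pair[OF E])
  then show "(\<lambda>z. emeasure \<nu> {w \<in> sphere 0 1. z * w \<in> A}) \<in> borel_measurable \<mu>"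
    by (rule measurable_cong[THEN iffD1, rotated]) (simp only: sec)
  show "{w \<in> sphere 0 1. z * w \<in> A} \<in> sets circle_borel" if z: "z \<in> sphere 0 1"
  proof -
    have zs: "z \<in> space \<mu>" using z space_circle[OF \<mu>] by simp
    have "Pair z -` ?E \<in> sets \<nu>" by (rule sets_Pair1[OF E])
    then show ?thesis unfolding sec[OF zs] \<nu>(1) .
  qed
qed

context unitary_action begin

text \<open>A set that is null for every \<open>\<nu> i\<close> is null for \<open>\<sigma>\<close>.
  This is applied twice, to the translated sections of a Lebesgue null set and to the set
  \<open>Bad\<close> of translations with a section of positive measure, so that each factor is
  replaced by \<open>\<sigma>\<close> in turn. Between the two replacements mixed convolutions of
  \<open>\<nu> i\<close> and \<open>\<nu> j\<close> occur, which is why the hypothesis covers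
  distinct \<open>i\<close> and \<open>j\<close>.\<close>

lemma convolution_ac:
  fixes F :: "nat \<Rightarrow> 'a \<Rightarrow> complex"
  assumes e: "e \<in> L2" and \<sigma>: "spectral_measure M S e \<sigma>"
    and F: "\<And>i. F i \<in> L2" and lim: "(\<lambda>i. nrm (\<lambda>x. e x - F i x)) \<longlonglongrightarrow> 0"
    and sq: "\<And>i j. \<exists>B. \<forall>K. finite K \<longrightarrow> (\<Sum>k\<in>K. (norm (corr k (F i) (F i) *
        corr k (F j) (F j)))\<^sup>2) \<le> B"
  shows "absolutely_continuous circle_lebesgue (circle_convolution \<sigma> \<sigma>)"
proof -
  have "\<forall>i. \<exists>\<nu>. spectral_measure M S (F i) \<nu>" using herglotz[OF F] by blast
  then obtain \<nu> where \<nu>: "\<And>i. spectral_measure M S (F i) (\<nu> i)" by metis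
  have \<nu>s: "sets (\<nu> i) = sets circle_borel" "finite_measure (\<nu> i)" for i using \<nu>[of i] by (auto simp: spectral_measure_def)
  have \<sigma>s: "sets \<sigma> = sets circle_borel" "finite_measure \<sigma>" using \<sigma> by (auto simp: spectral_measure_def)
  have \<nu>k: "(\<integral>z. z powi k \<partial>\<nu> i) = corr k (F i) (F i)" for i k
    using \<nu>[of i] by (simp add: spectral_measure_def)
  have ac: "absolutely_continuous circle_lebesgue (circle_convolution (\<nu> i) (\<nu> j))" for i j
  proof -
    obtain B where B: "\<And>K. finite K \<Longrightarrow> (\<Sum>k\<in>K. (norm (corr k (F i) (F i) *
        corr k (F j) (F j)))\<^sup>2) \<le> B" using sq[of i j] by blast
    show ?thesis
    proof (rule circle_ac_of_square_summable[OF sets_circle_convolution finite_circle_convolution])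
      show "(\<Sum>k\<in>K. (norm (\<integral>z. z powi k \<partial>circle_convolution (\<nu> i) (\<nu> j)))\<^sup>2) \<le> B" if "finite K" for K
        unfolding integral_circle_convolution_powi[OF \<nu>s \<nu>s] \<nu>k by (rule B[OF that])
    qed (rule \<nu>s)+
  qed
  have null: "emeasure \<sigma> A = 0" if A: "A \<in> sets circle_borel" and z: "\<And>i. emeasure (\<nu> i) A = 0" for A
  proof -
    have le: "emeasure \<sigma> A \<le> ennreal (4 * (nrm (\<lambda>x. e x - F i x))\<^sup>2)" for i
      by (rule spectral_null_close[OF e F \<sigma> \<nu>]) (use A z \<nu>s in \<open>simp add: null_sets_def\<close>)
    have "(\<lambda>i. ennreal (4 * (nrm (\<lambda>x. e x - F i x))\<^sup>2)) \<longlonglongrightarrow> ennreal (4 * 0\<^sup>2)"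
      by (intro tendsto_ennrealI tendsto_intros lim)
    then have "emeasure \<sigma> A \<le> ennreal (4 * 0\<^sup>2)" by (rule LIMSEQ_le_const) (use le in blast)
    then show ?thesis by simp
  qed
  show ?thesis unfolding absolutely_continuous_def
  proof
    fix A assume A: "A \<in> null_sets circle_lebesgue"
    then have As: "A \<in> sets circle_borel" by auto
    define sec where "sec z = {w \<in> sphere 0 1. z * w \<in> A}" for z
    have secs: "sec z \<in> sets circle_borel" if "z \<in> sphere 0 1" for z
      unfolding sec_def by (rule emeasure_circle_convolution(3)[OF \<sigma>s(1) \<sigma>s As that])
    define Bad where "Bad = {z \<in> sphere 0 1. emeasure \<sigma> (sec z) \<noteq> 0}"
    have m: "(\<lambda>z. emeasure \<sigma> (sec z)) \<in> borel_measurable circle_borel"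
      unfolding sec_def by (rule emeasure_circle_convolution(2)[OF refl \<sigma>s As])
    have Bs: "Bad \<in> sets circle_borel"
    proof -
      have "{z \<in> space circle_borel. emeasure \<sigma> (sec z) \<noteq> 0} \<in> sets circle_borel" using m by measurable
      then show ?thesis unfolding Bad_def using space_circle[OF refl] by simp
    qed
    have "emeasure (\<nu> i) Bad = 0" for i
    proof -
      have "AE z in \<nu> i. emeasure (\<nu> j) (sec z) = 0" for j
      proof -
        have "(\<integral>\<^sup>+z. emeasure (\<nu> j) (sec z) \<partial>\<nu> i) = emeasure (circle_convolution (\<nu> i) (\<nu> j)) A"
          unfolding sec_def by (rule emeasure_circle_convolution(1)[OF \<nu>s(1) \<nu>s As, symmetric])
        also have "\<dots> = 0" using ac[of i j] A unfolding absolutely_continuous_def by blast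
        finally show ?thesis using emeasure_circle_convolution(2)[OF \<nu>s(1) \<nu>s As, of j i]
          unfolding sec_def by (subst (asm) nn_integral_0_iff_AE) auto
      qed
      then have "AE z in \<nu> i. \<forall>j. emeasure (\<nu> j) (sec z) = 0" by (simp add: AE_all_countable)
      then have "AE z in \<nu> i. z \<notin> Bad" using AE_space
      proof eventually_elim
        case (elim z)
        have z: "z \<in> sphere 0 1" using elim(2) space_circle[OF \<nu>s(1)] by simp
        have "emeasure \<sigma> (sec z) = 0" by (rule null[OF secs[OF z]]) (use elim(1) in blast)
        then show ?case by (simp add: Bad_def)
      qed
      then show ?thesis using Bs \<nu>s(1)[of i] AE_iff_null_sets[of Bad "\<nu> i"] by (simp add: null_setsD1)
    qed
    then have "emeasure \<sigma> Bad = 0" by (intro null[OF Bs])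
    then have "AE z in \<sigma>. z \<notin> Bad"
      using Bs \<sigma>s(1) AE_iff_null_sets[of Bad \<sigma>] by (simp add: null_sets_def)
    then have "AE z in \<sigma>. emeasure \<sigma> (sec z) = 0"
      using AE_space by eventually_elim (use space_circle[OF \<sigma>s(1)] in \<open>auto simp: Bad_def\<close>)
    then have "(\<integral>\<^sup>+z. emeasure \<sigma> (sec z) \<partial>\<sigma>) = 0"
      using emeasure_circle_convolution(2)[OF \<sigma>s(1) \<sigma>s As]
      unfolding sec_def by (subst nn_integral_0_iff_AE) auto
    then have "emeasure (circle_convolution \<sigma> \<sigma>) A = 0"
      unfolding sec_def by (subst emeasure_circle_convolution(1)[OF \<sigma>s(1) \<sigma>s As])
    then show "A \<in> null_sets (circle_convolution \<sigma> \<sigma>)" using As by (auto simp: null_sets_def)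
  qed
qed

end

section \<open>The iceberg space\<close>

lemma card_mod_eq:
  fixes h q :: nat
  assumes "0 < h"
  shows "card {u. u < q * h \<and> P (u div h) (u mod h)} = (\<Sum>y<q. card {t. t < h \<and> P y t})"
proof -
  have "bij_betw (\<lambda>(y, t). y * h + t) (SIGMA y:{..<q}. {t. t < h \<and> P y t}) {u. u < q * h \<and> P (u div h) (u mod h)}"
  proof (rule bij_betw_byWitness[where f'="\<lambda>u. (u div h, u mod h)"])
    show "\<forall>a\<in>SIGMA y:{..<q}. {t. t < h \<and> P y t}. (\<lambda>u. (u div h, u mod h)) ((\<lambda>(y, t). y * h + t) a) = a"
      using assms by auto
    show "\<forall>a'\<in>{u. u < q * h \<and> P (u div h) (u mod h)}. (\<lambda>(y, t). y * h + t) ((\<lambda>u. (u div h, u mod h)) a') = a'"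
      by auto
    have "y * h + t < q * h" if "y < q" "t < h" for y t
    proof -
      have "y * h + t < (y + 1) * h" using that by simp
      also have "\<dots> \<le> q * h" using that by (intro mult_right_mono) auto
      finally show ?thesis .
    qed
    then show "(\<lambda>(y, t). y * h + t) ` (SIGMA y:{..<q}. {t. t < h \<and> P y t}) \<subseteq> {u. u < q * h \<and> P (u div h) (u mod h)}"
      by auto
    show "(\<lambda>u. (u div h, u mod h)) ` {u. u < q * h \<and> P (u div h) (u mod h)} \<subseteq> (SIGMA y:{..<q}. {t. t < h \<and> P y t})"
      using assms by (auto simp: less_mult_imp_div_less)
  qed
  from bij_betw_same_card[OF this]
  have "card {u. u < q * h \<and> P (u div h) (u mod h)} = card (SIGMA y:{..<q}. {t. t < h \<and> P y t})" by simp
  also have "\<dots> = (\<Sum>y<q. card {t. t < h \<and> P y t})" by (rule card_SigmaI) auto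
  finally show ?thesis .
qed

locale iceberg =
  fixes q :: "nat \<Rightarrow> nat" and \<alpha> :: "nat \<times> nat \<Rightarrow> nat"
  assumes q2: "\<And>n. 2 \<le> q n"
begin

abbreviation h :: "nat \<Rightarrow> nat" where "h \<equiv> iceberg_height q"
abbreviation \<phi> :: "nat \<Rightarrow> nat \<Rightarrow> nat" where "\<phi> \<equiv> iceberg_proj q \<alpha>"
abbreviation X :: "(nat \<Rightarrow> nat) set" where "X \<equiv> iceberg_space q \<alpha>"
abbreviation \<mu> :: "(nat \<Rightarrow> nat) measure" where "\<mu> \<equiv> iceberg_measure q \<alpha>"

lemma h_pos [simp]: "0 < h n"
proof (induction n)
  case (Suc n) then show ?case using q2[of n] by simp
qed simp

lemma h_ne0 [simp]: "h n \<noteq> 0" using h_pos[of n] by linarith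

lemma h_power: "2 ^ k * h n \<le> h (n + k)"
proof (induction k)
  case (Suc k)
  have "2 ^ Suc k * h n = 2 * (2 ^ k * h n)" by simp
  also have "\<dots> \<le> q (n + k) * h (n + k)" using Suc q2 by (intro mult_mono) auto
  finally show ?case by simp
qed simp

lemma h_ge: "2 ^ n \<le> h n" using h_power[of n 0] by simp

lemma h_ge_n: "n < h n" using h_ge[of n] less_exp[of n] by linarith

lemma h_mono: "n \<le> m \<Longrightarrow> h n \<le> h m"
proof -
  assume nm: "n \<le> m"
  have "h n \<le> 2 ^ (m - n) * h n" by simp
  also have "\<dots> \<le> h m" using h_power[of "m - n" n] nm by simp
  finally show ?thesis .
qed

text \<open>Translation of the integers modulo \<open>h n\<close>; integer steps keep inverses in
  the same form.\<close>

definition cadd :: "nat \<Rightarrow> int \<Rightarrow> nat \<Rightarrow> nat" where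
  "cadd n k x = nat ((int x + k) mod int (h n))"

lemma int_cadd: "int (cadd n k x) = (int x + k) mod int (h n)" by (simp add: cadd_def)

lemma cadd_lt [simp]: "cadd n k x < h n"
proof -
  have "int (cadd n k x) < int (h n)" unfolding int_cadd by simp
  then show ?thesis by simp
qed

lemma cadd_cadd [simp]: "cadd n j (cadd n k x) = cadd n (j + k) x"
proof -
  have "int (cadd n j (cadd n k x)) = int (cadd n (j + k) x)"
    unfolding int_cadd by (simp add: mod_add_left_eq mod_add_right_eq algebra_simps)
  then show ?thesis by simp
qed

lemma cadd_nat: "cadd n (int k) x = (x + k) mod h n"
proof -
  have "int (cadd n (int k) x) = int ((x + k) mod h n)" unfolding int_cadd by (simp add: zmod_int)
  then show ?thesis by simp
qed

lemma cadd_0_mod: "cadd n 0 x = x mod h n" using cadd_nat[of n 0 x] by simp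

lemma cadd_0: "x < h n \<Longrightarrow> cadd n 0 x = x" by (simp add: cadd_def)

lemma cadd_1: "cadd n 1 x = (x + 1) mod h n" using cadd_nat[of n 1 x] by simp

lemma cadd_mod: "cadd n k (x mod h n) = cadd n k x"
proof -
  have "int (cadd n k (x mod h n)) = int (cadd n k x)" unfolding int_cadd by (simp add: zmod_int mod_add_left_eq)
  then show ?thesis by simp
qed

lemma cadd_noover: "0 \<le> int x + k \<Longrightarrow> int x + k < int (h n) \<Longrightarrow> int (cadd n k x) = int x + k"
  unfolding int_cadd by simp

lemma \<phi>_eq: "\<phi> n u = cadd n (- int (\<alpha> (n, u div h n))) u" unfolding iceberg_proj_def Let_def
  by (subst cadd_mod[symmetric]) (simp add: cadd_def)

lemma \<phi>_lt [simp]: "\<phi> n u < h n" by (simp add: \<phi>_eq)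

text \<open>The inverse branch of \<open>\<phi> n\<close> on block \<open>d\<close>: undoing the
  rotation gives the unique point of that block lying above \<open>t\<close>.\<close>

definition glue :: "nat \<Rightarrow> nat \<Rightarrow> nat \<Rightarrow> nat" where
  "glue n d t = d * h n + cadd n (int (\<alpha> (n, d))) t"

lemma glue_div [simp]: "glue n d t div h n = d" by (simp add: glue_def)

lemma glue_mod [simp]: "glue n d t mod h n = cadd n (int (\<alpha> (n, d))) t" by (simp add: glue_def)

lemma \<phi>_glue: "t < h n \<Longrightarrow> \<phi> n (glue n d t) = t"
  unfolding \<phi>_eq by (subst cadd_mod[symmetric]) (simp add: cadd_0)

lemma glue_lt: "d < q n \<Longrightarrow> glue n d t < h (Suc n)"
proof -
  assume d: "d < q n"
  have "glue n d t < (d + 1) * h n" by (simp add: glue_def)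
  also have "\<dots> \<le> q n * h n" using d by (intro mult_right_mono) auto
  finally show ?thesis by simp
qed

lemma div_lt: "u < h (Suc n) \<Longrightarrow> u div h n < q n" by (simp add: less_mult_imp_div_less)

lemma glue_\<phi>: "glue n (u div h n) (\<phi> n u) = u"
  unfolding glue_def \<phi>_eq cadd_cadd by (simp only: cadd_0_mod add.right_inverse div_mult_mod_eq)

lemma X_lt: "x \<in> X \<Longrightarrow> x n < h n" and X_\<phi>: "x \<in> X \<Longrightarrow> \<phi> n (x (Suc n)) = x n"
  by (auto simp: iceberg_space_def)

lemma X_I: "(\<And>n. x n < h n) \<Longrightarrow> (\<And>n. \<phi> n (x (Suc n)) = x n) \<Longrightarrow> x \<in> X"
  by (auto simp: iceberg_space_def)

text \<open>A point of the inverse limit is coded by the block numbers of its coordinates, which can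
  be prescribed freely. This identifies the space with a product; \<open>dig\<close> reads the code
  back from a coordinate.\<close>

primrec lift :: "(nat \<Rightarrow> nat) \<Rightarrow> nat \<Rightarrow> nat" where
  "lift y 0 = 0"
| "lift y (Suc n) = glue n (y n) (lift y n)"

lemma lift_lt: "(\<And>n. y n < q n) \<Longrightarrow> lift y n < h n"
  by (cases n) (auto intro: glue_lt[simplified])

lemma lift_X: "(\<And>n. y n < q n) \<Longrightarrow> lift y \<in> X"
  by (intro X_I) (auto simp: \<phi>_glue lift_lt simp del: iceberg_height.simps)

primrec dig :: "nat \<Rightarrow> nat \<Rightarrow> nat \<Rightarrow> nat" where
  "dig 0 t = (\<lambda>_. 0)"
| "dig (Suc n) t = (dig n (\<phi> n t))(n := t div h n)"

lemma dig_lt: "t < h n \<Longrightarrow> i < n \<Longrightarrow> dig n t i < q i"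
  by (induction n arbitrary: t) (auto simp: less_Suc_eq div_lt[simplified])

lemma lift_eq_iff:
  assumes "\<And>n. y n < q n" "t < h n"
  shows "lift y n = t \<longleftrightarrow> (\<forall>i<n. y i = dig n t i)" using assms(2)
proof (induction n arbitrary: t)
  case (Suc n)
  have "lift y (Suc n) = t \<longleftrightarrow> y n = t div h n \<and> lift y n = \<phi> n t"
  proof
    assume "lift y (Suc n) = t"
    then have "t = glue n (y n) (lift y n)" by simp
    then show "y n = t div h n \<and> lift y n = \<phi> n t" using \<phi>_glue[OF lift_lt[OF assms(1)]] by simp
  next
    assume "y n = t div h n \<and> lift y n = \<phi> n t"
    then show "lift y (Suc n) = t" using glue_\<phi>[of n t] by simp
  qed
  also have "\<dots> \<longleftrightarrow> (\<forall>i<Suc n. y i = dig (Suc n) t i)"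
    using Suc.IH[OF \<phi>_lt] by (auto simp: less_Suc_eq)
  finally show ?case .
qed simp

definition \<Omega> :: "(nat \<Rightarrow> nat) measure" where
  "\<Omega> = PiM UNIV (\<lambda>n. uniform_count_measure {..<q n})"

lemma prob_ucm: "prob_space (uniform_count_measure {..<q n})"
  using q2[of n] by (intro prob_space_uniform_count_measure) (auto simp: lessThan_empty_iff)

lemma space_\<Omega>: "space \<Omega> = {y. \<forall>n. y n < q n}"
  by (auto simp: \<Omega>_def space_PiM space_uniform_count_measure PiE_def Pi_def)

lemma
  assumes d: "\<And>i. i < n \<Longrightarrow> d i < q i"
  shows cylinder_\<Omega>_sets: "{y \<in> space \<Omega>. \<forall>i<n. y i = d i} \<in> sets \<Omega>"
    and cylinder_\<Omega>_emeasure: "emeasure \<Omega> {y \<in> space \<Omega>. \<forall>i<n. y i = d i} = ennreal (1 / real (h n))"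
proof -
  interpret product_prob_space "\<lambda>n. uniform_count_measure {..<q n}" UNIV
    by (intro product_prob_spaceI prob_ucm)
  have eq: "{y \<in> space \<Omega>. \<forall>i<n. y i = d i} =
     prod_emb UNIV (\<lambda>n. uniform_count_measure {..<q n}) {..<n} (Pi\<^sub>E {..<n} (\<lambda>i. {d i}))"
    unfolding space_\<Omega> by (auto simp: prod_emb_def space_uniform_count_measure PiE_def Pi_def extensional_def)
  have s: "{d i} \<in> sets (uniform_count_measure {..<q i})" if "i \<in> {..<n}" for i
    using d[of i] that by (simp add: sets_uniform_count_measure)
  show "{y \<in> space \<Omega>. \<forall>i<n. y i = d i} \<in> sets \<Omega>"
    unfolding eq unfolding \<Omega>_def by (intro sets_PiM_I) (use s in auto)
  have "emeasure \<Omega> {y \<in> space \<Omega>. \<forall>i<n. y i = d i} = (\<Prod>i<n. emeasure (uniform_count_measure {..<q i}) {d i})"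
    unfolding eq unfolding \<Omega>_def by (rule emeasure_PiM_emb) (use s in auto)
  also have "\<dots> = (\<Prod>i<n. ennreal (1 / real (q i)))"
    using d by (intro prod.cong refl) (simp add: emeasure_uniform_count_measure)
  also have "\<dots> = ennreal (\<Prod>i<n. 1 / real (q i))" by (intro prod_ennreal) simp
  also have "(\<Prod>i<n. 1 / real (q i)) = 1 / real (h n)" by (induction n) simp_all
  finally show "emeasure \<Omega> {y \<in> space \<Omega>. \<forall>i<n. y i = d i} = ennreal (1 / real (h n))" .
qed

abbreviation cyl :: "nat \<Rightarrow> nat \<Rightarrow> (nat \<Rightarrow> nat) set" where
  "cyl n t \<equiv> {x \<in> X. x n = t}"

lemma space_\<mu>: "space \<mu> = X" unfolding iceberg_measure_def by (subst space_extend_measure) auto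

lemma sets_\<mu>: "sets \<mu> = sigma_sets X ((\<lambda>(n, t). cyl n t) ` (SIGMA n:UNIV. {..<h n}))"
  unfolding iceberg_measure_def by (subst sets_extend_measure) auto

lemma lift_measurable: "lift \<in> measurable \<Omega> \<mu>"
proof (rule measurable_sigma_sets[OF sets_\<mu>])
  show "(\<lambda>(n, t). cyl n t) ` (SIGMA n:UNIV. {..<h n}) \<subseteq> Pow X" by auto
  show "lift \<in> space \<Omega> \<rightarrow> X" by (auto simp: space_\<Omega> intro: lift_X)
  fix A assume "A \<in> (\<lambda>(n, t). cyl n t) ` (SIGMA n:UNIV. {..<h n})"
  then obtain n t where A: "A = cyl n t" "t < h n" by auto
  have "lift -` A \<inter> space \<Omega> = {y \<in> space \<Omega>. \<forall>i<n. y i = dig n t i}"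
    using A lift_eq_iff lift_X by (auto simp: space_\<Omega>)
  then show "lift -` A \<inter> space \<Omega> \<in> sets \<Omega>"
    by (simp only:) (rule cylinder_\<Omega>_sets, rule dig_lt[OF A(2)])
qed

text \<open>\<open>extend_measure\<close> takes the prescribed values only if some measure does. The
  image of the product measure under \<open>lift\<close> is such a measure.\<close>

lemma emeasure_cyl:
  assumes "t < h n" shows "emeasure \<mu> (cyl n t) = ennreal (1 / real (h n))"
proof -
  define Q where "Q = distr \<Omega> \<mu> lift"
  have sQ: "sets Q = sets \<mu>" by (simp add: Q_def)
  have Q: "emeasure Q (cyl n t) = ennreal (1 / real (h n))" if t: "t < h n" for n t
  proof -
    have s: "cyl n t \<in> sets \<mu>" unfolding sets_\<mu> using t by (intro sigma_sets.Basic) auto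
    have "lift -` cyl n t \<inter> space \<Omega> = {y \<in> space \<Omega>. \<forall>i<n. y i = dig n t i}"
      using t lift_eq_iff lift_X by (auto simp: space_\<Omega>)
    then show ?thesis unfolding Q_def emeasure_distr[OF lift_measurable s]
      by (simp only:) (rule cylinder_\<Omega>_emeasure, rule dig_lt[OF t])
  qed
  have "emeasure \<mu> ((\<lambda>(n, t). cyl n t) (n, t)) = (\<lambda>(n, t). ennreal (1 / real (h n))) (n, t)"
  proof (rule emeasure_extend_measure[OF iceberg_measure_def, where \<mu>'="emeasure Q"])
    show "(\<lambda>(n, t). cyl n t) ` (SIGMA n:UNIV. {..<h n}) \<subseteq> Pow X" by auto
    show "positive (sets \<mu>) (emeasure Q)" using emeasure_positive[of Q] sQ by simp
    show "countably_additive (sets \<mu>) (emeasure Q)" using emeasure_countably_additive[of Q] sQ by simp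
  qed (use assms Q in auto)
  then show ?thesis by simp
qed

lemma prob_\<mu>: "prob_space \<mu>"
proof (rule prob_spaceI)
  have "cyl 0 0 = X" using X_lt[of _ 0] by auto
  then show "emeasure \<mu> (space \<mu>) = 1" using emeasure_cyl[of 0 0] space_\<mu> by simp
qed

lemma coord_meas [measurable]: "(\<lambda>x. x n) \<in> measurable \<mu> (count_space UNIV)"
proof (rule measurable_count_space_eq2_countable[THEN iffD2], intro conjI ballI)
  fix t :: nat
  show "(\<lambda>x. x n) -` {t} \<inter> space \<mu> \<in> sets \<mu>"
  proof (cases "t < h n")
    case True
    then have "cyl n t \<in> sets \<mu>" unfolding sets_\<mu> by (intro sigma_sets.Basic) auto
    moreover have "(\<lambda>x. x n) -` {t} \<inter> space \<mu> = cyl n t" by (auto simp: space_\<mu>)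
    ultimately show ?thesis by simp
  next
    case False
    then have "(\<lambda>x. x n) -` {t} \<inter> space \<mu> = {}" using X_lt by (auto simp: space_\<mu>)
    then show ?thesis by simp
  qed
qed auto

lemma level_set_sets: "{x \<in> X. P (x n)} \<in> sets \<mu>"
proof -
  have "{x \<in> space \<mu>. P (x n)} \<in> sets \<mu>" by measurable
  then show ?thesis by (simp add: space_\<mu>)
qed

lemma cyl_sets: "cyl n t \<in> sets \<mu>" by (rule level_set_sets[of "\<lambda>s. s = t"])

lemma measure_cyl: "t < h n \<Longrightarrow> measure \<mu> (cyl n t) = 1 / real (h n)"
  by (rule measure_eq_emeasure_eq_ennreal[OF _ emeasure_cyl]) simp

lemma measure_level_set: "measure \<mu> {x \<in> X. P (x n)} = real (card {t. t < h n \<and> P t}) / real (h n)"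
proof -
  interpret prob_space \<mu> by (rule prob_\<mu>)
  let ?T = "{t. t < h n \<and> P t}"
  have eq: "{x \<in> X. P (x n)} = (\<Union>t\<in>?T. cyl n t)" using X_lt by auto
  have "measure \<mu> {x \<in> X. P (x n)} = (\<Sum>t\<in>?T. measure \<mu> (cyl n t))"
    unfolding eq by (rule finite_measure_finite_Union) (auto simp: disjoint_family_on_def cyl_sets)
  also have "\<dots> = (\<Sum>t\<in>?T. 1 / real (h n))" by (intro sum.cong refl measure_cyl) simp
  finally show ?thesis by (simp only: sum_constant times_divide_eq_right mult_1_right)
qed

primrec down :: "nat \<Rightarrow> nat \<Rightarrow> nat \<Rightarrow> nat" where
  "down n 0 u = u"
| "down n (Suc k) u = down n k (\<phi> (n + k) u)"

lemma X_down: "x \<in> X \<Longrightarrow> down n k (x (n + k)) = x n" by (induction k) (simp_all add: X_\<phi>)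

lemma down_lt: "u < h (n + k) \<Longrightarrow> down n k u < h n" by (induction k arbitrary: u) auto

lemma X_down': "x \<in> X \<Longrightarrow> n \<le> m \<Longrightarrow> down n (m - n) (x m) = x n"
  using X_down[of x n "m - n"] by simp

lemma X_eqI:
  assumes x: "x \<in> X" "x' \<in> X" and e: "\<And>n. n0 \<le> n \<Longrightarrow> x n = x' n" shows "x = x'"
proof
  fix n
  have "x n = down n n0 (x (n + n0))" using X_down[OF x(1)] by simp
  also have "x (n + n0) = x' (n + n0)" by (rule e) simp
  also have "down n n0 (x' (n + n0)) = x' n" using X_down[OF x(2)] by simp
  finally show "x n = x' n" .
qed

lemma X_extend:
  assumes "\<And>m. n0 \<le> m \<Longrightarrow> z m < h m" "\<And>m. n0 \<le> m \<Longrightarrow> \<phi> m (z (Suc m)) = z m"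
  shows "\<exists>x\<in>X. \<forall>m\<ge>n0. x m = z m" using assms
proof (induction n0 arbitrary: z)
  case 0 then show ?case using X_I[of z] by auto
next
  case (Suc n)
  define z' where "z' = z(n := \<phi> n (z (Suc n)))"
  have "\<exists>x\<in>X. \<forall>m\<ge>n. x m = z' m"
  proof (rule Suc.IH)
    fix m assume m: "n \<le> m"
    show "z' m < h m" "\<phi> m (z' (Suc m)) = z' m"
      using Suc.prems[of m] m by (cases "m = n"; simp add: z'_def)+
  qed
  then show ?case unfolding z'_def by (metis Suc_le_D Suc_n_not_le_n fun_upd_apply le_SucI Suc_leD)
qed

section \<open>Integer powers of the map as translations of tails\<close>

definition Reg :: "int \<Rightarrow> (nat \<Rightarrow> nat) set" where
  "Reg k = {x \<in> X. \<exists>n0. \<forall>n\<ge>n0. \<phi> n (cadd (Suc n) k (x (Suc n))) = cadd n k (x n)}"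

text \<open>All powers are defined at once by translating the coordinates of high level by
  \<open>k\<close>, so that the group law reduces to addition of integers. The iterates of the map
  and of its inverse are matched with \<open>V\<close> in \<open>pow_eq_V\<close>.\<close>

definition V :: "int \<Rightarrow> (nat \<Rightarrow> nat) \<Rightarrow> (nat \<Rightarrow> nat)" where
  "V k x = (THE x'. x' \<in> X \<and> (\<exists>n0. \<forall>n\<ge>n0. x' n = cadd n k (x n)))"

lemma V_eqI:
  assumes "x' \<in> X" "\<And>n. b \<le> n \<Longrightarrow> x' n = cadd n k (x n)" shows "V k x = x'"
  unfolding V_def
proof (rule the_equality)
  show "x' \<in> X \<and> (\<exists>n0. \<forall>n\<ge>n0. x' n = cadd n k (x n))" using assms by blast
  fix y assume y: "y \<in> X \<and> (\<exists>n0. \<forall>n\<ge>n0. y n = cadd n k (x n))"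
  then obtain n1 where n1: "\<forall>n\<ge>n1. y n = cadd n k (x n)" by blast
  show "y = x'" by (rule X_eqI[of _ _ "max b n1"]) (use y assms n1 in auto)
qed

lemma V_at:
  assumes x: "x \<in> X" and r: "\<And>n. m \<le> n \<Longrightarrow> \<phi> n (cadd (Suc n) k (x (Suc n))) = cadd n k (x n)"
  shows "V k x \<in> X" "m \<le> n \<Longrightarrow> V k x n = cadd n k (x n)"
proof -
  obtain x' where x': "x' \<in> X" "\<forall>n\<ge>m. x' n = cadd n k (x n)"
    using X_extend[of m "\<lambda>n. cadd n k (x n)"] r by auto
  then have "V k x = x'" by (intro V_eqI) auto
  then show "V k x \<in> X" "m \<le> n \<Longrightarrow> V k x n = cadd n k (x n)" using x' by auto
qed

lemma Reg_V:
  assumes "x \<in> Reg k" shows "V k x \<in> X" "\<exists>n0. \<forall>n\<ge>n0. V k x n = cadd n k (x n)"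
  using assms V_at[of x _ k] unfolding Reg_def by blast+

lemma Reg_X: "x \<in> Reg k \<Longrightarrow> x \<in> X" by (simp add: Reg_def)

lemma V_V:
  assumes k: "x \<in> Reg k" and jk: "x \<in> Reg (j + k)" shows "V k x \<in> Reg j" "V j (V k x) = V (j + k) x"
proof -
  obtain n0 where n0: "\<forall>n\<ge>n0. V k x n = cadd n k (x n)" using Reg_V[OF k] by blast
  obtain n1 where n1: "\<forall>n\<ge>n1. \<phi> n (cadd (Suc n) (j + k) (x (Suc n))) = cadd n (j + k) (x n)"
    using jk unfolding Reg_def by blast
  have "\<forall>n\<ge>max n0 n1. \<phi> n (cadd (Suc n) j (V k x (Suc n))) = cadd n j (V k x n)"
    using n0 n1 by simp
  then show "V k x \<in> Reg j" unfolding Reg_def using Reg_V(1)[OF k] by blast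
  obtain n2 where n2: "\<forall>n\<ge>n2. V (j + k) x n = cadd n (j + k) (x n)" using Reg_V[OF jk] by blast
  show "V j (V k x) = V (j + k) x" by (rule V_eqI[where b="max n0 n2"]) (use Reg_V(1)[OF jk] n0 n2 in simp_all)
qed

lemma Reg_0: "x \<in> X \<Longrightarrow> x \<in> Reg 0" and V_0: "x \<in> X \<Longrightarrow> V 0 x = x"
proof -
  assume x: "x \<in> X"
  show "x \<in> Reg 0" using x X_lt[OF x] X_\<phi>[OF x] cadd_0 unfolding Reg_def by (simp del: iceberg_height.simps)
  show "V 0 x = x" by (rule V_eqI[where b=0]) (use x X_lt[OF x] cadd_0 in simp_all)
qed

lemma regular_eq: "iceberg_regular q \<alpha> = Reg 1" unfolding iceberg_regular_def Reg_def cadd_1 ..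

lemma map_eq: "iceberg_map q \<alpha> x = (if x \<in> Reg 1 then V 1 x else x)"
  unfolding iceberg_map_def regular_eq V_def cadd_1 ..

lemma V_inverse: "x \<in> Reg k \<Longrightarrow> V k x \<in> Reg (- k)" "x \<in> Reg k \<Longrightarrow> V (- k) (V k x) = x"
  using V_V[of x k "- k"] Reg_0 Reg_X V_0 by simp_all

text \<open>On regular points the map is undone by translation by -1. This determines its image, and
  with it the case distinction in \<open>iceberg_inv\<close>.\<close>

lemma map_image: "iceberg_map q \<alpha> ` iceberg_regular q \<alpha> = Reg (- 1)"
proof
  show "iceberg_map q \<alpha> ` iceberg_regular q \<alpha> \<subseteq> Reg (- 1)"
    using V_inverse(1)[of _ 1] by (auto simp: regular_eq map_eq)
  show "Reg (- 1) \<subseteq> iceberg_map q \<alpha> ` iceberg_regular q \<alpha>"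
  proof
    fix x assume x: "x \<in> Reg (- 1)"
    then have "V (- 1) x \<in> Reg 1" "V 1 (V (- 1) x) = x" using V_inverse[of x "- 1"] by auto
    then show "x \<in> iceberg_map q \<alpha> ` iceberg_regular q \<alpha>"
      unfolding regular_eq by (intro image_eqI[of _ _ "V (- 1) x"]) (simp_all add: map_eq)
  qed
qed

lemma inv_eq: "iceberg_inv q \<alpha> x = (if x \<in> Reg (- 1) then V (- 1) x else x)"
proof -
  have "inv_into (Reg 1) (iceberg_map q \<alpha>) x = V (- 1) x" if x: "x \<in> Reg (- 1)"
  proof (rule inv_into_f_eq)
    show "inj_on (iceberg_map q \<alpha>) (Reg 1)"
      by (rule inj_on_inverseI[of _ "V (- 1)"]) (simp add: map_eq V_inverse)
    show "V (- 1) x \<in> Reg 1" "iceberg_map q \<alpha> (V (- 1) x) = x"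
      using V_inverse[of x "- 1"] x by (auto simp: map_eq)
  qed
  then show ?thesis unfolding iceberg_inv_def map_image unfolding regular_eq by simp
qed

text \<open>An invariant set, later shown to have full measure, on which all powers exist and form a
  group.\<close>

definition bireg :: "(nat \<Rightarrow> nat) set" where "bireg = (\<Inter>k. Reg k)"

lemma bireg_V: "x \<in> bireg \<Longrightarrow> V k x \<in> bireg" "x \<in> bireg \<Longrightarrow> V j (V k x) = V (j + k) x"
  using V_V by (auto simp: bireg_def)

lemma pow_eq_V: "x \<in> bireg \<Longrightarrow> iceberg_pow q \<alpha> k x = V k x"
proof -
  assume x: "x \<in> bireg"
  have xX: "x \<in> X" using x Reg_X by (auto simp: bireg_def)
  have 1: "(iceberg_map q \<alpha> ^^ n) x = V (int n) x" for n
  proof (induction n)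
    case 0 show ?case using V_0[OF xX] by simp
  next
    case (Suc n)
    have "V (int n) x \<in> Reg 1" using bireg_V(1)[OF x] by (auto simp: bireg_def)
    then show ?case using bireg_V(2)[OF x, of 1 "int n"] Suc by (simp add: map_eq)
  qed
  have 2: "(iceberg_inv q \<alpha> ^^ n) x = V (- int n) x" for n
  proof (induction n)
    case 0 show ?case using V_0[OF xX] by simp
  next
    case (Suc n)
    have "V (- int n) x \<in> Reg (- 1)" using bireg_V(1)[OF x] by (auto simp: bireg_def)
    then show ?case using bireg_V(2)[OF x, of "- 1" "- int n"] Suc by (simp add: inv_eq)
  qed
  show ?thesis using 1[of "nat k"] 2[of "nat (- k)"] by (simp add: iceberg_pow_def)
qed

end

lemma (in prob_space) prob_diff_le:
  assumes "A \<in> events" "B \<in> events" "G \<in> events" "A \<inter> G = B \<inter> G"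
  shows "\<bar>prob A - prob B\<bar> \<le> 1 - prob G"
proof -
  have 1: "prob C \<le> prob (C \<inter> G) + (1 - prob G)" if "C \<in> events" for C
  proof -
    have "prob C \<le> prob ((C \<inter> G) \<union> (space M - G))"
      using that assms(3) sets.sets_into_space by (intro finite_measure_mono) auto
    also have "\<dots> \<le> prob (C \<inter> G) + prob (space M - G)" using that assms(3) by (intro measure_Un_le) auto
    finally show ?thesis using prob_compl[OF assms(3)] by simp
  qed
  have 2: "prob (C \<inter> G) \<le> prob C" if "C \<in> events" for C
    using that by (intro finite_measure_mono) auto
  have "prob (A \<inter> G) = prob (B \<inter> G)" by (simp only: assms(4))
  then show ?thesis using 1[OF assms(1)] 1[OF assms(2)] 2[OF assms(1)] 2[OF assms(2)] by linarith
qed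

section \<open>Failures at block ends and invariance of the measure\<close>

context iceberg begin

sublocale P: prob_space \<mu> by (rule prob_\<mu>)

text \<open>Within one block \<open>\<phi> n\<close> is a single rotation, so it commutes with every
  translation that does not leave the block.\<close>

lemma \<phi>_cadd:
  assumes u: "u < h (Suc n)" and k: "0 \<le> int (u mod h n) + k" "int (u mod h n) + k < int (h n)"
  shows "\<phi> n (cadd (Suc n) k u) = cadd n k (\<phi> n u)"
proof -
  define y where "y = u div h n"
  define t where "t = u mod h n"
  have uy: "int u = int y * int (h n) + int t" unfolding y_def t_def
    by (metis div_mult_mod_eq of_nat_add of_nat_mult)
  have yq: "y < q n" unfolding y_def by (rule div_lt[OF u])
  have "int u + k < int y * int (h n) + int (h n)" using uy k(2) unfolding t_def by simp
  also have "\<dots> = int (y + 1) * int (h n)" by (simp add: algebra_simps)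
  also have "\<dots> \<le> int (q n) * int (h n)" using yq by (intro mult_right_mono) auto
  finally have le: "int u + k < int (h (Suc n))" by simp
  have ge: "0 \<le> int u + k" using uy k(1) unfolding t_def by (simp add: add.assoc)
  have v: "int (cadd (Suc n) k u) = int u + k" by (rule cadd_noover[OF ge le])
  have "int (cadd (Suc n) k u div h n) = (int u + k) div int (h n)" using v by (simp add: zdiv_int)
  also have "int u + k = (int t + k) + int y * int (h n)" using uy by simp
  also have "((int t + k) + int y * int (h n)) div int (h n) = int y" using k unfolding t_def by simp
  finally have d: "cadd (Suc n) k u div h n = u div h n" unfolding y_def by simp
  have "int (\<phi> n (cadd (Suc n) k u)) = int (cadd n k (\<phi> n u))"
    unfolding \<phi>_eq d cadd_cadd int_cadd[of n] v by (simp add: algebra_simps)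
  then show ?thesis by simp
qed

lemma card_overflow: "card {t. t < h n \<and> \<not> (0 \<le> int t + k \<and> int t + k < int (h n))} \<le> nat \<bar>k\<bar>"
proof (cases "0 \<le> k")
  case True
  have "card {t. t < h n \<and> \<not> (0 \<le> int t + k \<and> int t + k < int (h n))} \<le> card {h n - nat k..<h n}"
    using True by (intro card_mono) auto
  then show ?thesis using True by simp
next
  case False
  have "card {t. t < h n \<and> \<not> (0 \<le> int t + k \<and> int t + k < int (h n))} \<le> card {..<nat (- k)}"
    using False by (intro card_mono) auto
  then show ?thesis using False by simp
qed

definition bad :: "nat \<Rightarrow> int \<Rightarrow> (nat \<Rightarrow> nat) set" where
  "bad n k = {x \<in> X. \<phi> n (cadd (Suc n) k (x (Suc n))) \<noteq> cadd n k (\<phi> n (x (Suc n)))}"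

lemma bad_sets [measurable]: "bad n k \<in> sets \<mu>"
  unfolding bad_def by (rule level_set_sets[of "\<lambda>u. \<phi> n (cadd (Suc n) k u) \<noteq> cadd n k (\<phi> n u)"])

lemma measure_bad: "P.prob (bad n k) \<le> real_of_int \<bar>k\<bar> / real (h n)"
proof -
  let ?O = "\<lambda>t. \<not> (0 \<le> int t + k \<and> int t + k < int (h n))"
  have fin: "finite {u. u < h (Suc n) \<and> P u}" for P by simp
  have "card {u. u < h (Suc n) \<and> \<phi> n (cadd (Suc n) k u) \<noteq> cadd n k (\<phi> n u)} \<le> card {u. u < h (Suc n) \<and> ?O (u mod h n)}"
    using \<phi>_cadd by (intro card_mono[OF fin]) blast
  also have "\<dots> = (\<Sum>y<q n. card {t. t < h n \<and> ?O t})"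
    using card_mod_eq[OF h_pos[of n], where q="q n" and P="\<lambda>_. ?O"] by simp
  also have "\<dots> \<le> q n * nat \<bar>k\<bar>" using card_overflow[of n k] by (simp only: sum_constant card_lessThan mult_le_mono2 of_nat_id)
  finally have c: "card {u. u < h (Suc n) \<and> \<phi> n (cadd (Suc n) k u) \<noteq> cadd n k (\<phi> n u)} \<le> q n * nat \<bar>k\<bar>" .
  have "P.prob (bad n k) = real (card {u. u < h (Suc n) \<and> \<phi> n (cadd (Suc n) k u) \<noteq> cadd n k (\<phi> n u)}) / real (h (Suc n))"
    unfolding bad_def by (rule measure_level_set)
  also have "\<dots> \<le> real (q n * nat \<bar>k\<bar>) / real (h (Suc n))" using c by (intro divide_right_mono) (auto simp only: of_nat_le_iff)
  also have "\<dots> = real_of_int \<bar>k\<bar> / real (h n)" using q2[of n] by (simp add: field_simps)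
  finally show ?thesis .
qed

definition good :: "nat \<Rightarrow> int \<Rightarrow> (nat \<Rightarrow> nat) set" where
  "good m k = X - (\<Union>i. bad (m + i) k)"

lemma good_sets [measurable]: "good m k \<in> sets \<mu>"
proof -
  have "space \<mu> - (\<Union>i. bad (m + i) k) \<in> sets \<mu>" by measurable
  then show ?thesis by (simp add: good_def space_\<mu>)
qed

lemma good_X: "x \<in> good m k \<Longrightarrow> x \<in> X" by (simp add: good_def)

lemma good_at: "x \<in> good m k \<Longrightarrow> m \<le> n \<Longrightarrow> \<phi> n (cadd (Suc n) k (x (Suc n))) = cadd n k (x n)"
proof -
  assume x: "x \<in> good m k" and "m \<le> n"
  then obtain i where n: "n = m + i" using le_Suc_ex by blast
  have "x \<notin> bad n k" using x unfolding n good_def by blast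
  then show ?thesis using good_X[OF x] X_\<phi>[of x n] by (simp add: bad_def)
qed

text \<open>At level \<open>m + i\<close> translation by \<open>k\<close> fails with probability at
  most |k| / h (m + i). Heights at least double from level to level, so the failures from level
  \<open>m\<close> on sum to at most twice the first bound.\<close>

lemma measure_good: "1 - 2 * real_of_int \<bar>k\<bar> / real (h m) \<le> P.prob (good m k)"
proof -
  have le: "P.prob (bad (m + i) k) \<le> (real_of_int \<bar>k\<bar> / real (h m)) * (1/2) ^ i" for i
  proof -
    have "real (2 ^ i * h m) \<le> real (h (m + i))" using h_power[of i m] by (simp only: of_nat_le_iff)
    then have "real_of_int \<bar>k\<bar> / real (h (m + i)) \<le> real_of_int \<bar>k\<bar> / real (2 ^ i * h m)"
      by (intro divide_left_mono) auto
    also have "\<dots> = (real_of_int \<bar>k\<bar> / real (h m)) * (1/2) ^ i" by (simp add: power_one_over field_simps)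
    finally show ?thesis using measure_bad[of "m + i" k] by linarith
  qed
  have s: "summable (\<lambda>i. (real_of_int \<bar>k\<bar> / real (h m)) * (1/2) ^ i)"
    by (intro summable_mult summable_geometric) simp
  have s1: "summable (\<lambda>i. P.prob (bad (m + i) k))"
    by (rule summable_comparison_test'[OF s]) (use le in simp)
  have "P.prob (\<Union>i. bad (m + i) k) \<le> (\<Sum>i. P.prob (bad (m + i) k))"
    by (rule P.finite_measure_subadditive_countably[OF _ s1]) auto
  also have "\<dots> \<le> (\<Sum>i. (real_of_int \<bar>k\<bar> / real (h m)) * (1/2) ^ i)"
    by (rule suminf_le[OF le s1 s])
  also have "\<dots> = (real_of_int \<bar>k\<bar> / real (h m)) * 2"
    by (subst suminf_mult) (simp_all add: suminf_geometric summable_geometric)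
  finally have b: "P.prob (\<Union>i. bad (m + i) k) \<le> 2 * real_of_int \<bar>k\<bar> / real (h m)"
    by (simp add: mult.commute)
  have "P.prob (good m k) = 1 - P.prob (\<Union>i. bad (m + i) k)"
    unfolding good_def space_\<mu>[symmetric] by (rule P.prob_compl) auto
  then show ?thesis using b by linarith
qed

lemma Reg_good: "Reg k = (\<Union>m. good m k)"
proof
  show "(\<Union>m. good m k) \<subseteq> Reg k"
  proof
    fix x assume "x \<in> (\<Union>m. good m k)"
    then obtain m where x: "x \<in> good m k" by blast
    show "x \<in> Reg k" unfolding Reg_def
      by (intro CollectI conjI good_X[OF x] exI[of _ m] allI impI good_at[OF x])
  qed
  show "Reg k \<subseteq> (\<Union>m. good m k)"
  proof
    fix x assume "x \<in> Reg k"
    then obtain m where x: "x \<in> X" "\<forall>n\<ge>m. \<phi> n (cadd (Suc n) k (x (Suc n))) = cadd n k (x n)"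
      by (auto simp: Reg_def)
    then have "x \<in> good m k" using X_\<phi>[OF x(1)] by (auto simp: good_def bad_def)
    then show "x \<in> (\<Union>m. good m k)" by blast
  qed
qed

lemma Reg_sets [measurable]: "Reg k \<in> sets \<mu>" unfolding Reg_good by measurable

lemma lim_inv_h: "(\<lambda>m. c / real (h m)) \<longlonglongrightarrow> 0"
proof -
  have "filterlim (\<lambda>m. real (h m)) at_top sequentially"
    by (rule filterlim_at_top_mono[OF filterlim_real_sequentially])
       (intro always_eventually allI, use h_ge_n in \<open>simp add: less_imp_le\<close>)
  then show ?thesis by (intro tendsto_divide_0[OF tendsto_const] filterlim_at_top_imp_at_infinity)
qed

lemma AE_Reg: "AE x in \<mu>. x \<in> Reg k"
proof -
  have "1 - 2 * real_of_int \<bar>k\<bar> / real (h m) \<le> P.prob (Reg k)" for m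
  proof -
    have "P.prob (good m k) \<le> P.prob (Reg k)" by (rule P.finite_measure_mono) (auto simp: Reg_good)
    then show ?thesis using measure_good[of k m] by linarith
  qed
  moreover have "(\<lambda>m. 1 - 2 * real_of_int \<bar>k\<bar> / real (h m)) \<longlonglongrightarrow> 1 - 0"
    by (intro tendsto_intros lim_inv_h)
  ultimately have "1 - 0 \<le> P.prob (Reg k)" by (intro LIMSEQ_le_const2) auto
  then have "P.prob (Reg k) = 1" using P.prob_le_1[of "Reg k"] by linarith
  then show ?thesis by (subst P.AE_in_set_eq_1) auto
qed

lemma bireg_sets [measurable]: "bireg \<in> sets \<mu>" unfolding bireg_def by measurable

lemma AE_bireg: "AE x in \<mu>. x \<in> bireg" unfolding bireg_def using AE_Reg by (simp add: AE_all_countable)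

lemma bireg_X: "x \<in> bireg \<Longrightarrow> x \<in> X" using Reg_X by (auto simp: bireg_def)

definition Tk :: "int \<Rightarrow> (nat \<Rightarrow> nat) \<Rightarrow> (nat \<Rightarrow> nat)" where
  "Tk k x = (if x \<in> Reg k then V k x else x)"

text \<open>This expresses a coordinate of \<open>V k x\<close> through countably many conditions on
  the coordinates of \<open>x\<close>, from which measurability follows.\<close>

lemma V_coord:
  assumes "x \<in> Reg k"
  shows "V k x n = t \<longleftrightarrow> (\<exists>b. \<forall>i\<ge>b. down n i (cadd (n + i) k (x (n + i))) = t)"
proof -
  obtain b where b: "\<forall>m\<ge>b. V k x m = cadd m k (x m)" using Reg_V(2)[OF assms] by blast
  have e: "down n i (cadd (n + i) k (x (n + i))) = V k x n" if "i \<ge> b" for i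
    using X_down[OF Reg_V(1)[OF assms], of n i] b that by simp
  show ?thesis
  proof
    assume "V k x n = t"
    then show "\<exists>b. \<forall>i\<ge>b. down n i (cadd (n + i) k (x (n + i))) = t" using e by blast
  next
    assume "\<exists>b. \<forall>i\<ge>b. down n i (cadd (n + i) k (x (n + i))) = t"
    then obtain b' where "\<forall>i\<ge>b'. down n i (cadd (n + i) k (x (n + i))) = t" by blast
    then have "down n (max b b') (cadd (n + max b b') k (x (n + max b b'))) = t" by simp
    then show "V k x n = t" using e[of "max b b'"] by simp
  qed
qed

lemma eventually_level_sets: "{x \<in> X. \<exists>b. \<forall>i\<ge>b. Q i (x (n + i))} \<in> sets \<mu>"
proof -
  have "{x \<in> X. \<exists>b. \<forall>i\<ge>b. Q i (x (n + i))} = (\<Union>b. \<Inter>i\<in>{b..}. {x \<in> X. Q i (x (n + i))})" by auto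
  also have "\<dots> \<in> sets \<mu>" by (intro sets.countable_UN sets.countable_INT'' subsetI) (auto intro: level_set_sets)
  finally show ?thesis .
qed

lemma Tk_measurable: "Tk k \<in> measurable \<mu> \<mu>"
proof (rule measurable_sigma_sets[OF sets_\<mu>])
  show "(\<lambda>(n, t). cyl n t) ` (SIGMA n:UNIV. {..<h n}) \<subseteq> Pow X" by auto
  show "Tk k \<in> space \<mu> \<rightarrow> X" using Reg_V(1) by (auto simp: Tk_def space_\<mu>)
  fix A assume "A \<in> (\<lambda>(n, t). cyl n t) ` (SIGMA n:UNIV. {..<h n})"
  then obtain n t where A: "A = cyl n t" by auto
  have "Tk k -` A \<inter> space \<mu> = (Reg k \<inter> {x \<in> X. \<exists>b. \<forall>i\<ge>b. down n i (cadd (n + i) k (x (n + i))) = t}) \<union> (cyl n t - Reg k)"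
    using Reg_V(1) Reg_X V_coord[of _ k n t] by (auto simp: A Tk_def space_\<mu> split: if_splits)
  moreover have "{x \<in> X. \<exists>b. \<forall>i\<ge>b. down n i (cadd (n + i) k (x (n + i))) = t} \<in> sets \<mu>"
    by (rule eventually_level_sets[of "\<lambda>i u. down n i (cadd (n + i) k u) = t"])
  ultimately show "Tk k -` A \<inter> space \<mu> \<in> sets \<mu>" using cyl_sets Reg_sets by (simp only: sets.Un sets.Int sets.Diff)
qed

abbreviation S :: "int \<Rightarrow> (nat \<Rightarrow> nat) \<Rightarrow> (nat \<Rightarrow> nat)" where "S \<equiv> iceberg_pow q \<alpha>"

lemma S_measurable: "S k \<in> measurable \<mu> \<mu>"
proof -
  have m: "iceberg_map q \<alpha> = Tk 1" and i: "iceberg_inv q \<alpha> = Tk (- 1)"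
    by (auto simp: map_eq inv_eq Tk_def)
  have "Tk j ^^ n \<in> measurable \<mu> \<mu>" for j n
  proof (induction n)
    case (Suc n) then show ?case by (simp only: funpow.simps measurable_comp[OF Suc Tk_measurable])
  qed (simp add: id_def)
  then show ?thesis by (simp add: iceberg_pow_def m i)
qed

text \<open>On \<open>good m k\<close> the power \<open>S k\<close> is translation by
  \<open>k\<close> at level \<open>m\<close>, so joint probabilities at level \<open>n\<close>
  become counts at level \<open>m\<close>, up to the measure of the exceptional set. The level
  \<open>m\<close> is free: large \<open>m\<close> gives invariance of the measure,
  \<open>m = n + 1\<close> the correlation estimates.\<close>

lemma level_joint_law:
  assumes "n \<le> m" shows "\<bar>P.prob {x \<in> X. R (x n) (S k x n)} -
    real (card {u. u < h m \<and> R (down n (m - n) u) (down n (m - n) (cadd m k u))}) / real (h m)\<bar>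
    \<le> 2 * real_of_int \<bar>k\<bar> / real (h m)"
proof -
  let ?d = "down n (m - n)"
  let ?A = "{x \<in> X. R (x n) (S k x n)}" and ?B = "{x \<in> X. R (?d (x m)) (?d (cadd m k (x m)))}"
  have B: "P.prob ?B = real (card {u. u < h m \<and> R (?d u) (?d (cadd m k u))}) / real (h m)"
    by (rule measure_level_set)
  have Bs: "?B \<in> sets \<mu>" by (rule level_set_sets[of "\<lambda>u. R (?d u) (?d (cadd m k u))"])
  have As: "?A \<in> sets \<mu>"
  proof -
    have [measurable]: "(\<lambda>x. S k x n) \<in> measurable \<mu> (count_space UNIV)"
      by (rule measurable_compose[OF S_measurable coord_meas])
    have "{x \<in> space \<mu>. R (x n) (S k x n)} \<in> sets \<mu>" by measurable
    then show ?thesis by (simp add: space_\<mu>)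
  qed
  have G: "?A \<inter> (good m k \<inter> bireg) = ?B \<inter> (good m k \<inter> bireg)"
  proof -
    have "R (x n) (S k x n) \<longleftrightarrow> R (?d (x m)) (?d (cadd m k (x m)))" if x: "x \<in> good m k" "x \<in> bireg" for x
    proof -
      have xX: "x \<in> X" by (rule good_X[OF x(1)])
      have "V k x \<in> X" "V k x m = cadd m k (x m)" using V_at[OF xX good_at[OF x(1)]] by auto
      then have "?d (cadd m k (x m)) = V k x n" using X_down'[OF _ assms, of "V k x"] by simp
      then show ?thesis using pow_eq_V[OF x(2)] X_down'[OF xX assms] by simp
    qed
    then show ?thesis by auto
  qed
  have "P.prob (good m k \<inter> bireg) = P.prob (good m k)"
    by (rule P.finite_measure_eq_AE) (use AE_bireg in \<open>auto elim: eventually_mono\<close>)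
  then show ?thesis using P.prob_diff_le[OF As Bs _ G] measure_good[of k m] unfolding B by auto
qed

lemma card_cadd:
  "card {u. u < h m \<and> P (cadd m k u)} = card {u. u < h m \<and> P u}"
proof (rule bij_betw_same_card)
  show "bij_betw (cadd m k) {u. u < h m \<and> P (cadd m k u)} {u. u < h m \<and> P u}"
    by (rule bij_betw_byWitness[where f'="cadd m (- k)"]) (auto simp: cadd_0)
qed

lemma level_sets_Int_stable: "Int_stable {{x \<in> X. P (x n)} | n P. True}"
proof (rule Int_stableI)
  fix A B assume "A \<in> {{x \<in> X. P (x n)} | n P. True}" "B \<in> {{x \<in> X. P (x n)} | n P. True}"
  then obtain n P m Q where A: "A = {x \<in> X. P (x n)}" and B: "B = {x \<in> X. Q (x m)}" by blast
  let ?M = "max n m"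
  have "A \<inter> B = {x \<in> X. P (down n (?M - n) (x ?M)) \<and> Q (down m (?M - m) (x ?M))}"
    unfolding A B using X_down'[of _ n ?M] X_down'[of _ m ?M] by auto
  then show "A \<inter> B \<in> {{x \<in> X. P (x n)} | n P. True}"
    by (intro CollectI exI[of _ ?M] exI[of _ "\<lambda>u. P (down n (?M - n) u) \<and> Q (down m (?M - m) u)"]) auto
qed

lemma sets_\<mu>_level: "sets \<mu> = sigma_sets X {{x \<in> X. P (x n)} | n P. True}"
proof
  have "(\<lambda>(n, t). cyl n t) ` (SIGMA n:UNIV. {..<h n}) \<subseteq> {{x \<in> X. P (x n)} | n P. True}"
  proof (clarify)
    fix n t
    show "\<exists>n' P. cyl n t = {x \<in> X. P (x n')} \<and> True"
      by (intro exI[of _ n] exI[of _ "\<lambda>s. s = t"]) simp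
  qed
  then show "sets \<mu> \<subseteq> sigma_sets X {{x \<in> X. P (x n)} | n P. True}"
    unfolding sets_\<mu> by (intro sigma_sets_mono')
  show "sigma_sets X {{x \<in> X. P (x n)} | n P. True} \<subseteq> sets \<mu>" unfolding space_\<mu>[symmetric]
    by (rule sets.sigma_sets_subset) (auto simp: space_\<mu> intro: level_set_sets)
qed

text \<open>Translation permutes the points of level \<open>m\<close>, so the probabilities of a
  level set and of its preimage differ only by the error of \<open>level_joint_law\<close>, which
  tends to 0 with growing \<open>m\<close>.\<close>

lemma S_preserving: "distr \<mu> \<mu> (S k) = \<mu>"
proof (rule measure_eqI_generator_eq[OF level_sets_Int_stable, where \<Omega>=X and A="\<lambda>_. X"])
  show "{{x \<in> X. P (x n)} | n P. True} \<subseteq> Pow X" by auto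
  show "sets (distr \<mu> \<mu> (S k)) = sigma_sets X {{x \<in> X. P (x n)} | n P. True}"
    "sets \<mu> = sigma_sets X {{x \<in> X. P (x n)} | n P. True}" by (simp_all add: sets_\<mu>_level)
  show "range (\<lambda>_. X) \<subseteq> {{x \<in> X. P (x n)} | n P. True}" by (auto intro!: exI[of _ "\<lambda>_. True"])
  interpret D: prob_space "distr \<mu> \<mu> (S k)" by (rule P.prob_space_distr[OF S_measurable])
  show "emeasure (distr \<mu> \<mu> (S k)) X \<noteq> \<infinity>" for i :: nat by (simp add: D.emeasure_eq_measure)
  fix A assume "A \<in> {{x \<in> X. P (x n)} | n P. True}"
  then obtain n P where A: "A = {x \<in> X. P (x n)}" by blast
  have As: "A \<in> sets \<mu>" unfolding A by (rule level_set_sets)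
  have Sx: "S k x \<in> X" if "x \<in> X" for x using measurable_space[OF S_measurable] that by (simp add: space_\<mu>)
  have pre: "S k -` A \<inter> space \<mu> = {x \<in> X. P (S k x n)}" using Sx by (auto simp: A space_\<mu>)
  have bd: "\<bar>P.prob (S k -` A \<inter> space \<mu>) - P.prob A\<bar> \<le> 2 * real_of_int \<bar>k\<bar> / real (h m)" if "n \<le> m" for m
  proof -
    have "{x \<in> X. P (x n)} = {x \<in> X. P (down n (m - n) (x m))}" using X_down'[OF _ that] by auto
    then have "P.prob A = real (card {u. u < h m \<and> P (down n (m - n) u)}) / real (h m)"
      unfolding A by (simp only: measure_level_set[of "\<lambda>u. P (down n (m - n) u)"])
    also have "card {u. u < h m \<and> P (down n (m - n) u)} = card {u. u < h m \<and> P (down n (m - n) (cadd m k u))}"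
      by (rule card_cadd[of m "\<lambda>u. P (down n (m - n) u)", symmetric])
    finally show ?thesis unfolding pre using level_joint_law[OF that, of "\<lambda>_. P" k] by simp
  qed
  have "(\<lambda>m. 2 * real_of_int \<bar>k\<bar> / real (h m)) \<longlonglongrightarrow> 0" by (rule lim_inv_h)
  then have "\<bar>P.prob (S k -` A \<inter> space \<mu>) - P.prob A\<bar> \<le> 0"
    by (rule LIMSEQ_le_const) (use bd in blast)
  then have "P.prob (S k -` A \<inter> space \<mu>) = P.prob A" by simp
  then show "emeasure (distr \<mu> \<mu> (S k)) A = emeasure \<mu> A"
    unfolding emeasure_distr[OF S_measurable As] P.emeasure_eq_measure by simp
qed (auto)

sublocale U: unitary_action \<mu> S
proof unfold_locales
  show "S k \<in> measurable \<mu> \<mu>" for k by (rule S_measurable)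
  show "distr \<mu> \<mu> (S k) = \<mu>" for k by (rule S_preserving)
  show "AE x in \<mu>. S j (S k x) = S (j + k) x" for j k using AE_bireg proof eventually_elim
    case (elim x)
    show ?case unfolding pow_eq_V[OF elim] pow_eq_V[OF bireg_V(1)[OF elim]] by (rule bireg_V(2)[OF elim])
  qed
  show "AE x in \<mu>. S 0 x = x" by (simp add: iceberg_pow_def)
qed

end

section \<open>Sets and functions depending on one coordinate\<close>

context iceberg begin

text \<open>Finitely many coordinates are functions of the highest of them, so sets depending on one
  coordinate form an algebra. The approximable sets are then found to contain the generated
  sigma-algebra by induction.\<close>

lemma level_approx:
  assumes "A \<in> sets \<mu>" "0 < \<epsilon>"
  shows "\<exists>n P. P.prob (sym_diff {x \<in> X. P (x n)} A) < \<epsilon>"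
proof -
  have "A \<in> sigma_sets X {{x \<in> X. P (x n)} | n P. True}" using assms(1) by (simp add: sets_\<mu>_level)
  then have "\<forall>\<epsilon>>0. \<exists>n P. P.prob (sym_diff {x \<in> X. P (x n)} A) < \<epsilon>"
  proof induction
    case (Basic A)
    then obtain n P where "A = {x \<in> X. P (x n)}" by blast
    then have "P.prob (sym_diff {x \<in> X. P (x n)} A) = 0" by simp
    then show ?case by (intro allI impI exI[of _ n] exI[of _ P]) simp
  next
    case Empty
    have "P.prob (sym_diff {x \<in> X. False} {}) = 0" by simp
    then show ?case by (intro allI impI exI[of _ 0] exI[of _ "\<lambda>_. False"]) simp
  next
    case (Compl A)
    show ?case
    proof (intro allI impI)
      fix \<epsilon> :: real assume "0 < \<epsilon>"
      then obtain n P where nP: "P.prob (sym_diff {x \<in> X. P (x n)} A) < \<epsilon>" using Compl.IH by blast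
      have sub: "A \<subseteq> X" using Compl.hyps sigma_sets_into_sp[of "{{x \<in> X. P (x n)} | n P. True}" X A] by auto
      have "sym_diff {x \<in> X. \<not> P (x n)} (X - A) = sym_diff {x \<in> X. P (x n)} A" using sub by auto
      then show "\<exists>n P. P.prob (sym_diff {x \<in> X. P (x n)} (X - A)) < \<epsilon>"
        using nP by (intro exI[of _ n] exI[of _ "\<lambda>t. \<not> P t"]) simp
    qed
  next
    case (Union A)
    have As: "A i \<in> sets \<mu>" for i using Union.hyps by (simp add: sets_\<mu>_level)
    show ?case
    proof (intro allI impI)
      fix \<epsilon> :: real assume e: "0 < \<epsilon>"
      have "(\<lambda>N. P.prob (\<Union>i\<le>N. A i)) \<longlonglongrightarrow> P.prob (\<Union>N. \<Union>i\<le>N. A i)"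
      proof (rule P.finite_Lim_measure_incseq)
        show "range (\<lambda>N. \<Union>i\<le>N. A i) \<subseteq> P.events" using As by auto
        show "incseq (\<lambda>N. \<Union>i\<le>N. A i)" unfolding incseq_def by (intro allI impI UN_mono) auto
      qed
      moreover have "(\<Union>N. \<Union>i\<le>N. A i) = (\<Union>i. A i)" by auto
      ultimately have "(\<lambda>N. P.prob (\<Union>i\<le>N. A i)) \<longlonglongrightarrow> P.prob (\<Union>i. A i)" by simp
      then have "\<forall>\<^sub>F N in sequentially. P.prob (\<Union>i. A i) - \<epsilon> / 2 < P.prob (\<Union>i\<le>N. A i)"
        by (rule order_tendstoD) (use e in simp)
      then obtain N where N: "P.prob (\<Union>i. A i) - \<epsilon> / 2 < P.prob (\<Union>i\<le>N. A i)"
        by (auto simp: eventually_sequentially)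
      \<comment> \<open>Half of the tolerance pays for the tail of the union; the rest is shared
        among the \<open>N + 1\<close> sets kept.\<close>
      define \<delta> where "\<delta> = \<epsilon> / (2 * real (Suc N))"
      have \<delta>: "0 < \<delta>" using e by (simp add: \<delta>_def)
      have "\<forall>i. \<exists>n P. P.prob (sym_diff {x \<in> X. P (x n)} (A i)) < \<delta>" using Union.IH \<delta> by blast
      then have "\<exists>n. \<forall>i. \<exists>P. P.prob (sym_diff {x \<in> X. P (x (n i))} (A i)) < \<delta>" by (rule choice)
      then obtain n where "\<forall>i. \<exists>P. P.prob (sym_diff {x \<in> X. P (x (n i))} (A i)) < \<delta>" by blast
      then have "\<exists>P. \<forall>i. P.prob (sym_diff {x \<in> X. P i (x (n i))} (A i)) < \<delta>" by (rule choice)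
      then obtain P where nP: "\<And>i. P.prob (sym_diff {x \<in> X. P i (x (n i))} (A i)) < \<delta>" by blast
      define B where "B i = {x \<in> X. P i (x (n i))}" for i
      have Bs: "B i \<in> sets \<mu>" for i unfolding B_def by (rule level_set_sets)
      define M where "M = (MAX i\<in>{..N}. n i)"
      have M: "n i \<le> M" if "i \<le> N" for i unfolding M_def using that by (intro Max_ge) auto
      define R where "R u = (\<exists>i\<le>N. P i (down (n i) (M - n i) u))" for u
      have R: "{x \<in> X. R (x M)} = (\<Union>i\<le>N. B i)"
        unfolding R_def B_def using X_down'[OF _ M] by auto
      have fN: "(\<Union>i\<le>N. A i) \<in> sets \<mu>" "(\<Union>i. A i) \<in> sets \<mu>" "(\<Union>i\<le>N. B i) \<in> sets \<mu>" using As Bs by auto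
      have "P.prob (sym_diff (\<Union>i\<le>N. B i) (\<Union>i. A i)) \<le>
          P.prob ((\<Union>i\<le>N. sym_diff (B i) (A i)) \<union> ((\<Union>i. A i) - (\<Union>i\<le>N. A i)))"
        by (rule P.finite_measure_mono) (use fN As Bs in auto)
      also have "\<dots> \<le> P.prob (\<Union>i\<le>N. sym_diff (B i) (A i)) + P.prob ((\<Union>i. A i) - (\<Union>i\<le>N. A i))"
        by (rule measure_Un_le) (use fN As Bs in auto)
      also have "P.prob (\<Union>i\<le>N. sym_diff (B i) (A i)) \<le> (\<Sum>i\<le>N. P.prob (sym_diff (B i) (A i)))"
        by (rule P.finite_measure_subadditive_finite) (use As Bs in auto)
      also have "\<dots> \<le> (\<Sum>i\<le>N. \<delta>)" by (rule sum_mono) (use nP in \<open>auto simp: B_def less_imp_le\<close>)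
      also have "\<dots> = \<epsilon> / 2" by (simp add: \<delta>_def field_simps)
      also have "P.prob ((\<Union>i. A i) - (\<Union>i\<le>N. A i)) = P.prob (\<Union>i. A i) - P.prob (\<Union>i\<le>N. A i)"
        by (rule P.finite_measure_Diff) (use fN in auto)
      also have "\<epsilon> / 2 + (P.prob (\<Union>i. A i) - P.prob (\<Union>i\<le>N. A i)) < \<epsilon>" using N by simp
      finally have f: "P.prob (sym_diff (\<Union>i\<le>N. B i) (\<Union>i. A i)) < \<epsilon>" by simp
      show "\<exists>n P. P.prob (sym_diff {x \<in> X. P (x n)} (\<Union>i. A i)) < \<epsilon>"
        by (rule exI[of _ M], rule exI[of _ R], unfold R, rule f)
    qed
  qed
  then show ?thesis using assms(2) by blast
qed

definition levelf :: "nat \<Rightarrow> (nat \<Rightarrow> complex) \<Rightarrow> (nat \<Rightarrow> nat) \<Rightarrow> complex" where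
  "levelf n F = (\<lambda>x. F (x n))"

lemma levelf_measurable: "levelf n F \<in> borel_measurable \<mu>"
  unfolding levelf_def by (rule measurable_compose[OF coord_meas]) simp

lemma levelf_L2 [intro]: "levelf n F \<in> U.L2"
proof (rule L2_bounded[OF P.finite_measure_axioms levelf_measurable])
  fix x assume "x \<in> space \<mu>"
  then have "x n < h n" using X_lt by (simp add: space_\<mu>)
  then show "norm (levelf n F x) \<le> (\<Sum>t<h n. norm (F t))"
    unfolding levelf_def by (intro member_le_sum[of "x n" "{..<h n}" "\<lambda>t. norm (F t)"]) auto
qed

lemma levelf_lift:
  assumes "n \<le> m" "x \<in> X" shows "levelf n F x = levelf m (\<lambda>u. F (down n (m - n) u)) x"
  unfolding levelf_def using X_down'[OF assms(2,1)] by simp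

lemma integral_joint:
  "(\<integral>x. G (x n) (S k x n) \<partial>\<mu>) = (\<Sum>b<h n. \<Sum>a<h n. G b a * of_real (P.prob {x \<in> X. x n = b \<and> S k x n = a}))"
  for G :: "nat \<Rightarrow> nat \<Rightarrow> complex"
proof -
  let ?A = "\<lambda>b a. {x \<in> X. x n = b \<and> S k x n = a}"
  have As: "?A b a \<in> sets \<mu>" for b a
  proof -
    have [measurable]: "(\<lambda>x. S k x n) \<in> measurable \<mu> (count_space UNIV)"
      by (rule measurable_compose[OF S_measurable coord_meas])
    have "{x \<in> space \<mu>. x n = b \<and> S k x n = a} \<in> sets \<mu>" by measurable
    then show ?thesis by (simp add: space_\<mu>)
  qed
  have Sx: "S k x n < h n" if "x \<in> X" for x
    using measurable_space[OF S_measurable, of x k] that X_lt by (simp add: space_\<mu>)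
  have "(\<integral>x. G (x n) (S k x n) \<partial>\<mu>) = (\<integral>x. (\<Sum>b<h n. \<Sum>a<h n. indicat_real (?A b a) x *\<^sub>R G b a) \<partial>\<mu>)"
  proof (rule Bochner_Integration.integral_cong[OF refl])
    fix x assume "x \<in> space \<mu>"
    then have x: "x \<in> X" by (simp add: space_\<mu>)
    have "(\<Sum>b<h n. \<Sum>a<h n. indicat_real (?A b a) x *\<^sub>R G b a) =
       (\<Sum>b<h n. \<Sum>a<h n. if S k x n = a then (if x n = b then G b a else 0) else 0)"
      using x by (intro sum.cong refl) (auto simp: indicator_def)
    also have "\<dots> = (\<Sum>b<h n. if x n = b then G b (S k x n) else 0)"
      by (intro sum.cong refl) (use Sx[OF x] in \<open>simp add: sum.delta\<close>)
    also have "\<dots> = G (x n) (S k x n)" using X_lt[OF x] by (simp add: sum.delta)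
    finally show "G (x n) (S k x n) = (\<Sum>b<h n. \<Sum>a<h n. indicat_real (?A b a) x *\<^sub>R G b a)" ..
  qed
  also have "\<dots> = (\<Sum>b<h n. \<Sum>a<h n. (\<integral>x. indicat_real (?A b a) x *\<^sub>R G b a \<partial>\<mu>))"
  proof -
    have int: "integrable \<mu> (\<lambda>x. indicat_real (?A b a) x *\<^sub>R G b a)" for a b
      by (intro integrable_scaleR_left integrable_real_indicator As) (simp add: P.emeasure_eq_measure)
    have "(\<integral>x. (\<Sum>b<h n. \<Sum>a<h n. indicat_real (?A b a) x *\<^sub>R G b a) \<partial>\<mu>) =
       (\<Sum>b<h n. (\<integral>x. (\<Sum>a<h n. indicat_real (?A b a) x *\<^sub>R G b a) \<partial>\<mu>))"
      by (rule Bochner_Integration.integral_sum) (intro Bochner_Integration.integrable_sum int)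
    also have "\<dots> = (\<Sum>b<h n. \<Sum>a<h n. (\<integral>x. indicat_real (?A b a) x *\<^sub>R G b a \<partial>\<mu>))"
      by (rule sum.cong[OF refl], rule Bochner_Integration.integral_sum) (rule int)
    finally show ?thesis .
  qed
  also have "\<dots> = (\<Sum>b<h n. \<Sum>a<h n. G b a * of_real (P.prob (?A b a)))"
  proof (intro sum.cong refl)
    fix b a
    have "?A b a \<inter> space \<mu> = ?A b a" by (auto simp: space_\<mu>)
    then have 1: "(\<integral>x. indicat_real (?A b a) x \<partial>\<mu>) = P.prob (?A b a)"
      by (simp only: Bochner_Integration.integral_indicator)
    have "integrable \<mu> (indicat_real (?A b a))"
      by (intro integrable_real_indicator As) (simp add: P.emeasure_eq_measure)
    from Bochner_Integration.integral_scaleR_left[OF this, of "G b a"] show "(\<integral>x. indicat_real (?A b a) x *\<^sub>R G b a \<partial>\<mu>) = G b a * of_real (P.prob (?A b a))"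
      unfolding 1 by (simp only: scaleR_conv_of_real mult.commute)
  qed
  finally show ?thesis .
qed

lemma inner_levelf:
  "U.corr k (levelf n F) (levelf n G) =
     (\<Sum>b<h n. \<Sum>a<h n. F a * cnj (G b) * of_real (P.prob {x \<in> X. x n = b \<and> S k x n = a}))"
  using integral_joint[of "\<lambda>b a. F a * cnj (G b)" n k] unfolding L2_inner_def koopman_def levelf_def .

lemma inner_levelf0:
  "U.inn (levelf n F) (levelf n G) = (\<Sum>a<h n. F a * cnj (G a)) / of_nat (h n)"
proof -
  have "P.prob {x \<in> X. x n = b \<and> S 0 x n = a} = (if a = b then 1 / real (h n) else 0)" if "b < h n" for a b
  proof (cases "a = b")
    case True
    then have "{x \<in> X. x n = b \<and> S 0 x n = a} = cyl n b" by (auto simp: iceberg_pow_def)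
    then show ?thesis using measure_cyl[OF that] True by simp
  next
    case False
    then have e: "{x \<in> X. x n = b \<and> S 0 x n = a} = {}" by (auto simp: iceberg_pow_def)
    show ?thesis unfolding e using False by simp
  qed
  then have "U.corr 0 (levelf n F) (levelf n G) = (\<Sum>b<h n. \<Sum>a<h n. if a = b then F b * cnj (G b) / of_nat (h n) else 0)"
    unfolding inner_levelf by (intro sum.cong refl) auto
  also have "\<dots> = (\<Sum>b<h n. F b * cnj (G b) / of_nat (h n))" by (intro sum.cong refl) simp
  finally show ?thesis using U.corr_zero[OF levelf_L2 levelf_L2, of n F n G] by (simp only: sum_divide_distrib)
qed

lemma levelf_zero_mean_iff: "levelf n F \<in> U.L2_0 \<longleftrightarrow> (\<Sum>a<h n. F a) = 0"
  using inner_levelf0[of n F "\<lambda>_. 1"] levelf_L2[of n F] unfolding U.L2_zero_mean_iff by (simp add: levelf_def)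

text \<open>Equality is asked on the space only, because a function of one coordinate and its lift
  to a higher level agree there but not on arbitrary sequences. With this convention
  \<open>LF\<close> is closed under addition.\<close>

definition LF :: "((nat \<Rightarrow> nat) \<Rightarrow> complex) set" where
  "LF = {f. \<exists>n F. \<forall>x\<in>X. f x = F (x n)}"

lemma LF_AE: "f \<in> LF \<Longrightarrow> \<exists>n F. \<forall>x\<in>X. f x = levelf n F x" by (simp add: LF_def levelf_def)

lemma LF_L2: "f \<in> LF \<Longrightarrow> f \<in> U.L2"
proof -
  assume "f \<in> LF"
  then obtain n F where F: "\<forall>x\<in>X. f x = levelf n F x" using LF_AE by blast
  have m: "f \<in> borel_measurable \<mu>"
    using levelf_measurable[of n F] F by (subst measurable_cong[of \<mu> f "levelf n F"]) (auto simp: space_\<mu>)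
  have "integrable \<mu> (\<lambda>x. (norm (f x))\<^sup>2)" using L2_integrable_sq[OF levelf_L2[of n F]] F
    by (subst Bochner_Integration.integrable_cong[where g="\<lambda>x. (norm (levelf n F x))\<^sup>2" and N=\<mu>]) (auto simp: space_\<mu>)
  with m show ?thesis by (simp add: L2_space_def)
qed

lemma LF_subspace: "L2_subspace \<mu> LF" unfolding L2_subspace_def
proof (intro conjI ballI allI)
  show "LF \<subseteq> U.L2" using LF_L2 by blast
  show "LF \<noteq> {}" by (auto simp: LF_def intro!: exI[of _ "\<lambda>_. 0"])
  fix f assume "f \<in> LF"
  then obtain n F where F: "\<And>x. x \<in> X \<Longrightarrow> f x = F (x n)" by (auto simp: LF_def)
  show "(\<lambda>x. c * f x) \<in> LF" for c unfolding LF_def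
    by (intro CollectI exI[of _ n] exI[of _ "\<lambda>u. c * F u"]) (simp add: F)
  fix g assume "g \<in> LF"
  then obtain m G where G: "\<And>x. x \<in> X \<Longrightarrow> g x = G (x m)" by (auto simp: LF_def)
  let ?M = "max n m"
  have "f x + g x = F (down n (?M - n) (x ?M)) + G (down m (?M - m) (x ?M))" if x: "x \<in> X" for x
    using X_down'[OF x, of n ?M] X_down'[OF x, of m ?M] F[OF x] G[OF x] by simp
  then show "(\<lambda>x. f x + g x) \<in> LF" unfolding LF_def
    by (intro CollectI exI[of _ ?M] exI[of _ "\<lambda>u. F (down n (?M - n) u) + G (down m (?M - m) u)"]) simp
qed

lemma levelf_dense: "U.clo LF = U.L2"
proof
  show "U.clo LF \<subseteq> U.L2" by (rule L2_closure_subset)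
  have LFs: "LF \<subseteq> U.L2" using LF_L2 by blast
  have W: "L2_subspace \<mu> (U.clo LF)" by (rule L2_subspace_closure[OF LF_subspace])
  have ind: "(\<lambda>x. indicator A x) \<in> U.clo LF" if A: "A \<in> sets \<mu>" for A
    unfolding L2_closure_iff proof (intro conjI allI impI)
    show "(\<lambda>x. indicator A x) \<in> U.L2"
      by (rule L2_bounded[OF P.finite_measure_axioms, where C=1]) (use A in \<open>auto simp: indicator_def\<close>)
    fix \<epsilon> :: real assume e: "0 < \<epsilon>"
    then obtain n P where nP: "P.prob (sym_diff {x \<in> X. P (x n)} A) < \<epsilon>\<^sup>2" using level_approx[OF A, of "\<epsilon>\<^sup>2"] by auto
    let ?B = "{x \<in> X. P (x n)}"
    let ?g = "\<lambda>x. if P (x n) then 1 else 0 :: complex"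
    have g: "?g \<in> LF" unfolding LF_def by (intro CollectI exI[of _ n] exI[of _ "\<lambda>u. if P u then 1 else 0"]) simp
    have Ds: "sym_diff ?B A \<in> sets \<mu>" using A level_set_sets[of P n] by auto
    have "(\<integral>x. (norm (indicator A x - ?g x))\<^sup>2 \<partial>\<mu>) = (\<integral>x. indicat_real (sym_diff ?B A) x \<partial>\<mu>)"
      by (intro Bochner_Integration.integral_cong refl) (auto simp: indicator_def space_\<mu>)
    also have "\<dots> = P.prob (sym_diff ?B A)"
      using sets.sets_into_space[OF Ds] by (simp only: Bochner_Integration.integral_indicator Int_absorb2)
    finally have "(U.nrm (\<lambda>x. indicator A x - ?g x))\<^sup>2 < \<epsilon>\<^sup>2" using nP unfolding L2_norm_sq by simp
    then have le: "U.nrm (\<lambda>x. indicator A x - ?g x) < \<epsilon>" by (rule power2_less_imp_less) (use e in simp)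
    show "\<exists>g\<in>LF. U.nrm (\<lambda>x. indicator A x - g x) < \<epsilon>" by (rule bexI[of _ ?g], rule le, rule g)
  qed
  show "U.L2 \<subseteq> U.clo LF"
  proof
    fix f assume f: "f \<in> U.L2"
    then have fm: "f \<in> borel_measurable \<mu>" by auto
    from borel_measurable_implies_sequence_metric[OF fm, of 0] obtain s where
      s': "\<forall>i. simple_function \<mu> (s i)" "\<forall>x\<in>space \<mu>. (\<lambda>i. s i x) \<longlonglongrightarrow> f x"
        "\<forall>i. \<forall>x\<in>space \<mu>. dist (s i x) 0 \<le> 2 * dist (f x) 0" by blast
    have s: "\<And>i. simple_function \<mu> (s i)" "\<And>x. x \<in> space \<mu> \<Longrightarrow> (\<lambda>i. s i x) \<longlonglongrightarrow> f x"
       "\<And>i x. x \<in> space \<mu> \<Longrightarrow> norm (s i x) \<le> 2 * norm (f x)"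
      using s' by (blast, blast, simp add: dist_norm)
    have sW: "s i \<in> U.clo LF" for i
    proof -
      have "(\<lambda>x. \<Sum>y\<in>s i ` space \<mu>. y * indicator (s i -` {y} \<inter> space \<mu>) x) \<in> U.clo LF"
        by (intro L2_subspace_sum[OF W] L2_subspace_scale[OF W] ind simple_functionD(2)[OF s(1)])
      moreover have "AE x in \<mu>. s i x = (\<Sum>y\<in>s i ` space \<mu>. y * indicator (s i -` {y} \<inter> space \<mu>) x)"
      proof (rule AE_I2)
        fix x assume x: "x \<in> space \<mu>"
        have "(\<Sum>y\<in>s i ` space \<mu>. y * indicator (s i -` {y} \<inter> space \<mu>) x) = (\<Sum>y\<in>s i ` space \<mu>. if s i x = y then y else 0)"
          using x by (intro sum.cong refl) (auto simp: indicator_def)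
        also have "\<dots> = s i x" using x simple_functionD(1)[OF s(1)] by (simp add: sum.delta)
        finally show "s i x = (\<Sum>y\<in>s i ` space \<mu>. y * indicator (s i -` {y} \<inter> space \<mu>) x)" ..
      qed
      ultimately show ?thesis by (rule L2_closure_AE[OF LFs _ borel_measurable_simple_function[OF s(1)]])
    qed
    have sm: "s i \<in> borel_measurable \<mu>" for i by (rule borel_measurable_simple_function[OF s(1)])
    have "(\<lambda>i. \<integral>x. (norm (f x - s i x))\<^sup>2 \<partial>\<mu>) \<longlonglongrightarrow> (\<integral>x. 0 \<partial>\<mu>)"
    proof (rule integral_dominated_convergence[where w="\<lambda>x. 9 * (norm (f x))\<^sup>2"])
      show "(\<lambda>x. (norm (f x - s i x))\<^sup>2) \<in> borel_measurable \<mu>" for i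
      proof -
        note [measurable] = fm sm[of i]
        show ?thesis by measurable
      qed
      show "integrable \<mu> (\<lambda>x. 9 * (norm (f x))\<^sup>2)" using L2_integrable_sq[OF f] by simp
      show "AE x in \<mu>. (\<lambda>i. (norm (f x - s i x))\<^sup>2) \<longlonglongrightarrow> 0"
      proof (rule AE_I2)
        fix x assume "x \<in> space \<mu>"
        then have "(\<lambda>i. (norm (f x - s i x))\<^sup>2) \<longlonglongrightarrow> (norm (f x - f x))\<^sup>2" by (intro tendsto_intros s)
        then show "(\<lambda>i. (norm (f x - s i x))\<^sup>2) \<longlonglongrightarrow> 0" by simp
      qed
      show "AE x in \<mu>. norm ((norm (f x - s i x))\<^sup>2) \<le> 9 * (norm (f x))\<^sup>2" for i
      proof (rule AE_I2)
        fix x assume "x \<in> space \<mu>"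
        then have "norm (f x - s i x) \<le> 3 * norm (f x)"
          using s(3)[of x i] norm_triangle_ineq4[of "f x" "s i x"] by simp
        then have "(norm (f x - s i x))\<^sup>2 \<le> (3 * norm (f x))\<^sup>2" by (intro power_mono) auto
        then show "norm ((norm (f x - s i x))\<^sup>2) \<le> 9 * (norm (f x))\<^sup>2" by (simp add: power_mult_distrib)
      qed
    qed simp
    then have "(\<lambda>i. sqrt (\<integral>x. (norm (f x - s i x))\<^sup>2 \<partial>\<mu>)) \<longlonglongrightarrow> sqrt 0"
      by (intro tendsto_real_sqrt) simp
    then have lim: "(\<lambda>i. U.nrm (\<lambda>x. f x - s i x)) \<longlonglongrightarrow> 0" by (simp add: L2_norm_def)
    have "f \<in> U.clo (U.clo LF)" unfolding L2_closure_iff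
    proof (intro conjI allI impI f)
      fix \<epsilon> :: real assume "0 < \<epsilon>"
      then have "\<forall>\<^sub>F i in sequentially. U.nrm (\<lambda>x. f x - s i x) < \<epsilon>" by (rule order_tendstoD(2)[OF lim])
      then obtain i where "U.nrm (\<lambda>x. f x - s i x) < \<epsilon>" by (auto simp: eventually_sequentially)
      then show "\<exists>g\<in>U.clo LF. U.nrm (\<lambda>x. f x - g x) < \<epsilon>" using sW by blast
    qed
    then show "f \<in> U.clo LF" by (simp only: L2_closure_closed[OF LFs])
  qed
qed

definition LF0 :: "((nat \<Rightarrow> nat) \<Rightarrow> complex) set" where
  "LF0 = {levelf n F | n F. (\<Sum>a<h n. F a) = 0}"

lemma LF0_zero_mean: "LF0 \<subseteq> U.L2_0" unfolding LF0_def using levelf_zero_mean_iff by blast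

text \<open>Removing the mean of the approximating cylinder function costs no more than the
  approximation itself, by Cauchy-Schwarz against the constant 1.\<close>

lemma LF0_dense: "U.L2_0 \<subseteq> U.clo LF0"
proof
  fix f assume f: "f \<in> U.L2_0"
  then have fL: "f \<in> U.L2" and f1: "U.inn f (\<lambda>x. 1) = 0" unfolding U.L2_zero_mean_iff by auto
  show "f \<in> U.clo LF0" unfolding L2_closure_iff
  proof (intro conjI allI impI fL)
    fix \<epsilon> :: real assume e: "0 < \<epsilon>"
    have "f \<in> U.clo LF" using fL levelf_dense by simp
    then obtain g where g: "g \<in> LF" "U.nrm (\<lambda>x. f x - g x) < \<epsilon> / 2"
      using half_gt_zero[OF e] unfolding L2_closure_iff by blast
    obtain n F where F: "\<forall>x\<in>X. g x = levelf n F x" using LF_AE[OF g(1)] by blast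
    have gn: "U.nrm (\<lambda>x. f x - levelf n F x) < \<epsilon> / 2"
    proof -
      have "U.nrm (\<lambda>x. f x - g x) = U.nrm (\<lambda>x. f x - levelf n F x)"
        by (rule L2_norm_cong_AE) (use fL LF_L2[OF g(1)] levelf_measurable F in \<open>auto simp: space_\<mu> intro!: AE_I2 borel_measurable_diff\<close>)
      then show ?thesis using g(2) by simp
    qed
    define m where "m = (\<Sum>a<h n. F a) / of_nat (h n)"
    have gm: "U.inn (levelf n F) (\<lambda>x. 1) = m"
      using inner_levelf0[of n F "\<lambda>_. 1"] by (simp add: m_def levelf_def)
    have "U.inn (\<lambda>x. f x - levelf n F x) (\<lambda>x. 1) = - m"
      using inner_diff_left[OF fL levelf_L2 U.one_L2, of n F] f1 gm by simp
    then have "norm m \<le> U.nrm (\<lambda>x. f x - levelf n F x) * U.nrm (\<lambda>x. 1)"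
      using L2_cauchy_schwarz[OF L2_diff[OF fL levelf_L2] U.one_L2, of n F] by simp
    also have "U.nrm (\<lambda>x. 1) = 1" by (simp add: L2_norm_def P.prob_space)
    finally have m: "norm m < \<epsilon> / 2" using gn by simp
    define G where "G = (\<lambda>u. F u - m)"
    have G0: "levelf n G \<in> LF0"
      unfolding LF0_def by (intro CollectI exI[of _ n] exI[of _ G]) (simp add: G_def sum_subtractf m_def)
    have mL: "(\<lambda>x. m) \<in> U.L2" using L2_scale[OF U.one_L2, of m] by simp
    have "U.nrm (\<lambda>x. (f x - levelf n F x) + m) \<le> U.nrm (\<lambda>x. f x - levelf n F x) + U.nrm (\<lambda>x. m)"
      by (rule L2_triangle[OF L2_diff[OF fL levelf_L2] mL])
    also have "U.nrm (\<lambda>x. m) = norm m" by (simp add: L2_norm_def P.prob_space)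
    also have "(\<lambda>x. (f x - levelf n F x) + m) = (\<lambda>x. f x - levelf n G x)" by (auto simp: G_def levelf_def)
    finally have "U.nrm (\<lambda>x. f x - levelf n G x) < \<epsilon>" using gn m by simp
    with G0 show "\<exists>g\<in>LF0. U.nrm (\<lambda>x. f x - g x) < \<epsilon>" by blast
  qed
qed

end

section \<open>The tower for the local rank\<close>

context iceberg begin

lemma funpow_map: "iceberg_map q \<alpha> ^^ i = S (int i)" by (simp add: iceberg_pow_def)

text \<open>A tower of height m needs m positions of room in the block, so its base uses h + 1 - m
  of the h positions, and fixing the coordinate costs a further factor 1 / h. The covered fraction m
  (h + 1 - m) / h^2 is at least 1/4 for m near h / 2, and this rounding loses nothing.\<close>

definition half :: "nat \<Rightarrow> nat" where "half n = (h n + 1) div 2"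

lemma half: "1 \<le> half n" "half n \<le> h n" "(h n)\<^sup>2 \<le> 4 * (half n * (h n + 1 - half n))"
proof -
  have p: "0 < h n" by simp
  then show "1 \<le> half n" "half n \<le> h n" unfolding half_def by linarith+
  obtain m where "h n = 2 * m \<or> h n = 2 * m + 1" by (metis oddE evenE)
  then show "(h n)\<^sup>2 \<le> 4 * (half n * (h n + 1 - half n))"
    unfolding half_def by (auto simp: power2_eq_square algebra_simps)
qed

text \<open>The room left in the block lets coordinate \<open>n\<close> advance by 1 for
  \<open>half n\<close> levels, which makes the levels disjoint and each of them contained in one
  cylinder. The \<open>good\<close> sets ensure that the powers act at level \<open>Suc n\<close> by
  translation.\<close>

definition base :: "nat \<Rightarrow> nat \<Rightarrow> (nat \<Rightarrow> nat) set" where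
  "base n a = {x \<in> X. \<phi> n (x (Suc n)) = a \<and> x (Suc n) mod h n + half n \<le> h n} \<inter> bireg \<inter> (\<Inter>i\<in>{..<half n}. good (Suc n) (int i))"

lemma base_sets: "base n a \<in> sets \<mu>"
proof -
  have "{x \<in> X. \<phi> n (x (Suc n)) = a \<and> x (Suc n) mod h n + half n \<le> h n} \<in> sets \<mu>"
    by (rule level_set_sets[of "\<lambda>u. \<phi> n u = a \<and> u mod h n + half n \<le> h n"])
  moreover have "(\<Inter>i\<in>{..<half n}. good (Suc n) (int i)) \<in> sets \<mu>"
    by (rule sets.finite_INT) (use half(1)[of n] good_sets in \<open>auto simp: lessThan_empty_iff\<close>)
  ultimately show ?thesis unfolding base_def using bireg_sets by (intro sets.Int)
qed

lemma base_level:
  assumes x: "x \<in> base n a" and i: "i < half n" shows "S (int i) x n = cadd n (int i) a"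
proof -
  have xX: "x \<in> X" and xb: "x \<in> bireg" and xg: "x \<in> good (Suc n) (int i)"
    and xa: "\<phi> n (x (Suc n)) = a" and xm: "x (Suc n) mod h n + half n \<le> h n"
    using x i by (auto simp: base_def)
  have V: "V (int i) x \<in> X" "V (int i) x (Suc n) = cadd (Suc n) (int i) (x (Suc n))"
    using V_at[OF xX good_at[OF xg]] by auto
  have "V (int i) x n = \<phi> n (cadd (Suc n) (int i) (x (Suc n)))" using X_\<phi>[OF V(1), of n] V(2) by simp
  also have "\<dots> = cadd n (int i) (\<phi> n (x (Suc n)))"
    by (rule \<phi>_cadd) (use X_lt[OF xX, of "Suc n"] xm i in auto)
  finally show ?thesis using pow_eq_V[OF xb] xa by simp
qed

lemma S_image:
  assumes C: "C \<subseteq> bireg" shows "S k ` C = bireg \<inter> (S (- k) -` C \<inter> space \<mu>)"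
proof
  show "S k ` C \<subseteq> bireg \<inter> (S (- k) -` C \<inter> space \<mu>)"
  proof
    fix y assume "y \<in> S k ` C"
    then obtain x where x: "x \<in> C" "y = S k x" by blast
    then have xb: "x \<in> bireg" using C by blast
    have y: "y = V k x" "y \<in> bireg" using x pow_eq_V[OF xb] bireg_V(1)[OF xb] by auto
    have "S (- k) y = V (- k) (V k x)" using pow_eq_V[OF y(2)] y(1) by simp
    also have "\<dots> = x" using bireg_V(2)[OF xb, of "- k" k] V_0[OF bireg_X[OF xb]] by simp
    finally show "y \<in> bireg \<inter> (S (- k) -` C \<inter> space \<mu>)" using y x bireg_X[OF y(2)] by (simp add: space_\<mu>)
  qed
  show "bireg \<inter> (S (- k) -` C \<inter> space \<mu>) \<subseteq> S k ` C"
  proof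
    fix y assume y: "y \<in> bireg \<inter> (S (- k) -` C \<inter> space \<mu>)"
    then have yb: "y \<in> bireg" and c: "S (- k) y \<in> C" by auto
    have "S k (S (- k) y) = V k (V (- k) y)" using pow_eq_V[OF yb] pow_eq_V[OF bireg_V(1)[OF yb]] by simp
    also have "\<dots> = y" using bireg_V(2)[OF yb, of k "- k"] V_0[OF bireg_X[OF yb]] by simp
    finally show "y \<in> S k ` C" using c by (metis imageI)
  qed
qed

lemma S_image_measure:
  assumes C: "C \<subseteq> bireg" "C \<in> sets \<mu>"
  shows "S k ` C \<in> sets \<mu>" "P.prob (S k ` C) = P.prob C"
proof -
  have p: "S (- k) -` C \<inter> space \<mu> \<in> sets \<mu>" by (rule measurable_sets[OF S_measurable C(2)])
  show "S k ` C \<in> sets \<mu>" unfolding S_image[OF C(1)] by (intro sets.Int bireg_sets p)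
  have "P.prob (S k ` C) = P.prob (S (- k) -` C \<inter> space \<mu>)" unfolding S_image[OF C(1)]
    by (rule P.finite_measure_eq_AE) (use AE_bireg p in \<open>auto elim: eventually_mono\<close>)
  also have "\<dots> = measure (distr \<mu> \<mu> (S (- k))) C" by (rule measure_distr[OF S_measurable C(2), symmetric])
  finally show "P.prob (S k ` C) = P.prob C" by (simp only: S_preserving)
qed

lemma base_bireg: "base n a \<subseteq> bireg" by (auto simp: base_def)

lemma base_rokhlin: "rokhlin_tower \<mu> (iceberg_map q \<alpha>) (base n a) (half n)"
  unfolding rokhlin_tower_def tower_level_def funpow_map
proof (intro conjI allI impI half(1))
  show "S (int i) ` base n a \<in> sets \<mu>" for i by (rule S_image_measure(1)[OF base_bireg base_sets])
  show "disjoint_family_on (\<lambda>i. S (int i) ` base n a) {..<half n}" unfolding disjoint_family_on_def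
  proof (intro ballI impI)
    fix i j assume ij: "i \<in> {..<half n}" "j \<in> {..<half n}" "i \<noteq> j"
    show "S (int i) ` base n a \<inter> S (int j) ` base n a = {}"
    proof (rule ccontr)
      assume "\<not> ?thesis"
      then obtain x x' where x: "x \<in> base n a" "x' \<in> base n a" "S (int i) x = S (int j) x'" by blast
      then have "cadd n (int i) a = cadd n (int j) a" using base_level ij by (metis lessThan_iff)
      then have "(int a + int i) mod int (h n) = (int a + int j) mod int (h n)" by (simp only: int_cadd[symmetric])
      then have "int i mod int (h n) = int j mod int (h n)" by (simp add: mod_eq_dvd_iff)
      then show False using ij half(2)[of n] by simp
    qed
  qed
qed

lemma tower_measure:
  "P.prob (tower_union (iceberg_map q \<alpha>) (base n a) (half n)) = real (half n) * P.prob (base n a)"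
proof -
  have "P.prob (\<Union>i\<in>{..<half n}. S (int i) ` base n a) = (\<Sum>i<half n. P.prob (S (int i) ` base n a))"
    using base_rokhlin[of n a] unfolding rokhlin_tower_def tower_level_def funpow_map
    by (intro P.finite_measure_finite_Union) auto
  also have "\<dots> = (\<Sum>i<half n. P.prob (base n a))"
    by (intro sum.cong refl S_image_measure(2)[OF base_bireg base_sets])
  finally show ?thesis unfolding tower_union_def tower_level_def funpow_map by simp
qed

text \<open>The counts over all \<open>a\<close> add up to \<open>q n * (h n + 1 - half n)\<close>,
  so some \<open>a\<close> receives at least its share. The subtracted term comes from deleting
  \<open>half n\<close> exceptional sets, each of measure at most
  \<open>2 * half n / h (Suc n)\<close>.\<close>

lemma base_measure_ge:
  "\<exists>a<h n. 1 / 4 - 2 * (real (h n))\<^sup>2 / real (q n) \<le> real (half n) * P.prob (base n a)"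
proof -
  let ?Q = "\<lambda>a u. \<phi> n u = a \<and> u mod h n + half n \<le> h n"
  let ?c = "\<lambda>a. card {u. u < h (Suc n) \<and> ?Q a u}"
  have "(\<Sum>a<h n. ?c a) = card (\<Union>a<h n. {u. u < h (Suc n) \<and> ?Q a u})"
    by (rule card_UN_disjoint[symmetric]) auto
  also have "(\<Union>a<h n. {u. u < h (Suc n) \<and> ?Q a u}) = {u. u < q n * h n \<and> u mod h n + half n \<le> h n}"
    by auto
  also have "card \<dots> = (\<Sum>y<q n. card {t. t < h n \<and> t + half n \<le> h n})"
    by (rule card_mod_eq[OF h_pos])
  also have "{t. t < h n \<and> t + half n \<le> h n} = {..<h n + 1 - half n}" using half[of n] by auto
  finally have sum: "(\<Sum>a<h n. ?c a) = q n * (h n + 1 - half n)" by simp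
  have "\<exists>a<h n. q n * (h n + 1 - half n) \<le> h n * ?c a"
  proof (rule ccontr)
    assume "\<not> ?thesis"
    then have lt: "h n * ?c a < q n * (h n + 1 - half n)" if "a < h n" for a using that by (auto simp: not_le)
    have "h n * (\<Sum>a<h n. ?c a) = (\<Sum>a<h n. h n * ?c a)" by (rule sum_distrib_left)
    also have "\<dots> < (\<Sum>a<h n. q n * (h n + 1 - half n))"
      by (rule sum_strict_mono) (use lt in \<open>auto simp: lessThan_empty_iff\<close>)
    also have "\<dots> = h n * (q n * (h n + 1 - half n))" by simp
    finally show False unfolding sum by simp
  qed
  then obtain a where a: "a < h n" "q n * (h n + 1 - half n) \<le> h n * ?c a" by blast
  let ?H = "real (half n)"
  have H0: "0 < real (h n)" "0 < real (q n)" using q2[of n] by auto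
  define A where "A = {x \<in> X. \<phi> n (x (Suc n)) = a \<and> x (Suc n) mod h n + half n \<le> h n}"
  have As: "A \<in> sets \<mu>" unfolding A_def by (rule level_set_sets[of "?Q a"])
  define Bad where "Bad = (\<Union>i\<in>{..<half n}. space \<mu> - good (Suc n) (int i))"
  have Bs: "Bad \<in> sets \<mu>" unfolding Bad_def using good_sets by (intro sets.finite_UN sets.compl_sets) auto
  have mA: "P.prob A = real (?c a) / real (h (Suc n))" unfolding A_def by (rule measure_level_set)
  have mB: "P.prob Bad \<le> ?H * (2 * ?H / real (h (Suc n)))"
  proof -
    have "P.prob Bad \<le> (\<Sum>i<half n. P.prob (space \<mu> - good (Suc n) (int i)))"
      unfolding Bad_def using good_sets by (intro P.finite_measure_subadditive_finite) auto
    also have "\<dots> \<le> (\<Sum>i<half n. 2 * ?H / real (h (Suc n)))"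
    proof (rule sum_mono)
      fix i assume "i \<in> {..<half n}"
      then have i: "real i \<le> ?H" by simp
      have "P.prob (space \<mu> - good (Suc n) (int i)) = 1 - P.prob (good (Suc n) (int i))" by (rule P.prob_compl[OF good_sets])
      also have "\<dots> \<le> 2 * real i / real (h (Suc n))" using measure_good[of "int i" "Suc n"] by simp
      also have "\<dots> \<le> 2 * ?H / real (h (Suc n))" using i by (intro divide_right_mono) auto
      finally show "P.prob (space \<mu> - good (Suc n) (int i)) \<le> 2 * ?H / real (h (Suc n))" .
    qed
    finally show ?thesis by simp
  qed
  have "P.prob A \<le> P.prob (base n a \<union> Bad)"
  proof (rule P.finite_measure_mono_AE)
    show "AE x in \<mu>. x \<in> A \<longrightarrow> x \<in> base n a \<union> Bad" using AE_bireg AE_space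
      by eventually_elim (auto simp: base_def A_def Bad_def)
  qed (use base_sets Bs in auto)
  also have "\<dots> \<le> P.prob (base n a) + P.prob Bad" by (rule measure_Un_le[OF base_sets Bs])
  finally have ge: "real (?c a) / real (h (Suc n)) - ?H * (2 * ?H / real (h (Suc n))) \<le> P.prob (base n a)"
    using mA mB by linarith
  have c1: "real (q n) * real (h n + 1 - half n) / real (h n) \<le> real (?c a)"
  proof -
    have "real (q n * (h n + 1 - half n)) \<le> real (h n * ?c a)" using a(2) by (simp only: of_nat_le_iff)
    then show ?thesis using H0 by (simp add: pos_divide_le_eq mult.commute)
  qed
  have "?H * (real (q n) * real (h n + 1 - half n) / real (h n) / real (h (Suc n)) - ?H * (2 * ?H / real (h (Suc n))))
     \<le> ?H * P.prob (base n a)"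
  proof (rule mult_left_mono)
    have "real (q n) * real (h n + 1 - half n) / real (h n) / real (h (Suc n)) \<le> real (?c a) / real (h (Suc n))"
      by (rule divide_right_mono[OF c1]) simp
    then show "real (q n) * real (h n + 1 - half n) / real (h n) / real (h (Suc n)) - ?H * (2 * ?H / real (h (Suc n))) \<le> P.prob (base n a)"
      using ge by linarith
  qed simp
  moreover have "1 / 4 \<le> ?H * (real (q n) * real (h n + 1 - half n) / real (h n) / real (h (Suc n)))"
  proof -
    have "real ((h n)\<^sup>2) \<le> real (4 * (half n * (h n + 1 - half n)))" using half(3)[of n] by (simp only: of_nat_le_iff)
    then have "(real (h n))\<^sup>2 \<le> 4 * (?H * real (h n + 1 - half n))" by (simp only: of_nat_power of_nat_mult of_nat_numeral)
    moreover have e: "?H * (real (q n) * real (h n + 1 - half n) / real (h n) / real (h (Suc n))) = ?H * real (h n + 1 - half n) / (real (h n))\<^sup>2"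
      using H0 by (simp add: power2_eq_square)
    moreover have "0 < (real (h n))\<^sup>2" using H0 by simp
    ultimately show ?thesis unfolding e by (subst pos_le_divide_eq) (assumption, linarith)
  qed
  moreover have "?H * (?H * (2 * ?H / real (h (Suc n)))) \<le> 2 * (real (h n))\<^sup>2 / real (q n)"
  proof -
    have H: "?H \<le> real (h n)" using half(2)[of n] by simp
    have "?H * (?H * (2 * ?H / real (h (Suc n)))) = 2 * (?H * ?H * ?H) / real (h (Suc n))" by simp
    also have "\<dots> \<le> 2 * (real (h n) * real (h n) * real (h n)) / real (h (Suc n))"
      using H by (intro divide_right_mono mult_left_mono mult_mono) auto
    also have "\<dots> = 2 * (real (h n))\<^sup>2 / real (q n)" using H0 by (simp add: power2_eq_square)
    finally show ?thesis .
  qed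
  ultimately have "1 / 4 - 2 * (real (h n))\<^sup>2 / real (q n) \<le> ?H * P.prob (base n a)"
    unfolding right_diff_distrib by linarith
  then show ?thesis using a(1) by blast
qed

text \<open>One sequence has to serve every tolerance. A set depending on coordinate
  \<open>m\<close> also depends on coordinate \<open>n\<close> for all \<open>n \<ge> m\<close>, so
  choosing at each level a set closest to \<open>A\<close> works.\<close>

lemma best_level_approx:
  assumes A: "A \<in> sets \<mu>"
  shows "\<exists>E. (\<lambda>n. P.prob (sym_diff {x \<in> X. x n \<in> E n} A)) \<longlonglongrightarrow> 0"
proof -
  let ?d = "\<lambda>n E. P.prob (sym_diff {x \<in> X. x n \<in> E} A)"
  have "\<exists>E\<in>Pow {..<h n}. \<forall>E'\<in>Pow {..<h n}. ?d n E \<le> ?d n E'" for n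
  proof -
    have f: "finite (?d n ` Pow {..<h n})" and ne: "?d n ` Pow {..<h n} \<noteq> {}" by auto
    obtain E where E: "E \<in> Pow {..<h n}" "Min (?d n ` Pow {..<h n}) = ?d n E" using Min_in[OF f ne] by blast
    have "?d n E \<le> ?d n E'" if "E' \<in> Pow {..<h n}" for E' unfolding E(2)[symmetric] using f that by (intro Min_le) auto
    then show ?thesis using E(1) by blast
  qed
  then have "\<forall>n. \<exists>E. \<forall>E'\<in>Pow {..<h n}. ?d n E \<le> ?d n E'" by blast
  then have "\<exists>E. \<forall>n. \<forall>E'\<in>Pow {..<h n}. ?d n (E n) \<le> ?d n E'" by (rule choice)
  then obtain E where E: "\<And>n E'. E' \<in> Pow {..<h n} \<Longrightarrow> ?d n (E n) \<le> ?d n E'" by blast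
  have "(\<lambda>n. ?d n (E n)) \<longlonglongrightarrow> 0"
  proof (rule tendstoI)
    fix \<epsilon> :: real assume e: "0 < \<epsilon>"
    obtain m P where mP: "P.prob (sym_diff {x \<in> X. P (x m)} A) < \<epsilon>" using level_approx[OF A e] by blast
    show "\<forall>\<^sub>F n in sequentially. dist (?d n (E n)) 0 < \<epsilon>"
    proof (rule eventually_sequentiallyI[of m])
      fix n assume n: "m \<le> n"
      let ?E = "{u. u < h n \<and> P (down m (n - m) u)}"
      have "{x \<in> X. x n \<in> ?E} = {x \<in> X. P (x m)}" using X_down'[OF _ n] X_lt by auto
      then have "?d n ?E < \<epsilon>" using mP by (simp only:)
      moreover have "?d n (E n) \<le> ?d n ?E" by (rule E) auto
      ultimately show "dist (?d n (E n)) 0 < \<epsilon>" by simp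
    qed
  qed
  then show ?thesis by blast
qed

text \<open>The measures of the towers need not converge, whence the subsequence. Every level of a
  tower lies in a single cylinder of its coordinate, so inside the tower a set depending on that
  coordinate is a union of levels.\<close>

lemma local_rank_ge:
  assumes lim: "(\<lambda>n. (real (h n))\<^sup>2 / real (q n)) \<longlonglongrightarrow> 0"
  shows "1 / 4 \<le> local_rank \<mu> (iceberg_map q \<alpha>)"
proof -
  let ?T = "iceberg_map q \<alpha>"
  have "\<forall>n. \<exists>a. 1 / 4 - 2 * (real (h n))\<^sup>2 / real (q n) \<le> real (half n) * P.prob (base n a)"
    using base_measure_ge by blast
  then have "\<exists>a. \<forall>n. 1 / 4 - 2 * (real (h n))\<^sup>2 / real (q n) \<le> real (half n) * P.prob (base n (a n))" by (rule choice)
  then obtain a where a: "\<And>n. 1 / 4 - 2 * (real (h n))\<^sup>2 / real (q n) \<le> real (half n) * P.prob (base n (a n))" by blast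
  define b where "b n = P.prob (tower_union ?T (base n (a n)) (half n))" for n
  have b01: "b n \<in> {0..1}" for n by (simp add: b_def)
  have "seq_compact {0..1::real}" by (simp add: compact_imp_seq_compact)
  then obtain l r where r: "strict_mono (r :: nat \<Rightarrow> nat)" "(b \<circ> r) \<longlonglongrightarrow> l"
    using b01 unfolding seq_compact_def by meson
  have bge: "1 / 4 - 2 * ((real (h n))\<^sup>2 / real (q n)) \<le> b n" for n
    using a[of n] unfolding b_def tower_measure by simp
  have "(\<lambda>n. 1 / 4 - 2 * ((real (h (r n)))\<^sup>2 / real (q (r n)))) \<longlonglongrightarrow> 1 / 4 - 2 * 0"
    by (intro tendsto_intros LIMSEQ_subseq_LIMSEQ[OF lim r(1), unfolded comp_def])
  then have "1 / 4 - 2 * 0 \<le> l"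
    by (rule LIMSEQ_le[OF _ r(2)]) (use bge in \<open>auto simp: comp_def\<close>)
  then have l: "1 / 4 \<le> l" by simp
  have app: "approximating_towers \<mu> ?T (\<lambda>n. base (r n) (a (r n))) (\<lambda>n. half (r n))"
    unfolding approximating_towers_def proof (intro conjI allI ballI)
    show "rokhlin_tower \<mu> ?T (base (r n) (a (r n))) (half (r n))" for n by (rule base_rokhlin)
    fix A assume A: "A \<in> sets \<mu>"
    obtain E where E: "(\<lambda>n. P.prob (sym_diff {x \<in> X. x n \<in> E n} A)) \<longlonglongrightarrow> 0" using best_level_approx[OF A] by blast
    define B where "B n = {x \<in> X. x (r n) \<in> E (r n)}" for n
    show "\<exists>B. (\<forall>n. B n \<in> sets \<mu> \<and> (\<exists>J\<subseteq>{..<half (r n)}. B n \<inter> tower_union ?T (base (r n) (a (r n))) (half (r n)) =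
            (\<Union>j\<in>J. tower_level ?T (base (r n) (a (r n))) j))) \<and> (\<lambda>n. P.prob (sym_diff (B n) A)) \<longlonglongrightarrow> 0"
    proof (intro exI[of _ B] conjI allI)
      show "B n \<in> sets \<mu>" for n unfolding B_def by (rule level_set_sets)
      show "(\<lambda>n. P.prob (sym_diff (B n) A)) \<longlonglongrightarrow> 0"
        using LIMSEQ_subseq_LIMSEQ[OF E r(1)] unfolding B_def comp_def .
      fix n
      let ?J = "{j. j < half (r n) \<and> cadd (r n) (int j) (a (r n)) \<in> E (r n)}"
      have lev: "y \<in> B n \<longleftrightarrow> cadd (r n) (int j) (a (r n)) \<in> E (r n)"
        if y: "y \<in> S (int j) ` base (r n) (a (r n))" and j: "j < half (r n)" for y j
      proof -
        obtain x where x: "x \<in> base (r n) (a (r n))" "y = S (int j) x" using y by blast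
        have "S (int j) ` base (r n) (a (r n)) \<subseteq> X"
          using sets.sets_into_space[OF S_image_measure(1)[OF base_bireg base_sets]] unfolding space_\<mu> .
        then have "y \<in> X" using y by blast
        then show ?thesis using base_level[OF x(1) j] x(2) by (simp add: B_def)
      qed
      have "B n \<inter> (\<Union>j<half (r n). S (int j) ` base (r n) (a (r n))) = (\<Union>j\<in>?J. S (int j) ` base (r n) (a (r n)))"
        using lev by blast
      then show "\<exists>J\<subseteq>{..<half (r n)}. B n \<inter> tower_union ?T (base (r n) (a (r n))) (half (r n)) =
            (\<Union>j\<in>J. tower_level ?T (base (r n) (a (r n))) j)"
        unfolding tower_union_def tower_level_def funpow_map by (intro exI[of _ ?J]) auto
    qed
  qed
  have "l \<le> local_rank \<mu> ?T" unfolding local_rank_def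
  proof (rule cSup_upper)
    show "l \<in> {\<beta>. \<exists>C h. approximating_towers \<mu> ?T C h \<and> (\<lambda>n. P.prob (tower_union ?T (C n) (h n))) \<longlonglongrightarrow> \<beta>}"
      using app r(2) unfolding b_def comp_def by blast
    show "bdd_above {\<beta>. \<exists>C h. approximating_towers \<mu> ?T C h \<and> (\<lambda>n. P.prob (tower_union ?T (C n) (h n))) \<longlonglongrightarrow> \<beta>}"
    proof (rule bdd_aboveI[of _ 1])
      fix \<beta> assume "\<beta> \<in> {\<beta>. \<exists>C h. approximating_towers \<mu> ?T C h \<and> (\<lambda>n. P.prob (tower_union ?T (C n) (h n))) \<longlonglongrightarrow> \<beta>}"
      then obtain C h' where "(\<lambda>n. P.prob (tower_union ?T (C n) (h' n))) \<longlonglongrightarrow> \<beta>" by blast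
      then show "\<beta> \<le> 1" by (rule LIMSEQ_le_const2) (auto intro: P.prob_le_1)
    qed
  qed
  with l show ?thesis by simp
qed

end

section \<open>Equidistribution for random rotations\<close>

locale rotations =
  fixes q :: "nat \<Rightarrow> nat"
  assumes q2: "\<And>n. 2 \<le> q n"
begin

abbreviation h :: "nat \<Rightarrow> nat" where "h \<equiv> iceberg_height q"
abbreviation RM :: "(nat \<times> nat \<Rightarrow> nat) measure" where "RM \<equiv> rotation_measure q"

lemma iceberg_q: "iceberg q" by (rule iceberg.intro) (rule q2)
lemmas h_pos = iceberg.h_pos[OF iceberg_q]

lemma rotation_distr_prob: "prob_space (rotation_distr q i)"
  using h_pos[of "fst i"] unfolding rotation_distr_def split_def
  by (intro prob_space_uniform_count_measure) (auto simp: lessThan_empty_iff)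

sublocale RP: prob_space RM unfolding rotation_measure_def by (intro prob_space_PiM rotation_distr_prob)

lemma index_iff: "(n, y) \<in> rotation_index q \<longleftrightarrow> y < q n" by (simp add: rotation_index_def)

lemma measurable_rotation_distr: "f \<in> measurable (rotation_distr q i) (count_space UNIV)"
  unfolding rotation_distr_def split_def
  by (auto simp: measurable_def space_uniform_count_measure sets_uniform_count_measure)

lemma coord_measurable:
  assumes "i \<in> K" shows "(\<lambda>f. f i) \<in> measurable (PiM K (rotation_distr q)) (count_space UNIV)"
  by (rule measurable_compose[OF measurable_component_singleton[OF assms] measurable_rotation_distr])

lemma coord_RM: "y < q n \<Longrightarrow> (\<lambda>\<alpha>. \<alpha> (n, y)) \<in> measurable RM (count_space UNIV)"
  unfolding rotation_measure_def by (rule coord_measurable) (simp add: index_iff)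

lemma coord_lt: "\<alpha> \<in> space RM \<Longrightarrow> y < q n \<Longrightarrow> \<alpha> (n, y) < h n"
proof -
  assume a: "\<alpha> \<in> space RM" and y: "y < q n"
  then have "\<alpha> (n, y) \<in> space (rotation_distr q (n, y))"
    unfolding rotation_measure_def space_PiM using index_iff by (auto simp: PiE_def Pi_def)
  then show ?thesis by (simp add: rotation_distr_def space_uniform_count_measure)
qed

lemma indep_coords: "RP.indep_vars (rotation_distr q) (\<lambda>i \<alpha>. \<alpha> i) (rotation_index q)"
proof -
  have ne: "rotation_index q \<noteq> {}" using q2[of 0] index_iff[of 0 0] by auto
  have rv: "(\<lambda>\<alpha>. \<alpha> i) \<in> measurable RM (rotation_distr q i)" if "i \<in> rotation_index q" for i
    unfolding rotation_measure_def by (rule measurable_component_singleton[OF that])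
  have "distr RM (PiM (rotation_index q) (rotation_distr q)) (\<lambda>\<alpha>. \<lambda>i\<in>rotation_index q. \<alpha> i) = distr RM RM (\<lambda>\<alpha>. \<alpha>)"
    by (rule distr_cong) (auto simp: rotation_measure_def space_PiM PiE_def extensional_restrict)
  also have "\<dots> = PiM (rotation_index q) (rotation_distr q)" by (simp add: rotation_measure_def distr_id2)
  also have "\<dots> = PiM (rotation_index q) (\<lambda>i. distr RM (rotation_distr q i) (\<lambda>\<alpha>. \<alpha> i))"
    unfolding rotation_measure_def
    by (rule PiM_cong[OF refl]) (rule distr_PiM_component[symmetric], rule rotation_distr_prob)
  finally show ?thesis by (subst RP.indep_vars_iff_distr_eq_PiM'[OF ne rv])
qed

lemma prob_coord:
  assumes "y < q n" "c < h n" shows "RP.prob {\<alpha> \<in> space RM. \<alpha> (n, y) = c} = 1 / real (h n)"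
proof -
  have i: "(n, y) \<in> rotation_index q" using assms by (simp add: index_iff)
  have s: "{c} \<in> sets (rotation_distr q (n, y))" using assms by (simp add: rotation_distr_def sets_uniform_count_measure)
  have m: "(\<lambda>\<alpha>. \<alpha> (n, y)) \<in> measurable RM (rotation_distr q (n, y))"
    unfolding rotation_measure_def by (rule measurable_component_singleton[OF i])
  have "{\<alpha> \<in> space RM. \<alpha> (n, y) = c} = (\<lambda>\<alpha>. \<alpha> (n, y)) -` {c} \<inter> space RM" by auto
  then have "RP.prob {\<alpha> \<in> space RM. \<alpha> (n, y) = c} = measure (distr RM (rotation_distr q (n, y)) (\<lambda>\<alpha>. \<alpha> (n, y))) {c}"
    using measure_distr[OF m s] by simp
  also have "distr RM (rotation_distr q (n, y)) (\<lambda>\<alpha>. \<alpha> (n, y)) = rotation_distr q (n, y)"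
    unfolding rotation_measure_def by (rule distr_PiM_component[OF rotation_distr_prob i])
  also have "measure (rotation_distr q (n, y)) {c} = 1 / real (h n)"
    using assms by (simp add: rotation_distr_def measure_uniform_count_measure)
  finally show ?thesis .
qed

lemma prob_coord2:
  assumes "y < q n" "y' < q n" "y \<noteq> y'" "c < h n" "c' < h n"
  shows "RP.prob {\<alpha> \<in> space RM. \<alpha> (n, y) = c \<and> \<alpha> (n, y') = c'} = 1 / (real (h n))\<^sup>2"
proof -
  define C where "C = (\<lambda>i. if i = (n, y) then {c} else {c'})"
  have ne: "(n, y) \<noteq> (n, y')" using assms by simp
  have "RP.prob (\<Inter>i\<in>{(n, y), (n, y')}. (\<lambda>\<alpha>. \<alpha> i) -` C i \<inter> space RM) =
      (\<Prod>i\<in>{(n, y), (n, y')}. RP.prob ((\<lambda>\<alpha>. \<alpha> i) -` C i \<inter> space RM))"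
    by (rule RP.indep_varsD[OF indep_coords])
       (use assms in \<open>auto simp: index_iff C_def rotation_distr_def sets_uniform_count_measure\<close>)
  moreover have "(\<Inter>i\<in>{(n, y), (n, y')}. (\<lambda>\<alpha>. \<alpha> i) -` C i \<inter> space RM) = {\<alpha> \<in> space RM. \<alpha> (n, y) = c \<and> \<alpha> (n, y') = c'}"
    using ne by (auto simp: C_def)
  moreover have "(\<Prod>i\<in>{(n, y), (n, y')}. RP.prob ((\<lambda>\<alpha>. \<alpha> i) -` C i \<inter> space RM)) =
     RP.prob ((\<lambda>\<alpha>. \<alpha> (n, y)) -` C (n, y) \<inter> space RM) * RP.prob ((\<lambda>\<alpha>. \<alpha> (n, y')) -` C (n, y') \<inter> space RM)"
    using ne by simp
  moreover have "(\<lambda>\<alpha>. \<alpha> (n, y)) -` C (n, y) \<inter> space RM = {\<alpha> \<in> space RM. \<alpha> (n, y) = c}"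
    by (auto simp: C_def)
  moreover have "(\<lambda>\<alpha>. \<alpha> (n, y')) -` C (n, y') \<inter> space RM = {\<alpha> \<in> space RM. \<alpha> (n, y') = c'}"
    using ne by (auto simp: C_def)
  ultimately show ?thesis
    using prob_coord[OF assms(1,4)] prob_coord[OF assms(2,5)] by (simp add: power2_eq_square)
qed

definition pv :: "(nat \<Rightarrow> nat \<Rightarrow> real) \<Rightarrow> nat \<Rightarrow> nat \<Rightarrow> nat \<Rightarrow> (nat \<times> nat \<Rightarrow> nat) \<Rightarrow> real" where
  "pv g n y y' \<alpha> = g (\<alpha> (n, y)) (\<alpha> (n, y'))"

lemma pv_measurable:
  assumes "(n, y) \<in> K" "(n, y') \<in> K"
  shows "pv g n y y' \<in> borel_measurable (PiM K (rotation_distr q))"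
proof -
  have "(\<lambda>\<alpha>. g c (\<alpha> (n, y'))) \<in> borel_measurable (PiM K (rotation_distr q))" for c
    by (rule measurable_compose[OF coord_measurable[OF assms(2)]]) simp
  then show ?thesis unfolding pv_def by (rule measurable_compose_countable[OF _ coord_measurable[OF assms(1)]])
qed

lemma pv_RM: "y < q n \<Longrightarrow> y' < q n \<Longrightarrow> pv g n y y' \<in> borel_measurable RM"
  unfolding rotation_measure_def by (rule pv_measurable) (simp_all add: index_iff)

lemma coord2_sets: "y < q n \<Longrightarrow> y' < q n \<Longrightarrow> {\<alpha> \<in> space RM. \<alpha> (n, y) = c \<and> \<alpha> (n, y') = c'} \<in> sets RM"
proof -
  assume "y < q n" "y' < q n"
  then have [measurable]: "(\<lambda>\<alpha>. \<alpha> (n, y)) \<in> measurable RM (count_space UNIV)" "(\<lambda>\<alpha>. \<alpha> (n, y')) \<in> measurable RM (count_space UNIV)"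
    by (auto intro: coord_RM)
  show ?thesis by measurable
qed

text \<open>The expectation of \<open>g\<close> at the rotations of two blocks: \<open>b\<close>
  tells whether the blocks coincide, so that one uniform value is used twice, or differ, so that the
  values are independent.\<close>

definition mean2 :: "(nat \<Rightarrow> nat \<Rightarrow> real) \<Rightarrow> nat \<Rightarrow> bool \<Rightarrow> real" where
  "mean2 g N b = (if b then (\<Sum>c<N. g c c) / real N else (\<Sum>c<N. \<Sum>c'<N. g c c') / (real N)\<^sup>2)"

lemma expectation_pv:
  assumes y: "y < q n" "y' < q n" shows "RP.expectation (pv g n y y') = mean2 g (h n) (y = y')"
proof -
  let ?A = "\<lambda>c c'. {\<alpha> \<in> space RM. \<alpha> (n, y) = c \<and> \<alpha> (n, y') = c'}"
  have int: "integrable RM (\<lambda>\<alpha>. g c c' * indicat_real (?A c c') \<alpha>)" for c c'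
    by (intro integrable_mult_right integrable_real_indicator coord2_sets y) (simp add: RP.emeasure_eq_measure)
  have "RP.expectation (pv g n y y') = RP.expectation (\<lambda>\<alpha>. \<Sum>c<h n. \<Sum>c'<h n. g c c' * indicat_real (?A c c') \<alpha>)"
  proof (rule Bochner_Integration.integral_cong[OF refl])
    fix \<alpha> assume a: "\<alpha> \<in> space RM"
    have "(\<Sum>c<h n. \<Sum>c'<h n. g c c' * indicat_real (?A c c') \<alpha>) =
      (\<Sum>c<h n. \<Sum>c'<h n. if \<alpha> (n, y') = c' then (if \<alpha> (n, y) = c then g c c' else 0) else 0)"
      using a by (intro sum.cong refl) (auto simp: indicator_def)
    also have "\<dots> = (\<Sum>c<h n. if \<alpha> (n, y) = c then g c (\<alpha> (n, y')) else 0)"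
      using coord_lt[OF a y(2)] by (intro sum.cong refl) (simp add: sum.delta)
    also have "\<dots> = pv g n y y' \<alpha>" using coord_lt[OF a y(1)] by (simp add: sum.delta pv_def)
    finally show "pv g n y y' \<alpha> = (\<Sum>c<h n. \<Sum>c'<h n. g c c' * indicat_real (?A c c') \<alpha>)" ..
  qed
  also have "\<dots> = (\<Sum>c<h n. RP.expectation (\<lambda>\<alpha>. \<Sum>c'<h n. g c c' * indicat_real (?A c c') \<alpha>))"
    by (rule Bochner_Integration.integral_sum) (intro Bochner_Integration.integrable_sum int)
  also have "\<dots> = (\<Sum>c<h n. \<Sum>c'<h n. RP.expectation (\<lambda>\<alpha>. g c c' * indicat_real (?A c c') \<alpha>))"
    by (rule sum.cong[OF refl], rule Bochner_Integration.integral_sum) (rule int)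
  also have "\<dots> = (\<Sum>c<h n. \<Sum>c'<h n. g c c' * RP.prob (?A c c'))"
  proof (intro sum.cong refl)
    fix c c'
    have "?A c c' \<inter> space RM = ?A c c'" by auto
    then show "RP.expectation (\<lambda>\<alpha>. g c c' * indicat_real (?A c c') \<alpha>) = g c c' * RP.prob (?A c c')"
      by (simp only: Bochner_Integration.integral_mult_right_zero Bochner_Integration.integral_indicator)
  qed
  also have "\<dots> = mean2 g (h n) (y = y')"
  proof (cases "y = y'")
    case True
    have "(\<Sum>c'<h n. g c c' * RP.prob (?A c c')) = g c c / real (h n)" if c: "c < h n" for c
    proof -
      have "(\<Sum>c'<h n. g c c' * RP.prob (?A c c')) = (\<Sum>c'<h n. if c = c' then g c c / real (h n) else 0)"
      proof (intro sum.cong refl)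
        fix c' assume "c' \<in> {..<h n}"
        show "g c c' * RP.prob (?A c c') = (if c = c' then g c c / real (h n) else 0)"
        proof (cases "c = c'")
          case c': True
          have "?A c c' = {\<alpha> \<in> space RM. \<alpha> (n, y) = c}" using True c' by auto
          then show ?thesis using prob_coord[OF y(1) c] c' by simp
        next
          case False
          then have e: "?A c c' = {}" using True by auto
          show ?thesis unfolding e using False by simp
        qed
      qed
      also have "\<dots> = g c c / real (h n)" using c by (simp add: sum.delta)
      finally show ?thesis .
    qed
    then show ?thesis using True by (simp add: mean2_def sum_divide_distrib)
  next
    case False
    have "(\<Sum>c<h n. \<Sum>c'<h n. g c c' * RP.prob (?A c c')) = (\<Sum>c<h n. \<Sum>c'<h n. g c c' * (1 / (real (h n))\<^sup>2))"
    proof (intro sum.cong refl)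
      fix c c' assume "c \<in> {..<h n}" "c' \<in> {..<h n}"
      then show "g c c' * RP.prob (?A c c') = g c c' * (1 / (real (h n))\<^sup>2)"
        using prob_coord2[OF y False, of c c'] by simp
    qed
    also have "\<dots> = (\<Sum>c<h n. \<Sum>c'<h n. g c c') / (real (h n))\<^sup>2"
      by (simp add: sum_divide_distrib)
    finally show ?thesis using False by (simp add: mean2_def)
  qed
  finally show ?thesis .
qed

text \<open>Disjointness of the pairs makes the summands functions of disjoint families of
  rotations, hence independent, and Hoeffding's inequality applies. Replacing \<open>card J\<close>
  by \<open>q n\<close> in the exponent gives one tail bound for all classes.\<close>

lemma class_concentration:
  assumes J: "J \<subseteq> {..<q n}" and \<pi>: "\<And>y. y \<in> J \<Longrightarrow> \<pi> y < q n"
    and dis: "\<And>y z. y \<in> J \<Longrightarrow> z \<in> J \<Longrightarrow> y \<noteq> z \<Longrightarrow> {y, \<pi> y} \<inter> {z, \<pi> z} = {}"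
    and g: "\<And>c c'. 0 \<le> g c c'" "\<And>c c'. g c c' \<le> 1"
    and b: "\<And>y. y \<in> J \<Longrightarrow> (y = \<pi> y) = b" and l: "0 < \<theta>"
  shows "RP.prob {\<alpha> \<in> space RM. \<theta> \<le> \<bar>(\<Sum>y\<in>J. pv g n y (\<pi> y) \<alpha>) - real (card J) * mean2 g (h n) b\<bar>}
     \<le> 2 * exp (- 2 * \<theta>\<^sup>2 / real (q n))"
proof (cases "J = {}")
  case True
  then have "{\<alpha> \<in> space RM. \<theta> \<le> \<bar>(\<Sum>y\<in>J. pv g n y (\<pi> y) \<alpha>) - real (card J) * mean2 g (h n) b\<bar>} = {}"
    using l by auto
  then show ?thesis by (simp only: measure_empty) simp
next
  case False
  have fJ: "finite J" using J finite_subset by blast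
  have cJ: "0 < card J" "card J \<le> q n" using False fJ card_mono[OF _ J] by (auto simp: card_gt_0_iff)
  define K where "K y = {(n, y), (n, \<pi> y)}" for y
  have K: "K y \<subseteq> rotation_index q" if "y \<in> J" for y
    using that J \<pi> by (auto simp: K_def index_iff)
  have dK: "disjoint_family_on K J" unfolding disjoint_family_on_def K_def using dis by fastforce
  have ind: "RP.indep_vars (\<lambda>_. borel) (\<lambda>y. pv g n y (\<pi> y)) J"
  proof -
    have "RP.indep_vars (\<lambda>j. PiM (K j) (rotation_distr q)) (\<lambda>j \<alpha>. restrict (\<lambda>i. \<alpha> i) (K j)) J"
      by (rule RP.indep_vars_restrict[OF indep_coords K dK])
    then have "RP.indep_vars (\<lambda>_. borel) (\<lambda>y \<alpha>. pv g n y (\<pi> y) (restrict (\<lambda>i. \<alpha> i) (K y))) J"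
      by (rule RP.indep_vars_compose2) (rule pv_measurable, simp_all add: K_def)
    then show ?thesis by (simp add: pv_def[abs_def] K_def)
  qed
  interpret H: Hoeffding_ineq RM J "\<lambda>y. pv g n y (\<pi> y)" "\<lambda>_. 0" "\<lambda>_. 1" "\<Sum>y\<in>J. RP.expectation (pv g n y (\<pi> y))"
  proof unfold_locales
    show "finite J" by (rule fJ)
    show "RP.indep_vars (\<lambda>_. borel) (\<lambda>y. pv g n y (\<pi> y)) J" by (rule ind)
    show "AE \<alpha> in RM. pv g n i (\<pi> i) \<alpha> \<in> {0..1}" for i using g by (simp add: pv_def)
  qed
  have E: "(\<Sum>y\<in>J. RP.expectation (pv g n y (\<pi> y))) = real (card J) * mean2 g (h n) b"
  proof -
    have "RP.expectation (pv g n y (\<pi> y)) = mean2 g (h n) b" if "y \<in> J" for y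
      using expectation_pv[of y n "\<pi> y" g] that J \<pi>[OF that] b[OF that] by auto
    then show ?thesis by simp
  qed
  have "RP.prob {\<alpha> \<in> space RM. \<theta> \<le> \<bar>(\<Sum>y\<in>J. pv g n y (\<pi> y) \<alpha>) - real (card J) * mean2 g (h n) b\<bar>}
     \<le> 2 * exp (- 2 * \<theta>\<^sup>2 / (\<Sum>i\<in>J. (1 - 0)\<^sup>2))"
    unfolding E[symmetric] by (rule H.Hoeffding_ineq_abs_ge) (use l cJ in auto)
  also have "\<dots> \<le> 2 * exp (- 2 * \<theta>\<^sup>2 / real (q n))"
  proof -
    have "2 * \<theta>\<^sup>2 / real (q n) \<le> 2 * \<theta>\<^sup>2 / real (card J)"
      using cJ by (intro divide_left_mono) auto
    then show ?thesis by simp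
  qed
  finally show ?thesis .
qed

text \<open>The pairs \<open>(y, y + d mod q)\<close> overlap, so the index set is cut into four classes on which
  they are disjoint: without or with wrap-around, and by parity of the block of length \<open>d\<close>
  (resp. \<open>q - d\<close>) containing \<open>y\<close>.\<close>

lemma shift_concentration:
  assumes d: "d < q n" and g: "\<And>c c'. 0 \<le> g c c'" "\<And>c c'. g c c' \<le> 1" and l: "0 < \<theta>"
  shows "{\<alpha> \<in> space RM. 4 * \<theta> \<le> \<bar>(\<Sum>y<q n. pv g n y ((y + d) mod q n) \<alpha>) - real (q n) * mean2 g (h n) (d = 0)\<bar>} \<in> sets RM"
    and "RP.prob {\<alpha> \<in> space RM. 4 * \<theta> \<le> \<bar>(\<Sum>y<q n. pv g n y ((y + d) mod q n) \<alpha>) - real (q n) * mean2 g (h n) (d = 0)\<bar>}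
     \<le> 8 * exp (- 2 * \<theta>\<^sup>2 / real (q n))"
proof -
  let ?Q = "q n"
  have Q0: "0 < ?Q" using q2[of n] by simp
  define \<pi> where "\<pi> y = (y + d) mod ?Q" for y
  have \<pi>: "\<pi> y < ?Q" for y using Q0 by (simp add: \<pi>_def)
  have pm: "pv g n y (\<pi> y) \<in> borel_measurable RM" if "y < ?Q" for y by (rule pv_RM[OF that \<pi>])
  define dev where "dev J \<alpha> = \<bar>(\<Sum>y\<in>J. pv g n y (\<pi> y) \<alpha>) - real (card J) * mean2 g (h n) (d = 0)\<bar>" for J \<alpha>
  have dev_m: "dev J \<in> borel_measurable RM" if "J \<subseteq> {..<?Q}" for J
  proof -
    have "(\<lambda>\<alpha>. \<Sum>y\<in>J. pv g n y (\<pi> y) \<alpha>) \<in> borel_measurable RM"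
      using that by (intro borel_measurable_sum pm) auto
    then show ?thesis unfolding dev_def by measurable
  qed
  have dev_s: "{\<alpha> \<in> space RM. c \<le> dev J \<alpha>} \<in> sets RM" if "J \<subseteq> {..<?Q}" for J c
  proof -
    note [measurable] = dev_m[OF that]
    show ?thesis by measurable
  qed
  show "{\<alpha> \<in> space RM. 4 * \<theta> \<le> \<bar>(\<Sum>y<?Q. pv g n y ((y + d) mod ?Q) \<alpha>) - real ?Q * mean2 g (h n) (d = 0)\<bar>} \<in> sets RM"
    using dev_s[of "{..<?Q}" "4 * \<theta>"] unfolding dev_def \<pi>_def by simp
  \<comment> \<open>Wrap-around starts at \<open>e\<close>, and from there on the shift by
    \<open>d\<close> is the shift back by \<open>e\<close>. For \<open>d = 0\<close> all indices
    fall into the first class.\<close>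
  define e where "e = ?Q - d"
  define J where "J i = (if i = 0 then {y. y < e \<and> (d = 0 \<or> even (y div d))}
     else if i = 1 then {y. y < e \<and> \<not> (d = 0 \<or> even (y div d))}
     else if i = 2 then {y. e \<le> y \<and> y < ?Q \<and> even ((y - e) div e)}
     else {y. e \<le> y \<and> y < ?Q \<and> odd ((y - e) div e)})" for i :: nat
  have e0: "0 < e" "e \<le> ?Q" using d by (auto simp: e_def)
  have Jsub: "J i \<subseteq> {..<?Q}" for i using e0 by (auto simp: J_def)
  have \<pi>1: "\<pi> y = y + d" if "y < e" for y using that by (simp add: \<pi>_def e_def)
  have \<pi>2: "\<pi> y + e = y" if "e \<le> y" "y < ?Q" for y
  proof -
    have "y + d = (y - e) + ?Q" using that d unfolding e_def by simp
    then have "\<pi> y = (y - e) mod ?Q" unfolding \<pi>_def by simp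
    then show ?thesis using that by simp
  qed
  have b: "(y = \<pi> y) = (d = 0)" if "y < ?Q" for y
  proof (cases "y < e")
    case True then show ?thesis using \<pi>1[OF True] by simp
  next
    case False
    then have "d \<noteq> 0" using that by (auto simp: e_def)
    moreover have "y \<noteq> \<pi> y" using \<pi>2[of y] False that e0 by simp
    ultimately show ?thesis by simp
  qed
  have inj: "\<pi> y \<noteq> \<pi> z" if "y < ?Q" "z < ?Q" "y \<noteq> z" for y z
  proof
    assume eq: "\<pi> y = \<pi> z"
    then have "(y + d) mod ?Q = (z + d) mod ?Q" by (simp add: \<pi>_def)
    then have "(int y + int d) mod int ?Q = (int z + int d) mod int ?Q" by (metis of_nat_add zmod_int)
    then have "int y mod int ?Q = int z mod int ?Q" by (simp add: mod_eq_dvd_iff)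
    then show False using that by simp
  qed
  have sep: "y \<noteq> \<pi> z" if y: "y \<in> J i" and z: "z \<in> J i" and yz: "y \<noteq> z" for y z i
  proof
    assume eq: "y = \<pi> z"
    show False
    proof (cases "z < e")
      case True
      then have yd: "y = z + d" using \<pi>1 eq by simp
      then have d0: "d \<noteq> 0" using yz by auto
      then have "y div d = z div d + 1" using yd by simp
      then show False using y z True d0 e0 unfolding J_def by (auto split: if_splits)
    next
      case False
      then have ze: "z < ?Q" "e \<le> z" using z Jsub by auto
      then have zd: "z = y + e" using \<pi>2 eq by simp
      have "i \<noteq> 0" "i \<noteq> 1" using z False by (auto simp: J_def split: if_splits)
      then have "e \<le> y" "even ((y - e) div e) = even ((z - e) div e)" using y z by (auto simp: J_def split: if_splits)
      moreover from this have "(z - e) div e = (y - e) div e + 1"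
      proof -
        have "z - e = (y - e) + e" using zd \<open>e \<le> y\<close> by simp
        then show ?thesis using e0 by simp
      qed
      ultimately show False by simp
    qed
  qed
  have dis: "{y, \<pi> y} \<inter> {z, \<pi> z} = {}" if "y \<in> J i" "z \<in> J i" "y \<noteq> z" for y z i
  proof -
    have "y < ?Q" "z < ?Q" using that Jsub by auto
    then show ?thesis using sep[OF that] sep[OF that(2,1)] inj that(3) by auto
  qed
  have conc: "RP.prob {\<alpha> \<in> space RM. \<theta> \<le> dev (J i) \<alpha>} \<le> 2 * exp (- 2 * \<theta>\<^sup>2 / real ?Q)" for i
    unfolding dev_def by (rule class_concentration[OF Jsub \<pi> dis g _ l]) (use b Jsub in auto)
  have UN: "{..<?Q} = (\<Union>i<4. J i)"
  proof -
    have "y \<in> (\<Union>i<4. J i)" if "y < ?Q" for y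
    proof -
      have "y \<in> J 0 \<union> J 1 \<union> J 2 \<union> J 3" using that by (auto simp: J_def not_less)
      then show ?thesis by (auto intro: UN_I[of 0] UN_I[of 1] UN_I[of 2] UN_I[of 3])
    qed
    then show ?thesis using Jsub by auto
  qed
  have Jd: "J i \<inter> J j = {}" if "i < 4" "j < 4" "i \<noteq> j" for i j
    using that by (auto simp: J_def split: if_splits)
  have fin: "finite (J i)" for i using Jsub finite_subset by blast
  have split: "dev {..<?Q} \<alpha> \<le> (\<Sum>i<4. dev (J i) \<alpha>)" for \<alpha>
  proof -
    have "(\<Sum>y<?Q. pv g n y (\<pi> y) \<alpha>) = (\<Sum>i<4. \<Sum>y\<in>J i. pv g n y (\<pi> y) \<alpha>)"
      unfolding UN by (rule sum.UNION_disjoint) (use fin Jd in auto)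
    moreover have "card {..<?Q} = (\<Sum>i<4. card (J i))"
      unfolding UN by (rule card_UN_disjoint) (use fin Jd in auto)
    then have "real (card {..<?Q}) * mean2 g (h n) (d = 0) = (\<Sum>i<4. real (card (J i)) * mean2 g (h n) (d = 0))"
      by (simp only: of_nat_sum sum_distrib_right)
    ultimately have "dev {..<?Q} \<alpha> = \<bar>\<Sum>i<4. ((\<Sum>y\<in>J i. pv g n y (\<pi> y) \<alpha>) - real (card (J i)) * mean2 g (h n) (d = 0))\<bar>"
      unfolding dev_def by (simp only: sum_subtractf)
    also have "\<dots> \<le> (\<Sum>i<4. dev (J i) \<alpha>)" unfolding dev_def by (rule sum_abs)
    finally show ?thesis .
  qed
  have "RP.prob {\<alpha> \<in> space RM. 4 * \<theta> \<le> dev {..<?Q} \<alpha>} \<le> RP.prob (\<Union>i\<in>{..<4}. {\<alpha> \<in> space RM. \<theta> \<le> dev (J i) \<alpha>})"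
  proof (rule RP.finite_measure_mono)
    show "(\<Union>i\<in>{..<4}. {\<alpha> \<in> space RM. \<theta> \<le> dev (J i) \<alpha>}) \<in> sets RM" by (intro sets.finite_UN dev_s Jsub) simp
    show "{\<alpha> \<in> space RM. 4 * \<theta> \<le> dev {..<?Q} \<alpha>} \<subseteq> (\<Union>i\<in>{..<4}. {\<alpha> \<in> space RM. \<theta> \<le> dev (J i) \<alpha>})"
    proof
      fix \<alpha> assume a: "\<alpha> \<in> {\<alpha> \<in> space RM. 4 * \<theta> \<le> dev {..<?Q} \<alpha>}"
      show "\<alpha> \<in> (\<Union>i\<in>{..<4}. {\<alpha> \<in> space RM. \<theta> \<le> dev (J i) \<alpha>})"
      proof (rule ccontr)
        assume "\<not> ?thesis"
        then have "\<forall>i\<in>{..<4::nat}. dev (J i) \<alpha> < \<theta>" using a by (auto simp: not_le)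
        then have "(\<Sum>i<4::nat. dev (J i) \<alpha>) < (\<Sum>i<4::nat. \<theta>)"
          by (intro sum_strict_mono) (auto simp: lessThan_empty_iff)
        then show False using a split[of \<alpha>] by simp
      qed
    qed
  qed
  also have "\<dots> \<le> (\<Sum>i<4::nat. RP.prob {\<alpha> \<in> space RM. \<theta> \<le> dev (J i) \<alpha>})"
    by (rule RP.finite_measure_subadditive_finite) (use dev_s Jsub in auto)
  also have "\<dots> \<le> (\<Sum>i<4::nat. 2 * exp (- 2 * \<theta>\<^sup>2 / real ?Q))" by (intro sum_mono conc)
  finally show "RP.prob {\<alpha> \<in> space RM. 4 * \<theta> \<le> \<bar>(\<Sum>y<?Q. pv g n y ((y + d) mod ?Q) \<alpha>) - real ?Q * mean2 g (h n) (d = 0)\<bar>}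
     \<le> 8 * exp (- 2 * \<theta>\<^sup>2 / real ?Q)" unfolding dev_def \<pi>_def by simp
qed

end

section \<open>Counting transitions of a coordinate through the next level\<close>

context iceberg begin

definition pair_count :: "nat \<Rightarrow> nat \<Rightarrow> nat \<Rightarrow> nat \<Rightarrow> nat" where
  "pair_count n t a b = card {u. u < h (Suc n) \<and> \<phi> n u = b \<and> \<phi> n (cadd (Suc n) (int t) u) = a}"

definition pair_law :: "nat \<Rightarrow> nat \<Rightarrow> nat \<Rightarrow> nat \<Rightarrow> real" where
  "pair_law n t a b = max 0 (1 - real t / real (h n)) * of_bool ((b + t) mod h n = a)
     + min (real t / real (h n)) 1 / real (h n)"

abbreviation "passes n t a b u \<equiv> \<phi> n u = b \<and> \<phi> n (cadd (Suc n) (int t) u) = a"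

text \<open>Times stop one block short of \<open>h (Suc n)\<close>, so that a shifted point, even
  after a carry, never wraps around to the block where it started. The tolerance is large enough for
  a union bound over all \<open>a\<close>, \<open>b\<close>, \<open>t\<close> and still small
  against \<open>q n\<close>.\<close>

definition equidistributed :: "nat \<Rightarrow> bool" where
  "equidistributed n \<longleftrightarrow> (\<forall>a<h n. \<forall>b<h n. \<forall>t<(q n - 1) * h n.
     \<bar>real (pair_count n t a b) - real (q n) * pair_law n t a b\<bar> \<le> 8 * (sqrt (real (q n)) * ln (real (q n))))"

lemma cadd_cadd_Suc: "cadd n j (cadd (Suc n) k x) = cadd n (j + k) x"
proof -
  have d: "int (h n) dvd int (h (Suc n))" by simp
  have "int (cadd n j (cadd (Suc n) k x)) = ((int x + k) mod int (h (Suc n)) + j) mod int (h n)"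
    by (simp only: int_cadd)
  also have "\<dots> = ((int x + k) mod int (h (Suc n)) mod int (h n) + j) mod int (h n)"
    by (simp only: mod_add_left_eq)
  also have "\<dots> = ((int x + k) mod int (h n) + j) mod int (h n)" by (simp only: mod_mod_cancel[OF d])
  also have "\<dots> = (int x + (j + k)) mod int (h n)" by (simp only: mod_add_left_eq) (simp add: algebra_simps)
  also have "\<dots> = int (cadd n (j + k) x)" by (simp only: int_cadd)
  finally show ?thesis by simp
qed

lemma cadd_glue: "cadd n j (glue n y b) = cadd n (j + int (\<alpha> (n, y))) b"
  by (subst cadd_mod[symmetric]) (simp only: glue_mod cadd_cadd)

text \<open>\<open>D\<close> is the block reached: the number of whole blocks in \<open>t\<close>,
  plus a carry if the position inside the block passes its end. Along the way the coordinate changes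
  by \<open>t\<close> and by the difference of the rotations of the two blocks.\<close>

lemma \<phi>_shift_glue:
  assumes D: "D = (y + t div h n + (if (b + \<alpha> (n, y)) mod h n + t mod h n < h n then 0 else 1)) mod q n"
  shows "\<phi> n (cadd (Suc n) (int t) (glue n y b)) = cadd n (int t + int (\<alpha> (n, y)) - int (\<alpha> (n, D))) b"
proof -
  let ?N = "h n"
  define w where "w = (b + \<alpha> (n, y)) mod ?N"
  have g: "glue n y b = y * ?N + w" by (simp add: glue_def cadd_nat w_def)
  have "cadd (Suc n) (int t) (glue n y b) div ?N = (y * ?N + w + t) mod (?N * q n) div ?N"
    by (simp add: cadd_nat g mult.commute)
  also have "\<dots> = (y * ?N + w + t) div ?N mod q n" by (simp only: mod_mult2_eq) simp
  also have "(y * ?N + w + t) div ?N = y + t div ?N + (w + t mod ?N) div ?N"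
  proof -
    have "y * ?N + w + t = (w + t mod ?N) + (y + t div ?N) * ?N"
      using div_mult_mod_eq[of t ?N] by (simp add: algebra_simps)
    then show ?thesis by (simp only: div_mult_self1[OF h_ne0])
  qed
  also have "(w + t mod ?N) div ?N = (if w + t mod ?N < ?N then 0 else 1)"
  proof -
    have "w < ?N" "t mod ?N < ?N" by (simp_all add: w_def)
    then have "w + t mod ?N < 2 * ?N" by linarith
    then have "(w + t mod ?N) div ?N < 2" by (simp add: less_mult_imp_div_less)
    moreover have "(w + t mod ?N) div ?N = 0 \<longleftrightarrow> w + t mod ?N < ?N" by (simp add: div_eq_0_iff)
    ultimately show ?thesis by (simp only: split: if_split) linarith
  qed
  finally have "cadd (Suc n) (int t) (glue n y b) div ?N = D" by (simp only: D w_def)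
  then show ?thesis unfolding \<phi>_eq by (simp add: cadd_cadd_Suc cadd_glue algebra_simps)
qed

text \<open>Each block contains exactly one point above \<open>b\<close>, so the count becomes a sum
  over blocks, with each term depending on two rotations.\<close>

lemma pair_count_eq:
  assumes b: "b < h n"
  shows "real (pair_count n t a b) = (\<Sum>y<q n. of_bool (\<phi> n (cadd (Suc n) (int t) (glue n y b)) = a))"
proof -
  let ?A = "{y. y < q n \<and> \<phi> n (cadd (Suc n) (int t) (glue n y b)) = a}"
  have "{u. u < h (Suc n) \<and> \<phi> n u = b \<and> \<phi> n (cadd (Suc n) (int t) u) = a} = (\<lambda>y. glue n y b) ` ?A" (is "?L = ?R")
  proof (intro subset_antisym subsetI)
    fix u assume u: "u \<in> ?L"
    then have "glue n (u div h n) b = u" using glue_\<phi>[of n u] by auto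
    moreover have "u div h n < q n" using u by (intro div_lt) auto
    ultimately show "u \<in> ?R" using u by (intro image_eqI[of u _ "u div h n"]) auto
  next
    fix u assume "u \<in> ?R"
    then show "u \<in> ?L" using glue_lt \<phi>_glue[OF b] by (auto simp del: iceberg_height.simps)
  qed
  moreover have "inj_on (\<lambda>y. glue n y b) ?A" by (rule inj_onI) (metis glue_div)
  ultimately have pc: "pair_count n t a b = card ?A" by (simp add: pair_count_def card_image)
  have "real (card ?A) = (\<Sum>y<q n. of_bool (\<phi> n (cadd (Suc n) (int t) (glue n y b)) = a))"
  proof -
    have "?A = {y \<in> {..<q n}. \<phi> n (cadd (Suc n) (int t) (glue n y b)) = a}" by auto
    then have "real (card ?A) = (\<Sum>y\<in>{y \<in> {..<q n}. \<phi> n (cadd (Suc n) (int t) (glue n y b)) = a}. 1)"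
      by (simp only: real_of_card)
    then show ?thesis by (simp only: sum.inter_filter[OF finite_lessThan] of_bool_def)
  qed
  then show ?thesis by (simp only: pc)
qed

end

lemma sum_rotate:
  fixes f :: "nat \<Rightarrow> 'a::comm_monoid_add"
  assumes "0 < N" shows "(\<Sum>c<N. f ((b + c) mod N)) = (\<Sum>w<N. f w)"
proof (rule sum.reindex_bij_betw)
  have inj: "inj_on (\<lambda>c. (b + c) mod N) {..<N}"
  proof (rule inj_onI)
    fix c c' assume c: "c \<in> {..<N}" "c' \<in> {..<N}" "(b + c) mod N = (b + c') mod N"
    then have "(int b + int c) mod int N = (int b + int c') mod int N" by (metis of_nat_add zmod_int)
    then have "int c mod int N = int c' mod int N" by (simp add: mod_eq_dvd_iff)
    then show "c = c'" using c by simp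
  qed
  have "(\<lambda>c. (b + c) mod N) ` {..<N} = {..<N}" by (rule endo_inj_surj[OF _ _ inj]) (use assms in auto)
  then show "bij_betw (\<lambda>c. (b + c) mod N) {..<N} {..<N}" using inj by (simp add: bij_betw_def)
qed

lemma sum_residue:
  assumes "0 < N" "a < N" shows "(\<Sum>c'<N. of_bool ((k - int c') mod int N = int a)) = (1::real)"
proof -
  define c where "c = nat ((k - int a) mod int N)"
  have ic: "int c = (k - int a) mod int N" using assms by (simp add: c_def)
  have c: "c < N"
  proof -
    have "int c < int N" unfolding ic using assms by simp
    then show ?thesis by simp
  qed
  have "(k - int c') mod int N = int a \<longleftrightarrow> c' = c" if "c' < N" for c'
  proof -
    have "(k - int c') mod int N = int a \<longleftrightarrow> (k - int c') mod int N = int a mod int N" using assms by simp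
    also have "\<dots> \<longleftrightarrow> int c' mod int N = (k - int a) mod int N"
      by (simp only: mod_eq_dvd_iff) (metis diff_diff_eq diff_diff_eq2 dvd_diff_commute add.commute diff_right_commute)
    also have "\<dots> \<longleftrightarrow> int c' = int c" using that ic by simp
    finally show ?thesis by simp
  qed
  then have "(\<Sum>c'<N. of_bool ((k - int c') mod int N = int a)) = (\<Sum>c'<N. if c' = c then 1 else (0::real))"
    by (intro sum.cong) auto
  then show ?thesis using c by simp
qed

lemma sum_of_bool_lt:
  assumes "s \<le> N"
  shows "(\<Sum>w<N. of_bool (w + s < N)) = real N - real s" and "(\<Sum>w<N. of_bool (\<not> w + s < N)) = real s"
proof -
  have "{..<N} \<inter> {w. w + s < N} = {..<N - s}" by auto
  then show *: "(\<Sum>w<N. of_bool (w + s < N)) = real N - real s"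
    using assms by (simp add: of_bool_def sum.If_cases of_nat_diff)
  have "(\<Sum>w<N. of_bool (\<not> w + s < N)) = (\<Sum>w<N. 1 - of_bool (w + s < N) :: real)"
    by (rule sum.cong) auto
  then show "(\<Sum>w<N. of_bool (\<not> w + s < N)) = real s" using * by (simp add: sum_subtractf)
qed

section \<open>Concentration of the transition counts\<close>

context rotations begin

text \<open>\<open>c\<close> and \<open>c'\<close> are the rotations of the source and the target
  block, and \<open>p\<close> means that no carry occurs. Separating the cases by \<open>p\<close>
  makes the target a fixed shift of the source, as \<open>shift_concentration\<close> requires,
  although the carry itself is random.\<close>

definition hit :: "bool \<Rightarrow> nat \<Rightarrow> nat \<Rightarrow> nat \<Rightarrow> nat \<Rightarrow> nat \<Rightarrow> nat \<Rightarrow> real" where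
  "hit p N t a b c c' = of_bool (((b + c) mod N + t mod N < N) = p \<and> (int b + int t + int c - int c') mod int N = int a)"

lemma hit_01: "0 \<le> hit p N t a b c c'" "hit p N t a b c c' \<le> 1" by (simp_all add: hit_def)

text \<open>A uniform \<open>c\<close> makes the position \<open>(b + c) mod N\<close> uniform, and
  an independent uniform \<open>c'\<close> makes the final coordinate uniform. When source and
  target are the same block, the rotations cancel and the coordinate is
  \<open>b + t\<close>.\<close>

lemma mean2_hit:
  assumes N: "0 < N" "a < N"
  shows "mean2 (hit True N t a b) N False = (real N - real (t mod N)) / (real N)\<^sup>2"
    and "mean2 (hit False N t a b) N False = real (t mod N) / (real N)\<^sup>2"
    and "mean2 (hit True N t a b) N True = (real N - real (t mod N)) / real N * of_bool ((b + t) mod N = a)"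
proof -
  have tN: "t mod N \<le> N" using N by simp
  have *: "(\<Sum>c<N. \<Sum>c'<N. hit p N t a b c c') = (\<Sum>w<N. of_bool ((w + t mod N < N) = p))" for p
  proof -
    have "(\<Sum>c<N. \<Sum>c'<N. hit p N t a b c c')
      = (\<Sum>c<N. of_bool (((b + c) mod N + t mod N < N) = p) * (\<Sum>c'<N. of_bool ((int b + int t + int c - int c') mod int N = int a)))"
      unfolding sum_distrib_left by (intro sum.cong refl) (simp add: hit_def)
    also have "\<dots> = (\<Sum>c<N. of_bool (((b + c) mod N + t mod N < N) = p))"
      by (simp only: sum_residue[OF N] mult_1_right)
    also have "\<dots> = (\<Sum>w<N. of_bool ((w + t mod N < N) = p))"
      by (rule sum_rotate[OF N(1), where f="\<lambda>w. of_bool ((w + t mod N < N) = p)"])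
    finally show ?thesis .
  qed
  show "mean2 (hit True N t a b) N False = (real N - real (t mod N)) / (real N)\<^sup>2"
    using *[of True] sum_of_bool_lt(1)[OF tN] by (simp add: mean2_def)
  show "mean2 (hit False N t a b) N False = real (t mod N) / (real N)\<^sup>2"
    using *[of False] sum_of_bool_lt(2)[OF tN] by (simp add: mean2_def)
  have i: "((int b + int t) mod int N = int a) = ((b + t) mod N = a)"
  proof -
    have "(int b + int t) mod int N = int ((b + t) mod N)" by (simp add: zmod_int)
    then show ?thesis by (simp only: of_nat_eq_iff)
  qed
  have "(\<Sum>c<N. hit True N t a b c c) = (\<Sum>c<N. of_bool ((b + c) mod N + t mod N < N) * of_bool ((b + t) mod N = a))"
    by (intro sum.cong refl) (simp add: hit_def i)
  also have "\<dots> = (\<Sum>w<N. of_bool (w + t mod N < N)) * of_bool ((b + t) mod N = a)"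
    unfolding sum_distrib_right[symmetric]
    by (rule arg_cong2[where f="(*)"], rule sum_rotate[OF N(1), where f="\<lambda>w. of_bool (w + t mod N < N)"], rule refl)
  finally show "mean2 (hit True N t a b) N True = (real N - real (t mod N)) / real N * of_bool ((b + t) mod N = a)"
    using sum_of_bool_lt(1)[OF tN] by (simp add: mean2_def)
qed

lemma pair_count_hit:
  assumes b: "b < h n" and a: "a < h n" shows "real (iceberg.pair_count q \<alpha> n t a b)
    = (\<Sum>y<q n. pv (hit True (h n) t a b) n y ((y + (t div h n)) mod q n) \<alpha>)
    + (\<Sum>y<q n. pv (hit False (h n) t a b) n y ((y + (t div h n + 1)) mod q n) \<alpha>)"
proof -
  interpret I: iceberg q \<alpha> by (rule iceberg_q)
  show ?thesis unfolding I.pair_count_eq[OF b] sum.distrib[symmetric]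
  proof (rule sum.cong[OF refl])
    fix y assume y: "y \<in> {..<q n}"
    have ca: "(I.cadd n k b = a) = ((int b + k) mod int (h n) = int a)" for k
      unfolding I.int_cadd[symmetric] by simp
    show "of_bool (I.\<phi> n (I.cadd (Suc n) (int t) (I.glue n y b)) = a) =
      pv (hit True (h n) t a b) n y ((y + t div h n) mod q n) \<alpha> + pv (hit False (h n) t a b) n y ((y + (t div h n + 1)) mod q n) \<alpha>"
      unfolding I.\<phi>_shift_glue[OF refl] ca pv_def hit_def
      by (cases "(b + \<alpha> (n, y)) mod h n + t mod h n < h n") (simp_all add: algebra_simps)
  qed
qed

text \<open>For \<open>t < h n\<close> the case without carry stays in its block, so it uses one
  rotation twice and gives the translated part. For larger \<open>t\<close> both cases involve two
  independent rotations and add up to the uniform law.\<close>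

lemma mean_pair_law:
  assumes N: "a < h n" and r: "t < (q n - 1) * h n"
  shows "mean2 (hit True (h n) t a b) (h n) (t div h n = 0) + mean2 (hit False (h n) t a b) (h n) (t div h n + 1 = 0)
    = iceberg.pair_law q n t a b"
proof -
  interpret I: iceberg q undefined by (rule iceberg_q)
  let ?N = "h n"
  have N0: "0 < ?N" by (rule h_pos)
  show ?thesis
  proof (cases "t div ?N = 0")
    case True
    then have t: "t < ?N" using N0 by (simp add: div_eq_0_iff)
    then have "mean2 (hit True ?N t a b) ?N True + mean2 (hit False ?N t a b) ?N False =
      (real ?N - real t) / real ?N * of_bool ((b + t) mod ?N = a) + real t / (real ?N)\<^sup>2"
      using mean2_hit(2,3)[OF N0 N, of t b] by simp
    moreover have "max 0 (1 - real t / real ?N) = (real ?N - real t) / real ?N" "min (real t / real ?N) 1 = real t / real ?N"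
      using t N0 by (simp_all add: max_def min_def divide_simps)
    ultimately show ?thesis using True unfolding I.pair_law_def by (simp add: power2_eq_square)
  next
    case False
    then have t: "?N \<le> t" using N0 by (simp add: div_eq_0_iff)
    have 1: "max 0 (1 - real t / real ?N) = 0" "min (real t / real ?N) 1 = 1"
      using t N0 by (simp_all add: max_def min_def divide_simps)
    have "(real ?N - real (t mod ?N)) / (real ?N)\<^sup>2 + real (t mod ?N) / (real ?N)\<^sup>2 = 1 / real ?N"
      using N0 by (simp add: add_divide_distrib[symmetric] power2_eq_square)
    then show ?thesis using False mean2_hit(1,2)[OF N0 N, of t b] unfolding I.pair_law_def 1 by simp
  qed
qed

definition bad :: "nat \<Rightarrow> nat \<times> nat \<times> nat \<Rightarrow> bool \<Rightarrow> (nat \<times> nat \<Rightarrow> nat) set" where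
  "bad n = (\<lambda>(a, b, t) p. let d = t div h n + (if p then 0 else 1) in
     {\<alpha> \<in> space RM. 4 * (sqrt (real (q n)) * ln (real (q n))) \<le>
        \<bar>(\<Sum>y<q n. pv (hit p (h n) t a b) n y ((y + d) mod q n) \<alpha>) - real (q n) * mean2 (hit p (h n) t a b) (h n) (d = 0)\<bar>})"

definition bad_index :: "nat \<Rightarrow> (nat \<times> nat \<times> nat) set" where
  "bad_index n = {..<h n} \<times> {..<h n} \<times> {..<(q n - 1) * h n}"

lemma bad_prob:
  assumes i: "i \<in> bad_index n"
  shows "bad n i p \<in> sets RM" "RP.prob (bad n i p) \<le> 8 * exp (- 2 * (ln (real (q n)))\<^sup>2)"
proof -
  obtain a b t where it: "i = (a, b, t)" by (cases i)
  let ?Q = "q n"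
  let ?\<theta> = "sqrt (real ?Q) * ln (real ?Q)"
  define d where "d = t div h n + (if p then 0 else 1)"
  have "t div h n < ?Q - 1" using i it by (auto simp: bad_index_def intro: less_mult_imp_div_less)
  then have d: "d < ?Q" by (auto simp: d_def)
  have Q: "1 < real ?Q" using q2[of n] by simp
  have \<theta>: "0 < ?\<theta>" using Q by simp
  have B: "bad n i p = {\<alpha> \<in> space RM. 4 * ?\<theta> \<le>
        \<bar>(\<Sum>y<?Q. pv (hit p (h n) t a b) n y ((y + d) mod ?Q) \<alpha>) - real ?Q * mean2 (hit p (h n) t a b) (h n) (d = 0)\<bar>}"
    unfolding bad_def it d_def Let_def by simp
  have "- 2 * ?\<theta>\<^sup>2 / real ?Q = - 2 * (ln (real ?Q))\<^sup>2" using Q by (simp add: power_mult_distrib)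
  note e = this
  show "bad n i p \<in> sets RM" unfolding B by (rule shift_concentration(1)[OF d hit_01 \<theta>])
  show "RP.prob (bad n i p) \<le> 8 * exp (- 2 * (ln (real (q n)))\<^sup>2)"
    unfolding B e[symmetric] by (rule shift_concentration(2)[OF d hit_01 \<theta>])
qed

lemma not_bad_equidistributed:
  assumes \<alpha>: "\<alpha> \<in> space RM" and nb: "\<And>i p. i \<in> bad_index n \<Longrightarrow> \<alpha> \<notin> bad n i p"
  shows "iceberg.equidistributed q \<alpha> n"
proof -
  interpret I: iceberg q \<alpha> by (rule iceberg_q)
  show ?thesis unfolding I.equidistributed_def
  proof (intro allI impI)
    fix a b t assume a: "a < h n" and b: "b < h n" and t: "t < (q n - 1) * h n"
    let ?Q = "q n"
    let ?\<theta> = "sqrt (real ?Q) * ln (real ?Q)"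
    define X where "X p = (\<Sum>y<?Q. pv (hit p (h n) t a b) n y ((y + (t div h n + (if p then 0 else 1))) mod ?Q) \<alpha>)" for p
    define m where "m p = mean2 (hit p (h n) t a b) (h n) (t div h n + (if p then 0 else 1) = 0)" for p
    have i: "(a, b, t) \<in> bad_index n" using a b t by (simp add: bad_index_def)
    have X: "\<bar>X p - real ?Q * m p\<bar> < 4 * ?\<theta>" for p
      using nb[OF i, of p] \<alpha> unfolding bad_def Let_def X_def m_def by simp
    have 1: "real (I.pair_count n t a b) = X True + X False"
      using pair_count_hit[OF b a, of \<alpha> t] unfolding X_def by simp
    have 2: "I.pair_law n t a b = m True + m False" using mean_pair_law[OF a t, of b] unfolding m_def by simp
    have "\<bar>real (I.pair_count n t a b) - real ?Q * I.pair_law n t a b\<bar>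
      = \<bar>(X True - real ?Q * m True) + (X False - real ?Q * m False)\<bar>"
      unfolding 1 2 by (simp add: algebra_simps)
    also have "\<dots> \<le> \<bar>X True - real ?Q * m True\<bar> + \<bar>X False - real ?Q * m False\<bar>" by (rule abs_triangle_ineq)
    also have "\<dots> \<le> 8 * ?\<theta>" using X[of True] X[of False] by linarith
    finally show "\<bar>real (I.pair_count n t a b) - real ?Q * I.pair_law n t a b\<bar> \<le> 8 * ?\<theta>" .
  qed
qed

text \<open>There are at most \<open>q n ^ 4\<close> triples, and each is bad with probability at
  most \<open>16 / q n ^ 8\<close> once \<open>4 \<le> ln (q n)\<close>. The totals are summable, so
  the Borel-Cantelli lemma applies.\<close>

lemma AE_equidistributed:
  assumes gr: "\<And>n. 100 * 3 ^ h n \<le> q n"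
  shows "AE \<alpha> in RM. \<forall>\<^sub>F n in sequentially. iceberg.equidistributed q \<alpha> n"
proof -
  define B where "B n = (\<Union>i\<in>bad_index n. \<Union>p\<in>UNIV. bad n i p)" for n
  have fin: "finite (bad_index n)" for n by (simp add: bad_index_def)
  have Bs: "B n \<in> sets RM" for n unfolding B_def by (intro sets.finite_UN fin bad_prob(1)) auto
  have Bp: "RP.prob (B n) \<le> 16 * (1/2) ^ n" for n
  proof -
    let ?Q = "real (q n)"
    have hQ: "h n \<le> q n" and Q100: "100 \<le> q n"
    proof -
      have "h n < 2 ^ h n" by (rule less_exp)
      also have "2 ^ h n \<le> (3::nat) ^ h n" by (rule power_mono) simp_all
      finally have "h n < 3 ^ h n" .
      then show "h n \<le> q n" using gr[of n] by linarith
      have "(1::nat) \<le> 3 ^ h n" by simp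
      then show "100 \<le> q n" using gr[of n] by linarith
    qed
    have Q0: "1 \<le> ?Q" using Q100 by simp
    have "RP.prob (B n) \<le> (\<Sum>i\<in>bad_index n. RP.prob (\<Union>p\<in>UNIV. bad n i p))"
      unfolding B_def by (rule RP.finite_measure_subadditive_finite[OF fin]) (auto intro!: sets.finite_UN bad_prob(1))
    also have "\<dots> \<le> (\<Sum>i\<in>bad_index n. \<Sum>p\<in>UNIV. RP.prob (bad n i p))"
      by (intro sum_mono RP.finite_measure_subadditive_finite) (auto intro!: bad_prob(1))
    also have "\<dots> \<le> (\<Sum>i\<in>bad_index n. \<Sum>p\<in>(UNIV::bool set). 8 * exp (- 2 * (ln ?Q)\<^sup>2))"
      by (intro sum_mono bad_prob(2))
    also have "\<dots> = 16 * (real (card (bad_index n)) * exp (- 2 * (ln ?Q)\<^sup>2))" by (simp add: UNIV_bool)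
    also have "real (card (bad_index n)) * exp (- 2 * (ln ?Q)\<^sup>2) \<le> ?Q ^ 4 * (1 / ?Q ^ 8)"
    proof (intro mult_mono)
      have "card (bad_index n) = h n * (h n * ((q n - 1) * h n))" by (simp add: bad_index_def card_cartesian_product)
      also have "\<dots> \<le> q n * (q n * (q n * q n))" using hQ by (intro mult_mono) auto
      also have "\<dots> = q n ^ 4" by (simp add: power4_eq_xxxx)
      finally have "real (card (bad_index n)) \<le> real (q n ^ 4)" by (simp only: of_nat_le_iff)
      then show "real (card (bad_index n)) \<le> ?Q ^ 4" by simp
      \<comment> \<open>Here the factor 100 of the growth condition enters, since
        \<open>exp 4\<close> is at most \<open>3 ^ 4\<close>, that is 81.\<close>
      have e4: "exp (4::real) \<le> ?Q"
      proof -
        have "exp (4::real) = exp 1 ^ 4" by (simp add: exp_of_nat_mult[symmetric])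
        also have "\<dots> \<le> 3 ^ 4" using exp_le by (intro power_mono) auto
        finally show ?thesis using Q100 by simp
      qed
      have l4: "4 \<le> ln ?Q" using e4 Q0 by (simp add: ln_ge_iff)
      have "8 * ln ?Q \<le> 2 * (ln ?Q)\<^sup>2" using l4 by (simp add: power2_eq_square)
      then have "exp (- 2 * (ln ?Q)\<^sup>2) \<le> exp (- (8 * ln ?Q))" by simp
      also have "\<dots> = 1 / ?Q ^ 8"
      proof -
        have "exp (8 * ln ?Q) = exp (real 8 * ln ?Q)" by simp
        also have "\<dots> = exp (ln ?Q) ^ 8" by (rule exp_of_nat_mult)
        also have "\<dots> = ?Q ^ 8" using Q0 by simp
        finally show ?thesis by (simp add: exp_minus field_simps)
      qed
      finally show "exp (- 2 * (ln ?Q)\<^sup>2) \<le> 1 / ?Q ^ 8" .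
    qed auto
    also have "?Q ^ 4 * (1 / ?Q ^ 8) = 1 / ?Q ^ 4" using Q0 by (simp add: field_simps power_add[symmetric])
    also have "1 / ?Q ^ 4 \<le> 1 / 2 ^ n"
    proof (rule divide_left_mono)
      have "(2::nat) ^ n \<le> q n" using iceberg.h_ge[OF iceberg_q, of n] hQ by linarith
      then have "(2::real) ^ n \<le> ?Q" by (metis of_nat_le_iff of_nat_numeral of_nat_power)
      also have "?Q \<le> ?Q ^ 4" using Q0 power_increasing[of 1 4 ?Q] by simp
      finally show "(2::real) ^ n \<le> ?Q ^ 4" .
    qed (use Q0 in auto)
    finally show ?thesis by (simp add: power_one_over)
  qed
  have sm: "summable (\<lambda>n. RP.prob (B n))"
  proof (rule summable_comparison_test)
    show "\<exists>N. \<forall>n\<ge>N. norm (RP.prob (B n)) \<le> 16 * (1/2) ^ n" using Bp by simp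
    show "summable (\<lambda>n. 16 * (1/2) ^ n :: real)" by (intro summable_mult summable_geometric) simp
  qed
  have "AE \<alpha> in RM. \<forall>\<^sub>F n in sequentially. \<alpha> \<in> space RM - B n"
    by (rule borel_cantelli_AE1[OF Bs _ sm]) (simp add: RP.emeasure_eq_measure)
  then show ?thesis
  proof (rule AE_mp, intro AE_I2 impI)
    fix \<alpha> assume "\<forall>\<^sub>F n in sequentially. \<alpha> \<in> space RM - B n"
    then show "\<forall>\<^sub>F n in sequentially. iceberg.equidistributed q \<alpha> n"
    proof (rule eventually_mono)
      fix n assume a: "\<alpha> \<in> space RM - B n"
      show "iceberg.equidistributed q \<alpha> n"
      proof (rule not_bad_equidistributed)
        show "\<alpha> \<in> space RM" using a by (rule DiffD1)
        fix i p assume "i \<in> bad_index n"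
        then show "\<alpha> \<notin> bad n i p" using a unfolding B_def by blast
      qed
    qed
  qed
qed

end

context iceberg begin

section \<open>Decay of correlations and the spectrum\<close>

abbreviation "hR n \<equiv> real (h n)"
abbreviation "qR n \<equiv> real (q n)"
text \<open>The error of the transition law that \<open>equidistributed\<close> leaves after
  division by \<open>h (Suc n)\<close>, see \<open>pair_count_close\<close>. Below,
  \<open>damp\<close> is the part of a correlation that survives resampling, and
  \<open>cyc_corr\<close> the correlation under rotation of the finite cyclic group.\<close>

definition disc :: "nat \<Rightarrow> real" where "disc n = 8 * ln (qR n) / sqrt (qR n)"
definition damp :: "nat \<Rightarrow> nat \<Rightarrow> real" where "damp n t = max 0 (1 - real t / hR n)"
definition cyc_corr :: "nat \<Rightarrow> nat \<Rightarrow> (nat \<Rightarrow> complex) \<Rightarrow> (nat \<Rightarrow> complex) \<Rightarrow> complex" where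
  "cyc_corr n t F G = (\<Sum>b<h n. F ((b + t) mod h n) * cnj (G b)) / of_nat (h n)"

lemma q_gt1: "1 < qR n" using q2[of n] by simp

lemma disc_nonneg: "0 \<le> disc n" unfolding disc_def using q_gt1[of n] by simp

lemma damp_bounds: "0 \<le> damp n t" "damp n t \<le> 1" by (simp_all add: damp_def)

lemma bound_nonneg: "(\<And>u. u < h n \<Longrightarrow> norm (F u :: complex) \<le> C) \<Longrightarrow> 0 \<le> C"
  using norm_ge_zero[of "F 0"] order_trans h_pos by blast

lemma cyc_corr_bound:
  assumes F: "\<And>u. u < h n \<Longrightarrow> norm (F u) \<le> CF" and G: "\<And>u. u < h n \<Longrightarrow> norm (G u) \<le> CG"
  shows "norm (cyc_corr n t F G) \<le> CF * CG"
proof -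
  have "norm (\<Sum>b<h n. F ((b + t) mod h n) * cnj (G b)) \<le> (\<Sum>b<h n. CF * CG)"
  proof (rule sum_norm_le)
    fix b assume "b \<in> {..<h n}"
    then show "norm (F ((b + t) mod h n) * cnj (G b)) \<le> CF * CG"
      unfolding norm_mult complex_mod_cnj by (intro mult_mono F G bound_nonneg[OF F]) auto
  qed
  then show ?thesis by (simp add: cyc_corr_def norm_divide divide_le_eq mult.commute)
qed

text \<open>The uniform part of \<open>pair_law\<close> contributes a multiple of the sum of
  \<open>F\<close> times the conjugate sum of \<open>G\<close>, which vanishes as soon as one of the
  means is zero. Only the translated part remains.\<close>

lemma pair_sum_close:
  assumes W: "\<And>a b. a < h n \<Longrightarrow> b < h n \<Longrightarrow> \<bar>W a b - pair_law n t a b / hR n\<bar> \<le> e"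
    and F: "\<And>u. u < h n \<Longrightarrow> norm (F u) \<le> CF" and G: "\<And>u. u < h n \<Longrightarrow> norm (G u) \<le> CG"
    and z: "(\<Sum>a<h n. F a) = 0 \<or> (\<Sum>a<h n. G a) = 0"
  shows "norm ((\<Sum>b<h n. \<Sum>a<h n. F a * cnj (G b) * of_real (W a b)) - of_real (damp n t) * cyc_corr n t F G)
    \<le> CF * CG * (hR n)\<^sup>2 * e"
proof -
  let ?h = "h n"
  define \<kappa> where "\<kappa> = min (real t / real ?h) 1 / real ?h"
  have CF: "0 \<le> CF" and CG: "0 \<le> CG" using bound_nonneg[OF F] bound_nonneg[OF G] by auto
  have row: "(\<Sum>a<?h. F a * cnj (G b) * of_real (pair_law n t a b / real ?h)) =
      of_real (damp n t) * (F ((b + t) mod ?h) * cnj (G b) / of_nat ?h) + of_real (\<kappa> / real ?h) * (\<Sum>a<?h. F a) * cnj (G b)" for b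
  proof -
    have "(\<Sum>a<?h. F a * cnj (G b) * of_real (pair_law n t a b / real ?h)) =
      (\<Sum>a<?h. (if (b + t) mod ?h = a then of_real (damp n t) * (F a * cnj (G b) / of_nat ?h) else 0)
        + of_real (\<kappa> / real ?h) * F a * cnj (G b))"
      by (intro sum.cong refl) (simp add: pair_law_def damp_def \<kappa>_def algebra_simps add_divide_distrib)
    also have "\<dots> = of_real (damp n t) * (F ((b + t) mod ?h) * cnj (G b) / of_nat ?h) + of_real (\<kappa> / real ?h) * (\<Sum>a<?h. F a) * cnj (G b)"
      by (simp add: sum.distrib sum_distrib_left sum_distrib_right)
    finally show ?thesis .
  qed
  have "(\<Sum>b<?h. \<Sum>a<?h. F a * cnj (G b) * of_real (pair_law n t a b / real ?h)) =
     of_real (damp n t) * cyc_corr n t F G + of_real (\<kappa> / real ?h) * (\<Sum>a<?h. F a) * (\<Sum>b<?h. cnj (G b))"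
    unfolding row sum.distrib cyc_corr_def sum_divide_distrib by (simp only: sum_distrib_left)
  moreover have "(\<Sum>a<?h. F a) * (\<Sum>b<?h. cnj (G b)) = 0"
  proof -
    have "(\<Sum>b<?h. cnj (G b)) = cnj (\<Sum>b<?h. G b)" by (rule cnj_sum[symmetric])
    then show ?thesis using z by (auto simp del: cnj_sum)
  qed
  ultimately have main: "(\<Sum>b<?h. \<Sum>a<?h. F a * cnj (G b) * of_real (pair_law n t a b / real ?h)) = of_real (damp n t) * cyc_corr n t F G"
    by (simp only: mult.assoc mult_zero_right add_0_right)
  have "norm ((\<Sum>b<?h. \<Sum>a<?h. F a * cnj (G b) * of_real (W a b)) - of_real (damp n t) * cyc_corr n t F G)
    = norm (\<Sum>b<?h. \<Sum>a<?h. F a * cnj (G b) * of_real (W a b - pair_law n t a b / real ?h))"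
    unfolding main[symmetric] sum_subtractf[symmetric] right_diff_distrib[symmetric] of_real_diff[symmetric] by (rule refl)
  also have "\<dots> \<le> (\<Sum>b<?h. \<Sum>a<?h. CF * CG * e)"
  proof (intro sum_norm_le)
    fix b a assume ab: "b \<in> {..<?h}" "a \<in> {..<?h}"
    show "norm (F a * cnj (G b) * of_real (W a b - pair_law n t a b / real ?h)) \<le> CF * CG * e"
      unfolding norm_mult complex_mod_cnj norm_of_real
      by (intro mult_mono F G W mult_nonneg_nonneg CF CG) (use ab in auto)
  qed
  also have "\<dots> = CF * CG * (real ?h)\<^sup>2 * e" by (simp add: power2_eq_square)
  finally show ?thesis .
qed

lemma pair_count_close:
  assumes E: "equidistributed n" and a: "a < h n" "b < h n" and t: "t < (q n - 1) * h n"
  shows "\<bar>real (pair_count n t a b) / real (h (Suc n)) - pair_law n t a b / hR n\<bar> \<le> disc n"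
proof -
  let ?Q = "qR n" and ?h = "hR n"
  have Q: "0 < ?Q" using q_gt1[of n] by linarith
  have h1: "1 \<le> ?h" using h_pos[of n] by linarith
  have e: "\<bar>real (pair_count n t a b) - ?Q * pair_law n t a b\<bar> \<le> 8 * (sqrt ?Q * ln ?Q)"
    using E a t unfolding equidistributed_def by blast
  have "real (pair_count n t a b) / real (h (Suc n)) - pair_law n t a b / ?h = (real (pair_count n t a b) - ?Q * pair_law n t a b) / (?Q * ?h)"
    using Q h1 by (simp add: diff_divide_distrib)
  then have "\<bar>real (pair_count n t a b) / real (h (Suc n)) - pair_law n t a b / ?h\<bar> = \<bar>real (pair_count n t a b) - ?Q * pair_law n t a b\<bar> / (?Q * ?h)"
    using Q h1 by (simp add: abs_divide)
  also have "\<dots> \<le> 8 * (sqrt ?Q * ln ?Q) / (?Q * ?h)" using e Q h1 by (intro divide_right_mono) auto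
  also have "\<dots> \<le> 8 * (sqrt ?Q * ln ?Q) / (?Q * 1)" using Q h1 q_gt1[of n] by (intro divide_left_mono mult_left_mono) auto
  also have "\<dots> = disc n"
  proof -
    have c: "8 * (r * l) / (r * r * 1) = 8 * l / r" if "0 < r" for r l :: real using that by (simp add: field_simps)
    have "sqrt ?Q * sqrt ?Q = ?Q" using Q by simp
    then show ?thesis using c[of "sqrt ?Q" "ln ?Q"] Q unfolding disc_def by (simp only: real_sqrt_gt_0_iff)
  qed
  finally show ?thesis .
qed

text \<open>The error has two sources: \<open>disc n\<close> comes from the counts, and
  \<open>2 t / h (Suc n)\<close> from points where the power of the map is not the translation at
  level \<open>Suc n\<close>.\<close>

lemma corr_level:
  assumes E: "equidistributed n" and t: "t < (q n - 1) * h n"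
    and F: "\<And>u. u < h n \<Longrightarrow> norm (F u) \<le> CF" and G: "\<And>u. u < h n \<Longrightarrow> norm (G u) \<le> CG"
    and z: "(\<Sum>a<h n. F a) = 0 \<or> (\<Sum>a<h n. G a) = 0"
  shows "norm (U.corr (int t) (levelf n F) (levelf n G) - of_real (damp n t) * cyc_corr n t F G)
    \<le> CF * CG * (hR n)\<^sup>2 * (disc n + 2 * real t / real (h (Suc n)))" unfolding inner_levelf
proof (rule pair_sum_close[OF _ F G z])
  fix a b assume a: "a < h n" "b < h n"
  have d: "down n (Suc n - n) u = \<phi> n u" for u by simp
  have "\<bar>P.prob {x \<in> X. x n = b \<and> S (int t) x n = a} - real (pair_count n t a b) / real (h (Suc n))\<bar> \<le> 2 * real_of_int \<bar>int t\<bar> / real (h (Suc n))"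
    using level_joint_law[of n "Suc n" "\<lambda>u v. u = b \<and> v = a" "int t"] unfolding d pair_count_def by (simp del: iceberg_height.simps)
  then show "\<bar>P.prob {x \<in> X. x n = b \<and> S (int t) x n = a} - pair_law n t a b / hR n\<bar> \<le> disc n + 2 * real t / real (h (Suc n))"
    using pair_count_close[OF E a t] by simp
qed

text \<open>The same comparison for the exact cyclic translation at level \<open>Suc n\<close>. The
  second error of \<open>corr_level\<close> does not arise, so the bound stays small even when
  \<open>t\<close> is comparable with \<open>h (Suc n)\<close>.\<close>

lemma cyc_corr_step:
  assumes E: "equidistributed n" and t: "t < (q n - 1) * h n"
    and F: "\<And>u. u < h n \<Longrightarrow> norm (F u) \<le> CF" and G: "\<And>u. u < h n \<Longrightarrow> norm (G u) \<le> CG"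
    and z: "(\<Sum>a<h n. F a) = 0 \<or> (\<Sum>a<h n. G a) = 0"
  shows "norm (cyc_corr (Suc n) t (F \<circ> \<phi> n) (G \<circ> \<phi> n) - of_real (damp n t) * cyc_corr n t F G)
    \<le> CF * CG * (hR n)\<^sup>2 * disc n"
proof -
  let ?K = "\<lambda>b a. {u. u < h (Suc n) \<and> \<phi> n u = b \<and> \<phi> n (cadd (Suc n) (int t) u) = a}"
  have "(\<Sum>u<h (Suc n). (F \<circ> \<phi> n) ((u + t) mod h (Suc n)) * cnj ((G \<circ> \<phi> n) u)) =
     (\<Sum>b<h n. \<Sum>a<h n. F a * cnj (G b) * of_nat (pair_count n t a b))"
  proof -
    have "(\<Sum>u<h (Suc n). (F \<circ> \<phi> n) ((u + t) mod h (Suc n)) * cnj ((G \<circ> \<phi> n) u)) =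
      (\<Sum>u<h (Suc n). \<Sum>b<h n. \<Sum>a<h n. F a * cnj (G b) * of_bool (passes n t a b u))"
    proof (intro sum.cong refl)
      fix u
      have "(\<Sum>b<h n. \<Sum>a<h n. F a * cnj (G b) * of_bool (passes n t a b u)) =
        (\<Sum>b<h n. \<Sum>a<h n. if \<phi> n (cadd (Suc n) (int t) u) = a then (if \<phi> n u = b then F a * cnj (G b) else 0) else 0)"
        by (intro sum.cong refl) simp
      also have "\<dots> = F (\<phi> n (cadd (Suc n) (int t) u)) * cnj (G (\<phi> n u))" by simp
      finally show "(F \<circ> \<phi> n) ((u + t) mod h (Suc n)) * cnj ((G \<circ> \<phi> n) u) =
        (\<Sum>b<h n. \<Sum>a<h n. F a * cnj (G b) * of_bool (passes n t a b u))"
        by (simp only: cadd_nat o_def)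
    qed
    also have "\<dots> = (\<Sum>b<h n. \<Sum>u<h (Suc n). \<Sum>a<h n. F a * cnj (G b) * of_bool (passes n t a b u))"
      by (rule sum.swap)
    also have "\<dots> = (\<Sum>b<h n. \<Sum>a<h n. \<Sum>u<h (Suc n). F a * cnj (G b) * of_bool (passes n t a b u))"
      by (rule sum.cong[OF refl], rule sum.swap)
    also have "\<dots> = (\<Sum>b<h n. \<Sum>a<h n. F a * cnj (G b) * of_nat (pair_count n t a b))"
    proof (intro sum.cong refl)
      fix b a
      have "?K b a = {u \<in> {..<h (Suc n)}. \<phi> n u = b \<and> \<phi> n (cadd (Suc n) (int t) u) = a}" by (simp only: lessThan_iff)
      then have "(of_nat (pair_count n t a b) :: complex) = (\<Sum>u\<in>{u \<in> {..<h (Suc n)}. \<phi> n u = b \<and> \<phi> n (cadd (Suc n) (int t) u) = a}. 1)"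
        unfolding pair_count_def by (simp only: sum_constant mult_1_right)
      then have "(of_nat (pair_count n t a b) :: complex) = (\<Sum>u<h (Suc n). of_bool (passes n t a b u))"
        by (simp only: sum.inter_filter[OF finite_lessThan] of_bool_def)
      then show "(\<Sum>u<h (Suc n). F a * cnj (G b) * of_bool (passes n t a b u)) = F a * cnj (G b) * of_nat (pair_count n t a b)"
        by (simp only: sum_distrib_left)
    qed
    finally show ?thesis .
  qed
  then have "cyc_corr (Suc n) t (F \<circ> \<phi> n) (G \<circ> \<phi> n) = (\<Sum>b<h n. \<Sum>a<h n. F a * cnj (G b) * of_nat (pair_count n t a b)) / of_nat (h (Suc n))"
    by (simp only: cyc_corr_def)
  also have "\<dots> = (\<Sum>b<h n. \<Sum>a<h n. F a * cnj (G b) * of_real (real (pair_count n t a b) / real (h (Suc n))))"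
    by (simp only: sum_divide_distrib of_real_divide of_real_of_nat_eq times_divide_eq_right)
  finally have e: "cyc_corr (Suc n) t (F \<circ> \<phi> n) (G \<circ> \<phi> n) = (\<Sum>b<h n. \<Sum>a<h n. F a * cnj (G b) * of_real (real (pair_count n t a b) / real (h (Suc n))))" .
  show ?thesis unfolding e by (rule pair_sum_close[OF pair_count_close[OF E _ _ t] F G z])
qed

lemma corr_cong_X:
  assumes "f \<in> borel_measurable \<mu>" "f' \<in> borel_measurable \<mu>" "g \<in> borel_measurable \<mu>" "g' \<in> borel_measurable \<mu>"
    and f: "\<And>x. x \<in> X \<Longrightarrow> f x = f' x" and g: "\<And>x. x \<in> X \<Longrightarrow> g x = g' x"
  shows "U.corr k f g = U.corr k f' g'" unfolding L2_inner_def koopman_def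
proof (rule Bochner_Integration.integral_cong[OF refl])
  fix x assume "x \<in> space \<mu>"
  then have "x \<in> X" "S k x \<in> X" using measurable_space[OF S_measurable, of x] by (auto simp: space_\<mu>)
  then show "f (S k x) * cnj (g x) = f' (S k x) * cnj (g' x)" by (simp only: f g)
qed

lemma zero_mean_level:
  assumes f: "f \<in> U.L2_0" and e: "\<And>x. x \<in> X \<Longrightarrow> f x = levelf n F x"
  shows "(\<Sum>a<h n. F a) = 0"
proof -
  have "integral\<^sup>L \<mu> (levelf n F) = integral\<^sup>L \<mu> f"
    by (intro Bochner_Integration.integral_cong refl) (simp add: space_\<mu> e)
  then have "levelf n F \<in> U.L2_0" using f levelf_L2 by (simp add: L2_zero_mean_def)
  then show ?thesis using levelf_zero_mean_iff by blast
qed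

lemma levelf_Suc: "x \<in> X \<Longrightarrow> levelf n F x = levelf (Suc n) (F \<circ> \<phi> n) x"
  using X_\<phi>[of x n] by (simp add: levelf_def)

lemma sum_lift: "(\<Sum>a<h n. F a) = 0 \<Longrightarrow> (\<Sum>u<h (Suc n). (F \<circ> \<phi> n) u) = 0" for F :: "nat \<Rightarrow> complex"
  by (rule zero_mean_level[OF levelf_zero_mean_iff[THEN iffD2] levelf_Suc])

lemma inner_lift:
  "U.corr k (levelf n F) (levelf n G) = U.corr k (levelf (Suc n) (F \<circ> \<phi> n)) (levelf (Suc n) (G \<circ> \<phi> n))"
  by (rule corr_cong_X) (rule levelf_measurable levelf_Suc, assumption?)+

text \<open>Lifting to a higher level only repeats values, so one bound \<open>C\<close> serves all
  levels.\<close>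

lemma LF0_at_level:
  assumes "f \<in> LF0"
  shows "\<exists>m C. \<forall>n\<ge>m. \<exists>F. (\<forall>x\<in>X. f x = levelf n F x) \<and> (\<Sum>a<h n. F a) = 0 \<and> (\<forall>u<h n. norm (F u) \<le> C)"
proof -
  obtain m F where F: "f = levelf m F" using assms unfolding LF0_def by blast
  have z: "f \<in> U.L2_0" using assms LF0_zero_mean by blast
  have "\<exists>F'. (\<forall>x\<in>X. f x = levelf n F' x) \<and> (\<Sum>a<h n. F' a) = 0 \<and> (\<forall>u<h n. norm (F' u) \<le> (\<Sum>a<h m. norm (F a)))" if n: "m \<le> n" for n
  proof (intro exI conjI)
    let ?F' = "\<lambda>u. F (down m (n - m) u)"
    show e: "\<forall>x\<in>X. f x = levelf n ?F' x" unfolding F using levelf_lift[OF n] by blast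
    show "(\<Sum>a<h n. ?F' a) = 0" by (rule zero_mean_level[OF z]) (use e in blast)
    show "\<forall>u<h n. norm (?F' u) \<le> (\<Sum>a<h m. norm (F a))"
    proof (intro allI impI)
      fix u assume "u < h n"
      then have "down m (n - m) u < h m" using down_lt[of u m "n - m"] n by simp
      then show "norm (?F' u) \<le> (\<Sum>a<h m. norm (F a))"
        by (intro member_le_sum[where f="\<lambda>a. norm (F a)"]) auto
    qed
  qed
  note lift = this
  show ?thesis by (rule exI, rule exI, rule allI, rule impI, rule lift, assumption)
qed

lemma height_between:
  assumes "1 \<le> t" obtains n where "h n \<le> t" "t < h (Suc n)"
proof -
  define n where "n = (LEAST n. t < h (Suc n))"
  have "t < h (Suc t)" using h_ge_n[of "Suc t"] by linarith
  then have 1: "t < h (Suc n)" unfolding n_def by (rule LeastI[where P="\<lambda>n. t < h (Suc n)"])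
  have 2: "h n \<le> t"
  proof (cases n)
    case 0 then show ?thesis using assms by simp
  next
    case (Suc k)
    then have "\<not> t < h (Suc k)" unfolding n_def by (intro not_less_Least) simp
    then show ?thesis using Suc by (simp only: not_less)
  qed
  show thesis by (rule that[OF 2 1])
qed

end

text \<open>The deterministic setting of everything that follows: randomness enters only through
  \<open>equi\<close>, which holds almost surely by \<open>AE_equidistributed\<close>.\<close>

locale equi_iceberg = iceberg +
  assumes growth: "\<And>n. 100 * 3 ^ h n \<le> q n"
    and equi: "\<forall>\<^sub>F n in sequentially. equidistributed n"
begin

lemma q_ge: "100 \<le> qR n"
proof -
  have "(1::nat) \<le> 3 ^ h n" by simp
  then have "100 \<le> q n" using growth[of n] by linarith
  then show ?thesis by simp
qed

lemma h_le_ln: "hR n \<le> ln (qR n)"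
proof -
  have "exp (hR n) = exp 1 ^ h n" by (simp add: exp_of_nat_mult[symmetric])
  also have "\<dots> \<le> 3 ^ h n" using exp_le by (intro power_mono) auto
  also have "\<dots> \<le> qR n"
  proof -
    have "3 ^ h n \<le> q n" using growth[of n] by linarith
    then have "real (3 ^ h n) \<le> qR n" by (simp only: of_nat_le_iff)
    then show ?thesis by simp
  qed
  finally show ?thesis using q_ge[of n] by (subst ln_ge_iff) linarith+
qed

lemma one_le_ln: "1 \<le> ln (qR n)"
proof -
  have "1 \<le> hR n" using h_pos[of n] by linarith
  then show ?thesis using h_le_ln[of n] by linarith
qed

text \<open>This is \<open>(1 + y / 4) ^ 4 \<le> exp y\<close> for
  \<open>y = \<epsilon> * ln x\<close>, which explains \<open>256 = 4 ^ 4\<close>. The fourth power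
  covers the three logarithms of \<open>disc_le\<close> and one more factor.\<close>

lemma ln4_le:
  fixes x \<epsilon> :: real
  assumes "0 < \<epsilon>" "1 \<le> x" shows "(ln x) ^ 4 \<le> 256 / \<epsilon> ^ 4 * x powr \<epsilon>"
proof -
  have l: "0 \<le> \<epsilon> * ln x" using assms by simp
  have "(\<epsilon> * ln x / 4) ^ 4 \<le> (1 + \<epsilon> * ln x / real 4) ^ 4" using l by (intro power_mono) auto
  also have "\<dots> \<le> exp (\<epsilon> * ln x)" by (rule exp_ge_one_plus_x_over_n_power_n) (use l in auto)
  finally have "(\<epsilon> * ln x / 4) ^ 4 \<le> x powr \<epsilon>" using assms by (simp add: powr_def)
  then have "\<epsilon> ^ 4 * (ln x) ^ 4 \<le> 256 * x powr \<epsilon>" by (simp add: power_mult_distrib power_divide)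
  then show ?thesis using assms by (simp add: field_simps)
qed

lemma disc_le: "(hR n)\<^sup>2 * disc n \<le> 8 * (ln (qR n)) ^ 3 / sqrt (qR n)"
proof -
  let ?l = "ln (qR n)"
  have "(hR n)\<^sup>2 * disc n \<le> ?l\<^sup>2 * disc n"
    using h_le_ln[of n] disc_nonneg[of n] by (intro mult_right_mono power_mono) auto
  also have "\<dots> = 8 * ?l ^ 3 / sqrt (qR n)" by (simp add: disc_def power2_eq_square power3_eq_cube)
  finally show ?thesis .
qed

lemma h3_disc: "(hR n)\<^sup>2 * disc n \<le> 32768 / hR n"
proof -
  let ?l = "ln (qR n)" and ?Q = "qR n"
  have Q: "1 \<le> ?Q" using q_ge[of n] by linarith
  have h0: "0 < hR n" by simp
  have "hR n * ((hR n)\<^sup>2 * disc n) \<le> ?l * (8 * ?l ^ 3 / sqrt ?Q)"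
    using h_le_ln[of n] disc_le[of n] disc_nonneg[of n] one_le_ln[of n] by (intro mult_mono) auto
  also have "\<dots> = 8 * ?l ^ 4 / sqrt ?Q" by (simp add: power_numeral_reduce)
  also have "\<dots> \<le> 8 * (256 / (1/2) ^ 4 * ?Q powr (1/2)) / sqrt ?Q"
    using ln4_le[of "1/2" ?Q] Q by (intro divide_right_mono mult_left_mono) auto
  also have "\<dots> = 32768" using Q by (simp add: powr_half_sqrt power_divide)
  finally show ?thesis using h0 by (simp add: field_simps)
qed

text \<open>A fourth logarithm is inserted next to the three of \<open>disc_le\<close>, in order to
  pass from a power of \<open>q n\<close> to the same power of \<open>q n * ln (q n)\<close>. The
  latter dominates \<open>h (Suc n) = q n * h n\<close> and therefore \<open>t\<close>.\<close>

lemma disc_powr: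
  assumes e: "0 < \<epsilon>" "\<epsilon> \<le> 1/2" and t: "1 \<le> t" "t \<le> h (Suc n)"
  shows "(hR n)\<^sup>2 * disc n \<le> 2048 / \<epsilon> ^ 4 * real t powr (- 1/2 + \<epsilon>)"
proof -
  let ?l = "ln (qR n)" and ?Q = "qR n" and ?p = "- 1/2 + \<epsilon>"
  have Q: "1 \<le> ?Q" using q_ge[of n] by linarith
  have l: "1 \<le> ?l" by (rule one_le_ln)
  have sq: "0 < sqrt ?Q" using Q by simp
  have 1: "8 * ?l ^ 3 / sqrt ?Q = 8 * ?l ^ 4 / (sqrt ?Q * ?l)" using l by (simp add: power_numeral_reduce)
  have 2: "8 * ?l ^ 4 / (sqrt ?Q * ?l) \<le> 8 * (256 / \<epsilon> ^ 4 * ?Q powr \<epsilon>) / (sqrt ?Q * ?l)"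
  proof (rule divide_right_mono)
    show "8 * ?l ^ 4 \<le> 8 * (256 / \<epsilon> ^ 4 * ?Q powr \<epsilon>)"
      by (rule mult_left_mono[OF ln4_le[OF e(1) Q]]) simp
    show "0 \<le> sqrt ?Q * ?l" using sq l by (intro mult_nonneg_nonneg) linarith+
  qed
  have 3: "8 * (256 / \<epsilon> ^ 4 * ?Q powr \<epsilon>) / (sqrt ?Q * ?l) = 2048 / \<epsilon> ^ 4 * (?Q powr ?p * ?l powr (- 1))"
  proof -
    have "?Q powr ?p = ?Q powr (- (1/2)) * ?Q powr \<epsilon>" by (simp only: powr_add[symmetric]) simp
    moreover have "0 \<le> ?Q" by simp
    then have "?Q powr (- (1/2)) = 1 / sqrt ?Q" by (simp only: powr_minus_divide powr_half_sqrt)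
    ultimately have a: "?Q powr ?p = 1 / sqrt ?Q * ?Q powr \<epsilon>" by (simp only:)
    have "?l powr (- 1) = 1 / ?l powr 1" by (rule powr_minus_divide)
    also have "?l powr 1 = ?l" using l by simp
    finally have b: "?l powr (- 1) = 1 / ?l" .
    show ?thesis unfolding a b by simp
  qed
  have 4: "2048 / \<epsilon> ^ 4 * (?Q powr ?p * ?l powr (- 1)) \<le> 2048 / \<epsilon> ^ 4 * (?Q powr ?p * ?l powr ?p)"
    by (intro mult_left_mono powr_mono) (use e l in simp_all)
  have 5: "?Q powr ?p * ?l powr ?p = (?Q * ?l) powr ?p" by (rule powr_mult[symmetric])
  have 6: "2048 / \<epsilon> ^ 4 * (?Q * ?l) powr ?p \<le> 2048 / \<epsilon> ^ 4 * real t powr ?p"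
  proof (rule mult_left_mono[OF powr_mono2'])
    have "real t \<le> real (h (Suc n))" using t by (simp only: of_nat_le_iff)
    moreover have "real (h (Suc n)) = ?Q * hR n" by (simp only: iceberg_height.simps of_nat_mult)
    moreover have "?Q * hR n \<le> ?Q * ?l" by (rule mult_left_mono[OF h_le_ln]) simp
    ultimately show "real t \<le> ?Q * ?l" by linarith
    show "?p \<le> 0" using e by simp
    show "0 < real t" using t by simp
    show "0 \<le> 2048 / \<epsilon> ^ 4" using e by simp
  qed
  show ?thesis
    by (rule order_trans[OF disc_le]) (unfold 1, rule order_trans[OF 2], unfold 3, rule order_trans[OF 4], unfold 5, rule 6)
qed

lemma inv_q_le_disc: "1 / qR n \<le> disc n"
proof -
  let ?Q = "qR n"
  have Q: "1 \<le> ?Q" using q_ge[of n] by linarith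
  have "sqrt ?Q \<le> ?Q" using Q real_le_lsqrt[of ?Q ?Q] by (simp add: power2_eq_square)
  then have "1 / ?Q \<le> 1 / sqrt ?Q" using Q by (intro divide_left_mono) auto
  also have "\<dots> \<le> 8 * ln ?Q / sqrt ?Q" using one_le_ln[of n] Q by (intro divide_right_mono) auto
  finally show ?thesis by (simp add: disc_def)
qed

text \<open>The first term is twice the constant of \<open>disc_powr\<close>, for the error at level
  \<open>n\<close>; the second is three times that of \<open>h3_disc\<close>, for the error at level
  \<open>Suc n\<close>.\<close>

definition decay_const :: "real \<Rightarrow> real" where "decay_const \<epsilon> = 4096 / \<epsilon> ^ 4 + 98304"

text \<open>Both functions are lifted to level \<open>Suc n\<close>, where \<open>corr_level\<close>
  replaces the power by the cyclic translation. Since \<open>h n \<le> t\<close>, every point has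
  left its block of length \<open>h n\<close>, so \<open>damp n t = 0\<close> and
  \<open>cyc_corr_step\<close> leaves only the statistical error of level \<open>n\<close>. That
  error is the dominant one, of order near \<open>t powr (-1/2)\<close>; the error of level
  \<open>Suc n\<close> is of order \<open>1 / t\<close>.\<close>

lemma corr_decay:
  assumes E: "equidistributed n" "equidistributed (Suc n)" and t: "h n \<le> t" "t < h (Suc n)"
    and F: "\<And>u. u < h n \<Longrightarrow> norm (F u) \<le> CF" and G: "\<And>u. u < h n \<Longrightarrow> norm (G u) \<le> CG"
    and z: "(\<Sum>a<h n. F a) = 0" and e: "0 < \<epsilon>" "\<epsilon> \<le> 1/2"
  shows "norm (U.corr (int t) (levelf n F) (levelf n G)) \<le> CF * CG * decay_const \<epsilon> * real t powr (- 1/2 + \<epsilon>)"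
proof -
  let ?m = "Suc n" and ?p = "- 1/2 + \<epsilon>"
  let ?F = "F \<circ> \<phi> n" and ?G = "G \<circ> \<phi> n"
  have CF: "0 \<le> CF" and CG: "0 \<le> CG" using bound_nonneg[OF F] bound_nonneg[OF G] by auto
  have F': "norm (?F u) \<le> CF" and G': "norm (?G u) \<le> CG" for u using F[of "\<phi> n u"] G[of "\<phi> n u"] by auto
  have t1: "1 \<le> t" using t(1) h_pos[of n] by linarith
  define c where "c = cyc_corr ?m t ?F ?G"
  have tm: "t < (q ?m - 1) * h ?m"
  proof -
    have "1 * h ?m \<le> (q ?m - 1) * h ?m" by (rule mult_le_mono1) (use q2[of ?m] in linarith)
    then show ?thesis using t(2) by (simp only: mult_1)
  qed
  have "norm (U.corr (int t) (levelf n F) (levelf n G) - of_real (damp ?m t) * c)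
      \<le> CF * CG * (real (h ?m))\<^sup>2 * (disc ?m + 2 * real t / real (h (Suc ?m)))"
    unfolding inner_lift[of _ n] c_def by (rule corr_level[OF E(2) tm F' G']) (use sum_lift[OF z] in blast)
  also have "\<dots> \<le> CF * CG * (real (h ?m))\<^sup>2 * (3 * disc ?m)"
  proof (rule mult_left_mono)
    have "2 * real t / real (h (Suc ?m)) \<le> 2 * real (h ?m) / real (h (Suc ?m))"
      using t(2) by (intro divide_right_mono mult_left_mono) (auto simp del: iceberg_height.simps)
    also have "\<dots> = 2 * (1 / real (q ?m))"
    proof -
      have "real (h (Suc ?m)) = real (q ?m) * real (h ?m)" by (simp only: iceberg_height.simps(2)[of q ?m] of_nat_mult)
      moreover have "real (h ?m) \<noteq> 0" by (simp only: of_nat_eq_0_iff h_ne0 not_False_eq_True)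
      ultimately show ?thesis by (simp only: times_divide_eq_right mult_1_right) simp
    qed
    finally show "disc ?m + 2 * real t / real (h (Suc ?m)) \<le> 3 * disc ?m" using inv_q_le_disc[of ?m] by linarith
    show "0 \<le> CF * CG * (real (h ?m))\<^sup>2" using CF CG by (intro mult_nonneg_nonneg zero_le_power2)
  qed
  finally have 1: "norm (U.corr (int t) (levelf n F) (levelf n G) - of_real (damp ?m t) * c)
      \<le> CF * CG * (3 * ((real (h ?m))\<^sup>2 * disc ?m))" by (simp only: ac_simps)
  have h1: "1 \<le> (hR n)\<^sup>2"
  proof -
    have "1 \<le> hR n" using h_pos[of n] by linarith
    then show ?thesis by (rule one_le_power)
  qed
  have hd: "disc n \<le> (hR n)\<^sup>2 * disc n" using mult_right_mono[OF h1 disc_nonneg[of n]] by simp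
  have 2: "norm (of_real (damp ?m t) * c) \<le> CF * CG * ((hR n)\<^sup>2 * disc n)"
  proof (cases "t < (q n - 1) * h n")
    case True
    have "damp n t = 0" using t(1) by (simp add: damp_def)
    then have "norm c \<le> CF * CG * (hR n)\<^sup>2 * disc n"
      using cyc_corr_step[OF E(1) True F G disjI1[OF z]] unfolding c_def by simp
    moreover have "norm (of_real (damp ?m t) * c) \<le> 1 * norm c"
      unfolding norm_mult norm_of_real using damp_bounds[of ?m t] by (intro mult_right_mono) (auto simp only: abs_of_nonneg norm_ge_zero)
    ultimately show ?thesis by (simp only: mult_1 mult.assoc)
  next
    \<comment> \<open>In the last block before \<open>h (Suc n)\<close> the counts give no
      information, but there \<open>damp (Suc n) t\<close> is already at most
      \<open>1 / q n\<close>.\<close>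
    case False
    have "damp ?m t \<le> 1 / qR n"
    proof -
      have "real ((q n - 1) * h n) \<le> real t" using False by (simp only: not_less of_nat_le_iff)
      then have "(qR n - 1) * hR n \<le> real t" using q2[of n] by (simp add: of_nat_diff)
      then have "(qR n * hR n - real t) / (qR n * hR n) \<le> hR n / (qR n * hR n)"
        by (intro divide_right_mono) (simp_all add: algebra_simps)
      then have "1 - real t / (qR n * hR n) \<le> 1 / qR n"
        using q_gt1[of n] by (simp add: diff_divide_distrib)
      then show ?thesis using q_gt1[of n] by (simp add: damp_def)
    qed
    moreover have "norm c \<le> CF * CG" unfolding c_def by (rule cyc_corr_bound[OF F' G'])
    ultimately have "norm (of_real (damp ?m t) * c) \<le> (1 / qR n) * (CF * CG)"
      unfolding norm_mult norm_of_real using damp_bounds[of ?m t] by (intro mult_mono) (auto simp only: abs_of_nonneg norm_ge_zero of_nat_0_le_iff zero_le_divide_1_iff)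
    also have "\<dots> \<le> ((hR n)\<^sup>2 * disc n) * (CF * CG)"
      using inv_q_le_disc[of n] hd CF CG by (intro mult_right_mono) auto
    finally show ?thesis by (simp only: ac_simps)
  qed
  have tp: "1 / real (h ?m) \<le> real t powr ?p"
  proof -
    have "1 / real (h ?m) \<le> 1 / real t"
      using t(2) t1 by (intro divide_left_mono) (auto simp del: iceberg_height.simps)
    also have "\<dots> = real t powr (- 1)" using t1 by (simp add: powr_minus_divide)
    also have "\<dots> \<le> real t powr ?p" using t1 e by (intro powr_mono) auto
    finally show ?thesis .
  qed
  have A: "(hR n)\<^sup>2 * disc n \<le> 2048 / \<epsilon> ^ 4 * real t powr ?p"
    by (rule disc_powr[OF e t1 less_imp_le[OF t(2)]])
  have B: "(real (h ?m))\<^sup>2 * disc ?m \<le> 32768 * (real t powr ?p)" using h3_disc[of ?m] tp by linarith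
  have P: "0 \<le> 2048 / \<epsilon> ^ 4 * real t powr ?p" using e by simp
  have "norm (U.corr (int t) (levelf n F) (levelf n G)) \<le>
     norm (U.corr (int t) (levelf n F) (levelf n G) - of_real (damp ?m t) * c) + norm (of_real (damp ?m t) * c)"
    by (rule norm_triangle_sub[THEN order_trans]) (rule eq_refl, rule add.commute)
  also have "\<dots> \<le> CF * CG * (3 * ((real (h ?m))\<^sup>2 * disc ?m)) + CF * CG * ((hR n)\<^sup>2 * disc n)"
    by (rule add_mono[OF 1 2])
  also have "\<dots> = CF * CG * (3 * ((real (h ?m))\<^sup>2 * disc ?m) + (hR n)\<^sup>2 * disc n)" by (rule distrib_left[symmetric])
  also have "\<dots> \<le> CF * CG * (decay_const \<epsilon> * real t powr ?p)"
  proof (rule mult_left_mono)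
    have "3 * ((real (h ?m))\<^sup>2 * disc ?m) + (hR n)\<^sup>2 * disc n \<le> 98304 * (real t powr ?p) + (2048 / \<epsilon> ^ 4 * real t powr ?p + 2048 / \<epsilon> ^ 4 * real t powr ?p)"
      using A B P by linarith
    also have "\<dots> = decay_const \<epsilon> * real t powr ?p" by (simp add: decay_const_def algebra_simps)
    finally show "3 * ((real (h ?m))\<^sup>2 * disc ?m) + (hR n)\<^sup>2 * disc n \<le> decay_const \<epsilon> * real t powr ?p" .
  qed (use CF CG in simp)
  finally show ?thesis by (simp only: mult.assoc)
qed

text \<open>Each large \<open>t\<close> lies between two consecutive heights, and the functions are
  represented at the lower of these levels. Their sup bounds do not depend on the level, so the
  constant is uniform in \<open>t\<close>.\<close>

lemma LF0_decay:
  assumes f: "f \<in> LF0" and g: "g \<in> LF0"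
  shows "\<exists>C b. 0 \<le> C \<and> 1 \<le> b \<and> (\<forall>\<epsilon>>0. \<epsilon> \<le> 1/2 \<longrightarrow> (\<forall>t\<ge>b.
      norm (U.corr (int t) f g) \<le> C * decay_const \<epsilon> * real t powr (- 1/2 + \<epsilon>)))"
proof -
  obtain m CF where F: "\<forall>n\<ge>m. \<exists>F. (\<forall>x\<in>X. f x = levelf n F x) \<and> (\<Sum>a<h n. F a) = 0 \<and> (\<forall>u<h n. norm (F u) \<le> CF)"
    using LF0_at_level[OF f] by blast
  obtain m' CG where G: "\<forall>n\<ge>m'. \<exists>F. (\<forall>x\<in>X. g x = levelf n F x) \<and> (\<Sum>a<h n. F a) = 0 \<and> (\<forall>u<h n. norm (F u) \<le> CG)"
    using LF0_at_level[OF g] by blast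
  obtain l where l: "\<And>n. l \<le> n \<Longrightarrow> equidistributed n" using equi unfolding eventually_sequentially by blast
  have fm: "f \<in> borel_measurable \<mu>" and gm: "g \<in> borel_measurable \<mu>"
    using f g LF0_zero_mean by (auto simp: L2_zero_mean_def L2_space_def)
  define k where "k = max l (max m m')"
  have C0: "0 \<le> CF * CG"
  proof -
    obtain F' where "\<forall>u<h m. norm (F' u :: complex) \<le> CF" using F[rule_format, OF order_refl] by blast
    then have "0 \<le> CF" using bound_nonneg[of m F' CF] by blast
    moreover obtain G' where "\<forall>u<h m'. norm (G' u :: complex) \<le> CG" using G[rule_format, OF order_refl] by blast
    then have "0 \<le> CG" using bound_nonneg[of m' G' CG] by blast
    ultimately show ?thesis by (rule mult_nonneg_nonneg)
  qed
  show ?thesis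
  proof (rule exI[of _ "CF * CG"], rule exI[of _ "h k"], intro conjI allI impI C0)
    show "1 \<le> h k" using h_pos[of k] by linarith
    fix \<epsilon> :: real and t assume e: "0 < \<epsilon>" "\<epsilon> \<le> 1/2" and t: "h k \<le> t"
    have "1 \<le> t" using t h_pos[of k] by linarith
    then obtain n where n: "h n \<le> t" "t < h (Suc n)" by (rule height_between)
    have kn: "k \<le> n"
    proof (rule ccontr)
      assume "\<not> k \<le> n"
      then have "h (Suc n) \<le> h k" by (intro h_mono) simp
      then show False using n t by linarith
    qed
    have mn: "m \<le> n" "m' \<le> n" "l \<le> n" "l \<le> Suc n" using kn by (auto simp: k_def)
    obtain F' where F': "\<forall>x\<in>X. f x = levelf n F' x" "(\<Sum>a<h n. F' a) = 0" "\<forall>u<h n. norm (F' u) \<le> CF" using F[rule_format, OF mn(1)] by blast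
    obtain G' where G': "\<forall>x\<in>X. g x = levelf n G' x" "\<forall>u<h n. norm (G' u) \<le> CG" using G[rule_format, OF mn(2)] by blast
    have "U.corr (int t) f g = U.corr (int t) (levelf n F') (levelf n G')"
      by (rule corr_cong_X[OF fm levelf_measurable gm levelf_measurable]) (use F'(1) G'(1) in blast)+
    moreover have "norm (U.corr (int t) (levelf n F') (levelf n G')) \<le> CF * CG * decay_const \<epsilon> * real t powr (- 1/2 + \<epsilon>)"
      by (rule corr_decay[OF l[OF mn(3)] l[OF mn(4)] n _ _ F'(2) e]) (use F'(3) G'(2) in blast)+
    ultimately show "norm (U.corr (int t) f g) \<le> CF * CG * decay_const \<epsilon> * real t powr (- 1/2 + \<epsilon>)"
      by (simp only:)
  qed
qed

end

section \<open>Characters of the finite cyclic groups and their averages\<close>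

context iceberg begin

abbreviation \<omega> :: "nat \<Rightarrow> nat \<Rightarrow> complex" where "\<omega> n k \<equiv> cis (2 * pi * real k / hR n)"

definition \<psi> :: "nat \<Rightarrow> nat \<Rightarrow> (nat \<Rightarrow> nat) \<Rightarrow> complex" where "\<psi> n k = levelf n (\<lambda>u. \<omega> n k ^ u)"
definition coef :: "((nat \<Rightarrow> nat) \<Rightarrow> complex) \<Rightarrow> nat \<Rightarrow> nat \<Rightarrow> complex" where
  "coef f n k = U.inn f (\<psi> n k)"
definition tri :: "nat \<Rightarrow> int \<Rightarrow> real" where "tri n d = max 0 (1 - \<bar>real_of_int d\<bar> / hR n)"
definition wt :: "nat \<Rightarrow> nat \<Rightarrow> real" where
  "wt n L = (\<Sum>s<L * h n. \<Sum>s'<L * h n. tri n (int s - int s')) / (real (L * h n))\<^sup>2"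

lemma \<omega>_h: "\<omega> n k ^ h n = 1"
proof -
  have "\<omega> n k ^ h n = cis (2 * pi * real k)" unfolding Complex.DeMoivre by (rule arg_cong[of _ _ cis]) simp
  also have "\<dots> = 1" using cis_multiple_2pi[of "real k"] by (simp add: Ints_of_nat)
  finally show ?thesis .
qed

lemma \<omega>_mod: "\<omega> n k ^ (u mod h n) = \<omega> n k ^ u"
proof -
  have "\<omega> n k ^ u = \<omega> n k ^ (h n * (u div h n) + u mod h n)" by simp
  also have "\<dots> = \<omega> n k ^ (u mod h n)" by (simp only: power_add power_mult \<omega>_h power_one mult_1)
  finally show ?thesis ..
qed

lemma \<omega>_cnj: "\<omega> n k ^ u * cnj (\<omega> n k ^ u) = 1"
  by (simp only: complex_norm_square[symmetric] norm_power norm_cis) simp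

lemma norm_\<omega>: "norm (\<omega> n k ^ u) = 1" by (simp add: norm_power)

lemma sum_\<omega>:
  assumes "0 < k" "k < h n" shows "(\<Sum>a<h n. \<omega> n k ^ a) = 0"
proof -
  have "(\<Sum>a<h n. \<omega> n k ^ a) = (\<Sum>a<h n. cis (2 * pi * real a * of_int (int k) / hR n))"
    unfolding Complex.DeMoivre by (intro sum.cong refl arg_cong[of _ _ cis]) simp
  also have "\<dots> = (if int (h n) dvd int k then of_nat (h n) else 0)" by (rule sum_roots_unity[OF h_pos])
  also have "\<dots> = 0" using assms by (auto dest: dvd_imp_le)
  finally show ?thesis .
qed

lemma coef_levelf: "coef (levelf n F) n k = (\<Sum>a<h n. F a * cnj (\<omega> n k ^ a)) / of_nat (h n)"
  unfolding coef_def \<psi>_def by (rule inner_levelf0)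

text \<open>Characters are eigenfunctions of cyclic translations, so a time shift appears as the
  scalar \<open>\<omega> n k ^ t\<close>.\<close>

lemma cyc_corr_\<omega>: "cyc_corr n t F (\<lambda>u. \<omega> n k ^ u) = \<omega> n k ^ t * coef (levelf n F) n k"
proof -
  have "(\<Sum>a<h n. F a * cnj (\<omega> n k ^ a)) = (\<Sum>b<h n. F ((t + b) mod h n) * cnj (\<omega> n k ^ ((t + b) mod h n)))"
    by (rule sum_rotate[symmetric, where f="\<lambda>a. F a * cnj (\<omega> n k ^ a)"]) simp
  then have "\<omega> n k ^ t * (\<Sum>a<h n. F a * cnj (\<omega> n k ^ a)) = (\<Sum>b<h n. \<omega> n k ^ t * (F ((t + b) mod h n) * cnj (\<omega> n k ^ ((t + b) mod h n))))"
    by (simp only: sum_distrib_left)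
  also have "\<dots> = (\<Sum>b<h n. F ((b + t) mod h n) * cnj (\<omega> n k ^ b))"
  proof (intro sum.cong refl)
    fix b
    have "\<omega> n k ^ t * (F ((t + b) mod h n) * cnj (\<omega> n k ^ ((t + b) mod h n)))
      = (\<omega> n k ^ t * cnj (\<omega> n k ^ t)) * (F ((t + b) mod h n) * cnj (\<omega> n k ^ b))"
      unfolding \<omega>_mod power_add complex_cnj_mult by (simp only: ac_simps)
    then show "\<omega> n k ^ t * (F ((t + b) mod h n) * cnj (\<omega> n k ^ ((t + b) mod h n))) = F ((b + t) mod h n) * cnj (\<omega> n k ^ b)"
      by (simp only: \<omega>_cnj mult_1 add.commute)
  qed
  finally show ?thesis unfolding cyc_corr_def coef_levelf by simp
qed

lemma cyc_corr_\<omega>': "cyc_corr n t (\<lambda>u. \<omega> n k ^ u) G = \<omega> n k ^ t * cnj (coef (levelf n G) n k)"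
proof -
  have "(\<Sum>b<h n. \<omega> n k ^ ((b + t) mod h n) * cnj (G b)) = (\<Sum>b<h n. \<omega> n k ^ t * (cnj (G b) * \<omega> n k ^ b))"
    unfolding \<omega>_mod power_add by (intro sum.cong refl) (simp only: ac_simps)
  also have "\<dots> = \<omega> n k ^ t * cnj (\<Sum>b<h n. G b * cnj (\<omega> n k ^ b))"
    by (simp only: sum_distrib_left cnj_sum complex_cnj_mult complex_cnj_cnj)
  finally show ?thesis unfolding cyc_corr_def coef_levelf by simp
qed

text \<open>\<open>tri\<close> is the even extension of \<open>damp\<close>. Negative times follow
  from positive ones by exchanging the two functions and conjugating.\<close>

lemma corr_char:
  assumes E: "equidistributed n" and t: "nat \<bar>t\<bar> < (q n - 1) * h n"
    and F: "\<And>u. u < h n \<Longrightarrow> norm (F u) \<le> CF"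
    and z: "(\<Sum>a<h n. F a) = 0 \<or> (\<Sum>a<h n. \<omega> n k ^ a) = 0"
  shows "norm (U.corr t (levelf n F) (\<psi> n k) - of_real (tri n t) * (\<omega> n k powi t * coef (levelf n F) n k))
    \<le> CF * ((hR n)\<^sup>2 * (disc n + 2 * real_of_int \<bar>t\<bar> / real (h (Suc n))))"
proof (cases "0 \<le> t")
  case True
  define s where "s = nat t"
  have ts: "t = int s" using True by (simp add: s_def)
  have s: "s < (q n - 1) * h n" using t unfolding ts by simp
  have d: "tri n t = damp n s" unfolding ts tri_def damp_def by simp
  have "norm (U.corr (int s) (levelf n F) (levelf n (\<lambda>u. \<omega> n k ^ u)) - of_real (damp n s) * cyc_corr n s F (\<lambda>u. \<omega> n k ^ u))
    \<le> CF * 1 * (hR n)\<^sup>2 * (disc n + 2 * real s / real (h (Suc n)))"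
  proof (rule corr_level[OF E s _ _ z])
    show "norm (F u) \<le> CF" if "u < h n" for u by (rule F[OF that])
    show "norm (\<omega> n k ^ u) \<le> 1" for u by (simp only: norm_\<omega> order_refl)
  qed
  then show ?thesis unfolding d cyc_corr_\<omega> \<psi>_def unfolding ts power_int_of_nat
    by (simp only: mult_1_right mult.assoc of_int_of_nat_eq abs_of_nat)
next
  case False
  define s where "s = nat (- t)"
  have ts: "t = - int s" using False by (simp add: s_def)
  have s: "s < (q n - 1) * h n" using t unfolding ts by simp
  have d: "tri n t = damp n s" unfolding ts tri_def damp_def by simp
  have "norm (U.corr (int s) (levelf n (\<lambda>u. \<omega> n k ^ u)) (levelf n F) - of_real (damp n s) * cyc_corr n s (\<lambda>u. \<omega> n k ^ u) F)
    \<le> 1 * CF * (hR n)\<^sup>2 * (disc n + 2 * real s / real (h (Suc n)))"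
  proof (rule corr_level[OF E s])
    show "norm (F u) \<le> CF" if "u < h n" for u by (rule F[OF that])
    show "norm (\<omega> n k ^ u) \<le> 1" for u by (simp only: norm_\<omega> order_refl)
    show "(\<Sum>a<h n. \<omega> n k ^ a) = 0 \<or> (\<Sum>a<h n. F a) = 0" using z by blast
  qed
  moreover have "U.corr t (levelf n F) (\<psi> n k) - of_real (tri n t) * (\<omega> n k powi t * coef (levelf n F) n k)
    = cnj (U.corr (int s) (levelf n (\<lambda>u. \<omega> n k ^ u)) (levelf n F) - of_real (damp n s) * cyc_corr n s (\<lambda>u. \<omega> n k ^ u) F)"
  proof -
    have "\<omega> n k powi t = inverse (\<omega> n k ^ s)" unfolding ts power_int_minus power_int_of_nat by (rule refl)
    also have "\<dots> = cnj (\<omega> n k ^ s)" by (rule inverse_unique) (rule \<omega>_cnj)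
    finally have p: "\<omega> n k powi t = cnj (\<omega> n k ^ s)" .
    show ?thesis unfolding d p cyc_corr_\<omega>' complex_cnj_diff complex_cnj_mult complex_cnj_cnj complex_cnj_complex_of_real \<psi>_def
      unfolding ts U.corr_minus[OF levelf_L2 levelf_L2] by (rule refl)
  qed
  ultimately show ?thesis unfolding ts by (simp only: complex_mod_cnj mult_1 mult.assoc abs_minus_cancel of_int_of_nat_eq abs_of_nat)
qed

lemma inner_cong_X:
  "(\<And>x. x \<in> X \<Longrightarrow> f x = f' x) \<Longrightarrow> (\<And>x. x \<in> X \<Longrightarrow> g x = g' x) \<Longrightarrow> U.inn f g = U.inn f' g'"
  unfolding L2_inner_def by (intro Bochner_Integration.integral_cong refl) (simp only: space_\<mu>)

text \<open>The weights at \<open>i\<close> and at \<open>i - h n\<close> add up to 1 for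
  \<open>0 \<le> i < h n\<close>, and all weights outside this range of indices vanish.\<close>

lemma sum_tri:
  assumes "finite I"
  shows "(\<Sum>d\<in>I. tri n d) \<le> hR n" and "{- int (h n)..<int (h n)} \<subseteq> I \<Longrightarrow> (\<Sum>d\<in>I. tri n d) = hR n"
proof -
  let ?h = "h n"
  let ?J = "{- int ?h..<int ?h}"
  have J: "(\<Sum>d\<in>?J. tri n d) = real ?h"
  proof -
    have J: "?J = int ` {..<?h} \<union> (\<lambda>i. int i - int ?h) ` {..<?h}"
    proof (intro subset_antisym subsetI)
      fix d assume d: "d \<in> ?J"
      show "d \<in> int ` {..<?h} \<union> (\<lambda>i. int i - int ?h) ` {..<?h}"
      proof (cases "0 \<le> d")
        case True then show ?thesis using d by (intro UnI1 image_eqI[of _ _ "nat d"]) auto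
      next
        case False then show ?thesis using d by (intro UnI2 image_eqI[of _ _ "nat (d + int ?h)"]) auto
      qed
    qed auto
    have "(\<Sum>d\<in>?J. tri n d) = (\<Sum>d\<in>int ` {..<?h}. tri n d) + (\<Sum>d\<in>(\<lambda>i. int i - int ?h) ` {..<?h}. tri n d)"
      unfolding J by (rule sum.union_disjoint) auto
    also have "(\<Sum>d\<in>int ` {..<?h}. tri n d) = (\<Sum>i<?h. 1 - real i / real ?h)"
    proof (subst sum.reindex)
      show "inj_on int {..<?h}" by (rule inj_onI) simp
      show "sum (tri n \<circ> int) {..<?h} = (\<Sum>i<?h. 1 - real i / real ?h)"
        by (rule sum.cong) (auto simp: tri_def)
    qed
    also have "(\<Sum>d\<in>(\<lambda>i. int i - int ?h) ` {..<?h}. tri n d) = (\<Sum>i<?h. real i / real ?h)"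
    proof (subst sum.reindex)
      show "inj_on (\<lambda>i. int i - int ?h) {..<?h}" by (rule inj_onI) simp
      show "sum (tri n \<circ> (\<lambda>i. int i - int ?h)) {..<?h} = (\<Sum>i<?h. real i / real ?h)"
      proof (rule sum.cong[OF refl])
        fix i assume i: "i \<in> {..<?h}"
        have "\<bar>real_of_int (int i - int ?h)\<bar> = real ?h - real i" using i by simp
        then show "(tri n \<circ> (\<lambda>i. int i - int ?h)) i = real i / real ?h"
          by (simp add: tri_def diff_divide_distrib)
      qed
    qed
    finally show ?thesis by (simp add: sum.distrib[symmetric])
  qed
  have z: "tri n d = 0" if "d \<notin> ?J" for d
  proof -
    have "int ?h \<le> \<bar>d\<bar>" using that by auto
    then have "real_of_int (int ?h) \<le> real_of_int \<bar>d\<bar>" by (simp only: of_int_le_iff)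
    then show ?thesis by (simp add: tri_def divide_simps)
  qed
  have IJ: "(\<Sum>d\<in>I. tri n d) = (\<Sum>d\<in>I \<inter> ?J. tri n d)"
    by (rule sum.mono_neutral_right[OF assms]) (use z in blast)+
  also have "\<dots> \<le> (\<Sum>d\<in>?J. tri n d)" by (rule sum_mono2) (auto simp: tri_def)
  finally show "(\<Sum>d\<in>I. tri n d) \<le> real ?h" unfolding J .
  assume "?J \<subseteq> I"
  then have "I \<inter> ?J = ?J" by blast
  then show "(\<Sum>d\<in>I. tri n d) = real ?h" using IJ J by simp
qed

text \<open>A row \<open>s\<close> at distance at least \<open>h n\<close> from both ends sees the
  whole triangle and sums to \<open>h n\<close>. At most \<open>2 * h n\<close> of the
  \<open>L * h n\<close> rows are closer to an end, which produces the factor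
  \<open>1 - 2 / L\<close>.\<close>

lemma wt_bounds:
  assumes L: "0 < L" shows "(1 - 2 / real L) / real L \<le> wt n L" and "wt n L \<le> 1 / real L"
proof -
  let ?h = "h n" and ?Q = "L * h n"
  define row where "row s = (\<Sum>s'<?Q. tri n (int s - int s'))" for s
  have row: "row s = (\<Sum>d\<in>(\<lambda>s'. int s - int s') ` {..<?Q}. tri n d)" for s
    unfolding row_def by (subst sum.reindex) (auto intro: inj_onI)
  have le: "row s \<le> real ?h" for s unfolding row by (rule sum_tri(1)) simp
  have full: "row s = real ?h" if s: "?h \<le> s" "s < ?Q - ?h" for s
  proof -
    have "{- int ?h..<int ?h} \<subseteq> (\<lambda>s'. int s - int s') ` {..<?Q}"
    proof
      fix d assume "d \<in> {- int ?h..<int ?h}"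
      then show "d \<in> (\<lambda>s'. int s - int s') ` {..<?Q}"
        using s by (intro image_eqI[of _ _ "nat (int s - d)"]) auto
    qed
    then show ?thesis unfolding row by (intro sum_tri(2)) simp
  qed
  have r0: "0 \<le> row s" for s unfolding row_def by (intro sum_nonneg) (simp add: tri_def)
  have w: "wt n L = (\<Sum>s<?Q. row s) / (real ?Q)\<^sup>2" by (simp only: wt_def row_def)
  have l: "0 < real L" and hh: "0 < real ?h" using L by simp_all
  have Q: "real ?Q = real L * real ?h" by simp
  have "(\<Sum>s<?Q. row s) \<le> (\<Sum>s<?Q. real ?h)" by (rule sum_mono) (rule le)
  then have "wt n L \<le> real ?Q * real ?h / (real ?Q)\<^sup>2" unfolding w by (intro divide_right_mono) simp_all
  also have "\<dots> = 1 / real L" using l hh unfolding Q by (simp add: power2_eq_square)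
  finally show "wt n L \<le> 1 / real L" .
  have "?Q \<le> card {?h..<?Q - ?h} + 2 * ?h" unfolding card_atLeastLessThan by linarith
  then have "real ?Q \<le> real (card {?h..<?Q - ?h} + 2 * ?h)" by (simp only: of_nat_le_iff)
  then have "real ?Q - 2 * real ?h \<le> real (card {?h..<?Q - ?h})" by linarith
  then have "(real ?Q - 2 * real ?h) * real ?h \<le> real (card {?h..<?Q - ?h}) * real ?h"
    by (rule mult_right_mono) simp
  also have "\<dots> = (\<Sum>s\<in>{?h..<?Q - ?h}. row s)" using full by simp
  also have "\<dots> \<le> (\<Sum>s<?Q. row s)" by (rule sum_mono2) (auto simp: r0)
  finally have "(real ?Q - 2 * real ?h) * real ?h / (real ?Q)\<^sup>2 \<le> wt n L" unfolding w by (rule divide_right_mono) simp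
  moreover have "(real ?Q - 2 * real ?h) * real ?h / (real ?Q)\<^sup>2 = (1 - 2 / real L) / real L"
    using l hh unfolding Q by (simp add: power2_eq_square field_simps)
  ultimately show "(1 - 2 / real L) / real L \<le> wt n L" by simp
qed

lemma coef_parseval: "(\<Sum>k<h n. (norm (coef (levelf n F) n k))\<^sup>2) = (U.nrm (levelf n F))\<^sup>2"
proof -
  let ?h = "h n"
  have orth: "(\<Sum>k<?h. \<omega> n k ^ b * cnj (\<omega> n k ^ a)) = (if a = b then of_nat ?h else 0)" if ab: "a < ?h" "b < ?h" for a b
  proof -
    have "(\<Sum>k<?h. \<omega> n k ^ b * cnj (\<omega> n k ^ a)) = (\<Sum>k<?h. cis (2 * pi * real k * of_int (int b - int a) / real ?h))"
      unfolding Complex.DeMoivre cis_cnj cis_mult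
      by (intro sum.cong refl arg_cong[of _ _ cis]) (simp add: field_simps)
    also have "\<dots> = (if int ?h dvd int b - int a then of_nat ?h else 0)" by (rule sum_roots_unity[OF h_pos])
    also have "int ?h dvd int b - int a \<longleftrightarrow> a = b"
    proof
      assume "int ?h dvd int b - int a"
      then have "int b mod int ?h = int a mod int ?h" by (simp add: mod_eq_dvd_iff)
      then show "a = b" using ab by simp
    qed simp
    finally show ?thesis .
  qed
  have "complex_of_real (\<Sum>k<?h. (norm (coef (levelf n F) n k))\<^sup>2) =
    (\<Sum>k<?h. (\<Sum>a<?h. \<Sum>b<?h. F a * cnj (F b) * (\<omega> n k ^ b * cnj (\<omega> n k ^ a))) / (of_nat ?h)\<^sup>2)"
    unfolding of_real_sum proof (intro sum.cong refl)
    fix k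
    have "complex_of_real ((norm (coef (levelf n F) n k))\<^sup>2) =
      (\<Sum>a<?h. F a * cnj (\<omega> n k ^ a)) * (\<Sum>b<?h. cnj (F b) * \<omega> n k ^ b) / (of_nat ?h)\<^sup>2"
      unfolding coef_levelf complex_norm_square by (simp add: power2_eq_square)
    also have "(\<Sum>a<?h. F a * cnj (\<omega> n k ^ a)) * (\<Sum>b<?h. cnj (F b) * \<omega> n k ^ b) =
      (\<Sum>a<?h. \<Sum>b<?h. F a * cnj (F b) * (\<omega> n k ^ b * cnj (\<omega> n k ^ a)))"
      unfolding sum_product by (intro sum.cong refl) (simp only: ac_simps)
    finally show "complex_of_real ((norm (coef (levelf n F) n k))\<^sup>2) =
      (\<Sum>a<?h. \<Sum>b<?h. F a * cnj (F b) * (\<omega> n k ^ b * cnj (\<omega> n k ^ a))) / (of_nat ?h)\<^sup>2" .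
  qed
  also have "\<dots> = (\<Sum>k<?h. \<Sum>a<?h. \<Sum>b<?h. F a * cnj (F b) * (\<omega> n k ^ b * cnj (\<omega> n k ^ a))) / (of_nat ?h)\<^sup>2"
    by (rule sum_divide_distrib[symmetric])
  also have "(\<Sum>k<?h. \<Sum>a<?h. \<Sum>b<?h. F a * cnj (F b) * (\<omega> n k ^ b * cnj (\<omega> n k ^ a))) =
     (\<Sum>a<?h. \<Sum>k<?h. \<Sum>b<?h. F a * cnj (F b) * (\<omega> n k ^ b * cnj (\<omega> n k ^ a)))" by (rule sum.swap)
  also have "\<dots> = (\<Sum>a<?h. \<Sum>b<?h. \<Sum>k<?h. F a * cnj (F b) * (\<omega> n k ^ b * cnj (\<omega> n k ^ a)))"
    by (rule sum.cong[OF refl], rule sum.swap)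
  also have "\<dots> = (\<Sum>a<?h. \<Sum>b<?h. if a = b then F a * cnj (F b) * of_nat ?h else 0)"
  proof (intro sum.cong refl)
    fix a b assume "a \<in> {..<?h}" "b \<in> {..<?h}"
    then show "(\<Sum>k<?h. F a * cnj (F b) * (\<omega> n k ^ b * cnj (\<omega> n k ^ a))) = (if a = b then F a * cnj (F b) * of_nat ?h else 0)"
      using orth[of a b] by (simp only: sum_distrib_left[symmetric] lessThan_iff) simp
  qed
  also have "\<dots> = (\<Sum>a<?h. F a * cnj (F a)) * of_nat ?h" by (simp add: sum_distrib_right)
  also have "\<dots> / (of_nat ?h)\<^sup>2 = U.inn (levelf n F) (levelf n F)"
    unfolding inner_levelf0 by (simp add: power2_eq_square)
  also have "\<dots> = complex_of_real ((U.nrm (levelf n F))\<^sup>2)" by (rule inner_self)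
  finally show ?thesis by (simp only: of_real_eq_iff)
qed

abbreviation form_dev where
  "form_dev n L k f \<equiv> norm (U.bform (L * h n) (\<omega> n k) f (\<psi> n k) - coef f n k * of_real (wt n L))"
abbreviation norm_dev where
  "norm_dev n L k \<equiv> \<bar>(U.bnorm (L * h n) (\<omega> n k) (\<psi> n k))\<^sup>2 - wt n L\<bar>"

definition char_err :: "nat \<Rightarrow> nat \<Rightarrow> real" where
  "char_err n L = (hR n)\<^sup>2 * (disc n + 2 * real L / qR n)"

text \<open>The twist of the average cancels the phase that the character contributes to each
  correlation. All pairs \<open>s\<close>, \<open>s'\<close> thus carry the same coefficient,
  weighted by \<open>tri\<close>, and these weights average to \<open>wt\<close>.\<close>

lemma bform_char:
  assumes E: "equidistributed n" and L: "0 < L" "L \<le> q n - 1"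
    and f: "f \<in> U.L2" "\<And>x. x \<in> X \<Longrightarrow> f x = levelf n F x"
    and F: "\<And>u. u < h n \<Longrightarrow> norm (F u) \<le> CF"
    and z: "(\<Sum>a<h n. F a) = 0 \<or> (\<Sum>a<h n. \<omega> n k ^ a) = 0"
  shows "form_dev n L k f \<le> CF * char_err n L"
proof -
  let ?Q = "L * h n" and ?\<omega> = "\<omega> n k"
  have Q0: "0 < ?Q" using L by simp
  have CF: "0 \<le> CF" by (rule bound_nonneg[OF F])
  define c where "c = coef (levelf n F) n k"
  have cf: "coef f n k = c" unfolding c_def coef_def by (rule inner_cong_X[OF f(2) refl])
  have \<psi>: "\<psi> n k \<in> U.L2" unfolding \<psi>_def by (rule levelf_L2)
  have fm: "f \<in> borel_measurable \<mu>" using f(1) by (simp add: L2_space_def)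
  have \<psi>m: "\<psi> n k \<in> borel_measurable \<mu>" unfolding \<psi>_def by (rule levelf_measurable)
  have corr: "U.corr t f (\<psi> n k) = U.corr t (levelf n F) (\<psi> n k)" for t
    by (rule corr_cong_X[OF fm levelf_measurable \<psi>m \<psi>m f(2) refl])
  have summand: "norm (cnj ?\<omega> ^ s * ?\<omega> ^ s' / (of_nat ?Q)\<^sup>2 * U.corr (int s - int s') f (\<psi> n k)
      - of_real (tri n (int s - int s')) * c / (of_nat ?Q)\<^sup>2) \<le> CF * char_err n L / (real ?Q)\<^sup>2"
    if s: "s < ?Q" "s' < ?Q" for s s'
  proof -
    let ?t = "int s - int s'"
    have t: "nat \<bar>?t\<bar> < ?Q" using s by auto
    have "?Q \<le> (q n - 1) * h n" using L by (intro mult_right_mono) auto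
    then have t': "nat \<bar>?t\<bar> < (q n - 1) * h n" using t by linarith
    define A where "A = U.corr (?t) (levelf n F) (\<psi> n k)"
    have A: "norm (A - of_real (tri n ?t) * (?\<omega> powi ?t * c)) \<le> CF * char_err n L"
    proof -
      have "norm (A - of_real (tri n ?t) * (?\<omega> powi ?t * c)) \<le> CF * ((hR n)\<^sup>2 * (disc n + 2 * real_of_int \<bar>?t\<bar> / real (h (Suc n))))"
        unfolding A_def c_def by (rule corr_char[OF E t' F z])
      also have "\<dots> \<le> CF * char_err n L" unfolding char_err_def
      proof (intro mult_left_mono add_left_mono CF zero_le_power2)
        have "real_of_int \<bar>?t\<bar> \<le> real ?Q" using t by linarith
        then have "2 * real_of_int \<bar>?t\<bar> / real (h (Suc n)) \<le> 2 * real ?Q / real (h (Suc n))" by (intro divide_right_mono) auto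
        also have "\<dots> = 2 * real L / qR n" by simp
        finally show "2 * real_of_int \<bar>?t\<bar> / real (h (Suc n)) \<le> 2 * real L / qR n" .
      qed
      finally show ?thesis .
    qed
    have w: "cnj ?\<omega> ^ s * ?\<omega> ^ s' * ?\<omega> powi ?t = 1"
    proof -
      have n0: "?\<omega> \<noteq> 0" by simp
      have a: "?\<omega> powi ?t * ?\<omega> ^ s' = ?\<omega> ^ s"
        using power_int_add[of ?\<omega> ?t "int s'"] n0 by (simp only: power_int_of_nat) simp
      have "cnj ?\<omega> ^ s * ?\<omega> ^ s' * ?\<omega> powi ?t = (?\<omega> powi ?t * ?\<omega> ^ s') * cnj (?\<omega> ^ s)"
        unfolding complex_cnj_power by (simp only: ac_simps)
      then show ?thesis unfolding a by (simp only: \<omega>_cnj)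
    qed
    have nw: "norm (cnj ?\<omega> ^ s * ?\<omega> ^ s') = 1" by (simp add: norm_mult norm_power)
    have "cnj ?\<omega> ^ s * ?\<omega> ^ s' / (of_nat ?Q)\<^sup>2 * A - of_real (tri n ?t) * c / (of_nat ?Q)\<^sup>2
      = (cnj ?\<omega> ^ s * ?\<omega> ^ s') * (A - of_real (tri n ?t) * (?\<omega> powi ?t * c)) / (of_nat ?Q)\<^sup>2"
    proof -
      have "(cnj ?\<omega> ^ s * ?\<omega> ^ s') * (of_real (tri n ?t) * (?\<omega> powi ?t * c)) = (cnj ?\<omega> ^ s * ?\<omega> ^ s' * ?\<omega> powi ?t) * (of_real (tri n ?t) * c)"
        by (simp only: ac_simps)
      then have "(cnj ?\<omega> ^ s * ?\<omega> ^ s') * (A - of_real (tri n ?t) * (?\<omega> powi ?t * c)) = cnj ?\<omega> ^ s * ?\<omega> ^ s' * A - of_real (tri n ?t) * c"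
        unfolding right_diff_distrib w by (simp only: mult_1)
      then show ?thesis by (simp only: diff_divide_distrib times_divide_eq_left)
    qed
    then have "norm (cnj ?\<omega> ^ s * ?\<omega> ^ s' / (of_nat ?Q)\<^sup>2 * A - of_real (tri n ?t) * c / (of_nat ?Q)\<^sup>2)
      = norm (A - of_real (tri n ?t) * (?\<omega> powi ?t * c)) / (real ?Q)\<^sup>2"
      by (simp only: norm_divide norm_mult[of "cnj ?\<omega> ^ s * ?\<omega> ^ s'"] nw norm_power norm_of_nat mult_1)
    also have "\<dots> \<le> CF * char_err n L / (real ?Q)\<^sup>2" by (rule divide_right_mono[OF A]) simp
    finally show ?thesis unfolding corr A_def .
  qed
  have cw: "c * of_real (wt n L) = (\<Sum>s<?Q. \<Sum>s'<?Q. of_real (tri n (int s - int s')) * c / (of_nat ?Q)\<^sup>2)"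
    unfolding wt_def of_real_divide of_real_sum of_real_power of_real_of_nat_eq sum_divide_distrib[symmetric] sum_distrib_right[symmetric]
    by (simp only: times_divide_eq_right mult.commute)
  have "norm (U.bform ?Q ?\<omega> f (\<psi> n k) - c * of_real (wt n L)) \<le> (\<Sum>s<?Q. \<Sum>s'<?Q. CF * char_err n L / (real ?Q)\<^sup>2)"
    unfolding U.bform_eq[OF f(1) \<psi>] cw sum_subtractf[symmetric] by (intro sum_norm_le summand) simp_all
  also have "\<dots> = CF * char_err n L"
  proof -
    have "real ?Q * (real ?Q * (x / (real ?Q)\<^sup>2)) = x" for x using Q0 by (simp add: power2_eq_square)
    then show ?thesis by (simp only: sum_constant card_lessThan)
  qed
  finally show ?thesis unfolding cf .
qed

lemma bnorm_char:
  assumes E: "equidistributed n" and L: "0 < L" "L \<le> q n - 1" and k: "0 < k" "k < h n"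
  shows "norm_dev n L k \<le> char_err n L"
proof -
  have c1: "coef (\<psi> n k) n k = 1" unfolding \<psi>_def coef_levelf \<omega>_cnj by simp
  have "norm (U.inn (U.bop (L * h n) (\<omega> n k) (\<psi> n k)) (U.bop (L * h n) (\<omega> n k) (\<psi> n k)) - coef (\<psi> n k) n k * of_real (wt n L)) \<le> 1 * char_err n L"
  proof (rule bform_char[OF E L])
    show "\<psi> n k \<in> U.L2" unfolding \<psi>_def by (rule levelf_L2)
    show "\<psi> n k x = levelf n (\<lambda>u. \<omega> n k ^ u) x" for x by (simp only: \<psi>_def)
    show "norm (\<omega> n k ^ u) \<le> 1" for u by (simp only: norm_\<omega> order_refl)
    show "(\<Sum>a<h n. \<omega> n k ^ a) = 0 \<or> (\<Sum>a<h n. \<omega> n k ^ a) = 0" using sum_\<omega>[OF k] by blast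
  qed
  then show ?thesis unfolding c1 inner_self mult_1 of_real_diff[symmetric] norm_of_real .
qed

end

section \<open>Verification of the rank one hypotheses and conclusions\<close>

context equi_iceberg begin

lemma h_at_top: "filterlim h at_top sequentially"
  by (rule filterlim_at_top_mono[OF filterlim_ident]) (intro always_eventually allI less_imp_le h_ge_n)

lemma h_le_q: "h n \<le> q n"
proof -
  have "h n < 2 ^ h n" by (rule less_exp)
  also have "2 ^ h n \<le> (3::nat) ^ h n" by (rule power_mono) simp_all
  finally have "h n < 3 ^ h n" .
  then show ?thesis using growth[of n] by linarith
qed

lemma q_at_top: "filterlim q at_top sequentially"
  by (rule filterlim_at_top_mono[OF h_at_top]) (intro always_eventually allI h_le_q)

text \<open>The additional factor \<open>h n\<close> pays for summing the errors over all
  \<open>h n\<close> characters. Four logarithms against \<open>sqrt (q n)\<close> still leave a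
  negative power of \<open>q n\<close>.\<close>

lemma h_disc_lim: "(\<lambda>n. hR n * ((hR n)\<^sup>2 * disc n)) \<longlonglongrightarrow> 0"
proof (rule Lim_null_comparison)
  let ?K = "8 * (256 / (1/4) ^ 4) :: real"
  have "norm (hR n * ((hR n)\<^sup>2 * disc n)) \<le> ?K * qR n powr (- (1/4))" for n
  proof -
    let ?l = "ln (qR n)" and ?Q = "qR n"
    have Q: "1 \<le> ?Q" using q_ge[of n] by linarith
    have l: "0 \<le> ?l" using one_le_ln[of n] by linarith
    have "hR n * ((hR n)\<^sup>2 * disc n) \<le> ?l * (8 * ?l ^ 3 / sqrt ?Q)"
      by (rule mult_mono[OF h_le_ln disc_le l]) (intro mult_nonneg_nonneg zero_le_power2 disc_nonneg)
    also have "\<dots> = 8 * ?l ^ 4 / sqrt ?Q" by (simp add: power_numeral_reduce)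
    also have "\<dots> \<le> 8 * (256 / (1/4) ^ 4 * ?Q powr (1/4)) / sqrt ?Q"
      by (intro divide_right_mono mult_left_mono ln4_le Q) simp_all
    also have "\<dots> = ?K * (?Q powr (1/4) / ?Q powr (1/2))"
    proof -
      have "sqrt ?Q = ?Q powr (1/2)" by (rule powr_half_sqrt[symmetric]) simp
      then show ?thesis by (simp only: times_divide_eq_right mult.assoc)
    qed
    also have "?Q powr (1/4) / ?Q powr (1/2) = ?Q powr (1/4 - 1/2)" by (rule powr_diff[symmetric])
    also have "(1/4 - 1/2 :: real) = - (1/4)" by simp
    finally have "hR n * ((hR n)\<^sup>2 * disc n) \<le> ?K * ?Q powr (- (1/4))" .
    moreover have "0 \<le> hR n * ((hR n)\<^sup>2 * disc n)" by (intro mult_nonneg_nonneg zero_le_power2 disc_nonneg) simp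
    ultimately show ?thesis by (simp only: real_norm_def abs_of_nonneg)
  qed
  then show "\<forall>\<^sub>F n in sequentially. norm (hR n * ((hR n)\<^sup>2 * disc n)) \<le> ?K * qR n powr (- (1/4))"
    by (intro always_eventually allI)
  have "filterlim (\<lambda>n. qR n) at_top sequentially"
    by (rule filterlim_compose[OF filterlim_real_sequentially q_at_top])
  then have "(\<lambda>n. qR n powr (- (1/4))) \<longlonglongrightarrow> 0" by (intro tendsto_neg_powr) simp_all
  then have "(\<lambda>n. ?K * qR n powr (- (1/4))) \<longlonglongrightarrow> ?K * 0" by (intro tendsto_mult tendsto_const)
  then show "(\<lambda>n. ?K * qR n powr (- (1/4))) \<longlonglongrightarrow> 0" by (simp only: mult_zero_right)
qed

lemma h_char_err_lim: "(\<lambda>n. c * (hR n * char_err n L)) \<longlonglongrightarrow> 0"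
proof (rule Lim_null_comparison)
  let ?g = "\<lambda>n. \<bar>c\<bar> * (1 + 2 * real L) * (hR n * ((hR n)\<^sup>2 * disc n))"
  have "norm (c * (hR n * char_err n L)) \<le> ?g n" for n
  proof -
    have q0: "0 \<le> 2 * real L / qR n" by simp
    have "2 * real L * (1 / qR n) \<le> 2 * real L * disc n" by (rule mult_left_mono[OF inv_q_le_disc]) simp
    then have a: "disc n + 2 * real L / qR n \<le> (1 + 2 * real L) * disc n" by (simp add: distrib_right)
    have "hR n * char_err n L \<le> hR n * ((hR n)\<^sup>2 * ((1 + 2 * real L) * disc n))"
      unfolding char_err_def by (rule mult_left_mono[OF mult_left_mono[OF a]]) simp_all
    moreover have "0 \<le> hR n * char_err n L"
      unfolding char_err_def by (intro mult_nonneg_nonneg add_nonneg_nonneg zero_le_power2 disc_nonneg q0) simp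
    ultimately have "\<bar>c\<bar> * \<bar>hR n * char_err n L\<bar> \<le> \<bar>c\<bar> * (hR n * ((hR n)\<^sup>2 * ((1 + 2 * real L) * disc n)))"
      by (intro mult_left_mono) simp_all
    then show ?thesis unfolding real_norm_def abs_mult[of c] by (simp only: ac_simps)
  qed
  then show "\<forall>\<^sub>F n in sequentially. norm (c * (hR n * char_err n L)) \<le> ?g n" by (intro always_eventually allI)
  have "?g \<longlonglongrightarrow> \<bar>c\<bar> * (1 + 2 * real L) * 0" by (intro tendsto_mult tendsto_const h_disc_lim)
  then show "?g \<longlonglongrightarrow> 0" by (simp only: mult_zero_right)
qed

lemma local_rank_quarter: "1 / 4 \<le> local_rank \<mu> (iceberg_map q \<alpha>)"
proof (rule local_rank_ge, rule Lim_null_comparison[OF _ h_disc_lim], intro always_eventually allI)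
  fix n
  have "(hR n)\<^sup>2 * (1 / qR n) \<le> (hR n)\<^sup>2 * disc n" by (rule mult_left_mono[OF inv_q_le_disc]) simp
  also have "\<dots> \<le> hR n * ((hR n)\<^sup>2 * disc n)"
  proof -
    have "1 \<le> hR n" using h_pos[of n] by linarith
    moreover have "0 \<le> (hR n)\<^sup>2 * disc n" by (intro mult_nonneg_nonneg zero_le_power2 disc_nonneg)
    ultimately have "1 * ((hR n)\<^sup>2 * disc n) \<le> hR n * ((hR n)\<^sup>2 * disc n)" by (rule mult_right_mono)
    then show ?thesis by (simp only: mult_1)
  qed
  finally show "norm ((hR n)\<^sup>2 / qR n) \<le> hR n * ((hR n)\<^sup>2 * disc n)" by simp
qed

lemma LF0_mixing:
  assumes "f \<in> LF0" "g \<in> LF0" shows "(\<lambda>t::nat. U.corr (int t) f g) \<longlonglongrightarrow> 0"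
proof -
  obtain C b where "0 \<le> C" "1 \<le> b" and dec: "\<forall>\<epsilon>>0. \<epsilon> \<le> 1/2 \<longrightarrow> (\<forall>t\<ge>b.
      norm (U.corr (int t) f g) \<le> C * decay_const \<epsilon> * real t powr (- 1/2 + \<epsilon>))"
    using LF0_decay[OF assms] by blast
  note b = dec[rule_format]
  show ?thesis
  proof (rule Lim_null_comparison)
    show "\<forall>\<^sub>F t in sequentially. norm (U.corr (int t) f g) \<le> C * decay_const (1/4) * real t powr (- 1/2 + 1/4)"
      unfolding eventually_sequentially using b[of "1/4"] by (intro exI[of _ b] allI impI) simp
    have "(\<lambda>t. real t powr (- 1/2 + 1/4)) \<longlonglongrightarrow> 0"
      by (rule tendsto_neg_powr[OF _ filterlim_real_sequentially]) simp
    then have "(\<lambda>t. C * decay_const (1/4) * real t powr (- 1/2 + 1/4)) \<longlonglongrightarrow> C * decay_const (1/4) * 0"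
      by (rule tendsto_mult[OF tendsto_const])
    then show "(\<lambda>t. C * decay_const (1/4) * real t powr (- 1/2 + 1/4)) \<longlonglongrightarrow> 0" by (simp only: mult_zero_right)
  qed
qed

lemma coef_bound:
  assumes "\<And>u. u < h n \<Longrightarrow> norm (F u) \<le> C" shows "norm (coef (levelf n F) n k) \<le> C"
proof -
  have "norm (\<Sum>a<h n. F a * cnj (\<omega> n k ^ a)) \<le> (\<Sum>a<h n. C)"
    by (rule sum_norm_le) (use assms in \<open>simp add: norm_mult norm_power\<close>)
  then show ?thesis unfolding coef_levelf norm_divide norm_of_nat by (simp add: divide_le_eq mult.commute)
qed

lemma coef_cong: "(\<And>x. x \<in> X \<Longrightarrow> f x = g x) \<Longrightarrow> coef f n k = coef g n k"
  unfolding coef_def by (rule inner_cong_X[OF _ refl])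

lemma eventually_L: "\<forall>\<^sub>F n in sequentially. equidistributed n \<and> L \<le> q n - 1 \<and> m \<le> n"
proof -
  have "\<forall>\<^sub>F n in sequentially. Suc L \<le> q n" using q_at_top unfolding filterlim_at_top by blast
  moreover have "\<forall>\<^sub>F n in sequentially. m \<le> n" by (rule eventually_ge_at_top)
  ultimately show ?thesis using equi by eventually_elim auto
qed

lemma LF0_level_sums:
  assumes "f \<in> LF0"
  shows "\<exists>m C. (\<forall>n\<ge>m. (\<Sum>k<h n. (norm (coef f n k))\<^sup>2) = (U.nrm f)\<^sup>2) \<and>
    (\<forall>n\<ge>m. \<forall>L>0. equidistributed n \<longrightarrow> L \<le> q n - 1 \<longrightarrow>
      (\<Sum>k<h n. norm (coef f n k) * form_dev n L k f)
        \<le> C\<^sup>2 * (hR n * char_err n L) \<and>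
      (\<Sum>k<h n. (norm (coef f n k))\<^sup>2 * norm_dev n L k)
        \<le> C\<^sup>2 * (hR n * char_err n L))"
proof -
  obtain m C where F: "\<forall>n\<ge>m. \<exists>F. (\<forall>x\<in>X. f x = levelf n F x) \<and> (\<Sum>a<h n. F a) = 0 \<and> (\<forall>u<h n. norm (F u) \<le> C)"
    using LF0_at_level[OF assms] by blast
  have fL: "f \<in> U.L2" using assms LF0_zero_mean U.L2_zero_mean_L2 by blast
  have fm: "f \<in> borel_measurable \<mu>" using fL by (simp add: L2_space_def)
  have 1: "(\<Sum>k<h n. (norm (coef f n k))\<^sup>2) = (U.nrm f)\<^sup>2" if n: "m \<le> n" for n
  proof -
    obtain F' where F': "\<forall>x\<in>X. f x = levelf n F' x" using F[rule_format, OF n] by blast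
    have c: "coef f n k = coef (levelf n F') n k" for k by (rule coef_cong) (use F' in blast)
    have "U.nrm f = U.nrm (levelf n F')"
      by (rule L2_norm_cong_AE[OF fm levelf_measurable], rule AE_I2) (use F' space_\<mu> in blast)
    then show ?thesis unfolding c using coef_parseval[of n F'] by (simp only:)
  qed
  have 23: "(\<Sum>k<h n. norm (coef f n k) * form_dev n L k f)
        \<le> C\<^sup>2 * (hR n * char_err n L) \<and>
      (\<Sum>k<h n. (norm (coef f n k))\<^sup>2 * norm_dev n L k)
        \<le> C\<^sup>2 * (hR n * char_err n L)"
    if n: "m \<le> n" and E: "equidistributed n" and L: "0 < L" "L \<le> q n - 1" for n L
  proof -
    obtain F' where F': "\<forall>x\<in>X. f x = levelf n F' x" "(\<Sum>a<h n. F' a) = 0" "\<forall>u<h n. norm (F' u) \<le> C"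
      using F[rule_format, OF n] by blast
    have fe: "f x = levelf n F' x" if "x \<in> X" for x using F'(1) that by blast
    have Fb: "norm (F' u) \<le> C" if "u < h n" for u using F'(3) that by blast
    have c: "coef f n k = coef (levelf n F') n k" for k by (rule coef_cong[OF fe])
    have cb: "norm (coef f n k) \<le> C" for k unfolding c by (rule coef_bound[OF Fb])
    have C: "0 \<le> C" by (rule bound_nonneg[OF Fb])
    have err: "0 \<le> char_err n L"
      unfolding char_err_def by (intro mult_nonneg_nonneg zero_le_power2 add_nonneg_nonneg disc_nonneg divide_nonneg_nonneg) simp_all
    have s: "(\<Sum>k<h n. C\<^sup>2 * char_err n L) = C\<^sup>2 * (hR n * char_err n L)" by simp
    have t1: "norm (coef f n k) * form_dev n L k f \<le> C\<^sup>2 * char_err n L" for k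
    proof -
      have "form_dev n L k f \<le> C * char_err n L"
      proof (rule bform_char[OF E L fL fe])
        show "norm (F' u) \<le> C" if "u < h n" for u by (rule Fb[OF that])
      qed (use F'(2) in blast)+
      then have "norm (coef f n k) * form_dev n L k f \<le> C * (C * char_err n L)"
        by (rule mult_mono[OF cb _ C norm_ge_zero])
      then show ?thesis by (simp only: power2_eq_square mult.assoc)
    qed
    have t2: "(norm (coef f n k))\<^sup>2 * norm_dev n L k \<le> C\<^sup>2 * char_err n L" if k: "k < h n" for k
    proof (cases "k = 0")
      \<comment> \<open>The trivial character has nonzero mean and is outside the scope of
        \<open>bnorm_char\<close>, but the coefficient of a zero-mean function vanishes
        there.\<close>
      case True
      have "coef f n k = 0" unfolding c coef_levelf using True F'(2) by simp
      then show ?thesis using err by simp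
    next
      case False
      then have k0: "0 < k" by simp
      show ?thesis by (rule mult_mono[OF power_mono[OF cb norm_ge_zero] bnorm_char[OF E L k0 k] zero_le_power2 abs_ge_zero])
    qed
    show ?thesis unfolding s[symmetric] by (intro conjI sum_mono) (rule t1, rule t2, simp only: lessThan_iff)
  qed
  show ?thesis by (rule exI, rule exI, rule conjI, intro allI impI, erule 1, intro allI impI) (rule 23)
qed

sublocale R: rank_one_levels \<mu> S LF0 h \<psi> coef wt
proof (unfold_locales, goal_cases)
  case 1 show ?case by (rule LF0_zero_mean)
next
  case 2 show ?case by (rule LF0_dense)
next
  case (3 F G) then show ?case by (rule LF0_mixing)
next
  case 4 show ?case by (rule h_at_top)
next
  case (5 n k) show ?case unfolding \<psi>_def by (rule levelf_L2)
next
  case (6 F)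
  have "\<exists>m. \<forall>n\<ge>m. (\<Sum>k<h n. (norm (coef F n k))\<^sup>2) = (U.nrm F)\<^sup>2" using LF0_level_sums[OF 6] by blast
  then show ?case unfolding eventually_sequentially .
next
  case (7 L) then show ?case by (intro always_eventually allI conjI wt_bounds)
next
  case (8 F L)
  obtain m C where b: "\<forall>n\<ge>m. \<forall>L>0. equidistributed n \<longrightarrow> L \<le> q n - 1 \<longrightarrow>
      (\<Sum>k<h n. norm (coef F n k) * form_dev n L k F)
        \<le> C\<^sup>2 * (hR n * char_err n L)" using LF0_level_sums[OF 8(1)] by blast
  show ?case
  proof (rule Lim_null_comparison[OF eventually_mono[OF eventually_L[of L m]] h_char_err_lim])
    fix n assume n: "equidistributed n \<and> L \<le> q n - 1 \<and> m \<le> n"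
    have "0 \<le> (\<Sum>k<h n. norm (coef F n k) * form_dev n L k F)"
      by (intro sum_nonneg mult_nonneg_nonneg norm_ge_zero)
    then show "norm (\<Sum>k<h n. norm (coef F n k) * form_dev n L k F)
      \<le> C\<^sup>2 * (hR n * char_err n L)"
      unfolding real_norm_def using b[rule_format, of n L] 8(2) n by (simp only: abs_of_nonneg)
  qed
next
  case (9 F L)
  obtain m C where b: "\<forall>n\<ge>m. \<forall>L>0. equidistributed n \<longrightarrow> L \<le> q n - 1 \<longrightarrow>
      (\<Sum>k<h n. (norm (coef F n k))\<^sup>2 * norm_dev n L k)
        \<le> C\<^sup>2 * (hR n * char_err n L)" using LF0_level_sums[OF 9(1)] by blast
  show ?case
  proof (rule Lim_null_comparison[OF eventually_mono[OF eventually_L[of L m]] h_char_err_lim])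
    fix n assume n: "equidistributed n \<and> L \<le> q n - 1 \<and> m \<le> n"
    have "0 \<le> (\<Sum>k<h n. (norm (coef F n k))\<^sup>2 * norm_dev n L k)"
      by (intro sum_nonneg mult_nonneg_nonneg zero_le_power2 abs_ge_zero)
    then show "norm (\<Sum>k<h n. (norm (coef F n k))\<^sup>2 * norm_dev n L k)
      \<le> C\<^sup>2 * (hR n * char_err n L)"
      unfolding real_norm_def using b[rule_format, of n L] 9(2) n by (simp only: abs_of_nonneg)
  qed
qed

text \<open>Centred indicators of cylinders, which span \<open>LF0\<close> up to equality on the
  space. Reducing \<open>a\<close> modulo \<open>h m\<close> gives every pair of naturals a
  zero-mean function, so the pairs can be enumerated by \<open>prod_decode\<close>.\<close>

definition point_fun :: "nat \<Rightarrow> nat \<Rightarrow> (nat \<Rightarrow> nat) \<Rightarrow> complex" where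
  "point_fun m a = levelf m (\<lambda>u. of_bool (u = a mod h m) - 1 / of_nat (h m))"
definition total_seq :: "nat \<Rightarrow> (nat \<Rightarrow> nat) \<Rightarrow> complex" where
  "total_seq j = point_fun (fst (prod_decode j)) (snd (prod_decode j))"

lemma point_fun_zero_mean: "point_fun m a \<in> U.L2_0"
  unfolding point_fun_def levelf_zero_mean_iff by (simp add: sum_subtractf)

lemma total_seq_dense: "U.L2_0 \<subseteq> U.clo (complex_span (range total_seq))"
proof -
  have L: "range total_seq \<subseteq> U.L2" using point_fun_zero_mean U.L2_zero_mean_L2 by (auto simp: total_seq_def)
  have sL: "complex_span (range total_seq) \<subseteq> U.L2" by (rule L2_subspace_sub[OF complex_span_subspace[OF L]])
  have "LF0 \<subseteq> U.clo (complex_span (range total_seq))"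
  proof
    fix f assume "f \<in> LF0"
    then obtain m F where f: "f = levelf m F" and z: "(\<Sum>a<h m. F a) = 0" unfolding LF0_def by blast
    define g where "g = (\<lambda>x. \<Sum>a<h m. F a * point_fun m a x)"
    have "point_fun m a \<in> range total_seq" for a
      by (rule range_eqI[of _ _ "prod_encode (m, a)"]) (simp add: total_seq_def)
    then have g: "g \<in> complex_span (range total_seq)"
      unfolding g_def by (intro complex_span_sum complex_span_scale complex_span_superset)
    have fg: "f x = g x" if x: "x \<in> X" for x
    proof -
      have "g x = (\<Sum>a<h m. (if x m = a then F a else 0) - F a / of_nat (h m))"
        unfolding g_def point_fun_def levelf_def by (intro sum.cong refl) (simp add: algebra_simps)
      also have "\<dots> = F (x m) - (\<Sum>a<h m. F a) / of_nat (h m)"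
        using X_lt[OF x, of m] by (simp add: sum_subtractf sum_divide_distrib)
      finally show ?thesis using z by (simp add: f levelf_def)
    qed
    show "f \<in> U.clo (complex_span (range total_seq))"
    proof (rule L2_closure_AE[OF sL])
      show "g \<in> U.clo (complex_span (range total_seq))" using g L2_closure_superset[OF sL] by blast
      show "f \<in> borel_measurable \<mu>" unfolding f by (rule levelf_measurable)
      show "AE x in \<mu>. f x = g x" by (rule AE_I2) (simp only: space_\<mu> fg)
    qed
  qed
  then show ?thesis using LF0_dense L2_closure_minimal[OF _ sL] by blast
qed

text \<open>With exponent loss \<open>1/8\<close> each correlation is of order
  \<open>t powr (-3/8)\<close>, so the squared product of two of them is of order
  \<open>t powr (-3/2)\<close> and summable. The decay of a single correlation would not give square
  summability, which is why the convolution appears rather than \<open>\<sigma>\<close> itself.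
  Negative indices follow by conjugation.\<close>

lemma LF0_corr_square_sums:
  assumes f: "f \<in> LF0" and g: "g \<in> LF0"
  shows "\<exists>B. \<forall>K::int set. finite K \<longrightarrow>
    (\<Sum>k\<in>K. (norm (U.corr k f f * U.corr k g g))\<^sup>2) \<le> B"
proof -
  define A where "A k = (norm (U.corr k f f * U.corr k g g))\<^sup>2" for k
  have A0: "0 \<le> A k" for k by (simp add: A_def)
  have fL: "f \<in> U.L2" "g \<in> U.L2" using f g LF0_zero_mean U.L2_zero_mean_L2 by blast+
  have Am: "A (- k) = A k" for k
    unfolding A_def U.corr_minus[OF fL(1) fL(1)] U.corr_minus[OF fL(2) fL(2)] norm_mult complex_mod_cnj by (rule refl)
  obtain C b where C0: "0 \<le> C" "1 \<le> b" and C1: "\<forall>\<epsilon>>0. \<epsilon> \<le> 1/2 \<longrightarrow> (\<forall>t\<ge>b.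
      norm (U.corr (int t) f f) \<le> C * decay_const \<epsilon> * real t powr (- 1/2 + \<epsilon>))"
    using LF0_decay[OF f f] by blast
  note C = C0 C1[rule_format]
  obtain C' b' where C'0: "0 \<le> C'" "1 \<le> b'" and C'1: "\<forall>\<epsilon>>0. \<epsilon> \<le> 1/2 \<longrightarrow> (\<forall>t\<ge>b'.
      norm (U.corr (int t) g g) \<le> C' * decay_const \<epsilon> * real t powr (- 1/2 + \<epsilon>))"
    using LF0_decay[OF g g] by blast
  note C' = C'0 C'1[rule_format]
  define K where "K = decay_const (1/8)"
  have K: "0 \<le> K" by (simp add: K_def decay_const_def)
  have bd: "A (int t) \<le> (C * K * (C' * K))\<^sup>2 * real t powr (- (3/2))" if t: "b + b' \<le> t" for t
  proof -
    let ?p = "real t powr (- 1/2 + 1/8)"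
    have 1: "norm (U.corr (int t) f f) \<le> C * K * ?p" unfolding K_def by (rule C(3)) (use t in simp_all)
    have 2: "norm (U.corr (int t) g g) \<le> C' * K * ?p" unfolding K_def by (rule C'(3)) (use t in simp_all)
    have "A (int t) \<le> ((C * K * ?p) * (C' * K * ?p))\<^sup>2"
      unfolding A_def norm_mult by (intro power_mono mult_mono 1 2 mult_nonneg_nonneg norm_ge_zero C K powr_ge_zero)
    also have "\<dots> = (C * K * (C' * K))\<^sup>2 * (?p * ?p * (?p * ?p))" by (simp only: power2_eq_square ac_simps)
    also have "?p * ?p * (?p * ?p) = real t powr (- (3/2))" by (simp only: powr_add[symmetric]) simp
    finally show ?thesis .
  qed
  have sm: "summable (\<lambda>t. A (int t))"
  proof (rule summable_comparison_test')
    show "summable (\<lambda>t. (C * K * (C' * K))\<^sup>2 * real t powr (- (3/2)))"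
      by (rule summable_mult) (simp add: summable_real_powr_iff)
    show "norm (A (int t)) \<le> (C * K * (C' * K))\<^sup>2 * real t powr (- (3/2))" if "b + b' \<le> t" for t
      using bd[OF that] A0[of "int t"] by (simp only: real_norm_def abs_of_nonneg)
  qed
  have half: "(\<Sum>k\<in>I. A (int (\<nu> k))) \<le> (\<Sum>t. A (int t))" if I: "finite I" "inj_on \<nu> I" for I :: "int set" and \<nu> :: "int \<Rightarrow> nat"
  proof -
    have "(\<Sum>k\<in>I. A (int (\<nu> k))) = (\<Sum>t\<in>\<nu> ` I. A (int t))" by (simp only: sum.reindex[OF I(2)] o_def)
    also have "\<dots> \<le> (\<Sum>t. A (int t))" by (rule sum_le_suminf[OF sm]) (use I A0 in auto)
    finally show ?thesis .
  qed
  show ?thesis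
  proof (intro exI allI impI)
    fix J :: "int set" assume J: "finite J"
    have "(\<Sum>k\<in>J. A k) = (\<Sum>k\<in>(J \<inter> {0..}) \<union> (J \<inter> {..<0}). A k)" by (rule sum.cong) auto
    also have "\<dots> = (\<Sum>k\<in>J \<inter> {0..}. A k) + (\<Sum>k\<in>J \<inter> {..<0}. A k)"
      by (rule sum.union_disjoint) (use J in auto)
    also have "(\<Sum>k\<in>J \<inter> {0..}. A k) = (\<Sum>k\<in>J \<inter> {0..}. A (int (nat k)))" by (intro sum.cong refl) auto
    also have "(\<Sum>k\<in>J \<inter> {..<0}. A k) = (\<Sum>k\<in>J \<inter> {..<0}. A (int (nat (- k))))" by (intro sum.cong refl) (auto simp: Am)
    also have "(\<Sum>k\<in>J \<inter> {0..}. A (int (nat k))) + (\<Sum>k\<in>J \<inter> {..<0}. A (int (nat (- k)))) \<le> (\<Sum>t. A (int t)) + (\<Sum>t. A (int t))"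
      by (intro add_mono half) (use J in \<open>auto simp: inj_on_def\<close>)
    finally show "(\<Sum>k\<in>J. (norm (U.corr k f f * U.corr k g g))\<^sup>2) \<le> (\<Sum>t. A (int t)) + (\<Sum>t. A (int t))"
      by (simp only: A_def)
  qed
qed

text \<open>The cyclic vector is a limit object and need not lie in \<open>LF0\<close>, where decay
  is known. Its approximations from \<open>LF0\<close> are what \<open>convolution_ac\<close> works
  with.\<close>

lemma spectrum:
  "simple_spectrum \<mu> S \<and>
   (\<exists>\<sigma>. maximal_spectral_type \<mu> S \<sigma> \<and> absolutely_continuous circle_lebesgue (circle_convolution \<sigma> \<sigma>))"
proof -
  have "total_seq j \<in> U.L2_0" for j unfolding total_seq_def by (rule point_fun_zero_mean)
  then have "\<exists>e\<in>U.L2_0. U.L2_0 \<subseteq> U.cycZ e" by (rule R.exists_cyclic_zero_mean[OF _ total_seq_dense])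
  then obtain e where e: "e \<in> U.L2_0" "U.L2_0 \<subseteq> U.cycZ e" by blast
  have eL: "e \<in> U.L2" by (rule U.L2_zero_mean_L2[OF e(1)])
  obtain \<sigma> where \<sigma>: "spectral_measure \<mu> S e \<sigma>" using U.herglotz[OF eL] by blast
  have "e \<in> U.clo LF0" using e(1) LF0_dense by blast
  then have ap: "\<exists>f\<in>LF0. U.nrm (\<lambda>x. e x - f x) < \<epsilon>" if "0 < \<epsilon>" for \<epsilon> using that unfolding L2_closure_iff by blast
  have "\<forall>i. \<exists>f. f \<in> LF0 \<and> U.nrm (\<lambda>x. e x - f x) < 1 / real (Suc i)"
  proof
    fix i
    have "0 < 1 / real (Suc i)" by simp
    from ap[OF this] show "\<exists>f. f \<in> LF0 \<and> U.nrm (\<lambda>x. e x - f x) < 1 / real (Suc i)" by blast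
  qed
  from choice[OF this] obtain F where F: "\<forall>i. F i \<in> LF0 \<and> U.nrm (\<lambda>x. e x - F i x) < 1 / real (Suc i)" by blast
  have FL: "F i \<in> LF0" for i using F by blast
  have "absolutely_continuous circle_lebesgue (circle_convolution \<sigma> \<sigma>)"
  proof (rule U.convolution_ac[OF eL \<sigma>])
    show "F i \<in> U.L2" for i using FL[of i] LF0_zero_mean U.L2_zero_mean_L2 by blast
    show "(\<lambda>i. U.nrm (\<lambda>x. e x - F i x)) \<longlonglongrightarrow> 0"
    proof (rule Lim_null_comparison[OF _ LIMSEQ_Suc[OF lim_inverse_n']], intro always_eventually allI)
      fix i
      have "0 \<le> U.nrm (\<lambda>x. e x - F i x)" by (simp add: L2_norm_def)
      then show "norm (U.nrm (\<lambda>x. e x - F i x)) \<le> 1 / real (Suc i)"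
        using F[rule_format, of i] by (simp only: real_norm_def abs_of_nonneg less_imp_le)
    qed
    show "\<exists>B. \<forall>K. finite K \<longrightarrow> (\<Sum>k\<in>K. (norm (U.corr k (F i) (F i) *
        U.corr k (F j) (F j)))\<^sup>2) \<le> B" for i j by (rule LF0_corr_square_sums[OF FL FL])
  qed
  moreover have "maximal_spectral_type \<mu> S \<sigma>" by (rule U.maximal_spectral_type_cyclic[OF e \<sigma>])
  moreover have "simple_spectrum \<mu> S" by (rule R.simple_spectrum_of_cyclic[OF e])
  ultimately show ?thesis by blast
qed

lemma LF0_bigo:
  assumes f: "f \<in> LF0" and e: "0 < \<epsilon>"
  shows "(\<lambda>t::nat. norm (U.corr (int t) f f)) \<in> O(\<lambda>t. real t powr (- 1 / 2 + \<epsilon>))"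
proof -
  obtain C b where C0: "0 \<le> C" "1 \<le> b" and C1: "\<forall>\<epsilon>>0. \<epsilon> \<le> 1/2 \<longrightarrow> (\<forall>t\<ge>b.
      norm (U.corr (int t) f f) \<le> C * decay_const \<epsilon> * real t powr (- 1/2 + \<epsilon>))"
    using LF0_decay[OF f f] by blast
  note C = C0 C1[rule_format]
  \<comment> \<open>The decay estimate is stated for exponent losses up to \<open>1/2\<close>; a
    larger \<open>\<epsilon>\<close> asks for a weaker bound.\<close>
  define \<delta> where "\<delta> = min \<epsilon> (1/2)"
  have d: "0 < \<delta>" "\<delta> \<le> 1/2" "\<delta> \<le> \<epsilon>" using e by (auto simp: \<delta>_def)
  show ?thesis
  proof (rule bigoI)
    show "\<forall>\<^sub>F t in sequentially. norm (norm (U.corr (int t) f f)) \<le> C * decay_const \<delta> * norm (real t powr (- 1 / 2 + \<epsilon>))"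
      unfolding eventually_sequentially proof (intro exI[of _ b] allI impI)
      fix t assume t: "b \<le> t"
      have "norm (U.corr (int t) f f) \<le> C * decay_const \<delta> * real t powr (- 1/2 + \<delta>)" by (rule C(3)[OF d(1,2) t])
      also have "\<dots> \<le> C * decay_const \<delta> * real t powr (- 1 / 2 + \<epsilon>)"
      proof (intro mult_left_mono powr_mono)
        show "0 \<le> C * decay_const \<delta>" using C(1) by (simp add: decay_const_def)
        show "1 \<le> real t" using t C(2) by linarith
      qed (use d in simp)
      finally show "norm (norm (U.corr (int t) f f)) \<le> C * decay_const \<delta> * norm (real t powr (- 1 / 2 + \<epsilon>))"
        by simp
    qed
  qed
qed

end

theorem theorem2:
  shows "\<exists>\<Phi> :: nat \<Rightarrow> nat. \<forall>q :: nat \<Rightarrow> nat.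
    (\<forall>n. 2 \<le> q n \<and> \<Phi> (iceberg_height q n) \<le> q n) \<longrightarrow>
    (AE \<alpha> in rotation_measure q.
       local_rank (iceberg_measure q \<alpha>) (iceberg_map q \<alpha>) \<ge> 1 / 4 \<and>
       simple_spectrum (iceberg_measure q \<alpha>) (iceberg_pow q \<alpha>) \<and>
       (\<exists>\<sigma>. maximal_spectral_type (iceberg_measure q \<alpha>) (iceberg_pow q \<alpha>) \<sigma> \<and>
            absolutely_continuous circle_lebesgue (circle_convolution \<sigma> \<sigma>)) \<and>
       (\<exists>D \<subseteq> L2_zero_mean (iceberg_measure q \<alpha>).
            L2_zero_mean (iceberg_measure q \<alpha>) \<subseteq> L2_closure (iceberg_measure q \<alpha>) D \<and>
            (\<forall>f\<in>D. \<forall>\<epsilon>>0.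
               (\<lambda>t::nat. norm (L2_inner (iceberg_measure q \<alpha>)
                                 (koopman (iceberg_pow q \<alpha> (int t)) f) f))
               \<in> O(\<lambda>t. real t powr (- 1 / 2 + \<epsilon>)))))"
proof (rule exI[of _ "\<lambda>N. 100 * 3 ^ N"], intro allI impI, goal_cases)
  case (1 q)
  \<comment> \<open>The witness is 100 times a power of 3: the power yields
    \<open>h n \<le> ln (q n)\<close> because \<open>exp 1 \<le> 3\<close>, and the factor 100
    yields the bound \<open>4 \<le> ln (q n)\<close> used for Borel-Cantelli.\<close>
  then have q2: "2 \<le> q n" and gr: "100 * 3 ^ iceberg_height q n \<le> q n" for n by blast+
  interpret rotations q by (rule rotations.intro) (rule q2)
  show ?case
  proof (rule AE_mp[OF AE_equidistributed[OF gr]], intro AE_I2 impI, goal_cases)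
    case (1 \<alpha>)
    interpret E: equi_iceberg q \<alpha>
      by (intro equi_iceberg.intro equi_iceberg_axioms.intro iceberg_q gr 1)
    show ?case
      by (intro conjI E.local_rank_quarter E.spectrum[THEN conjunct1] E.spectrum[THEN conjunct2]
          exI[of _ E.LF0] ballI allI impI E.LF0_zero_mean E.LF0_dense E.LF0_bigo)
  qed
qed

end
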